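(* Let $\mathcal{M}$ be a braided monoidal category where $\mathcal{M}$ is abelian and the tensor product is additive and exact in each argument. Assume that $\mathcal{M}$ is pre-rigid and that $\overline{(-)^*}:\mathsf{Alg}(\mathcal{M}^{\mathrm{op}})\to\mathsf{Alg}(\mathcal{M})$ has a left adjoint. Then $\big((-)^*:\mathcal{M}^{\mathbb{N}}\to(\mathcal{M}^{\mathbb{N}})^{\mathrm{op}},\ (-)^*:(\mathcal{M}^{\mathbb{N}})^{\mathrm{op}}\to\mathcal{M}^{\mathbb{N}}\big)$ is a liftable pair of adjoint functors, where $\mathcal{M}^{\mathbb{N}}$ is the (pre-rigid braided monoidal) category of externally $\mathbb{N}$-graded $\mathcal{M}$-objects.
   Context: A monoidal category $(\mathcal{C},\otimes,\mathbb{I})$ is (right) pre-rigid if for every object $X$ there are an object $X^*$ (a pre-dual of $X$) and a morphism $\mathrm{ev}_X:X^*\otimes X\to\mathbb{I}$ such that for every object $T$ the map $\mathrm{Hom}_{\mathcal{C}}(T,X^* )\to\mathrm{Hom}_{\mathcal{C}}(T\otimes X,\mathbb{I})$, $u\mapsto \mathrm{ev}_X\circ(u\otimes X)$, is bijective; write $t\mapsto t^\dagger$ for the inverse bijection. Here $X$ also denotes the identity morphism of $X$. Associativity and unit constraints are suppressed. $\mathcal{M}^{\mathbb{N}}$ ($0\in\mathbb{N}$): objects are sequences $(X_n)_{n\in\mathbb{N}}$ of objects of $\mathcal{M}$, morphisms are sequences of morphisms $f_n:X_n\to Y_n$; $(X\otimes Y)_n=\bigoplus_{i=0}^n X_i\otimes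 Y_{n-i}$; the unit is $\mathbb{I}$ in degree $0$ and the zero object in other degrees; the braiding is $(c_{X,Y})_n=\bigoplus_{i=0}^n c_{X_i,Y_{n-i}}$. It is pre-rigid, the pre-dual $X^*$ of $X$ being $(X_0)^*$ in degree $0$ and zero in other degrees. For a pre-rigid braided monoidal category $\mathcal{C}$ with braiding $c$: $\mathcal{C}^{\mathrm{op}}$ is monoidal with $X^{\mathrm{op}}\otimes Y^{\mathrm{op}}=(X\otimes Y)^{\mathrm{op}}$ and unit $\mathbb{I}^{\mathrm{op}}$. The functor $(-)^*:\mathcal{C}^{\mathrm{op}}\to\mathcal{C}$ sends $X^{\mathrm{op}}$ to $X^*$ and, for $f:X\to Y$, $f^{\mathrm{op}}$ to the unique $f^*:Y^*\to X^*$ with $\mathrm{ev}_X\circ(f^*\otimes X)=\mathrm{ev}_Y\circ(Y^*\otimes f)$. It is lax monoidal via $\phi_2(X^{\mathrm{op}},Y^{\mathrm{op}})=\big((\mathrm{ev}_X\otimes\mathrm{ev}_Y)\circ(X^*\otimes (c_{X,Y^*})^{-1}\otimes Y)\big)^\dagger:X^*\otimes Y^*\to(X\otimes Y)^*$ and $\phi_0=(m_{\mathbb{I}})^\dagger:\mathbb{I}\to\mathbb{I}^*$, where $m_{\mathbb{I}}:\mathbb{I}\otimes\mathbb{I}\to\mathbb{I}$ is the canonical isomorphism. It has as left adjoint its opposite functor $(-)^*:\mathcal{C}\to\mathcal{C}^{\mathrm{op}}$, with unit $\eta_X=(\mathrm{ev}_X\circ c_{X,X^*})^\dagger:X\to X^{**}$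 and counit $\epsilon_{X^{\mathrm{op}}}=(j_X)^{\mathrm{op}}$, $j_X=(\mathrm{ev}_X\circ(c_{X^*,X})^{-1})^\dagger$. $\mathsf{Alg}(\mathcal{A})$ and $\mathsf{Coalg}(\mathcal{A})$ denote the categories of algebra (monoid) and coalgebra (comonoid) objects of a monoidal category $\mathcal{A}$. A lax monoidal functor $F:\mathcal{A}\to\mathcal{B}$ induces $\overline{F}=\mathsf{Alg}(F):\mathsf{Alg}(\mathcal{A})\to\mathsf{Alg}(\mathcal{B})$, $(A,m,u)\mapsto(FA,Fm\circ\phi_2(A,A),Fu\circ\phi_0)$. If $F$ has a left adjoint $E$ with unit $\eta$ and counit $\epsilon$, then $E$ is colax monoidal via $\psi_2(X,Y)=\epsilon_{EX\otimes EY}\circ E\phi_2(EX,EY)\circ E(\eta_X\otimes\eta_Y)$, $\psi_0=\epsilon_{\mathbb{I}_{\mathcal{A}}}\circ E\phi_0$, and induces $\underline{E}=\mathsf{Coalg}(E):\mathsf{Coalg}(\mathcal{B})\to\mathsf{Coalg}(\mathcal{A})$, $(C,\Delta,\varepsilon)\mapsto(EC,\psi_2(C,C)\circ E\Delta,\psi_0\circ E\varepsilon)$. The pair $(E,F)$ is called liftable if $\overline{F}$ has a left adjoint and $\underline{E}$ has a right adjoint. *)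

theory Defs
  imports "HOL-Algebra.FiniteProduct"
begin

section \<open>Categories, functors, adjunctions\<close>

text \<open>
  A category consists of a carrier of objects and a carrier of arrows; every arrow determines its
  domain and codomain.  \<open>g \<cdot> f\<close> is "g after f".
\<close>

record ('o, 'a) cat =
  Obj :: "'o set"
  Arr :: "'a set"
  Dom :: "'a \<Rightarrow> 'o"
  Cod :: "'a \<Rightarrow> 'o"
  Idt :: "'o \<Rightarrow> 'a"
  Comp :: "'a \<Rightarrow> 'a \<Rightarrow> 'a" (infixl "\<cdot>\<index>" 70)

definition Hom :: "('o, 'a, 'z) cat_scheme \<Rightarrow> 'o \<Rightarrow> 'o \<Rightarrow> 'a set" where
  "Hom C X Y = {f \<in> Arr C. Dom C f = X \<and> Cod C f = Y}"

locale category =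
  fixes C :: "('o, 'a, 'z) cat_scheme" (structure)
  assumes Dom_Obj: "f \<in> Arr C \<Longrightarrow> Dom C f \<in> Obj C"
    and Cod_Obj: "f \<in> Arr C \<Longrightarrow> Cod C f \<in> Obj C"
    and Idt_Hom: "X \<in> Obj C \<Longrightarrow> Idt C X \<in> Hom C X X"
    and Comp_Hom: "\<lbrakk>f \<in> Hom C X Y; g \<in> Hom C Y Z\<rbrakk> \<Longrightarrow> g \<cdot> f \<in> Hom C X Z"
    and Comp_Idt_left: "f \<in> Hom C X Y \<Longrightarrow> Idt C Y \<cdot> f = f"
    and Comp_Idt_right: "f \<in> Hom C X Y \<Longrightarrow> f \<cdot> Idt C X = f"
    and Comp_assoc: "\<lbrakk>f \<in> Hom C W X; g \<in> Hom C X Y; h \<in> Hom C Y Z\<rbrakk>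
      \<Longrightarrow> (h \<cdot> g) \<cdot> f = h \<cdot> (g \<cdot> f)"

definition inverse_arrows :: "('o, 'a, 'z) cat_scheme \<Rightarrow> 'a \<Rightarrow> 'a \<Rightarrow> bool" where
  "inverse_arrows C f g \<longleftrightarrow>
     f \<in> Arr C \<and> g \<in> Hom C (Cod C f) (Dom C f) \<and>
     g \<cdot>\<^bsub>C\<^esub> f = Idt C (Dom C f) \<and> f \<cdot>\<^bsub>C\<^esub> g = Idt C (Cod C f)"

definition iso_arr :: "('o, 'a, 'z) cat_scheme \<Rightarrow> 'a \<Rightarrow> bool" where
  "iso_arr C f \<longleftrightarrow> (\<exists>g. inverse_arrows C f g)"

definition inv_arr :: "('o, 'a, 'z) cat_scheme \<Rightarrow> 'a \<Rightarrow> 'a" where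
  "inv_arr C f = (THE g. inverse_arrows C f g)"

record ('o, 'a, 'p, 'b) functor_data =
  OMap :: "'o \<Rightarrow> 'p"
  AMap :: "'a \<Rightarrow> 'b"

definition is_functor ::
  "('o, 'a, 'z) cat_scheme \<Rightarrow> ('p, 'b, 'y) cat_scheme \<Rightarrow> ('o, 'a, 'p, 'b) functor_data \<Rightarrow> bool" where
  "is_functor A B F \<longleftrightarrow>
     category A \<and> category B \<and>
     (\<forall>X\<in>Obj A. OMap F X \<in> Obj B) \<and>
     (\<forall>X Y. \<forall>f\<in>Hom A X Y. AMap F f \<in> Hom B (OMap F X) (OMap F Y)) \<and>
     (\<forall>X\<in>Obj A. AMap F (Idt A X) = Idt B (OMap F X)) \<and>
     (\<forall>X Y Z. \<forall>f\<in>Hom A X Y. \<forall>g\<in>Hom A Y Z. AMap F (g \<cdot>\<^bsub>A\<^esub> f) = AMap F g \<cdot>\<^bsub>B\<^esub> AMap F f)"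

text \<open>\<open>adjunction B A E F \<eta> \<epsilon>\<close>: the functor \<open>E : B \<rightarrow> A\<close> is left adjoint to \<open>F : A \<rightarrow> B\<close>.\<close>

definition adjunction ::
  "('p, 'b, 'y) cat_scheme \<Rightarrow> ('o, 'a, 'z) cat_scheme \<Rightarrow>
   ('p, 'b, 'o, 'a) functor_data \<Rightarrow> ('o, 'a, 'p, 'b) functor_data \<Rightarrow>
   ('p \<Rightarrow> 'b) \<Rightarrow> ('o \<Rightarrow> 'a) \<Rightarrow> bool" where
  "adjunction B A E F \<eta> \<epsilon> \<longleftrightarrow>
     is_functor B A E \<and> is_functor A B F \<and>
     (\<forall>X\<in>Obj B. \<eta> X \<in> Hom B X (OMap F (OMap E X))) \<and>
     (\<forall>X Y. \<forall>f\<in>Hom B X Y. \<eta> Y \<cdot>\<^bsub>B\<^esub> f = AMap F (AMap E f) \<cdot>\<^bsub>B\<^esub> \<eta> X) \<and>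
     (\<forall>X\<in>Obj A. \<epsilon> X \<in> Hom A (OMap E (OMap F X)) X) \<and>
     (\<forall>X Y. \<forall>f\<in>Hom A X Y. \<epsilon> Y \<cdot>\<^bsub>A\<^esub> AMap E (AMap F f) = f \<cdot>\<^bsub>A\<^esub> \<epsilon> X) \<and>
     (\<forall>X\<in>Obj B. \<epsilon> (OMap E X) \<cdot>\<^bsub>A\<^esub> AMap E (\<eta> X) = Idt A (OMap E X)) \<and>
     (\<forall>X\<in>Obj A. AMap F (\<epsilon> X) \<cdot>\<^bsub>B\<^esub> \<eta> (OMap F X) = Idt B (OMap F X))"

definition has_left_adjoint ::
  "('o, 'a, 'z) cat_scheme \<Rightarrow> ('p, 'b, 'y) cat_scheme \<Rightarrow> ('o, 'a, 'p, 'b) functor_data \<Rightarrow> bool" where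
  "has_left_adjoint A B F \<longleftrightarrow> (\<exists>E \<eta> \<epsilon>. adjunction B A E F \<eta> \<epsilon>)"

definition has_right_adjoint ::
  "('p, 'b, 'y) cat_scheme \<Rightarrow> ('o, 'a, 'z) cat_scheme \<Rightarrow> ('p, 'b, 'o, 'a) functor_data \<Rightarrow> bool" where
  "has_right_adjoint B A E \<longleftrightarrow> (\<exists>F \<eta> \<epsilon>. adjunction B A E F \<eta> \<epsilon>)"

section \<open>Monoidal, braided and pre-rigid categories\<close>

text \<open>
  \<open>Assoc C X Y Z : (X \<odot> Y) \<odot> Z \<rightarrow> X \<odot> (Y \<odot> Z)\<close>, \<open>LUnit C X : I \<odot> X \<rightarrow> X\<close>, \<open>RUnit C X : X \<odot> I \<rightarrow> X\<close>.
  No strictness is assumed.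
\<close>

record ('o, 'a) moncat = "('o, 'a) cat" +
  TObj :: "'o \<Rightarrow> 'o \<Rightarrow> 'o" (infixl "\<odot>\<index>" 75)
  TArr :: "'a \<Rightarrow> 'a \<Rightarrow> 'a" (infixl "\<boxtimes>\<index>" 75)
  TUnit :: "'o"
  Assoc :: "'o \<Rightarrow> 'o \<Rightarrow> 'o \<Rightarrow> 'a"
  LUnit :: "'o \<Rightarrow> 'a"
  RUnit :: "'o \<Rightarrow> 'a"

locale monoidal_category = category C
  for C :: "('o, 'a, 'z) moncat_scheme" (structure) +
  assumes TObj_Obj: "\<lbrakk>X \<in> Obj C; Y \<in> Obj C\<rbrakk> \<Longrightarrow> X \<odot> Y \<in> Obj C"
    and TArr_Hom: "\<lbrakk>f \<in> Hom C X X'; g \<in> Hom C Y Y'\<rbrakk> \<Longrightarrow> f \<boxtimes> g \<in> Hom C (X \<odot> Y) (X' \<odot> Y')"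
    and TArr_Idt: "\<lbrakk>X \<in> Obj C; Y \<in> Obj C\<rbrakk> \<Longrightarrow> Idt C X \<boxtimes> Idt C Y = Idt C (X \<odot> Y)"
    and TArr_Comp: "\<lbrakk>f \<in> Hom C X X'; f' \<in> Hom C X' X''; g \<in> Hom C Y Y'; g' \<in> Hom C Y' Y''\<rbrakk>
      \<Longrightarrow> (f' \<cdot> f) \<boxtimes> (g' \<cdot> g) = (f' \<boxtimes> g') \<cdot> (f \<boxtimes> g)"
    and TUnit_Obj: "TUnit C \<in> Obj C"
    and Assoc_Hom: "\<lbrakk>X \<in> Obj C; Y \<in> Obj C; Z \<in> Obj C\<rbrakk>
      \<Longrightarrow> Assoc C X Y Z \<in> Hom C ((X \<odot> Y) \<odot> Z) (X \<odot> (Y \<odot> Z))"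
    and Assoc_iso: "\<lbrakk>X \<in> Obj C; Y \<in> Obj C; Z \<in> Obj C\<rbrakk> \<Longrightarrow> iso_arr C (Assoc C X Y Z)"
    and Assoc_natural: "\<lbrakk>f \<in> Hom C X X'; g \<in> Hom C Y Y'; h \<in> Hom C Z Z'\<rbrakk>
      \<Longrightarrow> Assoc C X' Y' Z' \<cdot> ((f \<boxtimes> g) \<boxtimes> h) = (f \<boxtimes> (g \<boxtimes> h)) \<cdot> Assoc C X Y Z"
    and LUnit_Hom: "X \<in> Obj C \<Longrightarrow> LUnit C X \<in> Hom C (TUnit C \<odot> X) X"
    and LUnit_iso: "X \<in> Obj C \<Longrightarrow> iso_arr C (LUnit C X)"
    and LUnit_natural: "f \<in> Hom C X Y \<Longrightarrow> LUnit C Y \<cdot> (Idt C (TUnit C) \<boxtimes> f) = f \<cdot> LUnit C X"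
    and RUnit_Hom: "X \<in> Obj C \<Longrightarrow> RUnit C X \<in> Hom C (X \<odot> TUnit C) X"
    and RUnit_iso: "X \<in> Obj C \<Longrightarrow> iso_arr C (RUnit C X)"
    and RUnit_natural: "f \<in> Hom C X Y \<Longrightarrow> RUnit C Y \<cdot> (f \<boxtimes> Idt C (TUnit C)) = f \<cdot> RUnit C X"
    and pentagon: "\<lbrakk>W \<in> Obj C; X \<in> Obj C; Y \<in> Obj C; Z \<in> Obj C\<rbrakk>
      \<Longrightarrow> (Idt C W \<boxtimes> Assoc C X Y Z) \<cdot> Assoc C W (X \<odot> Y) Z \<cdot> (Assoc C W X Y \<boxtimes> Idt C Z)
        = Assoc C W X (Y \<odot> Z) \<cdot> Assoc C (W \<odot> X) Y Z"
    and triangle: "\<lbrakk>X \<in> Obj C; Y \<in> Obj C\<rbrakk>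
      \<Longrightarrow> (Idt C X \<boxtimes> LUnit C Y) \<cdot> Assoc C X (TUnit C) Y = RUnit C X \<boxtimes> Idt C Y"

record ('o, 'a) brcat = "('o, 'a) moncat" +
  Braid :: "'o \<Rightarrow> 'o \<Rightarrow> 'a"

locale braided_monoidal_category = monoidal_category C
  for C :: "('o, 'a, 'z) brcat_scheme" (structure) +
  assumes Braid_Hom: "\<lbrakk>X \<in> Obj C; Y \<in> Obj C\<rbrakk> \<Longrightarrow> Braid C X Y \<in> Hom C (X \<odot> Y) (Y \<odot> X)"
    and Braid_iso: "\<lbrakk>X \<in> Obj C; Y \<in> Obj C\<rbrakk> \<Longrightarrow> iso_arr C (Braid C X Y)"
    and Braid_natural: "\<lbrakk>f \<in> Hom C X X'; g \<in> Hom C Y Y'\<rbrakk>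
      \<Longrightarrow> Braid C X' Y' \<cdot> (f \<boxtimes> g) = (g \<boxtimes> f) \<cdot> Braid C X Y"
    and hexagon1: "\<lbrakk>X \<in> Obj C; Y \<in> Obj C; Z \<in> Obj C\<rbrakk>
      \<Longrightarrow> Assoc C Y Z X \<cdot> Braid C X (Y \<odot> Z) \<cdot> Assoc C X Y Z
        = (Idt C Y \<boxtimes> Braid C X Z) \<cdot> Assoc C Y X Z \<cdot> (Braid C X Y \<boxtimes> Idt C Z)"
    and hexagon2: "\<lbrakk>X \<in> Obj C; Y \<in> Obj C; Z \<in> Obj C\<rbrakk>
      \<Longrightarrow> inv_arr C (Assoc C Z X Y) \<cdot> Braid C (X \<odot> Y) Z \<cdot> inv_arr C (Assoc C X Y Z)
        = (Braid C X Z \<boxtimes> Idt C Y) \<cdot> inv_arr C (Assoc C X Z Y) \<cdot> (Idt C X \<boxtimes> Braid C Y Z)"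

text \<open>A pre-rigid category comes with a choice of pre-duals and evaluations.\<close>

record ('o, 'a) prcat = "('o, 'a) brcat" +
  Dual :: "'o \<Rightarrow> 'o"
  Ev :: "'o \<Rightarrow> 'a"

locale prerigid_braided_category = braided_monoidal_category C
  for C :: "('o, 'a, 'z) prcat_scheme" (structure) +
  assumes Dual_Obj: "X \<in> Obj C \<Longrightarrow> Dual C X \<in> Obj C"
    and Ev_Hom: "X \<in> Obj C \<Longrightarrow> Ev C X \<in> Hom C (Dual C X \<odot> X) (TUnit C)"
    and Ev_bij: "\<lbrakk>X \<in> Obj C; T \<in> Obj C\<rbrakk>
      \<Longrightarrow> bij_betw (\<lambda>u. Ev C X \<cdot> (u \<boxtimes> Idt C X)) (Hom C T (Dual C X)) (Hom C (T \<odot> X) (TUnit C))"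

text \<open>\<open>dag C T X t\<close> is the arrow \<open>t\<^sup>\<dagger> : T \<rightarrow> X\<^sup>*\<close> belonging to \<open>t : T \<odot> X \<rightarrow> I\<close>.\<close>

definition dag :: "('o, 'a, 'z) prcat_scheme \<Rightarrow> 'o \<Rightarrow> 'o \<Rightarrow> 'a \<Rightarrow> 'a" where
  "dag C T X = the_inv_into (Hom C T (Dual C X)) (\<lambda>u. Ev C X \<cdot>\<^bsub>C\<^esub> (u \<boxtimes>\<^bsub>C\<^esub> Idt C X))"

text \<open>The opposite monoidal category: arrows are reversed, the order of tensor factors is kept.\<close>

definition op_moncat :: "('o, 'a, 'z) moncat_scheme \<Rightarrow> ('o, 'a) moncat" where
  "op_moncat C = \<lparr>
     Obj = Obj C, Arr = Arr C, Dom = Cod C, Cod = Dom C, Idt = Idt C, Comp = (\<lambda>g f. f \<cdot>\<^bsub>C\<^esub> g),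
     TObj = TObj C, TArr = TArr C, TUnit = TUnit C,
     Assoc = (\<lambda>X Y Z. inv_arr C (Assoc C X Y Z)),
     LUnit = (\<lambda>X. inv_arr C (LUnit C X)), RUnit = (\<lambda>X. inv_arr C (RUnit C X))\<rparr>"

section \<open>Algebras, coalgebras and liftable pairs\<close>

text \<open>
  An algebra is a triple \<open>(X, m, u)\<close>.  A morphism of algebras records its source and target besides
  the underlying arrow, so that it has a well-defined domain and codomain; likewise for coalgebras.
\<close>

type_synonym ('o, 'a) triple = "'o \<times> 'a \<times> 'a"

definition is_algebra :: "('o, 'a, 'z) moncat_scheme \<Rightarrow> ('o, 'a) triple \<Rightarrow> bool" where
  "is_algebra C = (\<lambda>(X, m, u).
     X \<in> Obj C \<and> m \<in> Hom C (X \<odot>\<^bsub>C\<^esub> X) X \<and> u \<in> Hom C (TUnit C) X \<and>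
     m \<cdot>\<^bsub>C\<^esub> (m \<boxtimes>\<^bsub>C\<^esub> Idt C X) = m \<cdot>\<^bsub>C\<^esub> (Idt C X \<boxtimes>\<^bsub>C\<^esub> m) \<cdot>\<^bsub>C\<^esub> Assoc C X X X \<and>
     m \<cdot>\<^bsub>C\<^esub> (u \<boxtimes>\<^bsub>C\<^esub> Idt C X) = LUnit C X \<and>
     m \<cdot>\<^bsub>C\<^esub> (Idt C X \<boxtimes>\<^bsub>C\<^esub> u) = RUnit C X)"

definition is_algebra_mor :: "('o, 'a, 'z) moncat_scheme \<Rightarrow> ('o, 'a) triple \<Rightarrow> 'a \<Rightarrow> ('o, 'a) triple \<Rightarrow> bool" where
  "is_algebra_mor C = (\<lambda>(X, m, u) f (X', m', u').
     f \<in> Hom C X X' \<and> f \<cdot>\<^bsub>C\<^esub> m = m' \<cdot>\<^bsub>C\<^esub> (f \<boxtimes>\<^bsub>C\<^esub> f) \<and> f \<cdot>\<^bsub>C\<^esub> u = u')"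

definition is_coalgebra :: "('o, 'a, 'z) moncat_scheme \<Rightarrow> ('o, 'a) triple \<Rightarrow> bool" where
  "is_coalgebra C = (\<lambda>(X, d, e).
     X \<in> Obj C \<and> d \<in> Hom C X (X \<odot>\<^bsub>C\<^esub> X) \<and> e \<in> Hom C X (TUnit C) \<and>
     Assoc C X X X \<cdot>\<^bsub>C\<^esub> (d \<boxtimes>\<^bsub>C\<^esub> Idt C X) \<cdot>\<^bsub>C\<^esub> d = (Idt C X \<boxtimes>\<^bsub>C\<^esub> d) \<cdot>\<^bsub>C\<^esub> d \<and>
     LUnit C X \<cdot>\<^bsub>C\<^esub> (e \<boxtimes>\<^bsub>C\<^esub> Idt C X) \<cdot>\<^bsub>C\<^esub> d = Idt C X \<and>
     RUnit C X \<cdot>\<^bsub>C\<^esub> (Idt C X \<boxtimes>\<^bsub>C\<^esub> e) \<cdot>\<^bsub>C\<^esub> d = Idt C X)"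

definition is_coalgebra_mor :: "('o, 'a, 'z) moncat_scheme \<Rightarrow> ('o, 'a) triple \<Rightarrow> 'a \<Rightarrow> ('o, 'a) triple \<Rightarrow> bool" where
  "is_coalgebra_mor C = (\<lambda>(X, d, e) f (X', d', e').
     f \<in> Hom C X X' \<and> d' \<cdot>\<^bsub>C\<^esub> f = (f \<boxtimes>\<^bsub>C\<^esub> f) \<cdot>\<^bsub>C\<^esub> d \<and> e' \<cdot>\<^bsub>C\<^esub> f = e)"

definition Alg :: "('o, 'a, 'z) moncat_scheme
    \<Rightarrow> (('o, 'a) triple, ('o, 'a) triple \<times> 'a \<times> ('o, 'a) triple) cat" where
  "Alg C = \<lparr>
     Obj = {S. is_algebra C S},
     Arr = {(S, f, S'). is_algebra C S \<and> is_algebra C S' \<and> is_algebra_mor C S f S'},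
     Dom = (\<lambda>(S, f, S'). S), Cod = (\<lambda>(S, f, S'). S'),
     Idt = (\<lambda>S. (S, Idt C (fst S), S)),
     Comp = (\<lambda>(T, g, T') (S, f, S'). (S, g \<cdot>\<^bsub>C\<^esub> f, T'))\<rparr>"

definition Coalg :: "('o, 'a, 'z) moncat_scheme
    \<Rightarrow> (('o, 'a) triple, ('o, 'a) triple \<times> 'a \<times> ('o, 'a) triple) cat" where
  "Coalg C = \<lparr>
     Obj = {S. is_coalgebra C S},
     Arr = {(S, f, S'). is_coalgebra C S \<and> is_coalgebra C S' \<and> is_coalgebra_mor C S f S'},
     Dom = (\<lambda>(S, f, S'). S), Cod = (\<lambda>(S, f, S'). S'),
     Idt = (\<lambda>S. (S, Idt C (fst S), S)),
     Comp = (\<lambda>(T, g, T') (S, f, S'). (S, g \<cdot>\<^bsub>C\<^esub> f, T'))\<rparr>"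

definition lax_monoidal_functor ::
  "('o, 'a, 'z) moncat_scheme \<Rightarrow> ('p, 'b, 'y) moncat_scheme \<Rightarrow> ('o, 'a, 'p, 'b) functor_data \<Rightarrow>
   ('o \<Rightarrow> 'o \<Rightarrow> 'b) \<Rightarrow> 'b \<Rightarrow> bool" where
  "lax_monoidal_functor A B F \<phi>2 \<phi>0 \<longleftrightarrow>
     monoidal_category A \<and> monoidal_category B \<and> is_functor A B F \<and>
     (\<forall>X\<in>Obj A. \<forall>Y\<in>Obj A. \<phi>2 X Y \<in> Hom B (OMap F X \<odot>\<^bsub>B\<^esub> OMap F Y) (OMap F (X \<odot>\<^bsub>A\<^esub> Y))) \<and>
     (\<forall>X X' Y Y'. \<forall>f\<in>Hom A X X'. \<forall>g\<in>Hom A Y Y'.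
        \<phi>2 X' Y' \<cdot>\<^bsub>B\<^esub> (AMap F f \<boxtimes>\<^bsub>B\<^esub> AMap F g) = AMap F (f \<boxtimes>\<^bsub>A\<^esub> g) \<cdot>\<^bsub>B\<^esub> \<phi>2 X Y) \<and>
     \<phi>0 \<in> Hom B (TUnit B) (OMap F (TUnit A)) \<and>
     (\<forall>X\<in>Obj A. \<forall>Y\<in>Obj A. \<forall>Z\<in>Obj A.
        AMap F (Assoc A X Y Z) \<cdot>\<^bsub>B\<^esub> \<phi>2 (X \<odot>\<^bsub>A\<^esub> Y) Z \<cdot>\<^bsub>B\<^esub> (\<phi>2 X Y \<boxtimes>\<^bsub>B\<^esub> Idt B (OMap F Z))
        = \<phi>2 X (Y \<odot>\<^bsub>A\<^esub> Z) \<cdot>\<^bsub>B\<^esub> (Idt B (OMap F X) \<boxtimes>\<^bsub>B\<^esub> \<phi>2 Y Z)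
            \<cdot>\<^bsub>B\<^esub> Assoc B (OMap F X) (OMap F Y) (OMap F Z)) \<and>
     (\<forall>X\<in>Obj A. AMap F (LUnit A X) \<cdot>\<^bsub>B\<^esub> \<phi>2 (TUnit A) X \<cdot>\<^bsub>B\<^esub> (\<phi>0 \<boxtimes>\<^bsub>B\<^esub> Idt B (OMap F X))
        = LUnit B (OMap F X)) \<and>
     (\<forall>X\<in>Obj A. AMap F (RUnit A X) \<cdot>\<^bsub>B\<^esub> \<phi>2 X (TUnit A) \<cdot>\<^bsub>B\<^esub> (Idt B (OMap F X) \<boxtimes>\<^bsub>B\<^esub> \<phi>0)
        = RUnit B (OMap F X))"

definition alg_functor ::
  "('p, 'b, 'y) moncat_scheme \<Rightarrow> ('o, 'a, 'p, 'b) functor_data \<Rightarrow> ('o \<Rightarrow> 'o \<Rightarrow> 'b) \<Rightarrow> 'b \<Rightarrow>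
   (('o, 'a) triple, ('o, 'a) triple \<times> 'a \<times> ('o, 'a) triple,
    ('p, 'b) triple, ('p, 'b) triple \<times> 'b \<times> ('p, 'b) triple) functor_data" where
  "alg_functor B F \<phi>2 \<phi>0 =
     (let obj = (\<lambda>(X, m, u). (OMap F X, AMap F m \<cdot>\<^bsub>B\<^esub> \<phi>2 X X, AMap F u \<cdot>\<^bsub>B\<^esub> \<phi>0))
      in \<lparr>OMap = obj, AMap = (\<lambda>(S, f, S'). (obj S, AMap F f, obj S'))\<rparr>)"

definition coalg_functor ::
  "('o, 'a, 'z) moncat_scheme \<Rightarrow> ('p, 'b, 'o, 'a) functor_data \<Rightarrow> ('p \<Rightarrow> 'p \<Rightarrow> 'a) \<Rightarrow> 'a \<Rightarrow>
   (('p, 'b) triple, ('p, 'b) triple \<times> 'b \<times> ('p, 'b) triple,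
    ('o, 'a) triple, ('o, 'a) triple \<times> 'a \<times> ('o, 'a) triple) functor_data" where
  "coalg_functor A E \<psi>2 \<psi>0 =
     (let obj = (\<lambda>(X, d, e). (OMap E X, \<psi>2 X X \<cdot>\<^bsub>A\<^esub> AMap E d, \<psi>0 \<cdot>\<^bsub>A\<^esub> AMap E e))
      in \<lparr>OMap = obj, AMap = (\<lambda>(S, f, S'). (obj S, AMap E f, obj S'))\<rparr>)"

text \<open>The colax structure of the left adjoint \<open>E : B \<rightarrow> A\<close> of the lax monoidal functor \<open>F : A \<rightarrow> B\<close>.\<close>

definition colax2 ::
  "('o, 'a, 'z) moncat_scheme \<Rightarrow> ('p, 'b, 'y) moncat_scheme \<Rightarrow> ('p, 'b, 'o, 'a) functor_data \<Rightarrow>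
   ('p \<Rightarrow> 'b) \<Rightarrow> ('o \<Rightarrow> 'a) \<Rightarrow> ('o \<Rightarrow> 'o \<Rightarrow> 'b) \<Rightarrow> 'p \<Rightarrow> 'p \<Rightarrow> 'a" where
  "colax2 A B E \<eta> \<epsilon> \<phi>2 X Y =
     \<epsilon> (OMap E X \<odot>\<^bsub>A\<^esub> OMap E Y) \<cdot>\<^bsub>A\<^esub> AMap E (\<phi>2 (OMap E X) (OMap E Y))
       \<cdot>\<^bsub>A\<^esub> AMap E (\<eta> X \<boxtimes>\<^bsub>B\<^esub> \<eta> Y)"

definition colax0 ::
  "('o, 'a, 'z) moncat_scheme \<Rightarrow> ('p, 'b, 'o, 'a) functor_data \<Rightarrow> ('o \<Rightarrow> 'a) \<Rightarrow> 'b \<Rightarrow> 'a" where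
  "colax0 A E \<epsilon> \<phi>0 = \<epsilon> (TUnit A) \<cdot>\<^bsub>A\<^esub> AMap E \<phi>0"

definition liftable_pair ::
  "('o, 'a, 'z) moncat_scheme \<Rightarrow> ('p, 'b, 'y) moncat_scheme \<Rightarrow>
   ('p, 'b, 'o, 'a) functor_data \<Rightarrow> ('o, 'a, 'p, 'b) functor_data \<Rightarrow>
   ('p \<Rightarrow> 'b) \<Rightarrow> ('o \<Rightarrow> 'a) \<Rightarrow> ('o \<Rightarrow> 'o \<Rightarrow> 'b) \<Rightarrow> 'b \<Rightarrow> bool" where
  "liftable_pair A B E F \<eta> \<epsilon> \<phi>2 \<phi>0 \<longleftrightarrow>
     adjunction B A E F \<eta> \<epsilon> \<and>
     lax_monoidal_functor A B F \<phi>2 \<phi>0 \<and>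
     has_left_adjoint (Alg A) (Alg B) (alg_functor B F \<phi>2 \<phi>0) \<and>
     has_right_adjoint (Coalg B) (Coalg A)
       (coalg_functor A E (colax2 A B E \<eta> \<epsilon> \<phi>2) (colax0 A E \<epsilon> \<phi>0))"

section \<open>The pre-dual functor\<close>

text \<open>
  Objects and arrows of \<open>op_moncat C\<close> are those of \<open>C\<close>, so the same data describe
  \<open>(-)\<^sup>* : C\<^sup>o\<^sup>p \<rightarrow> C\<close> and its opposite functor \<open>C \<rightarrow> C\<^sup>o\<^sup>p\<close>.
\<close>

definition dual_functor :: "('o, 'a, 'z) prcat_scheme \<Rightarrow> ('o, 'a, 'o, 'a) functor_data" where
  "dual_functor C = \<lparr>
     OMap = Dual C,
     AMap = (\<lambda>f. dag C (Dual C (Cod C f)) (Dom C f)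
                  (Ev C (Cod C f) \<cdot>\<^bsub>C\<^esub> (Idt C (Dual C (Cod C f)) \<boxtimes>\<^bsub>C\<^esub> f)))\<rparr>"

text \<open>
  \<open>mid_pairing C X Y : (X\<^sup>* \<odot> Y\<^sup>*) \<odot> (X \<odot> Y) \<rightarrow> I\<close> is
  \<open>(ev\<^sub>X \<otimes> ev\<^sub>Y) \<circ> (X\<^sup>* \<otimes> (c\<^bsub>X,Y\<^sup>*\<^esub>)\<^sup>-\<^sup>1 \<otimes> Y)\<close> with the constraints written out.
\<close>

definition mid_pairing :: "('o, 'a, 'z) prcat_scheme \<Rightarrow> 'o \<Rightarrow> 'o \<Rightarrow> 'a" where
  "mid_pairing C X Y = (let X' = Dual C X; Y' = Dual C Y in
     LUnit C (TUnit C) \<cdot>\<^bsub>C\<^esub> (Ev C X \<boxtimes>\<^bsub>C\<^esub> Ev C Y)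
     \<cdot>\<^bsub>C\<^esub> inv_arr C (Assoc C X' X (Y' \<odot>\<^bsub>C\<^esub> Y))
     \<cdot>\<^bsub>C\<^esub> (Idt C X' \<boxtimes>\<^bsub>C\<^esub> Assoc C X Y' Y)
     \<cdot>\<^bsub>C\<^esub> (Idt C X' \<boxtimes>\<^bsub>C\<^esub> (inv_arr C (Braid C X Y') \<boxtimes>\<^bsub>C\<^esub> Idt C Y))
     \<cdot>\<^bsub>C\<^esub> (Idt C X' \<boxtimes>\<^bsub>C\<^esub> inv_arr C (Assoc C Y' X Y))
     \<cdot>\<^bsub>C\<^esub> Assoc C X' Y' (X \<odot>\<^bsub>C\<^esub> Y))"

definition dual2 :: "('o, 'a, 'z) prcat_scheme \<Rightarrow> 'o \<Rightarrow> 'o \<Rightarrow> 'a" where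
  "dual2 C X Y = dag C (Dual C X \<odot>\<^bsub>C\<^esub> Dual C Y) (X \<odot>\<^bsub>C\<^esub> Y) (mid_pairing C X Y)"

definition dual0 :: "('o, 'a, 'z) prcat_scheme \<Rightarrow> 'a" where
  "dual0 C = dag C (TUnit C) (TUnit C) (LUnit C (TUnit C))"

definition dual_eta :: "('o, 'a, 'z) prcat_scheme \<Rightarrow> 'o \<Rightarrow> 'a" where
  "dual_eta C X = dag C X (Dual C X) (Ev C X \<cdot>\<^bsub>C\<^esub> Braid C X (Dual C X))"

text \<open>The arrow \<open>j\<^sub>X : X \<rightarrow> X\<^sup>*\<^sup>*\<close> of \<open>C\<close>, i.e. the component \<open>X\<^sup>*\<^sup>* \<rightarrow> X\<close> in \<open>C\<^sup>o\<^sup>p\<close> of the counit.\<close>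

definition dual_eps :: "('o, 'a, 'z) prcat_scheme \<Rightarrow> 'o \<Rightarrow> 'a" where
  "dual_eps C X = dag C X (Dual C X) (Ev C X \<cdot>\<^bsub>C\<^esub> inv_arr C (Braid C (Dual C X) X))"

section \<open>Abelian categories\<close>

text \<open>
  The additive structure is a family \<open>H\<close> of abelian groups on the hom sets.  The groups of
  \<open>HOL-Algebra\<close> are written multiplicatively: \<open>\<one>\<^bsub>H X Y\<^esub>\<close> is the zero arrow, \<open>f \<otimes>\<^bsub>H X Y\<^esub> g\<close> is
  the sum of arrows and \<open>finprod (H X Y)\<close> is a finite sum of arrows.
\<close>

locale preadditive_category = category C
  for C :: "('o, 'a, 'z) cat_scheme" (structure) +
  fixes H :: "'o \<Rightarrow> 'o \<Rightarrow> 'a monoid"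
  assumes Hom_group: "\<lbrakk>X \<in> Obj C; Y \<in> Obj C\<rbrakk> \<Longrightarrow> comm_group (H X Y)"
    and Hom_carrier: "\<lbrakk>X \<in> Obj C; Y \<in> Obj C\<rbrakk> \<Longrightarrow> carrier (H X Y) = Hom C X Y"
    and Comp_add_left: "\<lbrakk>f \<in> Hom C X Y; g \<in> Hom C Y Z; g' \<in> Hom C Y Z\<rbrakk>
      \<Longrightarrow> (g \<otimes>\<^bsub>H Y Z\<^esub> g') \<cdot> f = (g \<cdot> f) \<otimes>\<^bsub>H X Z\<^esub> (g' \<cdot> f)"
    and Comp_add_right: "\<lbrakk>f \<in> Hom C X Y; f' \<in> Hom C X Y; g \<in> Hom C Y Z\<rbrakk>
      \<Longrightarrow> g \<cdot> (f \<otimes>\<^bsub>H X Y\<^esub> f') = (g \<cdot> f) \<otimes>\<^bsub>H X Z\<^esub> (g \<cdot> f')"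

definition is_zero_obj :: "('o, 'a, 'z) cat_scheme \<Rightarrow> 'o \<Rightarrow> bool" where
  "is_zero_obj C Z \<longleftrightarrow> Z \<in> Obj C \<and>
     (\<forall>X\<in>Obj C. (\<exists>!f. f \<in> Hom C X Z) \<and> (\<exists>!f. f \<in> Hom C Z X))"

text \<open>\<open>S\<close> with injections \<open>\<iota> i\<close> and projections \<open>\<pi> i\<close> is a direct sum of \<open>X 0, \<dots>, X n\<close>.\<close>

definition is_direct_sum ::
  "('o, 'a, 'z) cat_scheme \<Rightarrow> ('o \<Rightarrow> 'o \<Rightarrow> 'a monoid) \<Rightarrow> nat \<Rightarrow> (nat \<Rightarrow> 'o) \<Rightarrow>
   'o \<Rightarrow> (nat \<Rightarrow> 'a) \<Rightarrow> (nat \<Rightarrow> 'a) \<Rightarrow> bool" where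
  "is_direct_sum C H n X S \<iota> \<pi> \<longleftrightarrow>
     S \<in> Obj C \<and>
     (\<forall>i\<le>n. \<iota> i \<in> Hom C (X i) S \<and> \<pi> i \<in> Hom C S (X i)) \<and>
     (\<forall>i\<le>n. \<forall>j\<le>n. \<pi> j \<cdot>\<^bsub>C\<^esub> \<iota> i = (if i = j then Idt C (X i) else \<one>\<^bsub>H (X i) (X j)\<^esub>)) \<and>
     finprod (H S S) (\<lambda>i. \<iota> i \<cdot>\<^bsub>C\<^esub> \<pi> i) {..n} = Idt C S"

definition is_mono :: "('o, 'a, 'z) cat_scheme \<Rightarrow> 'a \<Rightarrow> bool" where
  "is_mono C f \<longleftrightarrow> f \<in> Arr C \<and>
     (\<forall>T. \<forall>g\<in>Hom C T (Dom C f). \<forall>h\<in>Hom C T (Dom C f). f \<cdot>\<^bsub>C\<^esub> g = f \<cdot>\<^bsub>C\<^esub> h \<longrightarrow> g = h)"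

definition is_epi :: "('o, 'a, 'z) cat_scheme \<Rightarrow> 'a \<Rightarrow> bool" where
  "is_epi C f \<longleftrightarrow> f \<in> Arr C \<and>
     (\<forall>T. \<forall>g\<in>Hom C (Cod C f) T. \<forall>h\<in>Hom C (Cod C f) T. g \<cdot>\<^bsub>C\<^esub> f = h \<cdot>\<^bsub>C\<^esub> f \<longrightarrow> g = h)"

definition is_kernel ::
  "('o, 'a, 'z) cat_scheme \<Rightarrow> ('o \<Rightarrow> 'o \<Rightarrow> 'a monoid) \<Rightarrow> 'a \<Rightarrow> 'a \<Rightarrow> bool" where
  "is_kernel C H k f \<longleftrightarrow>
     k \<in> Arr C \<and> f \<in> Arr C \<and> Cod C k = Dom C f \<and>
     f \<cdot>\<^bsub>C\<^esub> k = \<one>\<^bsub>H (Dom C k) (Cod C f)\<^esub> \<and>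
     (\<forall>T. \<forall>h\<in>Hom C T (Dom C f). f \<cdot>\<^bsub>C\<^esub> h = \<one>\<^bsub>H T (Cod C f)\<^esub>
        \<longrightarrow> (\<exists>!u. u \<in> Hom C T (Dom C k) \<and> k \<cdot>\<^bsub>C\<^esub> u = h))"

definition is_cokernel ::
  "('o, 'a, 'z) cat_scheme \<Rightarrow> ('o \<Rightarrow> 'o \<Rightarrow> 'a monoid) \<Rightarrow> 'a \<Rightarrow> 'a \<Rightarrow> bool" where
  "is_cokernel C H q f \<longleftrightarrow>
     q \<in> Arr C \<and> f \<in> Arr C \<and> Dom C q = Cod C f \<and>
     q \<cdot>\<^bsub>C\<^esub> f = \<one>\<^bsub>H (Dom C f) (Cod C q)\<^esub> \<and>
     (\<forall>T. \<forall>h\<in>Hom C (Cod C f) T. h \<cdot>\<^bsub>C\<^esub> f = \<one>\<^bsub>H (Dom C f) T\<^esub>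
        \<longrightarrow> (\<exists>!u. u \<in> Hom C (Cod C q) T \<and> u \<cdot>\<^bsub>C\<^esub> q = h))"

locale abelian_category = preadditive_category C H
  for C :: "('o, 'a, 'z) cat_scheme" (structure) and H +
  assumes zero_obj: "\<exists>Z. is_zero_obj C Z"
    and direct_sums: "(\<And>i. i \<le> n \<Longrightarrow> X i \<in> Obj C) \<Longrightarrow> \<exists>S \<iota> \<pi>. is_direct_sum C H n X S \<iota> \<pi>"
    and kernels: "f \<in> Arr C \<Longrightarrow> \<exists>k. is_kernel C H k f"
    and cokernels: "f \<in> Arr C \<Longrightarrow> \<exists>q. is_cokernel C H q f"
    and mono_normal: "is_mono C f \<Longrightarrow> \<exists>g. is_kernel C H f g"
    and epi_normal: "is_epi C f \<Longrightarrow> \<exists>g. is_cokernel C H f g"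

definition short_exact ::
  "('o, 'a, 'z) cat_scheme \<Rightarrow> ('o \<Rightarrow> 'o \<Rightarrow> 'a monoid) \<Rightarrow> 'a \<Rightarrow> 'a \<Rightarrow> bool" where
  "short_exact C H f g \<longleftrightarrow> is_kernel C H f g \<and> is_cokernel C H g f"

definition additive_endofunctor ::
  "('o, 'a, 'z) cat_scheme \<Rightarrow> ('o \<Rightarrow> 'o \<Rightarrow> 'a monoid) \<Rightarrow> ('o, 'a, 'o, 'a) functor_data \<Rightarrow> bool" where
  "additive_endofunctor C H F \<longleftrightarrow> is_functor C C F \<and>
     (\<forall>X\<in>Obj C. \<forall>Y\<in>Obj C. AMap F \<in> hom (H X Y) (H (OMap F X) (OMap F Y)))"

definition exact_endofunctor ::
  "('o, 'a, 'z) cat_scheme \<Rightarrow> ('o \<Rightarrow> 'o \<Rightarrow> 'a monoid) \<Rightarrow> ('o, 'a, 'o, 'a) functor_data \<Rightarrow> bool" where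
  "exact_endofunctor C H F \<longleftrightarrow> is_functor C C F \<and>
     (\<forall>f g. short_exact C H f g \<longrightarrow> short_exact C H (AMap F f) (AMap F g))"

definition tensor_left :: "('o, 'a, 'z) moncat_scheme \<Rightarrow> 'o \<Rightarrow> ('o, 'a, 'o, 'a) functor_data" where
  "tensor_left C X = \<lparr>OMap = (\<lambda>Y. X \<odot>\<^bsub>C\<^esub> Y), AMap = (\<lambda>f. Idt C X \<boxtimes>\<^bsub>C\<^esub> f)\<rparr>"

definition tensor_right :: "('o, 'a, 'z) moncat_scheme \<Rightarrow> 'o \<Rightarrow> ('o, 'a, 'o, 'a) functor_data" where
  "tensor_right C X = \<lparr>OMap = (\<lambda>Y. Y \<odot>\<^bsub>C\<^esub> X), AMap = (\<lambda>f. f \<boxtimes>\<^bsub>C\<^esub> Idt C X)\<rparr>"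

definition tensor_additive :: "('o, 'a, 'z) moncat_scheme \<Rightarrow> ('o \<Rightarrow> 'o \<Rightarrow> 'a monoid) \<Rightarrow> bool" where
  "tensor_additive C H \<longleftrightarrow> (\<forall>X\<in>Obj C.
     additive_endofunctor C H (tensor_left C X) \<and> additive_endofunctor C H (tensor_right C X))"

definition tensor_exact :: "('o, 'a, 'z) moncat_scheme \<Rightarrow> ('o \<Rightarrow> 'o \<Rightarrow> 'a monoid) \<Rightarrow> bool" where
  "tensor_exact C H \<longleftrightarrow> (\<forall>X\<in>Obj C.
     exact_endofunctor C H (tensor_left C X) \<and> exact_endofunctor C H (tensor_right C X))"

section \<open>Externally \<open>\<nat>\<close>-graded objects\<close>

definition zero_object :: "('o, 'a, 'z) cat_scheme \<Rightarrow> 'o" where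
  "zero_object C = (SOME Z. is_zero_obj C Z)"

definition direct_sum ::
  "('o, 'a, 'z) cat_scheme \<Rightarrow> ('o \<Rightarrow> 'o \<Rightarrow> 'a monoid) \<Rightarrow> nat \<Rightarrow> (nat \<Rightarrow> 'o) \<Rightarrow>
   'o \<times> (nat \<Rightarrow> 'a) \<times> (nat \<Rightarrow> 'a)" where
  "direct_sum C H n X = (SOME (S, \<iota>, \<pi>). is_direct_sum C H n X S \<iota> \<pi>)"

text \<open>
  \<open>gr_obj M H X Y n\<close> is \<open>\<Oplus>\<^bsub>i\<le>n\<^esub> X\<^sub>i \<odot> Y\<^bsub>n-i\<^esub>\<close>; its injections and projections are
  \<open>gr_in M H X Y n i\<close> and \<open>gr_pr M H X Y n i\<close>.
\<close>

definition gr_sum ::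
  "('o, 'a, 'z) moncat_scheme \<Rightarrow> ('o \<Rightarrow> 'o \<Rightarrow> 'a monoid) \<Rightarrow> (nat \<Rightarrow> 'o) \<Rightarrow> (nat \<Rightarrow> 'o) \<Rightarrow> nat \<Rightarrow>
   'o \<times> (nat \<Rightarrow> 'a) \<times> (nat \<Rightarrow> 'a)" where
  "gr_sum M H X Y n = direct_sum M H n (\<lambda>i. X i \<odot>\<^bsub>M\<^esub> Y (n - i))"

definition gr_obj ::
  "('o, 'a, 'z) moncat_scheme \<Rightarrow> ('o \<Rightarrow> 'o \<Rightarrow> 'a monoid) \<Rightarrow> (nat \<Rightarrow> 'o) \<Rightarrow> (nat \<Rightarrow> 'o) \<Rightarrow> nat \<Rightarrow> 'o" where
  "gr_obj M H X Y n = fst (gr_sum M H X Y n)"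

definition gr_in ::
  "('o, 'a, 'z) moncat_scheme \<Rightarrow> ('o \<Rightarrow> 'o \<Rightarrow> 'a monoid) \<Rightarrow> (nat \<Rightarrow> 'o) \<Rightarrow> (nat \<Rightarrow> 'o) \<Rightarrow> nat \<Rightarrow> nat \<Rightarrow> 'a" where
  "gr_in M H X Y n = fst (snd (gr_sum M H X Y n))"

definition gr_pr ::
  "('o, 'a, 'z) moncat_scheme \<Rightarrow> ('o \<Rightarrow> 'o \<Rightarrow> 'a monoid) \<Rightarrow> (nat \<Rightarrow> 'o) \<Rightarrow> (nat \<Rightarrow> 'o) \<Rightarrow> nat \<Rightarrow> nat \<Rightarrow> 'a" where
  "gr_pr M H X Y n = snd (snd (gr_sum M H X Y n))"

text \<open>The direct sum of the arrows \<open>f\<^sub>i \<otimes> g\<^bsub>n-i\<^esub>\<close>.\<close>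

definition gr_arr ::
  "('o, 'a, 'z) moncat_scheme \<Rightarrow> ('o \<Rightarrow> 'o \<Rightarrow> 'a monoid) \<Rightarrow> (nat \<Rightarrow> 'a) \<Rightarrow> (nat \<Rightarrow> 'a) \<Rightarrow> nat \<Rightarrow> 'a" where
  "gr_arr M H f g n =
     (let X = (\<lambda>i. Dom M (f i)); X' = (\<lambda>i. Cod M (f i));
          Y = (\<lambda>i. Dom M (g i)); Y' = (\<lambda>i. Cod M (g i))
      in finprod (H (gr_obj M H X Y n) (gr_obj M H X' Y' n))
           (\<lambda>i. gr_in M H X' Y' n i \<cdot>\<^bsub>M\<^esub> (f i \<boxtimes>\<^bsub>M\<^esub> g (n - i)) \<cdot>\<^bsub>M\<^esub> gr_pr M H X Y n i) {..n})"

text \<open>The unit (and, below, the pre-dual): an object placed in degree \<open>0\<close>.\<close>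

definition gr_deg0 :: "('o, 'a, 'z) cat_scheme \<Rightarrow> 'o \<Rightarrow> nat \<Rightarrow> 'o" where
  "gr_deg0 M X n = (if n = 0 then X else zero_object M)"

text \<open>
  In degree \<open>n\<close> the associator maps the summand \<open>(X\<^sub>i \<odot> Y\<^bsub>p-i\<^esub>) \<odot> Z\<^bsub>n-p\<^esub>\<close> (\<open>i \<le> p \<le> n\<close>) onto
  \<open>X\<^sub>i \<odot> (Y\<^bsub>p-i\<^esub> \<odot> Z\<^bsub>n-p\<^esub>)\<close> by the associator of \<open>M\<close>; note \<open>n - p = (n - i) - (p - i)\<close>.
\<close>

definition gr_assoc ::
  "('o, 'a, 'z) moncat_scheme \<Rightarrow> ('o \<Rightarrow> 'o \<Rightarrow> 'a monoid) \<Rightarrow>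
   (nat \<Rightarrow> 'o) \<Rightarrow> (nat \<Rightarrow> 'o) \<Rightarrow> (nat \<Rightarrow> 'o) \<Rightarrow> nat \<Rightarrow> 'a" where
  "gr_assoc M H X Y Z n =
     (let XY = gr_obj M H X Y; YZ = gr_obj M H Y Z;
          G = H (gr_obj M H XY Z n) (gr_obj M H X YZ n)
      in finprod G (\<lambda>p. finprod G (\<lambda>i.
           gr_in M H X YZ n i
           \<cdot>\<^bsub>M\<^esub> (Idt M (X i) \<boxtimes>\<^bsub>M\<^esub> gr_in M H Y Z (n - i) (p - i))
           \<cdot>\<^bsub>M\<^esub> Assoc M (X i) (Y (p - i)) (Z (n - p))
           \<cdot>\<^bsub>M\<^esub> (gr_pr M H X Y p i \<boxtimes>\<^bsub>M\<^esub> Idt M (Z (n - p)))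
           \<cdot>\<^bsub>M\<^esub> gr_pr M H XY Z n p) {..p}) {..n})"

definition gr_lunit ::
  "('o, 'a, 'z) moncat_scheme \<Rightarrow> ('o \<Rightarrow> 'o \<Rightarrow> 'a monoid) \<Rightarrow> (nat \<Rightarrow> 'o) \<Rightarrow> nat \<Rightarrow> 'a" where
  "gr_lunit M H X n = LUnit M (X n) \<cdot>\<^bsub>M\<^esub> gr_pr M H (gr_deg0 M (TUnit M)) X n 0"

definition gr_runit ::
  "('o, 'a, 'z) moncat_scheme \<Rightarrow> ('o \<Rightarrow> 'o \<Rightarrow> 'a monoid) \<Rightarrow> (nat \<Rightarrow> 'o) \<Rightarrow> nat \<Rightarrow> 'a" where
  "gr_runit M H X n = RUnit M (X n) \<cdot>\<^bsub>M\<^esub> gr_pr M H X (gr_deg0 M (TUnit M)) n n"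

text \<open>The braiding maps the \<open>i\<close>-th summand \<open>X\<^sub>i \<odot> Y\<^bsub>n-i\<^esub>\<close> onto the summand \<open>Y\<^bsub>n-i\<^esub> \<odot> X\<^sub>i\<close> of index \<open>n - i\<close>.\<close>

definition gr_braid ::
  "('o, 'a, 'z) brcat_scheme \<Rightarrow> ('o \<Rightarrow> 'o \<Rightarrow> 'a monoid) \<Rightarrow> (nat \<Rightarrow> 'o) \<Rightarrow> (nat \<Rightarrow> 'o) \<Rightarrow> nat \<Rightarrow> 'a" where
  "gr_braid M H X Y n =
     finprod (H (gr_obj M H X Y n) (gr_obj M H Y X n))
       (\<lambda>i. gr_in M H Y X n (n - i) \<cdot>\<^bsub>M\<^esub> Braid M (X i) (Y (n - i)) \<cdot>\<^bsub>M\<^esub> gr_pr M H X Y n i) {..n}"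

definition gr_dual :: "('o, 'a, 'z) prcat_scheme \<Rightarrow> (nat \<Rightarrow> 'o) \<Rightarrow> nat \<Rightarrow> 'o" where
  "gr_dual M X = gr_deg0 M (Dual M (X 0))"

definition gr_ev ::
  "('o, 'a, 'z) prcat_scheme \<Rightarrow> ('o \<Rightarrow> 'o \<Rightarrow> 'a monoid) \<Rightarrow> (nat \<Rightarrow> 'o) \<Rightarrow> nat \<Rightarrow> 'a" where
  "gr_ev M H X n =
     (if n = 0 then Ev M (X 0) \<cdot>\<^bsub>M\<^esub> gr_pr M H (gr_dual M X) X 0 0
      else \<one>\<^bsub>H (gr_obj M H (gr_dual M X) X n) (zero_object M)\<^esub>)"

definition graded ::
  "('o, 'a, 'z) prcat_scheme \<Rightarrow> ('o \<Rightarrow> 'o \<Rightarrow> 'a monoid) \<Rightarrow> (nat \<Rightarrow> 'o, nat \<Rightarrow> 'a) prcat" where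
  "graded M H = \<lparr>
     Obj = {X. \<forall>n. X n \<in> Obj M},
     Arr = {f. \<forall>n. f n \<in> Arr M},
     Dom = (\<lambda>f n. Dom M (f n)), Cod = (\<lambda>f n. Cod M (f n)),
     Idt = (\<lambda>X n. Idt M (X n)),
     Comp = (\<lambda>g f n. g n \<cdot>\<^bsub>M\<^esub> f n),
     TObj = gr_obj M H, TArr = gr_arr M H,
     TUnit = gr_deg0 M (TUnit M),
     Assoc = gr_assoc M H, LUnit = gr_lunit M H, RUnit = gr_runit M H,
     Braid = gr_braid M H,
     Dual = gr_dual M, Ev = gr_ev M H\<rparr>"

end

theory Submission
  imports Defs
begin

text \<open>
  A morphism of graded algebras into the dual \<open>V\<^sup>*\<close> of a graded coalgebra \<open>V\<close> is determined by its component
  in degree \<open>0\<close>, because \<open>V\<^sup>*\<close> is concentrated there.  Hence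
  \<open>Alg(A, V\<^sup>*) = Alg(A\<^sub>0, V\<^sub>0\<^sup>*) = Coalg(V\<^sub>0, U) = Coalg(V, U[0])\<close>, where \<open>U\<close> represents the algebra \<open>A\<^sub>0\<close> by
  hypothesis and \<open>U[0]\<close> is \<open>U\<close> placed in degree \<open>0\<close>; this is the left adjoint on algebras.

  For the right adjoint on coalgebras one works in an arbitrary pre-rigid braided category.  The colax
  structure of \<open>(-)\<^sup>*\<close> turns out to be \<open>\<phi>\<^sub>2 \<circ> c\<^bsub>Y\<^sup>*,X\<^sup>*\<^esub> \<circ> c\<^bsub>X\<^sup>*,Y\<^sup>*\<^esub>\<close>, so the induced functor on coalgebras is the
  opposite of the one on algebras followed by the automorphism \<open>m \<mapsto> m \<circ> c \<circ> c\<close> of the category of algebras.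
\<close>

section \<open>Categories\<close>

lemma in_Hom: "f \<in> Hom C X Y \<longleftrightarrow> f \<in> Arr C \<and> Dom C f = X \<and> Cod C f = Y"
  by (auto simp: Hom_def)

context category
begin

lemma Idt_arr [simp]:
  assumes "X \<in> Obj C"
  shows "Idt C X \<in> Arr C" "Dom C (Idt C X) = X" "Cod C (Idt C X) = X"
  using Idt_Hom[OF assms] by (auto simp: in_Hom)

lemma comp_arr [simp]:
  assumes "f \<in> Arr C" "g \<in> Arr C" "Dom C g = Cod C f"
  shows "g \<cdot> f \<in> Arr C" "Dom C (g \<cdot> f) = Dom C f" "Cod C (g \<cdot> f) = Cod C g"
  using Comp_Hom[of f "Dom C f" "Cod C f" g "Cod C g"] assms by (auto simp: in_Hom)

lemma comp_assoc [simp]: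
  assumes "f \<in> Arr C" "g \<in> Arr C" "h \<in> Arr C" "Dom C g = Cod C f" "Dom C h = Cod C g"
  shows "(h \<cdot> g) \<cdot> f = h \<cdot> (g \<cdot> f)"
  using assms by (intro Comp_assoc) (auto simp: in_Hom)

lemma comp_Idt [simp]:
  assumes "f \<in> Arr C"
  shows "Cod C f = Y \<Longrightarrow> Idt C Y \<cdot> f = f" "Dom C f = X \<Longrightarrow> f \<cdot> Idt C X = f"
  using assms by (auto intro!: Comp_Idt_left Comp_Idt_right simp: in_Hom)

declare Dom_Obj [simp] Cod_Obj [simp]

lemma comp_eq_cont:
  assumes "g \<cdot> f = k \<cdot> h"
    and "f \<in> Arr C" "g \<in> Arr C" "Dom C g = Cod C f"
    and "h \<in> Arr C" "k \<in> Arr C" "Dom C k = Cod C h"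
    and "w \<in> Arr C" "Cod C w = Dom C f"
  shows "g \<cdot> (f \<cdot> w) = k \<cdot> (h \<cdot> w)"
proof -
  have "Dom C h = Dom C f"
    using assms(1-7) comp_arr(2) by metis
  then show ?thesis
    using assms by (metis comp_assoc)
qed

lemma inverse_arrows_unique:
  assumes "inverse_arrows C f g" "inverse_arrows C f h"
  shows "g = h"
proof -
  have "g = (h \<cdot> f) \<cdot> g"
    using assms by (auto simp: inverse_arrows_def in_Hom)
  also have "\<dots> = h \<cdot> (f \<cdot> g)"
    using assms by (intro comp_assoc) (auto simp: inverse_arrows_def in_Hom)
  also have "\<dots> = h"
    using assms by (auto simp: inverse_arrows_def in_Hom)
  finally show ?thesis .
qed

lemma inv_arr_eqI:
  assumes "inverse_arrows C f g"
  shows "inv_arr C f = g"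
  unfolding inv_arr_def using assms inverse_arrows_unique by blast

lemma iso_inverse_arrows:
  assumes "iso_arr C f"
  shows "inverse_arrows C f (inv_arr C f)"
  using assms inv_arr_eqI unfolding iso_arr_def by metis

lemma iso_arr_arr: "iso_arr C f \<Longrightarrow> f \<in> Arr C"
  by (auto simp: iso_arr_def inverse_arrows_def)

lemma inv_arr [simp]:
  assumes "iso_arr C f"
  shows "inv_arr C f \<in> Arr C" "Dom C (inv_arr C f) = Cod C f" "Cod C (inv_arr C f) = Dom C f"
    "inv_arr C f \<cdot> f = Idt C (Dom C f)" "f \<cdot> inv_arr C f = Idt C (Cod C f)"
  using iso_inverse_arrows[OF assms] by (auto simp: inverse_arrows_def in_Hom)

lemma inv_arr_cont [simp]:
  assumes "iso_arr C f" "k \<in> Arr C"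
  shows "Cod C k = Dom C f \<Longrightarrow> inv_arr C f \<cdot> (f \<cdot> k) = k"
    "Cod C k = Cod C f \<Longrightarrow> f \<cdot> (inv_arr C f \<cdot> k) = k"
proof -
  show "inv_arr C f \<cdot> (f \<cdot> k) = k" if "Cod C k = Dom C f"
    using assms that comp_assoc[of k f "inv_arr C f"] iso_arr_arr by simp
  show "f \<cdot> (inv_arr C f \<cdot> k) = k" if "Cod C k = Cod C f"
    using assms that comp_assoc[of k "inv_arr C f" f] iso_arr_arr by simp
qed

lemma iso_inv_arr [simp]:
  assumes "iso_arr C f"
  shows "iso_arr C (inv_arr C f)" "inv_arr C (inv_arr C f) = f"
proof -
  have *: "inverse_arrows C (inv_arr C f) f"
    using assms iso_arr_arr by (auto simp: inverse_arrows_def in_Hom)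
  then show "iso_arr C (inv_arr C f)" "inv_arr C (inv_arr C f) = f"
    using inv_arr_eqI by (auto simp: iso_arr_def)
qed

lemma inverse_arrows_comp:
  assumes "iso_arr C f" "iso_arr C g" "Dom C g = Cod C f"
  shows "inverse_arrows C (g \<cdot> f) (inv_arr C f \<cdot> inv_arr C g)"
  using assms iso_arr_arr by (auto simp: inverse_arrows_def in_Hom)

lemma iso_comp [simp]:
  assumes "iso_arr C f" "iso_arr C g" "Dom C g = Cod C f"
  shows "iso_arr C (g \<cdot> f)" "inv_arr C (g \<cdot> f) = inv_arr C f \<cdot> inv_arr C g"
  using inverse_arrows_comp[OF assms] inv_arr_eqI by (auto simp: iso_arr_def)

lemma iso_Idt [simp]:
  assumes "X \<in> Obj C"
  shows "iso_arr C (Idt C X)" "inv_arr C (Idt C X) = Idt C X"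
proof -
  have *: "inverse_arrows C (Idt C X) (Idt C X)"
    using assms by (auto simp: inverse_arrows_def in_Hom)
  then show "iso_arr C (Idt C X)" "inv_arr C (Idt C X) = Idt C X"
    using inv_arr_eqI by (auto simp: iso_arr_def)
qed

lemma iso_cancel_left:
  assumes "iso_arr C f" "f \<cdot> g = f \<cdot> h" "g \<in> Arr C" "h \<in> Arr C" "Cod C g = Dom C f" "Cod C h = Dom C f"
  shows "g = h"
  using assms inv_arr_cont(1) by metis

lemma iso_cancel_right:
  assumes "iso_arr C f" "g \<cdot> f = h \<cdot> f" "g \<in> Arr C" "h \<in> Arr C" "Dom C g = Cod C f" "Dom C h = Cod C f"
  shows "g = h"
proof -
  note f = iso_arr_arr[OF assms(1)]
  have "g = (g \<cdot> f) \<cdot> inv_arr C f"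
    using assms(1,3,5) f by simp
  also have "\<dots> = (h \<cdot> f) \<cdot> inv_arr C f"
    using assms(2) by simp
  also have "\<dots> = h"
    using assms(1,4,6) f by simp
  finally show ?thesis .
qed

end

section \<open>Monoidal categories\<close>

context monoidal_category
begin

abbreviation unit_object ("\<I>") where "\<I> \<equiv> TUnit C"
abbreviation assoc ("\<alpha>") where "\<alpha> \<equiv> Assoc C"
abbreviation assoc_inv ("\<alpha>\<^sup>-") where "\<alpha>\<^sup>- X Y Z \<equiv> inv_arr C (Assoc C X Y Z)"
abbreviation lunit ("\<l>") where "\<l> \<equiv> LUnit C"
abbreviation runit ("\<r>") where "\<r> \<equiv> RUnit C"
abbreviation whisker_left (infixr "\<rhd>" 76) where "X \<rhd> f \<equiv> Idt C X \<boxtimes> f"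
abbreviation whisker_right (infixl "\<lhd>" 76) where "f \<lhd> X \<equiv> f \<boxtimes> Idt C X"

declare TObj_Obj [simp] TUnit_Obj [simp] Assoc_iso [simp] LUnit_iso [simp] RUnit_iso [simp]
  TArr_Idt [simp]

lemma tensor_arr [simp]:
  assumes "f \<in> Arr C" "g \<in> Arr C"
  shows "f \<boxtimes> g \<in> Arr C" "Dom C (f \<boxtimes> g) = Dom C f \<odot> Dom C g" "Cod C (f \<boxtimes> g) = Cod C f \<odot> Cod C g"
  using TArr_Hom[of f "Dom C f" "Cod C f" g "Dom C g" "Cod C g"] assms by (auto simp: in_Hom)

lemma assoc_arr [simp]:
  assumes "X \<in> Obj C" "Y \<in> Obj C" "Z \<in> Obj C"
  shows "\<alpha> X Y Z \<in> Arr C" "Dom C (\<alpha> X Y Z) = (X \<odot> Y) \<odot> Z" "Cod C (\<alpha> X Y Z) = X \<odot> (Y \<odot> Z)"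
  using Assoc_Hom[OF assms] by (auto simp: in_Hom)

lemma unit_arr [simp]:
  assumes "X \<in> Obj C"
  shows "\<l> X \<in> Arr C" "Dom C (\<l> X) = \<I> \<odot> X" "Cod C (\<l> X) = X"
    "\<r> X \<in> Arr C" "Dom C (\<r> X) = X \<odot> \<I>" "Cod C (\<r> X) = X"
  using LUnit_Hom[OF assms] RUnit_Hom[OF assms] by (auto simp: in_Hom)

lemma interchange:
  assumes "f \<in> Arr C" "f' \<in> Arr C" "g \<in> Arr C" "g' \<in> Arr C" "Dom C f' = Cod C f" "Dom C g' = Cod C g"
  shows "(f' \<boxtimes> g') \<cdot> (f \<boxtimes> g) = (f' \<cdot> f) \<boxtimes> (g' \<cdot> g)"
  using TArr_Comp[of f "Dom C f" "Cod C f" f' "Cod C f'" g "Dom C g" "Cod C g" g' "Cod C g'"] assms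
  by (auto simp: in_Hom)

lemma interchange_cont:
  assumes "f \<in> Arr C" "f' \<in> Arr C" "g \<in> Arr C" "g' \<in> Arr C" "Dom C f' = Cod C f" "Dom C g' = Cod C g"
    "k \<in> Arr C" "Cod C k = Dom C f \<odot> Dom C g"
  shows "(f' \<boxtimes> g') \<cdot> ((f \<boxtimes> g) \<cdot> k) = ((f' \<cdot> f) \<boxtimes> (g' \<cdot> g)) \<cdot> k"
  using assms interchange[of f f' g g', symmetric] by simp

lemma whisker_comp:
  assumes "f \<in> Arr C" "g \<in> Arr C" "Dom C g = Cod C f" "X \<in> Obj C"
  shows "X \<rhd> (g \<cdot> f) = (X \<rhd> g) \<cdot> (X \<rhd> f)" "(g \<cdot> f) \<lhd> X = (g \<lhd> X) \<cdot> (f \<lhd> X)"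
  using assms by (simp_all add: interchange)

lemma assoc_natural:
  assumes "f \<in> Arr C" "g \<in> Arr C" "h \<in> Arr C" "Cod C f = X" "Cod C g = Y" "Cod C h = Z"
  shows "\<alpha> X Y Z \<cdot> ((f \<boxtimes> g) \<boxtimes> h) = (f \<boxtimes> (g \<boxtimes> h)) \<cdot> \<alpha> (Dom C f) (Dom C g) (Dom C h)"
  using assms by (intro Assoc_natural) (auto simp: in_Hom)

lemma assoc_inv_natural:
  assumes "f \<in> Arr C" "g \<in> Arr C" "h \<in> Arr C" "Cod C f = X" "Cod C g = Y" "Cod C h = Z"
  shows "\<alpha>\<^sup>- X Y Z \<cdot> (f \<boxtimes> (g \<boxtimes> h)) = ((f \<boxtimes> g) \<boxtimes> h) \<cdot> \<alpha>\<^sup>- (Dom C f) (Dom C g) (Dom C h)"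
proof (rule iso_cancel_left[of "\<alpha> X Y Z"])
  show "\<alpha> X Y Z \<cdot> (\<alpha>\<^sup>- X Y Z \<cdot> (f \<boxtimes> (g \<boxtimes> h))) =
      \<alpha> X Y Z \<cdot> (((f \<boxtimes> g) \<boxtimes> h) \<cdot> \<alpha>\<^sup>- (Dom C f) (Dom C g) (Dom C h))"
    using assms comp_eq_cont[OF assoc_natural[OF assms], of "\<alpha>\<^sup>- (Dom C f) (Dom C g) (Dom C h)"]
    by auto
qed (use assms in auto)

lemma lunit_natural:
  assumes "f \<in> Arr C" "Cod C f = Y"
  shows "\<l> Y \<cdot> (\<I> \<rhd> f) = f \<cdot> \<l> (Dom C f)"
  using assms by (intro LUnit_natural) (auto simp: in_Hom)

lemma runit_natural:
  assumes "f \<in> Arr C" "Cod C f = Y"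
  shows "\<r> Y \<cdot> (f \<lhd> \<I>) = f \<cdot> \<r> (Dom C f)"
  using assms by (intro RUnit_natural) (auto simp: in_Hom)

lemma assoc_natural_cont:
  assumes "f \<in> Arr C" "g \<in> Arr C" "h \<in> Arr C" "Cod C f = X" "Cod C g = Y" "Cod C h = Z"
    "k \<in> Arr C" "Cod C k = (Dom C f \<odot> Dom C g) \<odot> Dom C h"
  shows "\<alpha> X Y Z \<cdot> (((f \<boxtimes> g) \<boxtimes> h) \<cdot> k) = (f \<boxtimes> (g \<boxtimes> h)) \<cdot> (\<alpha> (Dom C f) (Dom C g) (Dom C h) \<cdot> k)"
  by (rule comp_eq_cont[OF assoc_natural]) (use assms in auto)

lemma assoc_inv_natural_cont:
  assumes "f \<in> Arr C" "g \<in> Arr C" "h \<in> Arr C" "Cod C f = X" "Cod C g = Y" "Cod C h = Z"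
    "k \<in> Arr C" "Cod C k = Dom C f \<odot> (Dom C g \<odot> Dom C h)"
  shows "\<alpha>\<^sup>- X Y Z \<cdot> ((f \<boxtimes> (g \<boxtimes> h)) \<cdot> k) = ((f \<boxtimes> g) \<boxtimes> h) \<cdot> (\<alpha>\<^sup>- (Dom C f) (Dom C g) (Dom C h) \<cdot> k)"
  by (rule comp_eq_cont[OF assoc_inv_natural]) (use assms in auto)

lemma lunit_natural_cont:
  assumes "f \<in> Arr C" "Cod C f = Y" "k \<in> Arr C" "Cod C k = \<I> \<odot> Dom C f"
  shows "\<l> Y \<cdot> ((\<I> \<rhd> f) \<cdot> k) = f \<cdot> (\<l> (Dom C f) \<cdot> k)"
  by (rule comp_eq_cont[OF lunit_natural]) (use assms in auto)

lemma runit_natural_cont: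
  assumes "f \<in> Arr C" "Cod C f = Y" "k \<in> Arr C" "Cod C k = Dom C f \<odot> \<I>"
  shows "\<r> Y \<cdot> ((f \<lhd> \<I>) \<cdot> k) = f \<cdot> (\<r> (Dom C f) \<cdot> k)"
  by (rule comp_eq_cont[OF runit_natural]) (use assms in auto)

lemma lunit_inv_natural:
  assumes [simp]: "f \<in> Arr C" "Cod C f = Y"
  shows "(\<I> \<rhd> f) \<cdot> inv_arr C (\<l> (Dom C f)) = inv_arr C (\<l> Y) \<cdot> f"
proof -
  have [simp]: "Y \<in> Obj C"
    using assms Cod_Obj by blast
  have "\<l> Y \<cdot> ((\<I> \<rhd> f) \<cdot> inv_arr C (\<l> (Dom C f))) = \<l> Y \<cdot> (inv_arr C (\<l> Y) \<cdot> f)"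
    by (simp add: lunit_natural_cont)
  then show ?thesis
    by (rule iso_cancel_left[rotated]) simp_all
qed

lemma runit_inv_natural:
  assumes [simp]: "f \<in> Arr C" "Cod C f = Y"
  shows "(f \<lhd> \<I>) \<cdot> inv_arr C (\<r> (Dom C f)) = inv_arr C (\<r> Y) \<cdot> f"
proof -
  have [simp]: "Y \<in> Obj C"
    using assms Cod_Obj by blast
  have "\<r> Y \<cdot> ((f \<lhd> \<I>) \<cdot> inv_arr C (\<r> (Dom C f))) = \<r> Y \<cdot> (inv_arr C (\<r> Y) \<cdot> f)"
    by (simp add: runit_natural_cont)
  then show ?thesis
    by (rule iso_cancel_left[rotated]) simp_all
qed

lemma iso_tensor [simp]:
  assumes "iso_arr C f" "iso_arr C g"
  shows "iso_arr C (f \<boxtimes> g)" "inv_arr C (f \<boxtimes> g) = inv_arr C f \<boxtimes> inv_arr C g"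
proof -
  have *: "inverse_arrows C (f \<boxtimes> g) (inv_arr C f \<boxtimes> inv_arr C g)"
    using assms iso_arr_arr by (auto simp: inverse_arrows_def in_Hom interchange)
  then show "iso_arr C (f \<boxtimes> g)" "inv_arr C (f \<boxtimes> g) = inv_arr C f \<boxtimes> inv_arr C g"
    using inv_arr_eqI by (auto simp: iso_arr_def)
qed

lemma unit_whisker_faithful:
  assumes "f \<in> Arr C" "g \<in> Arr C" "Dom C f = Dom C g" "Cod C f = Cod C g"
  shows "\<I> \<rhd> f = \<I> \<rhd> g \<Longrightarrow> f = g" "f \<lhd> \<I> = g \<lhd> \<I> \<Longrightarrow> f = g"
proof -
  show "f = g" if "\<I> \<rhd> f = \<I> \<rhd> g"
  proof (rule iso_cancel_right[of "\<l> (Dom C f)"])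
    show "f \<cdot> \<l> (Dom C f) = g \<cdot> \<l> (Dom C f)"
      using assms that lunit_natural[of f "Cod C f"] lunit_natural[of g "Cod C f"] by simp
  qed (use assms in auto)
  show "f = g" if "f \<lhd> \<I> = g \<lhd> \<I>"
  proof (rule iso_cancel_right[of "\<r> (Dom C f)"])
    show "f \<cdot> \<r> (Dom C f) = g \<cdot> \<r> (Dom C f)"
      using assms that runit_natural[of f "Cod C f"] runit_natural[of g "Cod C f"] by simp
  qed (use assms in auto)
qed

lemma triangle':
  assumes "X \<in> Obj C" "Y \<in> Obj C"
  shows "(X \<rhd> \<l> Y) \<cdot> \<alpha> X \<I> Y = \<r> X \<lhd> Y"
  using triangle[OF assms] .

lemma pentagon':
  assumes "W \<in> Obj C" "X \<in> Obj C" "Y \<in> Obj C" "Z \<in> Obj C"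
  shows "(W \<rhd> \<alpha> X Y Z) \<cdot> (\<alpha> W (X \<odot> Y) Z \<cdot> (\<alpha> W X Y \<lhd> Z)) = \<alpha> W X (Y \<odot> Z) \<cdot> \<alpha> (W \<odot> X) Y Z"
  using pentagon[OF assms] assms by simp

lemma lunit_tensor:
  assumes [simp]: "X \<in> Obj C" "Y \<in> Obj C"
  shows "\<l> (X \<odot> Y) \<cdot> \<alpha> \<I> X Y = \<l> X \<lhd> Y"
proof (rule unit_whisker_faithful(1))
  let ?k = "\<alpha> \<I> (\<I> \<odot> X) Y \<cdot> (\<alpha> \<I> \<I> X \<lhd> Y)"
  have "(\<I> \<rhd> (\<l> (X \<odot> Y) \<cdot> \<alpha> \<I> X Y)) \<cdot> ?k = (\<I> \<rhd> \<l> (X \<odot> Y)) \<cdot> ((\<I> \<rhd> \<alpha> \<I> X Y) \<cdot> ?k)"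
    by (simp add: whisker_comp)
  also have "\<dots> = ((\<I> \<rhd> \<l> (X \<odot> Y)) \<cdot> \<alpha> \<I> \<I> (X \<odot> Y)) \<cdot> \<alpha> (\<I> \<odot> \<I>) X Y"
    by (simp add: pentagon')
  also have "\<dots> = (\<r> \<I> \<lhd> (X \<odot> Y)) \<cdot> \<alpha> (\<I> \<odot> \<I>) X Y"
    by (simp add: triangle' del: comp_assoc)
  also have "\<dots> = \<alpha> \<I> X Y \<cdot> ((\<r> \<I> \<lhd> X) \<lhd> Y)"
    by (simp add: assoc_natural)
  also have "\<dots> = \<alpha> \<I> X Y \<cdot> (((\<I> \<rhd> \<l> X) \<lhd> Y) \<cdot> (\<alpha> \<I> \<I> X \<lhd> Y))"
    by (simp add: interchange triangle')
  also have "\<dots> = (\<I> \<rhd> (\<l> X \<lhd> Y)) \<cdot> ?k"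
    by (simp add: assoc_natural_cont)
  finally show "\<I> \<rhd> (\<l> (X \<odot> Y) \<cdot> \<alpha> \<I> X Y) = \<I> \<rhd> (\<l> X \<lhd> Y)"
    by (rule iso_cancel_right[rotated]) simp_all
qed simp_all

lemma runit_tensor:
  assumes [simp]: "X \<in> Obj C" "Y \<in> Obj C"
  shows "(X \<rhd> \<r> Y) \<cdot> \<alpha> X Y \<I> = \<r> (X \<odot> Y)"
proof (rule unit_whisker_faithful(2))
  have "\<alpha> X Y \<I> \<cdot> (\<r> (X \<odot> Y) \<lhd> \<I>) = \<alpha> X Y \<I> \<cdot> (((X \<odot> Y) \<rhd> \<l> \<I>) \<cdot> \<alpha> (X \<odot> Y) \<I> \<I>)"
    by (simp add: triangle')
  also have "\<dots> = (X \<rhd> (Y \<rhd> \<l> \<I>)) \<cdot> (\<alpha> X Y (\<I> \<odot> \<I>) \<cdot> \<alpha> (X \<odot> Y) \<I> \<I>)"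
    using assoc_natural_cont[of "Idt C X" "Idt C Y" "\<l> \<I>" X Y \<I> "\<alpha> (X \<odot> Y) \<I> \<I>"] by simp
  also have "\<dots> = (X \<rhd> (Y \<rhd> \<l> \<I>)) \<cdot> ((X \<rhd> \<alpha> Y \<I> \<I>) \<cdot> (\<alpha> X (Y \<odot> \<I>) \<I> \<cdot> (\<alpha> X Y \<I> \<lhd> \<I>)))"
    by (simp add: pentagon')
  also have "\<dots> = (X \<rhd> (\<r> Y \<lhd> \<I>)) \<cdot> (\<alpha> X (Y \<odot> \<I>) \<I> \<cdot> (\<alpha> X Y \<I> \<lhd> \<I>))"
    by (simp add: interchange_cont triangle')
  also have "\<dots> = \<alpha> X Y \<I> \<cdot> (((X \<rhd> \<r> Y) \<lhd> \<I>) \<cdot> (\<alpha> X Y \<I> \<lhd> \<I>))"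
    by (simp add: assoc_natural_cont)
  also have "\<dots> = \<alpha> X Y \<I> \<cdot> (((X \<rhd> \<r> Y) \<cdot> \<alpha> X Y \<I>) \<lhd> \<I>)"
    by (simp add: whisker_comp)
  finally have "\<r> (X \<odot> Y) \<lhd> \<I> = ((X \<rhd> \<r> Y) \<cdot> \<alpha> X Y \<I>) \<lhd> \<I>"
    by (rule iso_cancel_left[rotated]) simp_all
  then show "((X \<rhd> \<r> Y) \<cdot> \<alpha> X Y \<I>) \<lhd> \<I> = \<r> (X \<odot> Y) \<lhd> \<I>" ..
qed simp_all

lemma lunit_unit_eq_runit_unit: "\<l> \<I> = \<r> \<I>"
proof (rule unit_whisker_faithful(2))
  have "\<I> \<rhd> \<l> \<I> = \<l> (\<I> \<odot> \<I>)"
    by (rule iso_cancel_left[of "\<l> \<I>"]) (simp_all add: lunit_natural)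
  then show "\<l> \<I> \<lhd> \<I> = \<r> \<I> \<lhd> \<I>"
    using lunit_tensor[of \<I> \<I>] triangle'[of \<I> \<I>] by simp
qed simp_all

end

lemma op_moncat_simps [simp]:
  "Obj (op_moncat C) = Obj C" "Arr (op_moncat C) = Arr C" "Dom (op_moncat C) = Cod C"
  "Cod (op_moncat C) = Dom C" "Idt (op_moncat C) = Idt C" "g \<cdot>\<^bsub>op_moncat C\<^esub> f = f \<cdot>\<^bsub>C\<^esub> g"
  "TObj (op_moncat C) = TObj C" "TArr (op_moncat C) = TArr C" "TUnit (op_moncat C) = TUnit C"
  "Assoc (op_moncat C) X Y Z = inv_arr C (Assoc C X Y Z)"
  "LUnit (op_moncat C) X = inv_arr C (LUnit C X)" "RUnit (op_moncat C) X = inv_arr C (RUnit C X)"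
  by (simp_all add: op_moncat_def)

lemma Hom_op_moncat [simp]: "Hom (op_moncat C) X Y = Hom C Y X"
  by (auto simp: Hom_def)

lemma inverse_op_moncat [simp]:
  "inverse_arrows (op_moncat C) = inverse_arrows C" "iso_arr (op_moncat C) = iso_arr C"
  "inv_arr (op_moncat C) = inv_arr C"
proof -
  show *: "inverse_arrows (op_moncat C) = inverse_arrows C"
    by (intro ext) (auto simp: inverse_arrows_def in_Hom)
  show "iso_arr (op_moncat C) = iso_arr C" "inv_arr (op_moncat C) = inv_arr C"
    by (intro ext; simp add: iso_arr_def inv_arr_def *)+
qed

lemma (in monoidal_category) monoidal_op_moncat: "monoidal_category (op_moncat C)"
proof
  fix f g h X X' Y Y' Z Z'
  assume "f \<in> Hom (op_moncat C) X X'" "g \<in> Hom (op_moncat C) Y Y'" "h \<in> Hom (op_moncat C) Z Z'"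
  then show "Assoc (op_moncat C) X' Y' Z' \<cdot>\<^bsub>op_moncat C\<^esub> ((f \<boxtimes>\<^bsub>op_moncat C\<^esub> g) \<boxtimes>\<^bsub>op_moncat C\<^esub> h) =
     (f \<boxtimes>\<^bsub>op_moncat C\<^esub> (g \<boxtimes>\<^bsub>op_moncat C\<^esub> h)) \<cdot>\<^bsub>op_moncat C\<^esub> Assoc (op_moncat C) X Y Z"
    using assoc_inv_natural[of f g h X Y Z] by (auto simp: in_Hom)
next
  fix f X Y assume "f \<in> Hom (op_moncat C) X Y"
  then have f: "f \<in> Arr C" "Dom C f = Y" "Cod C f = X" "X \<in> Obj C" "Y \<in> Obj C"
    using Dom_Obj Cod_Obj by (auto simp: in_Hom)
  then show "LUnit (op_moncat C) Y \<cdot>\<^bsub>op_moncat C\<^esub> (Idt (op_moncat C) (TUnit (op_moncat C)) \<boxtimes>\<^bsub>op_moncat C\<^esub> f) =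
      f \<cdot>\<^bsub>op_moncat C\<^esub> LUnit (op_moncat C) X"
    "RUnit (op_moncat C) Y \<cdot>\<^bsub>op_moncat C\<^esub> (f \<boxtimes>\<^bsub>op_moncat C\<^esub> Idt (op_moncat C) (TUnit (op_moncat C))) =
      f \<cdot>\<^bsub>op_moncat C\<^esub> RUnit (op_moncat C) X"
    using lunit_inv_natural[of f X] runit_inv_natural[of f X] by simp_all
next
  fix W X Y Z
  assume *: "W \<in> Obj (op_moncat C)" "X \<in> Obj (op_moncat C)" "Y \<in> Obj (op_moncat C)" "Z \<in> Obj (op_moncat C)"
  then have "inv_arr C ((W \<rhd> \<alpha> X Y Z) \<cdot> (\<alpha> W (X \<odot> Y) Z \<cdot> (\<alpha> W X Y \<lhd> Z))) =
      inv_arr C (\<alpha> W X (Y \<odot> Z) \<cdot> \<alpha> (W \<odot> X) Y Z)"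
    by (simp add: pentagon')
  then show "(Idt (op_moncat C) W \<boxtimes>\<^bsub>op_moncat C\<^esub> Assoc (op_moncat C) X Y Z)
        \<cdot>\<^bsub>op_moncat C\<^esub> Assoc (op_moncat C) W (X \<odot>\<^bsub>op_moncat C\<^esub> Y) Z
        \<cdot>\<^bsub>op_moncat C\<^esub> (Assoc (op_moncat C) W X Y \<boxtimes>\<^bsub>op_moncat C\<^esub> Idt (op_moncat C) Z) =
      Assoc (op_moncat C) W X (Y \<odot>\<^bsub>op_moncat C\<^esub> Z) \<cdot>\<^bsub>op_moncat C\<^esub> Assoc (op_moncat C) (W \<odot>\<^bsub>op_moncat C\<^esub> X) Y Z"
    using * by simp
next
  fix X Y
  assume *: "X \<in> Obj (op_moncat C)" "Y \<in> Obj (op_moncat C)"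
  then have "inv_arr C ((X \<rhd> \<l> Y) \<cdot> \<alpha> X \<I> Y) = inv_arr C (\<r> X \<lhd> Y)"
    by (simp add: triangle')
  then show "(Idt (op_moncat C) X \<boxtimes>\<^bsub>op_moncat C\<^esub> LUnit (op_moncat C) Y)
        \<cdot>\<^bsub>op_moncat C\<^esub> Assoc (op_moncat C) X (TUnit (op_moncat C)) Y =
      RUnit (op_moncat C) X \<boxtimes>\<^bsub>op_moncat C\<^esub> Idt (op_moncat C) Y"
    using * by simp
next
  fix f f' g g' X X' X'' Y Y' Y''
  assume "f \<in> Hom (op_moncat C) X X'" "f' \<in> Hom (op_moncat C) X' X''"
    "g \<in> Hom (op_moncat C) Y Y'" "g' \<in> Hom (op_moncat C) Y' Y''"
  then show "(f' \<cdot>\<^bsub>op_moncat C\<^esub> f) \<boxtimes>\<^bsub>op_moncat C\<^esub> (g' \<cdot>\<^bsub>op_moncat C\<^esub> g) =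
      (f' \<boxtimes>\<^bsub>op_moncat C\<^esub> g') \<cdot>\<^bsub>op_moncat C\<^esub> (f \<boxtimes>\<^bsub>op_moncat C\<^esub> g)"
    by (auto simp: in_Hom interchange)
qed (simp_all del: comp_assoc, auto simp: in_Hom)

context monoidal_category
begin

lemma pentagon_variants:
  assumes [simp]: "W \<in> Obj C" "X \<in> Obj C" "Y \<in> Obj C" "Z \<in> Obj C"
  shows "\<alpha> W X (Y \<odot> Z) \<cdot> (\<alpha> (W \<odot> X) Y Z \<cdot> (\<alpha>\<^sup>- W X Y \<lhd> Z)) = (W \<rhd> \<alpha> X Y Z) \<cdot> \<alpha> W (X \<odot> Y) Z"
    and "\<alpha> W (X \<odot> Y) Z \<cdot> (\<alpha> W X Y \<lhd> Z) = (W \<rhd> \<alpha>\<^sup>- X Y Z) \<cdot> (\<alpha> W X (Y \<odot> Z) \<cdot> \<alpha> (W \<odot> X) Y Z)"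
    and "\<alpha> (W \<odot> X) Y Z \<cdot> ((\<alpha>\<^sup>- W X Y \<lhd> Z) \<cdot> \<alpha>\<^sup>- W (X \<odot> Y) Z) = \<alpha>\<^sup>- W X (Y \<odot> Z) \<cdot> (W \<rhd> \<alpha> X Y Z)"
    and "\<alpha>\<^sup>- W X (Y \<odot> Z) \<cdot> ((W \<rhd> \<alpha> X Y Z) \<cdot> \<alpha> W (X \<odot> Y) Z) = \<alpha> (W \<odot> X) Y Z \<cdot> (\<alpha>\<^sup>- W X Y \<lhd> Z)"
    and "(W \<rhd> \<alpha> X Y Z) \<cdot> (\<alpha> W (X \<odot> Y) Z \<cdot> ((\<alpha> W X Y \<lhd> Z) \<cdot> \<alpha>\<^sup>- (W \<odot> X) Y Z)) = \<alpha> W X (Y \<odot> Z)"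
proof -
  let ?a = "\<alpha> W X Y \<lhd> Z" and ?b = "\<alpha> W (X \<odot> Y) Z" and ?c = "W \<rhd> \<alpha> X Y Z"
    and ?d = "\<alpha> (W \<odot> X) Y Z" and ?e = "\<alpha> W X (Y \<odot> Z)"
  have p: "?c \<cdot> (?b \<cdot> ?a) = ?e \<cdot> ?d"
    by (rule pentagon') simp_all
  have [simp]: "inv_arr C ?a = \<alpha>\<^sup>- W X Y \<lhd> Z" "inv_arr C ?c = W \<rhd> \<alpha>\<^sup>- X Y Z"
    by simp_all
  have "?e \<cdot> (?d \<cdot> inv_arr C ?a) = (?e \<cdot> ?d) \<cdot> inv_arr C ?a"
    by simp
  also have "\<dots> = (?c \<cdot> (?b \<cdot> ?a)) \<cdot> inv_arr C ?a"
    by (simp only: p)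
  also have "\<dots> = ?c \<cdot> ?b"
    by (simp add: interchange)
  finally show 1: "?e \<cdot> (?d \<cdot> (\<alpha>\<^sup>- W X Y \<lhd> Z)) = ?c \<cdot> ?b"
    by simp
  have "?b \<cdot> ?a = inv_arr C ?c \<cdot> (?c \<cdot> (?b \<cdot> ?a))"
    by (rule inv_arr_cont(1)[symmetric]) simp_all
  then show "?b \<cdot> ?a = (W \<rhd> \<alpha>\<^sup>- X Y Z) \<cdot> (?e \<cdot> ?d)"
    by (simp add: p)
  have "inv_arr C ?e \<cdot> ((?e \<cdot> (?d \<cdot> (\<alpha>\<^sup>- W X Y \<lhd> Z))) \<cdot> inv_arr C ?b) = inv_arr C ?e \<cdot> ((?c \<cdot> ?b) \<cdot> inv_arr C ?b)"
    by (simp only: 1)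
  then show "?d \<cdot> ((\<alpha>\<^sup>- W X Y \<lhd> Z) \<cdot> inv_arr C ?b) = inv_arr C ?e \<cdot> ?c"
    by simp
  show "inv_arr C ?e \<cdot> (?c \<cdot> ?b) = ?d \<cdot> (\<alpha>\<^sup>- W X Y \<lhd> Z)"
    by (simp flip: 1)
  have "?e = (?e \<cdot> ?d) \<cdot> inv_arr C ?d"
    by simp
  also have "\<dots> = ?c \<cdot> (?b \<cdot> (?a \<cdot> inv_arr C ?d))"
    by (simp flip: p)
  finally show "?c \<cdot> (?b \<cdot> (?a \<cdot> inv_arr C ?d)) = ?e" ..
qed

text \<open>A pairing \<open>s : A \<odot> X \<rightarrow> I\<close> applied to the first two factors of \<open>A \<odot> (X \<odot> W)\<close>.\<close>

definition cap :: "'o \<Rightarrow> 'o \<Rightarrow> 'a \<Rightarrow> 'o \<Rightarrow> 'a" where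
  "cap A X s W = \<l> W \<cdot> ((s \<lhd> W) \<cdot> \<alpha>\<^sup>- A X W)"

abbreviation pairing :: "'o \<Rightarrow> 'o \<Rightarrow> 'a \<Rightarrow> bool" where
  "pairing A X s \<equiv> s \<in> Hom C (A \<odot> X) \<I>"

lemma cap_arr [simp]:
  assumes "A \<in> Obj C" "X \<in> Obj C" "W \<in> Obj C" "pairing A X s"
  shows "cap A X s W \<in> Arr C" "Dom C (cap A X s W) = A \<odot> (X \<odot> W)" "Cod C (cap A X s W) = W"
  using assms by (auto simp: cap_def in_Hom)

lemma cap_natural:
  assumes "A \<in> Obj C" "X \<in> Obj C" "pairing A X s" "f \<in> Arr C" "Cod C f = W"
  shows "cap A X s W \<cdot> (A \<rhd> (X \<rhd> f)) = f \<cdot> cap A X s (Dom C f)"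
proof -
  have [simp]: "W \<in> Obj C" "s \<in> Arr C" "Dom C s = A \<odot> X" "Cod C s = \<I>"
    using assms Cod_Obj by (auto simp: in_Hom)
  have "cap A X s W \<cdot> (A \<rhd> (X \<rhd> f)) = \<l> W \<cdot> (((s \<lhd> W) \<cdot> ((A \<odot> X) \<rhd> f)) \<cdot> \<alpha>\<^sup>- A X (Dom C f))"
    using assms by (simp add: cap_def assoc_inv_natural)
  also have "\<dots> = \<l> W \<cdot> (((\<I> \<rhd> f) \<cdot> (s \<lhd> Dom C f)) \<cdot> \<alpha>\<^sup>- A X (Dom C f))"
    using assms by (simp add: interchange del: comp_assoc)
  also have "\<dots> = f \<cdot> cap A X s (Dom C f)"
    using assms by (simp add: cap_def lunit_natural_cont)
  finally show ?thesis .
qed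

lemma cap_whisker:
  assumes "A \<in> Obj C" "X \<in> Obj C" "W \<in> Obj C" "pairing A X s"
    "f \<in> Arr C" "g \<in> Arr C" "Cod C f = A" "Cod C g = X" "Dom C f = A'" "Dom C g = X'"
  shows "cap A X s W \<cdot> (f \<boxtimes> (g \<lhd> W)) = cap A' X' (s \<cdot> (f \<boxtimes> g)) W"
proof -
  have [simp]: "A' \<in> Obj C" "X' \<in> Obj C" "s \<in> Arr C" "Dom C s = A \<odot> X" "Cod C s = \<I>"
    using assms Dom_Obj by (auto simp: in_Hom)
  show ?thesis
    using assms(1-3,5-) by (simp add: cap_def assoc_inv_natural interchange_cont)
qed

lemma cap_unit:
  assumes [simp]: "A \<in> Obj C" "X \<in> Obj C" and s: "pairing A X s"
  shows "cap A X s \<I> = s \<cdot> (A \<rhd> \<r> X)"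
proof -
  have [simp]: "s \<in> Arr C" "Dom C s = A \<odot> X" "Cod C s = \<I>"
    using s by (auto simp: in_Hom)
  have "cap A X s \<I> \<cdot> \<alpha> A X \<I> = \<r> \<I> \<cdot> (s \<lhd> \<I>)"
    by (simp add: cap_def lunit_unit_eq_runit_unit)
  also have "\<dots> = (s \<cdot> (A \<rhd> \<r> X)) \<cdot> \<alpha> A X \<I>"
    by (simp add: runit_natural runit_tensor)
  finally show ?thesis
    by (rule iso_cancel_right[rotated]) (simp_all add: s)
qed

lemma cap_tensor:
  assumes [simp]: "A \<in> Obj C" "X \<in> Obj C" "Y \<in> Obj C" "Z \<in> Obj C" and s: "pairing A X s"
  shows "cap A X s Y \<lhd> Z = cap A X s (Y \<odot> Z) \<cdot> ((A \<rhd> \<alpha> X Y Z) \<cdot> \<alpha> A (X \<odot> Y) Z)"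
proof -
  have [simp]: "s \<in> Arr C" "Dom C s = A \<odot> X" "Cod C s = \<I>"
    using s by (auto simp: in_Hom)
  have "cap A X s (Y \<odot> Z) \<cdot> ((A \<rhd> \<alpha> X Y Z) \<cdot> \<alpha> A (X \<odot> Y) Z) =
      \<l> (Y \<odot> Z) \<cdot> ((s \<lhd> (Y \<odot> Z)) \<cdot> (\<alpha>\<^sup>- A X (Y \<odot> Z) \<cdot> ((A \<rhd> \<alpha> X Y Z) \<cdot> \<alpha> A (X \<odot> Y) Z)))"
    by (simp add: cap_def)
  also have "\<dots> = \<l> (Y \<odot> Z) \<cdot> (((s \<lhd> (Y \<odot> Z)) \<cdot> \<alpha> (A \<odot> X) Y Z) \<cdot> (\<alpha>\<^sup>- A X Y \<lhd> Z))"
    by (simp add: pentagon_variants(4))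
  also have "(s \<lhd> (Y \<odot> Z)) \<cdot> \<alpha> (A \<odot> X) Y Z = \<alpha> \<I> Y Z \<cdot> ((s \<lhd> Y) \<lhd> Z)"
    by (simp add: assoc_natural)
  also have "\<l> (Y \<odot> Z) \<cdot> ((\<alpha> \<I> Y Z \<cdot> ((s \<lhd> Y) \<lhd> Z)) \<cdot> (\<alpha>\<^sup>- A X Y \<lhd> Z)) =
      (\<l> (Y \<odot> Z) \<cdot> \<alpha> \<I> Y Z) \<cdot> (((s \<lhd> Y) \<lhd> Z) \<cdot> (\<alpha>\<^sup>- A X Y \<lhd> Z))"
    by simp
  also have "\<dots> = cap A X s Y \<lhd> Z"
    by (simp add: lunit_tensor cap_def interchange del: comp_assoc)
  finally show ?thesis ..
qed

definition nest :: "'o \<Rightarrow> 'o \<Rightarrow> 'a \<Rightarrow> 'o \<Rightarrow> 'o \<Rightarrow> 'a \<Rightarrow> 'a" where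
  "nest A X s B Y t = t \<cdot> ((B \<rhd> cap A X s Y) \<cdot> \<alpha> B A (X \<odot> Y))"

lemma pairing_nest:
  assumes "A \<in> Obj C" "X \<in> Obj C" "pairing A X s" "B \<in> Obj C" "Y \<in> Obj C" "pairing B Y t"
  shows "pairing (B \<odot> A) (X \<odot> Y) (nest A X s B Y t)"
  using assms by (simp add: nest_def in_Hom)

lemma cap_nest:
  assumes [simp]: "A \<in> Obj C" "X \<in> Obj C" "B \<in> Obj C" "Y \<in> Obj C" "Z \<in> Obj C"
    and s: "pairing A X s" and t: "pairing B Y t"
  shows "cap (B \<odot> A) (X \<odot> Y) (nest A X s B Y t) Z =
    cap B Y t Z \<cdot> ((B \<rhd> cap A X s (Y \<odot> Z)) \<cdot> ((B \<rhd> (A \<rhd> \<alpha> X Y Z)) \<cdot> \<alpha> B A ((X \<odot> Y) \<odot> Z)))"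
proof -
  have [simp]: "t \<in> Arr C" "Dom C t = B \<odot> Y" "Cod C t = \<I>"
    using t by (auto simp: in_Hom)
  note s [simp]
  have *: "\<l> Z \<cdot> (t \<lhd> Z) = cap B Y t Z \<cdot> \<alpha> B Y Z"
    by (simp add: cap_def)
  have "cap (B \<odot> A) (X \<odot> Y) (nest A X s B Y t) Z =
      (\<l> Z \<cdot> (t \<lhd> Z)) \<cdot> (((B \<rhd> cap A X s Y) \<lhd> Z) \<cdot> ((\<alpha> B A (X \<odot> Y) \<lhd> Z) \<cdot> \<alpha>\<^sup>- (B \<odot> A) (X \<odot> Y) Z))"
    by (simp add: cap_def[of "B \<odot> A"] nest_def whisker_comp)
  also have "\<dots> = cap B Y t Z \<cdot> (\<alpha> B Y Z \<cdot>
      (((B \<rhd> cap A X s Y) \<lhd> Z) \<cdot> ((\<alpha> B A (X \<odot> Y) \<lhd> Z) \<cdot> \<alpha>\<^sup>- (B \<odot> A) (X \<odot> Y) Z)))"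
    unfolding * using t by simp
  also have "\<dots> = cap B Y t Z \<cdot> ((B \<rhd> (cap A X s Y \<lhd> Z)) \<cdot>
      (\<alpha> B (A \<odot> (X \<odot> Y)) Z \<cdot> ((\<alpha> B A (X \<odot> Y) \<lhd> Z) \<cdot> \<alpha>\<^sup>- (B \<odot> A) (X \<odot> Y) Z)))"
    by (simp add: assoc_natural_cont)
  also have "B \<rhd> (cap A X s Y \<lhd> Z) = (B \<rhd> cap A X s (Y \<odot> Z)) \<cdot> ((B \<rhd> (A \<rhd> \<alpha> X Y Z)) \<cdot> (B \<rhd> \<alpha> A (X \<odot> Y) Z))"
    by (simp add: cap_tensor whisker_comp)
  also have "cap B Y t Z \<cdot> (((B \<rhd> cap A X s (Y \<odot> Z)) \<cdot> ((B \<rhd> (A \<rhd> \<alpha> X Y Z)) \<cdot> (B \<rhd> \<alpha> A (X \<odot> Y) Z))) \<cdot>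
      (\<alpha> B (A \<odot> (X \<odot> Y)) Z \<cdot> ((\<alpha> B A (X \<odot> Y) \<lhd> Z) \<cdot> \<alpha>\<^sup>- (B \<odot> A) (X \<odot> Y) Z))) =
    cap B Y t Z \<cdot> ((B \<rhd> cap A X s (Y \<odot> Z)) \<cdot> ((B \<rhd> (A \<rhd> \<alpha> X Y Z)) \<cdot> \<alpha> B A ((X \<odot> Y) \<odot> Z)))"
    using t by (simp add: pentagon_variants(5))
  finally show ?thesis .
qed

end

section \<open>Braided monoidal categories\<close>

definition reverse_braiding :: "('o, 'a, 'z) brcat_scheme \<Rightarrow> ('o, 'a, 'z) brcat_scheme" where
  "reverse_braiding C = C\<lparr>Braid := \<lambda>X Y. inv_arr C (Braid C Y X)\<rparr>"

lemma reverse_braiding_simps [simp]: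
  "Obj (reverse_braiding C) = Obj C" "Arr (reverse_braiding C) = Arr C"
  "Dom (reverse_braiding C) = Dom C" "Cod (reverse_braiding C) = Cod C"
  "Idt (reverse_braiding C) = Idt C" "Comp (reverse_braiding C) = Comp C"
  "TObj (reverse_braiding C) = TObj C" "TArr (reverse_braiding C) = TArr C"
  "TUnit (reverse_braiding C) = TUnit C" "Assoc (reverse_braiding C) = Assoc C"
  "LUnit (reverse_braiding C) = LUnit C" "RUnit (reverse_braiding C) = RUnit C"
  "Braid (reverse_braiding C) X Y = inv_arr C (Braid C Y X)"
  "Hom (reverse_braiding C) = Hom C"
  "iso_arr (reverse_braiding C) = iso_arr C" "inv_arr (reverse_braiding C) = inv_arr C"
  by (simp_all add: reverse_braiding_def fun_eq_iff Hom_def inverse_arrows_def iso_arr_def inv_arr_def)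

context braided_monoidal_category
begin

abbreviation braid ("\<c>") where "\<c> \<equiv> Braid C"
abbreviation braid_inv ("\<c>\<^sup>-") where "\<c>\<^sup>- X Y \<equiv> inv_arr C (Braid C X Y)"

declare Braid_iso [simp]

lemma braid_arr [simp]:
  assumes "X \<in> Obj C" "Y \<in> Obj C"
  shows "\<c> X Y \<in> Arr C" "Dom C (\<c> X Y) = X \<odot> Y" "Cod C (\<c> X Y) = Y \<odot> X"
  using Braid_Hom[OF assms] by (auto simp: in_Hom)

lemma braid_natural:
  assumes "f \<in> Arr C" "g \<in> Arr C" "Cod C f = X" "Cod C g = Y"
  shows "\<c> X Y \<cdot> (f \<boxtimes> g) = (g \<boxtimes> f) \<cdot> \<c> (Dom C f) (Dom C g)"
  using assms by (intro Braid_natural) (auto simp: in_Hom)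

lemma braid_natural_cont:
  assumes "f \<in> Arr C" "g \<in> Arr C" "Cod C f = X" "Cod C g = Y" "k \<in> Arr C" "Cod C k = Dom C f \<odot> Dom C g"
  shows "\<c> X Y \<cdot> ((f \<boxtimes> g) \<cdot> k) = (g \<boxtimes> f) \<cdot> (\<c> (Dom C f) (Dom C g) \<cdot> k)"
  by (rule comp_eq_cont[OF braid_natural]) (use assms in auto)

lemma braid_inv_natural:
  assumes "f \<in> Arr C" "g \<in> Arr C" "Cod C f = X" "Cod C g = Y"
  shows "\<c>\<^sup>- X Y \<cdot> (g \<boxtimes> f) = (f \<boxtimes> g) \<cdot> \<c>\<^sup>- (Dom C f) (Dom C g)"
proof -
  have [simp]: "X \<in> Obj C" "Y \<in> Obj C"
    using assms Cod_Obj by auto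
  have "\<c> X Y \<cdot> (\<c>\<^sup>- X Y \<cdot> (g \<boxtimes> f)) = \<c> X Y \<cdot> ((f \<boxtimes> g) \<cdot> \<c>\<^sup>- (Dom C f) (Dom C g))"
    using assms by (simp add: braid_natural_cont)
  then show ?thesis
    by (rule iso_cancel_left[rotated]) (use assms in simp_all)
qed

lemma braid_tensor_right:
  assumes [simp]: "X \<in> Obj C" "Y \<in> Obj C" "Z \<in> Obj C"
  shows "\<c> X (Y \<odot> Z) = \<alpha>\<^sup>- Y Z X \<cdot> ((Y \<rhd> \<c> X Z) \<cdot> (\<alpha> Y X Z \<cdot> ((\<c> X Y \<lhd> Z) \<cdot> \<alpha>\<^sup>- X Y Z)))"
proof -
  have "\<alpha> Y Z X \<cdot> \<c> X (Y \<odot> Z) \<cdot> \<alpha> X Y Z = (Y \<rhd> \<c> X Z) \<cdot> \<alpha> Y X Z \<cdot> (\<c> X Y \<lhd> Z)"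
    by (rule hexagon1) simp_all
  then have "\<alpha>\<^sup>- Y Z X \<cdot> ((\<alpha> Y Z X \<cdot> \<c> X (Y \<odot> Z) \<cdot> \<alpha> X Y Z) \<cdot> \<alpha>\<^sup>- X Y Z) =
      \<alpha>\<^sup>- Y Z X \<cdot> (((Y \<rhd> \<c> X Z) \<cdot> \<alpha> Y X Z \<cdot> (\<c> X Y \<lhd> Z)) \<cdot> \<alpha>\<^sup>- X Y Z)"
    by (simp only:)
  then show ?thesis
    by simp
qed

lemma braid_tensor_left:
  assumes [simp]: "X \<in> Obj C" "Y \<in> Obj C" "Z \<in> Obj C"
  shows "\<c> (X \<odot> Y) Z = \<alpha> Z X Y \<cdot> ((\<c> X Z \<lhd> Y) \<cdot> (\<alpha>\<^sup>- X Z Y \<cdot> ((X \<rhd> \<c> Y Z) \<cdot> \<alpha> X Y Z)))"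
proof -
  have "\<alpha>\<^sup>- Z X Y \<cdot> \<c> (X \<odot> Y) Z \<cdot> \<alpha>\<^sup>- X Y Z = (\<c> X Z \<lhd> Y) \<cdot> \<alpha>\<^sup>- X Z Y \<cdot> (X \<rhd> \<c> Y Z)"
    by (rule hexagon2) simp_all
  then have "\<alpha> Z X Y \<cdot> ((\<alpha>\<^sup>- Z X Y \<cdot> \<c> (X \<odot> Y) Z \<cdot> \<alpha>\<^sup>- X Y Z) \<cdot> \<alpha> X Y Z) =
      \<alpha> Z X Y \<cdot> (((\<c> X Z \<lhd> Y) \<cdot> \<alpha>\<^sup>- X Z Y \<cdot> (X \<rhd> \<c> Y Z)) \<cdot> \<alpha> X Y Z)"
    by (simp only:)
  then show ?thesis
    by simp
qed

lemma braided_reverse_braiding: "braided_monoidal_category (reverse_braiding C)"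
proof -
  have "monoidal_category (reverse_braiding C)"
    by unfold_locales
      (auto simp: in_Hom Assoc_natural LUnit_natural RUnit_natural pentagon triangle interchange
        assoc_natural lunit_natural runit_natural pentagon')
  then show ?thesis
  proof (intro braided_monoidal_category.intro braided_monoidal_category_axioms.intro)
    fix f g X X' Y Y'
    assume "f \<in> Hom (reverse_braiding C) X X'" "g \<in> Hom (reverse_braiding C) Y Y'"
    then show "Braid (reverse_braiding C) X' Y' \<cdot>\<^bsub>reverse_braiding C\<^esub> (f \<boxtimes>\<^bsub>reverse_braiding C\<^esub> g) =
        (g \<boxtimes>\<^bsub>reverse_braiding C\<^esub> f) \<cdot>\<^bsub>reverse_braiding C\<^esub> Braid (reverse_braiding C) X Y"
      using braid_inv_natural[of g f Y' X'] by (auto simp: in_Hom)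
  next
    fix X Y Z
    assume "X \<in> Obj (reverse_braiding C)" "Y \<in> Obj (reverse_braiding C)" "Z \<in> Obj (reverse_braiding C)"
    then have [simp]: "X \<in> Obj C" "Y \<in> Obj C" "Z \<in> Obj C"
      by simp_all
    show "Assoc (reverse_braiding C) Y Z X \<cdot>\<^bsub>reverse_braiding C\<^esub> Braid (reverse_braiding C) X (Y \<odot>\<^bsub>reverse_braiding C\<^esub> Z)
         \<cdot>\<^bsub>reverse_braiding C\<^esub> Assoc (reverse_braiding C) X Y Z =
       (Idt (reverse_braiding C) Y \<boxtimes>\<^bsub>reverse_braiding C\<^esub> Braid (reverse_braiding C) X Z)
         \<cdot>\<^bsub>reverse_braiding C\<^esub> Assoc (reverse_braiding C) Y X Z
         \<cdot>\<^bsub>reverse_braiding C\<^esub> (Braid (reverse_braiding C) X Y \<boxtimes>\<^bsub>reverse_braiding C\<^esub> Idt (reverse_braiding C) Z)"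
      by (simp add: braid_tensor_left)
    show "inv_arr (reverse_braiding C) (Assoc (reverse_braiding C) Z X Y)
         \<cdot>\<^bsub>reverse_braiding C\<^esub> Braid (reverse_braiding C) (X \<odot>\<^bsub>reverse_braiding C\<^esub> Y) Z
         \<cdot>\<^bsub>reverse_braiding C\<^esub> inv_arr (reverse_braiding C) (Assoc (reverse_braiding C) X Y Z) =
       (Braid (reverse_braiding C) X Z \<boxtimes>\<^bsub>reverse_braiding C\<^esub> Idt (reverse_braiding C) Y)
         \<cdot>\<^bsub>reverse_braiding C\<^esub> inv_arr (reverse_braiding C) (Assoc (reverse_braiding C) X Z Y)
         \<cdot>\<^bsub>reverse_braiding C\<^esub> (Idt (reverse_braiding C) X \<boxtimes>\<^bsub>reverse_braiding C\<^esub> Braid (reverse_braiding C) Y Z)"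
      by (simp add: braid_tensor_right)
  qed (auto simp: in_Hom)
qed

lemma braid_unit_right:
  assumes [simp]: "X \<in> Obj C"
  shows "\<l> X \<cdot> \<c> X \<I> = \<r> X"
proof -
  have hex: "\<alpha> \<I> \<I> X \<cdot> (\<c> X (\<I> \<odot> \<I>) \<cdot> \<alpha> X \<I> \<I>) = (\<I> \<rhd> \<c> X \<I>) \<cdot> (\<alpha> \<I> X \<I> \<cdot> (\<c> X \<I> \<lhd> \<I>))"
    by (simp add: braid_tensor_right)
  have "\<c> X \<I> \<cdot> (\<r> X \<lhd> \<I>) = (\<c> X \<I> \<cdot> (X \<rhd> \<l> \<I>)) \<cdot> \<alpha> X \<I> \<I>"
    by (simp add: triangle')
  also have "\<dots> = (\<l> \<I> \<lhd> X) \<cdot> (\<c> X (\<I> \<odot> \<I>) \<cdot> \<alpha> X \<I> \<I>)"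
    by (simp add: braid_natural)
  also have "\<dots> = \<l> (\<I> \<odot> X) \<cdot> (\<alpha> \<I> \<I> X \<cdot> (\<c> X (\<I> \<odot> \<I>) \<cdot> \<alpha> X \<I> \<I>))"
    by (simp flip: lunit_tensor)
  also have "\<dots> = \<c> X \<I> \<cdot> (\<l> (X \<odot> \<I>) \<cdot> (\<alpha> \<I> X \<I> \<cdot> (\<c> X \<I> \<lhd> \<I>)))"
    unfolding hex by (simp add: lunit_natural_cont)
  also have "\<dots> = \<c> X \<I> \<cdot> ((\<l> X \<cdot> \<c> X \<I>) \<lhd> \<I>)"
    by (simp add: whisker_comp flip: lunit_tensor)
  finally have "\<r> X \<lhd> \<I> = (\<l> X \<cdot> \<c> X \<I>) \<lhd> \<I>"
    by (rule iso_cancel_left[rotated]) simp_all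
  then show ?thesis
    by (rule unit_whisker_faithful(2)[rotated 4, symmetric]) simp_all
qed

lemma braid_unit_left:
  assumes [simp]: "X \<in> Obj C"
  shows "\<r> X \<cdot> \<c> \<I> X = \<l> X"
proof -
  interpret R: braided_monoidal_category "reverse_braiding C"
    by (rule braided_reverse_braiding)
  have "\<l> X \<cdot> \<c>\<^sup>- \<I> X = \<r> X"
    using R.braid_unit_right[of X] by simp
  then have "(\<l> X \<cdot> \<c>\<^sup>- \<I> X) \<cdot> \<c> \<I> X = \<r> X \<cdot> \<c> \<I> X"
    by (simp only:)
  then show ?thesis
    by simp
qed

lemma braid_unit_inverse: "X \<in> Obj C \<Longrightarrow> \<c>\<^sup>- X \<I> = \<c> \<I> X"
proof -
  assume [simp]: "X \<in> Obj C"
  have "\<r> X \<cdot> \<c>\<^sup>- X \<I> = (\<l> X \<cdot> \<c> X \<I>) \<cdot> \<c>\<^sup>- X \<I>"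
    by (simp only: braid_unit_right[OF \<open>X \<in> Obj C\<close>])
  also have "\<dots> = \<r> X \<cdot> \<c> \<I> X"
    by (simp add: braid_unit_left)
  finally show ?thesis
    by (rule iso_cancel_left[rotated]) simp_all
qed

text \<open>The braiding of the first two factors of \<open>X \<odot> (Y \<odot> W)\<close>.\<close>

definition brd :: "'o \<Rightarrow> 'o \<Rightarrow> 'o \<Rightarrow> 'a" where
  "brd X Y W = \<alpha> Y X W \<cdot> ((\<c> X Y \<lhd> W) \<cdot> \<alpha>\<^sup>- X Y W)"

lemma brd_arr [simp]:
  assumes "X \<in> Obj C" "Y \<in> Obj C" "W \<in> Obj C"
  shows "brd X Y W \<in> Arr C" "Dom C (brd X Y W) = X \<odot> (Y \<odot> W)" "Cod C (brd X Y W) = Y \<odot> (X \<odot> W)"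
    "iso_arr C (brd X Y W)"
  using assms by (auto simp: brd_def)

lemma inv_brd:
  assumes "X \<in> Obj C" "Y \<in> Obj C" "W \<in> Obj C"
  shows "inv_arr C (brd X Y W) = \<alpha> X Y W \<cdot> ((\<c>\<^sup>- X Y \<lhd> W) \<cdot> \<alpha>\<^sup>- Y X W)"
  using assms by (simp add: brd_def)

lemma brd_assoc:
  assumes "X \<in> Obj C" "Y \<in> Obj C" "W \<in> Obj C"
  shows "brd X Y W \<cdot> \<alpha> X Y W = \<alpha> Y X W \<cdot> (\<c> X Y \<lhd> W)"
  using assms by (simp add: brd_def)

lemma brd_natural:
  assumes "f \<in> Arr C" "g \<in> Arr C" "h \<in> Arr C" "Cod C f = X" "Cod C g = Y" "Cod C h = W"
  shows "brd X Y W \<cdot> (f \<boxtimes> (g \<boxtimes> h)) = (g \<boxtimes> (f \<boxtimes> h)) \<cdot> brd (Dom C f) (Dom C g) (Dom C h)"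
proof -
  have [simp]: "X \<in> Obj C" "Y \<in> Obj C" "W \<in> Obj C"
    using assms Cod_Obj by auto
  have "brd X Y W \<cdot> (f \<boxtimes> (g \<boxtimes> h)) =
      \<alpha> Y X W \<cdot> (((\<c> X Y \<lhd> W) \<cdot> ((f \<boxtimes> g) \<boxtimes> h)) \<cdot> \<alpha>\<^sup>- (Dom C f) (Dom C g) (Dom C h))"
    using assms by (simp add: brd_def assoc_inv_natural)
  also have "(\<c> X Y \<lhd> W) \<cdot> ((f \<boxtimes> g) \<boxtimes> h) = ((g \<boxtimes> f) \<boxtimes> h) \<cdot> (\<c> (Dom C f) (Dom C g) \<lhd> Dom C h)"
    using assms by (simp add: interchange braid_natural)
  also have "\<alpha> Y X W \<cdot> ((((g \<boxtimes> f) \<boxtimes> h) \<cdot> (\<c> (Dom C f) (Dom C g) \<lhd> Dom C h)) \<cdot> \<alpha>\<^sup>- (Dom C f) (Dom C g) (Dom C h)) =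
      (g \<boxtimes> (f \<boxtimes> h)) \<cdot> brd (Dom C f) (Dom C g) (Dom C h)"
    using assms by (simp add: brd_def assoc_natural_cont)
  finally show ?thesis .
qed

lemma brd_natural_cont:
  assumes "f \<in> Arr C" "g \<in> Arr C" "h \<in> Arr C" "Cod C f = X" "Cod C g = Y" "Cod C h = W"
    "k \<in> Arr C" "Cod C k = Dom C f \<odot> (Dom C g \<odot> Dom C h)"
  shows "brd X Y W \<cdot> ((f \<boxtimes> (g \<boxtimes> h)) \<cdot> k) = (g \<boxtimes> (f \<boxtimes> h)) \<cdot> (brd (Dom C f) (Dom C g) (Dom C h) \<cdot> k)"
  by (rule comp_eq_cont[OF brd_natural]) (use assms Cod_Obj in auto)

lemma braid_tensor_right_brd:
  assumes "X \<in> Obj C" "Y \<in> Obj C" "Z \<in> Obj C"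
  shows "\<alpha> Y Z X \<cdot> \<c> X (Y \<odot> Z) = (Y \<rhd> \<c> X Z) \<cdot> brd X Y Z"
  using assms by (simp add: braid_tensor_right brd_def)

lemma braid_tensor_left_brd:
  assumes "X \<in> Obj C" "Y \<in> Obj C" "Z \<in> Obj C"
  shows "\<c> (X \<odot> Y) Z = brd X Z Y \<cdot> ((X \<rhd> \<c> Y Z) \<cdot> \<alpha> X Y Z)"
  using assms by (simp add: braid_tensor_left brd_def)

lemma brd_tensor_right:
  assumes [simp]: "X \<in> Obj C" "Y \<in> Obj C" "Z \<in> Obj C" "W \<in> Obj C"
  shows "\<alpha> Y Z (X \<odot> W) \<cdot> brd X (Y \<odot> Z) W = (Y \<rhd> brd X Z W) \<cdot> (brd X Y (Z \<odot> W) \<cdot> (X \<rhd> \<alpha> Y Z W))"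
proof -
  have "\<alpha> Y Z (X \<odot> W) \<cdot> brd X (Y \<odot> Z) W =
      (\<alpha> Y Z (X \<odot> W) \<cdot> (\<alpha> (Y \<odot> Z) X W \<cdot> (\<alpha>\<^sup>- Y Z X \<lhd> W))) \<cdot>
      (((Y \<rhd> \<c> X Z) \<lhd> W) \<cdot> ((\<alpha> Y X Z \<lhd> W) \<cdot> (((\<c> X Y \<lhd> Z) \<lhd> W) \<cdot> ((\<alpha>\<^sup>- X Y Z \<lhd> W) \<cdot> \<alpha>\<^sup>- X (Y \<odot> Z) W))))"
    by (simp add: brd_def braid_tensor_right whisker_comp)
  also have "\<dots> = (Y \<rhd> \<alpha> Z X W) \<cdot> (\<alpha> Y (Z \<odot> X) W \<cdot>
      (((Y \<rhd> \<c> X Z) \<lhd> W) \<cdot> ((\<alpha> Y X Z \<lhd> W) \<cdot> (((\<c> X Y \<lhd> Z) \<lhd> W) \<cdot> ((\<alpha>\<^sup>- X Y Z \<lhd> W) \<cdot> \<alpha>\<^sup>- X (Y \<odot> Z) W)))))"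
    by (subst pentagon_variants(1)) simp_all
  also have "\<dots> = (Y \<rhd> \<alpha> Z X W) \<cdot> ((Y \<rhd> (\<c> X Z \<lhd> W)) \<cdot> ((\<alpha> Y (X \<odot> Z) W \<cdot> (\<alpha> Y X Z \<lhd> W)) \<cdot>
      (((\<c> X Y \<lhd> Z) \<lhd> W) \<cdot> ((\<alpha>\<^sup>- X Y Z \<lhd> W) \<cdot> \<alpha>\<^sup>- X (Y \<odot> Z) W))))"
    by (simp add: assoc_natural_cont)
  also have "\<alpha> Y (X \<odot> Z) W \<cdot> (\<alpha> Y X Z \<lhd> W) = (Y \<rhd> \<alpha>\<^sup>- X Z W) \<cdot> (\<alpha> Y X (Z \<odot> W) \<cdot> \<alpha> (Y \<odot> X) Z W)"
    by (rule pentagon_variants(2)) simp_all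
  also have "(Y \<rhd> \<alpha> Z X W) \<cdot> ((Y \<rhd> (\<c> X Z \<lhd> W)) \<cdot> (((Y \<rhd> \<alpha>\<^sup>- X Z W) \<cdot> (\<alpha> Y X (Z \<odot> W) \<cdot> \<alpha> (Y \<odot> X) Z W)) \<cdot>
      (((\<c> X Y \<lhd> Z) \<lhd> W) \<cdot> ((\<alpha>\<^sup>- X Y Z \<lhd> W) \<cdot> \<alpha>\<^sup>- X (Y \<odot> Z) W)))) =
    (Y \<rhd> brd X Z W) \<cdot> (\<alpha> Y X (Z \<odot> W) \<cdot> ((\<c> X Y \<lhd> (Z \<odot> W)) \<cdot>
      (\<alpha> (X \<odot> Y) Z W \<cdot> ((\<alpha>\<^sup>- X Y Z \<lhd> W) \<cdot> \<alpha>\<^sup>- X (Y \<odot> Z) W))))"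
    by (simp add: brd_def[of X Z] assoc_natural_cont whisker_comp)
  also have "\<dots> = (Y \<rhd> brd X Z W) \<cdot> (brd X Y (Z \<odot> W) \<cdot> (X \<rhd> \<alpha> Y Z W))"
    by (simp add: pentagon_variants(3) brd_def[of X Y])
  finally show ?thesis .
qed

lemma brd_tensor_left:
  assumes [simp]: "X \<in> Obj C" "Y \<in> Obj C" "Z \<in> Obj C" "W \<in> Obj C"
  shows "(Z \<rhd> \<alpha> X Y W) \<cdot> brd (X \<odot> Y) Z W = brd X Z (Y \<odot> W) \<cdot> ((X \<rhd> brd Y Z W) \<cdot> \<alpha> X Y (Z \<odot> W))"
proof -
  interpret R: braided_monoidal_category "reverse_braiding C"
    by (rule braided_reverse_braiding)
  have R: "R.brd A B V = inv_arr C (brd B A V)" if "A \<in> Obj C" "B \<in> Obj C" "V \<in> Obj C" for A B V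
    using that by (simp add: R.brd_def inv_brd)
  have "\<alpha> X Y (Z \<odot> W) \<cdot> inv_arr C (brd (X \<odot> Y) Z W) =
      (X \<rhd> inv_arr C (brd Y Z W)) \<cdot> (inv_arr C (brd X Z (Y \<odot> W)) \<cdot> (Z \<rhd> \<alpha> X Y W))"
    using R.brd_tensor_right[of Z X Y W] by (simp add: R)
  then have "inv_arr C (\<alpha> X Y (Z \<odot> W) \<cdot> inv_arr C (brd (X \<odot> Y) Z W)) =
      inv_arr C ((X \<rhd> inv_arr C (brd Y Z W)) \<cdot> (inv_arr C (brd X Z (Y \<odot> W)) \<cdot> (Z \<rhd> \<alpha> X Y W)))"
    by (simp only:)
  then have "(Z \<rhd> \<alpha> X Y W) \<cdot> ((brd (X \<odot> Y) Z W \<cdot> \<alpha>\<^sup>- X Y (Z \<odot> W)) \<cdot> \<alpha> X Y (Z \<odot> W)) =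
     (Z \<rhd> \<alpha> X Y W) \<cdot> (((Z \<rhd> \<alpha>\<^sup>- X Y W) \<cdot> (brd X Z (Y \<odot> W) \<cdot> (X \<rhd> brd Y Z W))) \<cdot> \<alpha> X Y (Z \<odot> W))"
    by simp
  then show ?thesis
    by (simp add: interchange_cont)
qed

lemma yang_baxter:
  assumes [simp]: "A \<in> Obj C" "B \<in> Obj C" "X \<in> Obj C"
  shows "brd A B X \<cdot> ((A \<rhd> \<c> X B) \<cdot> brd X A B) = (B \<rhd> \<c> X A) \<cdot> (brd X B A \<cdot> (X \<rhd> \<c> A B))"
proof -
  have "brd A B X \<cdot> ((A \<rhd> \<c> X B) \<cdot> brd X A B) = brd A B X \<cdot> (\<alpha> A B X \<cdot> \<c> X (A \<odot> B))"
    by (simp add: braid_tensor_right_brd)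
  also have "\<dots> = \<alpha> B A X \<cdot> ((\<c> A B \<lhd> X) \<cdot> \<c> X (A \<odot> B))"
    by (simp add: brd_def)
  also have "\<dots> = (\<alpha> B A X \<cdot> \<c> X (B \<odot> A)) \<cdot> (X \<rhd> \<c> A B)"
    by (simp add: braid_natural)
  also have "\<dots> = (B \<rhd> \<c> X A) \<cdot> (brd X B A \<cdot> (X \<rhd> \<c> A B))"
    by (simp add: braid_tensor_right_brd)
  finally show ?thesis .
qed

lemma yang_baxter_brd:
  assumes [simp]: "A \<in> Obj C" "B \<in> Obj C" "X \<in> Obj C" "W \<in> Obj C"
  shows "brd A B (X \<odot> W) \<cdot> ((A \<rhd> brd X B W) \<cdot> brd X A (B \<odot> W)) =
    (B \<rhd> brd X A W) \<cdot> (brd X B (A \<odot> W) \<cdot> (X \<rhd> brd A B W))"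
proof -
  have "(brd A B (X \<odot> W) \<cdot> ((A \<rhd> brd X B W) \<cdot> brd X A (B \<odot> W))) \<cdot> (X \<rhd> \<alpha> A B W) =
      brd A B (X \<odot> W) \<cdot> (\<alpha> A B (X \<odot> W) \<cdot> brd X (A \<odot> B) W)"
    by (simp add: brd_tensor_right)
  also have "\<dots> = \<alpha> B A (X \<odot> W) \<cdot> ((\<c> A B \<lhd> (X \<odot> W)) \<cdot> brd X (A \<odot> B) W)"
    by (simp add: brd_def)
  also have "\<dots> = (\<alpha> B A (X \<odot> W) \<cdot> brd X (B \<odot> A) W) \<cdot> (X \<rhd> (\<c> A B \<lhd> W))"
    by (simp add: brd_natural)
  also have "\<dots> = (B \<rhd> brd X A W) \<cdot> (brd X B (A \<odot> W) \<cdot> ((X \<rhd> \<alpha> B A W) \<cdot> (X \<rhd> (\<c> A B \<lhd> W))))"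
    by (simp add: brd_tensor_right)
  also have "\<dots> = (B \<rhd> brd X A W) \<cdot> (brd X B (A \<odot> W) \<cdot> (X \<rhd> (brd A B W \<cdot> \<alpha> A B W)))"
    by (simp add: brd_assoc interchange)
  also have "\<dots> = ((B \<rhd> brd X A W) \<cdot> (brd X B (A \<odot> W) \<cdot> (X \<rhd> brd A B W))) \<cdot> (X \<rhd> \<alpha> A B W)"
    by (simp add: whisker_comp)
  finally show ?thesis
    by (rule iso_cancel_right[rotated]) simp_all
qed

lemma half_twist:
  assumes [simp]: "A \<in> Obj C" "B \<in> Obj C" "D \<in> Obj C"
  shows "\<alpha> D B A \<cdot> ((\<c> B D \<lhd> A) \<cdot> (\<c> A (B \<odot> D) \<cdot> \<alpha> A B D)) = (D \<rhd> \<c> A B) \<cdot> \<c> (A \<odot> B) D"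
proof -
  have "\<alpha> D B A \<cdot> ((\<c> B D \<lhd> A) \<cdot> (\<c> A (B \<odot> D) \<cdot> \<alpha> A B D)) =
      (\<alpha> D B A \<cdot> \<c> A (D \<odot> B)) \<cdot> ((A \<rhd> \<c> B D) \<cdot> \<alpha> A B D)"
    by (simp add: braid_natural_cont)
  also have "\<dots> = (D \<rhd> \<c> A B) \<cdot> \<c> (A \<odot> B) D"
    by (simp add: braid_tensor_right_brd braid_tensor_left_brd)
  finally show ?thesis .
qed

lemma cap_slide:
  assumes [simp]: "A \<in> Obj C" "X \<in> Obj C" "B \<in> Obj C" "Y \<in> Obj C" and s: "pairing A X s"
  shows "cap A X s (B \<odot> Y) = (B \<rhd> cap A X s Y) \<cdot> (brd A B (X \<odot> Y) \<cdot> (A \<rhd> brd X B Y))"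
proof -
  have [simp]: "s \<in> Arr C" "Dom C s = A \<odot> X" "Cod C s = \<I>"
    using s by (auto simp: in_Hom)
  have "(B \<rhd> cap A X s Y) \<cdot> (brd A B (X \<odot> Y) \<cdot> (A \<rhd> brd X B Y)) =
      (B \<rhd> cap A X s Y) \<cdot> ((brd A B (X \<odot> Y) \<cdot> ((A \<rhd> brd X B Y) \<cdot> \<alpha> A X (B \<odot> Y))) \<cdot> \<alpha>\<^sup>- A X (B \<odot> Y))"
    by (simp add: s)
  also have "\<dots> = (B \<rhd> \<l> Y) \<cdot> ((B \<rhd> (s \<lhd> Y)) \<cdot> (((B \<rhd> \<alpha>\<^sup>- A X Y) \<cdot> (B \<rhd> \<alpha> A X Y)) \<cdot> (brd (A \<odot> X) B Y \<cdot> \<alpha>\<^sup>- A X (B \<odot> Y))))"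
    by (subst brd_tensor_left[symmetric]) (simp_all add: cap_def whisker_comp)
  also have "\<dots> = (B \<rhd> \<l> Y) \<cdot> (((B \<rhd> (s \<lhd> Y)) \<cdot> brd (A \<odot> X) B Y) \<cdot> \<alpha>\<^sup>- A X (B \<odot> Y))"
    by (simp add: interchange)
  also have "(B \<rhd> (s \<lhd> Y)) \<cdot> brd (A \<odot> X) B Y = brd \<I> B Y \<cdot> (s \<lhd> (B \<odot> Y))"
    using brd_natural[of s "Idt C B" "Idt C Y" \<I> B Y] by simp
  also have "(B \<rhd> \<l> Y) \<cdot> ((brd \<I> B Y \<cdot> (s \<lhd> (B \<odot> Y))) \<cdot> \<alpha>\<^sup>- A X (B \<odot> Y)) =
      ((B \<rhd> \<l> Y) \<cdot> \<alpha> B \<I> Y) \<cdot> ((\<c> \<I> B \<lhd> Y) \<cdot> (\<alpha>\<^sup>- \<I> B Y \<cdot> ((s \<lhd> (B \<odot> Y)) \<cdot> \<alpha>\<^sup>- A X (B \<odot> Y))))"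
    by (simp add: brd_def)
  also have "\<dots> = (\<l> B \<lhd> Y) \<cdot> (\<alpha>\<^sup>- \<I> B Y \<cdot> ((s \<lhd> (B \<odot> Y)) \<cdot> \<alpha>\<^sup>- A X (B \<odot> Y)))"
    by (subst triangle') (simp_all add: interchange_cont braid_unit_left)
  also have "\<dots> = \<l> (B \<odot> Y) \<cdot> ((s \<lhd> (B \<odot> Y)) \<cdot> \<alpha>\<^sup>- A X (B \<odot> Y))"
    by (simp flip: lunit_tensor)
  finally show ?thesis
    by (simp add: cap_def)
qed

definition mid :: "'o \<Rightarrow> 'o \<Rightarrow> 'a \<Rightarrow> 'o \<Rightarrow> 'o \<Rightarrow> 'a \<Rightarrow> 'a" where
  "mid A X s B Y t = t \<cdot> (cap A X s (B \<odot> Y) \<cdot> ((A \<rhd> inv_arr C (brd X B Y)) \<cdot> \<alpha> A B (X \<odot> Y)))"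

lemma pairing_mid:
  assumes "A \<in> Obj C" "X \<in> Obj C" "pairing A X s" "B \<in> Obj C" "Y \<in> Obj C" "pairing B Y t"
  shows "pairing (A \<odot> B) (X \<odot> Y) (mid A X s B Y t)"
  using assms by (simp add: mid_def in_Hom)

lemma cap_slide_inv:
  assumes [simp]: "A \<in> Obj C" "X \<in> Obj C" "B \<in> Obj C" "Y \<in> Obj C" and s [simp]: "pairing A X s"
  shows "cap A X s (B \<odot> Y) \<cdot> (A \<rhd> inv_arr C (brd X B Y)) = (B \<rhd> cap A X s Y) \<cdot> brd A B (X \<odot> Y)"
  by (subst cap_slide) (simp_all add: interchange)

text \<open>Sliding the strand \<open>B\<close> past the pairing \<open>s\<close> moves the braiding to the factors \<open>A\<close> and \<open>B\<close>.\<close>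

lemma mid_eq_nest:
  assumes [simp]: "A \<in> Obj C" "X \<in> Obj C" "B \<in> Obj C" "Y \<in> Obj C"
    and s [simp]: "pairing A X s" and t: "pairing B Y t"
  shows "mid A X s B Y t = nest A X s B Y t \<cdot> (\<c> A B \<lhd> (X \<odot> Y))"
proof -
  have [simp]: "t \<in> Arr C" "Dom C t = B \<odot> Y" "Cod C t = \<I>"
    using t by (auto simp: in_Hom)
  have "mid A X s B Y t = t \<cdot> ((cap A X s (B \<odot> Y) \<cdot> (A \<rhd> inv_arr C (brd X B Y))) \<cdot> \<alpha> A B (X \<odot> Y))"
    by (simp add: mid_def)
  also have "\<dots> = nest A X s B Y t \<cdot> (\<c> A B \<lhd> (X \<odot> Y))"
    by (simp add: cap_slide_inv nest_def brd_assoc)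
  finally show ?thesis .
qed

lemma mid_whisker:
  assumes s: "pairing A X s" and t: "pairing B Y t"
    and [simp]: "f \<in> Hom C A' A" "h \<in> Hom C X' X" "g \<in> Hom C B' B" "k \<in> Hom C Y' Y"
  shows "mid A X s B Y t \<cdot> ((f \<boxtimes> g) \<boxtimes> (h \<boxtimes> k)) =
    mid A' X' (s \<cdot> (f \<boxtimes> h)) B' Y' (t \<cdot> (g \<boxtimes> k))"
proof -
  have arr [simp]: "f \<in> Arr C" "Dom C f = A'" "Cod C f = A" "h \<in> Arr C" "Dom C h = X'" "Cod C h = X"
    "g \<in> Arr C" "Dom C g = B'" "Cod C g = B" "k \<in> Arr C" "Dom C k = Y'" "Cod C k = Y"
    "t \<in> Arr C" "Dom C t = B \<odot> Y" "Cod C t = \<I>" "s \<in> Arr C" "Dom C s = A \<odot> X" "Cod C s = \<I>"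
    using assms by (auto simp: in_Hom)
  have [simp]: "A \<in> Obj C" "A' \<in> Obj C" "B \<in> Obj C" "B' \<in> Obj C" "X \<in> Obj C" "X' \<in> Obj C"
      "Y \<in> Obj C" "Y' \<in> Obj C"
    using Dom_Obj Cod_Obj arr by metis+
  have sfh [simp]: "pairing A' X' (s \<cdot> (f \<boxtimes> h))"
    by (simp add: in_Hom)
  have n: "inv_arr C (brd X B Y) \<cdot> (g \<boxtimes> (h \<boxtimes> k)) = (h \<boxtimes> (g \<boxtimes> k)) \<cdot> inv_arr C (brd X' B' Y')"
  proof (rule iso_cancel_left[of "brd X B Y"])
    show "brd X B Y \<cdot> (inv_arr C (brd X B Y) \<cdot> (g \<boxtimes> (h \<boxtimes> k))) =
        brd X B Y \<cdot> ((h \<boxtimes> (g \<boxtimes> k)) \<cdot> inv_arr C (brd X' B' Y'))"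
      by (simp add: brd_natural_cont)
  qed simp_all
  have "mid A X s B Y t \<cdot> ((f \<boxtimes> g) \<boxtimes> (h \<boxtimes> k)) = t \<cdot> (cap A X s (B \<odot> Y) \<cdot>
      ((f \<boxtimes> (inv_arr C (brd X B Y) \<cdot> (g \<boxtimes> (h \<boxtimes> k)))) \<cdot> \<alpha> A' B' (X' \<odot> Y')))"
    by (simp add: mid_def assoc_natural interchange_cont s)
  also have "\<dots> = t \<cdot> ((cap A X s (B \<odot> Y) \<cdot> (f \<boxtimes> (h \<lhd> (B \<odot> Y)))) \<cdot> ((A' \<rhd> (X' \<rhd> (g \<boxtimes> k))) \<cdot>
      ((A' \<rhd> inv_arr C (brd X' B' Y')) \<cdot> \<alpha> A' B' (X' \<odot> Y'))))"
    unfolding n by (simp add: interchange_cont interchange s)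
  also have "\<dots> = t \<cdot> ((cap A' X' (s \<cdot> (f \<boxtimes> h)) (B \<odot> Y) \<cdot> (A' \<rhd> (X' \<rhd> (g \<boxtimes> k)))) \<cdot>
      ((A' \<rhd> inv_arr C (brd X' B' Y')) \<cdot> \<alpha> A' B' (X' \<odot> Y')))"
    by (simp add: cap_whisker s)
  also have "\<dots> = mid A' X' (s \<cdot> (f \<boxtimes> h)) B' Y' (t \<cdot> (g \<boxtimes> k))"
    by (subst cap_natural) (simp_all add: mid_def)
  finally show ?thesis .
qed

lemma nest_nest:
  assumes [simp]: "A \<in> Obj C" "X \<in> Obj C" "B \<in> Obj C" "Y \<in> Obj C" "D \<in> Obj C" "Z \<in> Obj C"
    and s [simp]: "pairing A X s" and t [simp]: "pairing B Y t" and r: "pairing D Z r"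
  shows "nest (B \<odot> A) (X \<odot> Y) (nest A X s B Y t) D Z r =
    nest A X s (D \<odot> B) (Y \<odot> Z) (nest B Y t D Z r) \<cdot> (\<alpha>\<^sup>- D B A \<boxtimes> \<alpha> X Y Z)"
proof -
  have [simp]: "r \<in> Arr C" "Dom C r = D \<odot> Z" "Cod C r = \<I>"
    using r by (auto simp: in_Hom)
  let ?P = "X \<odot> (Y \<odot> Z)"
  let ?cs = "cap A X s (Y \<odot> Z)" and ?ct = "cap B Y t Z"
  have *: "\<alpha> D B (Y \<odot> Z) \<cdot> ((D \<odot> B) \<rhd> ?cs) = (D \<rhd> (B \<rhd> ?cs)) \<cdot> \<alpha> D B (A \<odot> ?P)"
    using assoc_natural[of "Idt C D" "Idt C B" ?cs D B "Y \<odot> Z"] by simp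
  have "nest A X s (D \<odot> B) (Y \<odot> Z) (nest B Y t D Z r) \<cdot> (\<alpha>\<^sup>- D B A \<boxtimes> \<alpha> X Y Z) =
      r \<cdot> ((D \<rhd> ?ct) \<cdot> ((\<alpha> D B (Y \<odot> Z) \<cdot> ((D \<odot> B) \<rhd> ?cs)) \<cdot> (\<alpha> (D \<odot> B) A ?P \<cdot> (\<alpha>\<^sup>- D B A \<boxtimes> \<alpha> X Y Z))))"
    by (simp add: nest_def)
  also have "\<alpha>\<^sup>- D B A \<boxtimes> \<alpha> X Y Z = (\<alpha>\<^sup>- D B A \<lhd> ?P) \<cdot> ((D \<odot> (B \<odot> A)) \<rhd> \<alpha> X Y Z)"
    by (simp add: interchange)
  also have "r \<cdot> ((D \<rhd> ?ct) \<cdot> ((\<alpha> D B (Y \<odot> Z) \<cdot> ((D \<odot> B) \<rhd> ?cs)) \<cdot> (\<alpha> (D \<odot> B) A ?P \<cdot>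
      ((\<alpha>\<^sup>- D B A \<lhd> ?P) \<cdot> ((D \<odot> (B \<odot> A)) \<rhd> \<alpha> X Y Z))))) =
    r \<cdot> ((D \<rhd> ?ct) \<cdot> ((D \<rhd> (B \<rhd> ?cs)) \<cdot> ((\<alpha> D B (A \<odot> ?P) \<cdot> (\<alpha> (D \<odot> B) A ?P \<cdot> (\<alpha>\<^sup>- D B A \<lhd> ?P))) \<cdot>
      ((D \<odot> (B \<odot> A)) \<rhd> \<alpha> X Y Z))))"
    unfolding * by simp
  also have "\<dots> = r \<cdot> ((D \<rhd> ?ct) \<cdot> ((D \<rhd> (B \<rhd> ?cs)) \<cdot> ((D \<rhd> \<alpha> B A ?P) \<cdot> (\<alpha> D (B \<odot> A) ?P \<cdot> ((D \<odot> (B \<odot> A)) \<rhd> \<alpha> X Y Z)))))"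
    by (subst pentagon_variants(1)) simp_all
  also have "\<alpha> D (B \<odot> A) ?P \<cdot> ((D \<odot> (B \<odot> A)) \<rhd> \<alpha> X Y Z) = (D \<rhd> ((B \<odot> A) \<rhd> \<alpha> X Y Z)) \<cdot> \<alpha> D (B \<odot> A) ((X \<odot> Y) \<odot> Z)"
    using assoc_natural[of "Idt C D" "Idt C (B \<odot> A)" "\<alpha> X Y Z" D "B \<odot> A" ?P] by simp
  also have "r \<cdot> ((D \<rhd> ?ct) \<cdot> ((D \<rhd> (B \<rhd> ?cs)) \<cdot> ((D \<rhd> \<alpha> B A ?P) \<cdot>
      ((D \<rhd> ((B \<odot> A) \<rhd> \<alpha> X Y Z)) \<cdot> \<alpha> D (B \<odot> A) ((X \<odot> Y) \<odot> Z))))) =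
    r \<cdot> ((D \<rhd> ?ct) \<cdot> ((D \<rhd> (B \<rhd> ?cs)) \<cdot> ((D \<rhd> (\<alpha> B A ?P \<cdot> ((B \<odot> A) \<rhd> \<alpha> X Y Z))) \<cdot> \<alpha> D (B \<odot> A) ((X \<odot> Y) \<odot> Z))))"
    by (simp add: interchange_cont)
  also have "\<alpha> B A ?P \<cdot> ((B \<odot> A) \<rhd> \<alpha> X Y Z) = (B \<rhd> (A \<rhd> \<alpha> X Y Z)) \<cdot> \<alpha> B A ((X \<odot> Y) \<odot> Z)"
    using assoc_natural[of "Idt C B" "Idt C A" "\<alpha> X Y Z" B A ?P] by simp
  also have "r \<cdot> ((D \<rhd> ?ct) \<cdot> ((D \<rhd> (B \<rhd> ?cs)) \<cdot> ((D \<rhd> ((B \<rhd> (A \<rhd> \<alpha> X Y Z)) \<cdot> \<alpha> B A ((X \<odot> Y) \<odot> Z))) \<cdot>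
      \<alpha> D (B \<odot> A) ((X \<odot> Y) \<odot> Z)))) =
    r \<cdot> ((D \<rhd> cap (B \<odot> A) (X \<odot> Y) (nest A X s B Y t) Z) \<cdot> \<alpha> D (B \<odot> A) ((X \<odot> Y) \<odot> Z))"
    by (simp add: cap_nest whisker_comp)
  also have "\<dots> = nest (B \<odot> A) (X \<odot> Y) (nest A X s B Y t) D Z r"
    by (simp add: nest_def)
  finally show ?thesis
    by (simp add: interchange)
qed

lemma nest_whisker:
  assumes [simp]: "A \<in> Obj C" "X \<in> Obj C" "B \<in> Obj C" "Y \<in> Obj C"
    and s [simp]: "pairing A X s" and t: "pairing B Y t"
    and f: "f \<in> Hom C A' A" and g: "g \<in> Hom C B' B"
  shows "nest A' X (s \<cdot> (f \<lhd> X)) B' Y (t \<cdot> (g \<lhd> Y)) = nest A X s B Y t \<cdot> ((g \<boxtimes> f) \<lhd> (X \<odot> Y))"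
proof -
  have arr [simp]: "f \<in> Arr C" "Dom C f = A'" "Cod C f = A" "g \<in> Arr C" "Dom C g = B'" "Cod C g = B"
    "t \<in> Arr C" "Dom C t = B \<odot> Y" "Cod C t = \<I>" "s \<in> Arr C" "Dom C s = A \<odot> X" "Cod C s = \<I>"
    using assms by (auto simp: in_Hom)
  have [simp]: "A' \<in> Obj C" "B' \<in> Obj C"
    using Dom_Obj arr by metis+
  have "cap A' X (s \<cdot> (f \<lhd> X)) Y = cap A X s Y \<cdot> (f \<lhd> (X \<odot> Y))"
    using cap_whisker[of A X Y s f "Idt C X" A' X] by simp
  moreover have "\<alpha> B A (X \<odot> Y) \<cdot> ((g \<boxtimes> f) \<lhd> (X \<odot> Y)) = (g \<boxtimes> (f \<lhd> (X \<odot> Y))) \<cdot> \<alpha> B' A' (X \<odot> Y)"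
    using assoc_natural[of g f "Idt C (X \<odot> Y)" B A "X \<odot> Y"] by simp
  ultimately show ?thesis
    by (simp add: nest_def interchange_cont)
qed

lemma mid_assoc:
  assumes [simp]: "A \<in> Obj C" "X \<in> Obj C" "B \<in> Obj C" "Y \<in> Obj C" "D \<in> Obj C" "Z \<in> Obj C"
    and s [simp]: "pairing A X s" and t [simp]: "pairing B Y t" and r: "pairing D Z r"
  shows "mid (A \<odot> B) (X \<odot> Y) (mid A X s B Y t) D Z r =
    mid A X s (B \<odot> D) (Y \<odot> Z) (mid B Y t D Z r) \<cdot> (\<alpha> A B D \<boxtimes> \<alpha> X Y Z)"
proof -
  note r [simp]
  have [simp]: "r \<in> Arr C" "Dom C r = D \<odot> Z" "Cod C r = \<I>"
    using r by (auto simp: in_Hom)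
  note pairing_nest [simp] pairing_mid [simp]
  have arr_nest [simp]: "nest A X s B Y t \<in> Arr C" "Dom C (nest A X s B Y t) = (B \<odot> A) \<odot> (X \<odot> Y)"
      "Cod C (nest A X s B Y t) = \<I>" if "pairing A X s" "pairing B Y t"
      "A \<in> Obj C" "X \<in> Obj C" "B \<in> Obj C" "Y \<in> Obj C" for A X s B Y t
    using pairing_nest[of A X s B Y t] that by (auto simp: in_Hom)
  let ?N = "nest (B \<odot> A) (X \<odot> Y) (nest A X s B Y t) D Z r"
  let ?N' = "nest A X s (D \<odot> B) (Y \<odot> Z) (nest B Y t D Z r)"
  have m: "mid A X s B Y t = nest A X s B Y t \<cdot> (\<c> A B \<lhd> (X \<odot> Y))"
    by (simp add: mid_eq_nest)
  have pm: "pairing (A \<odot> B) (X \<odot> Y) (nest A X s B Y t \<cdot> (\<c> A B \<lhd> (X \<odot> Y)))"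
    by (simp flip: m)
  have "mid (A \<odot> B) (X \<odot> Y) (mid A X s B Y t) D Z r =
      nest (A \<odot> B) (X \<odot> Y) (nest A X s B Y t \<cdot> (\<c> A B \<lhd> (X \<odot> Y))) D Z (r \<cdot> (Idt C D \<lhd> Z)) \<cdot>
      (\<c> (A \<odot> B) D \<lhd> ((X \<odot> Y) \<odot> Z))"
    by (simp add: m mid_eq_nest[of "A \<odot> B", OF _ _ _ _ pm])
  also have "nest (A \<odot> B) (X \<odot> Y) (nest A X s B Y t \<cdot> (\<c> A B \<lhd> (X \<odot> Y))) D Z (r \<cdot> (Idt C D \<lhd> Z)) =
      ?N \<cdot> ((D \<rhd> \<c> A B) \<lhd> ((X \<odot> Y) \<odot> Z))"
    by (rule nest_whisker) (simp_all add: Braid_Hom Idt_Hom)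
  also have "?N \<cdot> ((D \<rhd> \<c> A B) \<lhd> ((X \<odot> Y) \<odot> Z)) \<cdot> (\<c> (A \<odot> B) D \<lhd> ((X \<odot> Y) \<odot> Z)) =
      ?N \<cdot> (((D \<rhd> \<c> A B) \<cdot> \<c> (A \<odot> B) D) \<lhd> ((X \<odot> Y) \<odot> Z))"
    by (simp add: interchange)
  also have "\<dots> = ?N' \<cdot> ((\<alpha>\<^sup>- D B A \<boxtimes> \<alpha> X Y Z) \<cdot>
      ((\<alpha> D B A \<cdot> ((\<c> B D \<lhd> A) \<cdot> (\<c> A (B \<odot> D) \<cdot> \<alpha> A B D))) \<lhd> ((X \<odot> Y) \<odot> Z)))"
    by (simp add: nest_nest half_twist)
  also have "\<dots> = ?N' \<cdot> (((\<c> B D \<lhd> A) \<lhd> (X \<odot> (Y \<odot> Z))) \<cdot> ((\<c> A (B \<odot> D) \<lhd> (X \<odot> (Y \<odot> Z))) \<cdot> (\<alpha> A B D \<boxtimes> \<alpha> X Y Z)))"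
    by (simp add: interchange)
  also have "\<dots> = (?N' \<cdot> ((\<c> B D \<lhd> A) \<lhd> (X \<odot> (Y \<odot> Z)))) \<cdot> ((\<c> A (B \<odot> D) \<lhd> (X \<odot> (Y \<odot> Z))) \<cdot> (\<alpha> A B D \<boxtimes> \<alpha> X Y Z))"
    by simp
  also have "?N' \<cdot> ((\<c> B D \<lhd> A) \<lhd> (X \<odot> (Y \<odot> Z))) =
      nest A X (s \<cdot> (Idt C A \<lhd> X)) (B \<odot> D) (Y \<odot> Z) (nest B Y t D Z r \<cdot> (\<c> B D \<lhd> (Y \<odot> Z)))"
    by (rule nest_whisker[symmetric]) (simp_all add: Braid_Hom Idt_Hom)
  also have "s \<cdot> (Idt C A \<lhd> X) = s"
    using s by (auto simp: in_Hom)
  also have "nest A X s (B \<odot> D) (Y \<odot> Z) (nest B Y t D Z r \<cdot> (\<c> B D \<lhd> (Y \<odot> Z))) \<cdot>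
      ((\<c> A (B \<odot> D) \<lhd> (X \<odot> (Y \<odot> Z))) \<cdot> (\<alpha> A B D \<boxtimes> \<alpha> X Y Z)) =
    mid A X s (B \<odot> D) (Y \<odot> Z) (mid B Y t D Z r) \<cdot> (\<alpha> A B D \<boxtimes> \<alpha> X Y Z)"
    by (simp flip: mid_eq_nest) (simp add: mid_eq_nest[of A X])
  finally show ?thesis .
qed

lemma cap_full_twist:
  assumes [simp]: "A \<in> Obj C" "X \<in> Obj C" "B \<in> Obj C" "Y \<in> Obj C" and s [simp]: "pairing A X s"
  shows "cap A X s (B \<odot> Y) \<cdot> ((A \<rhd> inv_arr C (brd X B Y)) \<cdot> (brd B A (X \<odot> Y) \<cdot> (brd A B (X \<odot> Y) \<cdot>
      ((A \<rhd> brd X B Y) \<cdot> brd X A (B \<odot> Y))))) =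
    cap A X s (B \<odot> Y) \<cdot> (brd X A (B \<odot> Y) \<cdot> (X \<rhd> (brd B A Y \<cdot> brd A B Y)))"
proof -
  have "cap A X s (B \<odot> Y) \<cdot> ((A \<rhd> inv_arr C (brd X B Y)) \<cdot> (brd B A (X \<odot> Y) \<cdot> (brd A B (X \<odot> Y) \<cdot>
      ((A \<rhd> brd X B Y) \<cdot> brd X A (B \<odot> Y))))) =
    (cap A X s (B \<odot> Y) \<cdot> (A \<rhd> inv_arr C (brd X B Y))) \<cdot> (brd B A (X \<odot> Y) \<cdot>
      ((B \<rhd> brd X A Y) \<cdot> (brd X B (A \<odot> Y) \<cdot> (X \<rhd> brd A B Y))))"
    by (simp add: yang_baxter_brd)
  also have "\<dots> = (B \<rhd> cap A X s Y) \<cdot> (brd A B (X \<odot> Y) \<cdot>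
      ((brd B A (X \<odot> Y) \<cdot> ((B \<rhd> brd X A Y) \<cdot> brd X B (A \<odot> Y))) \<cdot> (X \<rhd> brd A B Y)))"
    unfolding cap_slide_inv[OF assms] by simp
  also have "\<dots> = ((B \<rhd> cap A X s Y) \<cdot> (brd A B (X \<odot> Y) \<cdot> (A \<rhd> brd X B Y))) \<cdot>
      (brd X A (B \<odot> Y) \<cdot> ((X \<rhd> brd B A Y) \<cdot> (X \<rhd> brd A B Y)))"
    by (subst yang_baxter_brd) simp_all
  also have "\<dots> = cap A X s (B \<odot> Y) \<cdot> (brd X A (B \<odot> Y) \<cdot> (X \<rhd> (brd B A Y \<cdot> brd A B Y)))"
    unfolding cap_slide[OF assms, symmetric] by (simp add: interchange)
  finally show ?thesis .
qed

text \<open>This identity relates \<open>dual2\<close> to the colax structure of the left adjoint.\<close>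

lemma mid_braid:
  assumes [simp]: "A \<in> Obj C" "X \<in> Obj C" "B \<in> Obj C" "Y \<in> Obj C"
    and s [simp]: "pairing A X s" and t: "pairing B Y t"
  shows "mid X A (s \<cdot> \<c> X A) Y B (t \<cdot> \<c> Y B) =
    mid A X s B Y t \<cdot> (((\<c> B A \<cdot> \<c> A B) \<lhd> (X \<odot> Y)) \<cdot> \<c> (X \<odot> Y) (A \<odot> B))"
proof -
  have [simp]: "t \<in> Arr C" "Dom C t = B \<odot> Y" "Cod C t = \<I>" "s \<in> Arr C" "Dom C s = A \<odot> X" "Cod C s = \<I>"
    using s t by (auto simp: in_Hom)
  let ?P = "X \<odot> Y"
  let ?t = "t \<cdot> \<c> Y B"
  have s' [simp]: "pairing X A (s \<cdot> \<c> X A)"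
    by (simp add: in_Hom)
  have cap': "cap X A (s \<cdot> \<c> X A) W = cap A X s W \<cdot> brd X A W" if "W \<in> Obj C" for W
    using that by (simp add: cap_def brd_def whisker_comp)
  have nat: "t \<cdot> cap A X s (B \<odot> Y) = cap A X s \<I> \<cdot> (A \<rhd> (X \<rhd> t))"
    by (subst cap_natural) simp_all
  have nat': "?t \<cdot> cap A X s (Y \<odot> B) = cap A X s \<I> \<cdot> (A \<rhd> (X \<rhd> ?t))"
    by (subst cap_natural) simp_all
  have braid: "\<alpha> A B ?P \<cdot> \<c> ?P (A \<odot> B) =
      (A \<rhd> brd X B Y) \<cdot> (brd X A (B \<odot> Y) \<cdot> ((X \<rhd> (A \<rhd> \<c> Y B)) \<cdot> ((X \<rhd> brd Y A B) \<cdot> \<alpha> X Y (A \<odot> B))))"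
  proof -
    have "\<alpha> A B ?P \<cdot> \<c> ?P (A \<odot> B) = (A \<rhd> \<c> ?P B) \<cdot> brd ?P A B"
      by (simp add: braid_tensor_right_brd)
    also have "\<dots> = (A \<rhd> brd X B Y) \<cdot> ((A \<rhd> (X \<rhd> \<c> Y B)) \<cdot> ((A \<rhd> \<alpha> X Y B) \<cdot> brd ?P A B))"
      by (simp add: braid_tensor_left_brd whisker_comp)
    also have "\<dots> = (A \<rhd> brd X B Y) \<cdot> ((A \<rhd> (X \<rhd> \<c> Y B)) \<cdot> (brd X A (Y \<odot> B) \<cdot> ((X \<rhd> brd Y A B) \<cdot> \<alpha> X Y (A \<odot> B))))"
      by (simp add: brd_tensor_left)
    also have "\<dots> = (A \<rhd> brd X B Y) \<cdot> (brd X A (B \<odot> Y) \<cdot> ((X \<rhd> (A \<rhd> \<c> Y B)) \<cdot> ((X \<rhd> brd Y A B) \<cdot> \<alpha> X Y (A \<odot> B))))"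
      by (simp add: brd_natural_cont)
    finally show ?thesis .
  qed
  have key: "(A \<rhd> t) \<cdot> (brd B A Y \<cdot> (brd A B Y \<cdot> ((A \<rhd> \<c> Y B) \<cdot> brd Y A B))) =
      (A \<rhd> ?t) \<cdot> inv_arr C (brd A Y B)"
  proof -
    have "(A \<rhd> t) \<cdot> (brd B A Y \<cdot> (brd A B Y \<cdot> ((A \<rhd> \<c> Y B) \<cdot> brd Y A B))) =
        (A \<rhd> t) \<cdot> ((brd B A Y \<cdot> (B \<rhd> \<c> Y A)) \<cdot> (brd Y B A \<cdot> (Y \<rhd> \<c> A B)))"
      by (simp add: yang_baxter)
    also have "brd B A Y \<cdot> (B \<rhd> \<c> Y A) = \<c> (B \<odot> Y) A \<cdot> \<alpha>\<^sup>- B Y A"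
      by (simp add: braid_tensor_left_brd)
    also have "(A \<rhd> t) \<cdot> ((\<c> (B \<odot> Y) A \<cdot> \<alpha>\<^sup>- B Y A) \<cdot> (brd Y B A \<cdot> (Y \<rhd> \<c> A B))) =
        ((A \<rhd> t) \<cdot> \<c> (B \<odot> Y) A) \<cdot> ((\<c> Y B \<lhd> A) \<cdot> (\<alpha>\<^sup>- Y B A \<cdot> (Y \<rhd> \<c> A B)))"
      by (simp add: brd_def)
    also have "(A \<rhd> t) \<cdot> \<c> (B \<odot> Y) A = \<c> \<I> A \<cdot> (t \<lhd> A)"
      by (simp add: braid_natural)
    finally have l: "(A \<rhd> t) \<cdot> (brd B A Y \<cdot> (brd A B Y \<cdot> ((A \<rhd> \<c> Y B) \<cdot> brd Y A B))) =
        \<c> \<I> A \<cdot> ((?t \<lhd> A) \<cdot> (\<alpha>\<^sup>- Y B A \<cdot> (Y \<rhd> \<c> A B)))"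
      by (simp add: interchange_cont)
    have "\<c> A (Y \<odot> B) = \<alpha>\<^sup>- Y B A \<cdot> (\<alpha> Y B A \<cdot> \<c> A (Y \<odot> B))"
      by simp
    also have "\<dots> = \<alpha>\<^sup>- Y B A \<cdot> ((Y \<rhd> \<c> A B) \<cdot> brd A Y B)"
      by (simp add: braid_tensor_right_brd)
    finally have c: "\<c> A (Y \<odot> B) = \<alpha>\<^sup>- Y B A \<cdot> ((Y \<rhd> \<c> A B) \<cdot> brd A Y B)" .
    have "\<c> A \<I> \<cdot> (A \<rhd> ?t) = (?t \<lhd> A) \<cdot> \<c> A (Y \<odot> B)"
      by (simp add: braid_natural)
    then have "\<c>\<^sup>- A \<I> \<cdot> ((\<c> A \<I> \<cdot> (A \<rhd> ?t)) \<cdot> inv_arr C (brd A Y B)) =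
        \<c>\<^sup>- A \<I> \<cdot> (((?t \<lhd> A) \<cdot> \<c> A (Y \<odot> B)) \<cdot> inv_arr C (brd A Y B))"
      by (simp only:)
    then have "(A \<rhd> ?t) \<cdot> inv_arr C (brd A Y B) = \<c>\<^sup>- A \<I> \<cdot> ((?t \<lhd> A) \<cdot> (\<alpha>\<^sup>- Y B A \<cdot> (Y \<rhd> \<c> A B)))"
      unfolding c by simp
    with l show ?thesis
      by (simp add: braid_unit_inverse)
  qed
  have pull: "(A \<rhd> (X \<rhd> f)) \<cdot> (brd X A (Dom C f) \<cdot> k) = brd X A (Cod C f) \<cdot> ((X \<rhd> (A \<rhd> f)) \<cdot> k)"
    if "f \<in> Arr C" "k \<in> Arr C" "Cod C k = X \<odot> (A \<odot> Dom C f)" for f k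
    using that by (simp add: brd_natural_cont)
  have twist: "\<alpha> A B ?P \<cdot> (((\<c> B A \<cdot> \<c> A B) \<lhd> ?P) \<cdot> k) = brd B A ?P \<cdot> (brd A B ?P \<cdot> (\<alpha> A B ?P \<cdot> k))"
    if "k \<in> Arr C" "Cod C k = (A \<odot> B) \<odot> ?P" for k
    using that by (simp add: brd_def whisker_comp)
  have "mid A X s B Y t \<cdot> (((\<c> B A \<cdot> \<c> A B) \<lhd> ?P) \<cdot> \<c> ?P (A \<odot> B)) =
      t \<cdot> (cap A X s (B \<odot> Y) \<cdot> ((A \<rhd> inv_arr C (brd X B Y)) \<cdot>
        (brd B A ?P \<cdot> (brd A B ?P \<cdot> (\<alpha> A B ?P \<cdot> \<c> ?P (A \<odot> B))))))"
    by (simp add: mid_def twist)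
  also have "\<dots> = t \<cdot> ((cap A X s (B \<odot> Y) \<cdot> ((A \<rhd> inv_arr C (brd X B Y)) \<cdot> (brd B A ?P \<cdot> (brd A B ?P \<cdot>
        ((A \<rhd> brd X B Y) \<cdot> brd X A (B \<odot> Y)))))) \<cdot>
        ((X \<rhd> (A \<rhd> \<c> Y B)) \<cdot> ((X \<rhd> brd Y A B) \<cdot> \<alpha> X Y (A \<odot> B))))"
    unfolding braid by simp
  also have "\<dots> = (t \<cdot> cap A X s (B \<odot> Y)) \<cdot> (brd X A (B \<odot> Y) \<cdot> ((X \<rhd> (brd B A Y \<cdot> brd A B Y)) \<cdot>
        ((X \<rhd> (A \<rhd> \<c> Y B)) \<cdot> ((X \<rhd> brd Y A B) \<cdot> \<alpha> X Y (A \<odot> B)))))"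
    unfolding cap_full_twist[OF assms(1-5)] by simp
  also have "\<dots> = cap A X s \<I> \<cdot> (brd X A \<I> \<cdot> ((X \<rhd> ((A \<rhd> t) \<cdot>
        (brd B A Y \<cdot> (brd A B Y \<cdot> ((A \<rhd> \<c> Y B) \<cdot> brd Y A B))))) \<cdot> \<alpha> X Y (A \<odot> B)))"
    unfolding nat using pull[of t] by (simp add: interchange_cont)
  also have "\<dots> = cap A X s \<I> \<cdot> (brd X A \<I> \<cdot> ((X \<rhd> (A \<rhd> ?t)) \<cdot> ((X \<rhd> inv_arr C (brd A Y B)) \<cdot> \<alpha> X Y (A \<odot> B))))"
    unfolding key by (simp add: whisker_comp)
  also have "\<dots> = (cap A X s \<I> \<cdot> (A \<rhd> (X \<rhd> ?t))) \<cdot> (brd X A (Y \<odot> B) \<cdot> ((X \<rhd> inv_arr C (brd A Y B)) \<cdot> \<alpha> X Y (A \<odot> B)))"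
    using pull[of ?t] by simp
  also have "\<dots> = mid X A (s \<cdot> \<c> X A) Y B ?t"
    unfolding nat'[symmetric] by (simp add: mid_def cap')
  finally show ?thesis ..
qed

lemma mid_unit_left:
  assumes [simp]: "B \<in> Obj C" "Y \<in> Obj C" and t: "pairing B Y t"
  shows "mid \<I> \<I> (\<l> \<I>) B Y t \<cdot> ((\<I> \<odot> B) \<rhd> inv_arr C (\<l> Y)) = t \<cdot> (\<l> B \<lhd> Y)"
proof -
  have [simp]: "t \<in> Arr C" "Dom C t = B \<odot> Y" "Cod C t = \<I>"
    using t by (auto simp: in_Hom)
  have l [simp]: "pairing \<I> \<I> (\<l> \<I>)"
    by (simp add: in_Hom)
  have "\<l> (\<I> \<odot> Y) = (\<l> \<I> \<lhd> Y) \<cdot> \<alpha>\<^sup>- \<I> \<I> Y"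
    by (simp flip: lunit_tensor)
  then have cap: "cap \<I> \<I> (\<l> \<I>) Y = \<l> Y \<cdot> \<l> (\<I> \<odot> Y)"
    by (simp add: cap_def)
  have inv: "\<l> (\<I> \<odot> Y) \<cdot> (\<I> \<rhd> inv_arr C (\<l> Y)) = inv_arr C (\<l> Y) \<cdot> \<l> Y"
    using lunit_natural[of "inv_arr C (\<l> Y)" "\<I> \<odot> Y"] by simp
  have "mid \<I> \<I> (\<l> \<I>) B Y t \<cdot> ((\<I> \<odot> B) \<rhd> inv_arr C (\<l> Y)) =
      nest \<I> \<I> (\<l> \<I>) B Y t \<cdot> (\<c> \<I> B \<boxtimes> inv_arr C (\<l> Y))"
    using pairing_nest[OF _ _ l _ _ t] by (simp add: mid_eq_nest t in_Hom interchange)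
  also have "\<dots> = t \<cdot> ((B \<rhd> cap \<I> \<I> (\<l> \<I>) Y) \<cdot> (\<alpha> B \<I> (\<I> \<odot> Y) \<cdot> (((B \<odot> \<I>) \<rhd> inv_arr C (\<l> Y)) \<cdot> (\<c> \<I> B \<lhd> Y))))"
    by (simp add: nest_def interchange)
  also have "\<dots> = t \<cdot> ((B \<rhd> cap \<I> \<I> (\<l> \<I>) Y) \<cdot> ((B \<rhd> (\<I> \<rhd> inv_arr C (\<l> Y))) \<cdot> (\<alpha> B \<I> Y \<cdot> (\<c> \<I> B \<lhd> Y))))"
    using assoc_natural_cont[of "Idt C B" "Idt C \<I>" "inv_arr C (\<l> Y)" B \<I> "\<I> \<odot> Y" "\<c> \<I> B \<lhd> Y"] by simp
  also have "\<dots> = t \<cdot> ((B \<rhd> (\<l> Y \<cdot> (\<l> (\<I> \<odot> Y) \<cdot> (\<I> \<rhd> inv_arr C (\<l> Y))))) \<cdot> (\<alpha> B \<I> Y \<cdot> (\<c> \<I> B \<lhd> Y)))"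
    by (simp add: cap interchange_cont)
  also have "\<dots> = t \<cdot> (((B \<rhd> \<l> Y) \<cdot> \<alpha> B \<I> Y) \<cdot> (\<c> \<I> B \<lhd> Y))"
    unfolding inv by simp
  also have "\<dots> = t \<cdot> (\<l> B \<lhd> Y)"
    unfolding triangle'[OF assms(1,2)] by (simp add: interchange braid_unit_left)
  finally show ?thesis .
qed

lemma mid_unit_right:
  assumes [simp]: "A \<in> Obj C" "X \<in> Obj C" and s [simp]: "pairing A X s"
  shows "mid A X s \<I> \<I> (\<l> \<I>) \<cdot> ((A \<odot> \<I>) \<rhd> inv_arr C (\<r> X)) = s \<cdot> (\<r> A \<lhd> X)"
proof -
  have [simp]: "s \<in> Arr C" "Dom C s = A \<odot> X" "Cod C s = \<I>"
    using s by (auto simp: in_Hom)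
  have l [simp]: "pairing \<I> \<I> (\<l> \<I>)"
    by (simp add: in_Hom)
  have "nest A X s \<I> \<I> (\<l> \<I>) = (\<l> \<I> \<cdot> (\<I> \<rhd> cap A X s \<I>)) \<cdot> \<alpha> \<I> A (X \<odot> \<I>)"
    by (simp add: nest_def)
  also have "\<dots> = cap A X s \<I> \<cdot> (\<l> A \<lhd> (X \<odot> \<I>))"
    by (simp add: lunit_natural flip: lunit_tensor)
  finally have "mid A X s \<I> \<I> (\<l> \<I>) = s \<cdot> ((A \<rhd> \<r> X) \<cdot> (\<r> A \<lhd> (X \<odot> \<I>)))"
    by (simp add: mid_eq_nest interchange braid_unit_right cap_unit)
  then show ?thesis
    by (simp add: interchange)
qed

end

section \<open>The pre-dual functor\<close>

context prerigid_braided_category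
begin

abbreviation dual_obj ("_\<^sup>\<star>" [999] 999) where "X\<^sup>\<star> \<equiv> Dual C X"
abbreviation ev where "ev \<equiv> Ev C"
abbreviation dual_arr where "dual_arr f \<equiv> AMap (dual_functor C) f"

declare Dual_Obj [simp] Ev_Hom [simp]

lemma ev_arr [simp]:
  assumes "X \<in> Obj C"
  shows "ev X \<in> Arr C" "Dom C (ev X) = X\<^sup>\<star> \<odot> X" "Cod C (ev X) = \<I>"
  using Ev_Hom[OF assms] by (auto simp: in_Hom)

lemma dag_Hom:
  assumes "X \<in> Obj C" "T \<in> Obj C" "t \<in> Hom C (T \<odot> X) \<I>"
  shows "dag C T X t \<in> Hom C T (X\<^sup>\<star>)" "ev X \<cdot> (dag C T X t \<lhd> X) = t"
proof -
  let ?f = "\<lambda>u. ev X \<cdot> (u \<lhd> X)"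
  have f: "inj_on ?f (Hom C T (X\<^sup>\<star>))" "t \<in> ?f ` Hom C T (X\<^sup>\<star>)"
    using Ev_bij[OF assms(1,2)] assms(3) by (auto simp: bij_betw_def)
  show "dag C T X t \<in> Hom C T (X\<^sup>\<star>)"
    unfolding dag_def by (rule the_inv_into_into[OF f]) simp
  show "ev X \<cdot> (dag C T X t \<lhd> X) = t"
    unfolding dag_def by (rule f_the_inv_into_f[OF f])
qed

lemma ev_faithful:
  assumes "X \<in> Obj C" "u \<in> Hom C T (X\<^sup>\<star>)" "v \<in> Hom C T (X\<^sup>\<star>)" "ev X \<cdot> (u \<lhd> X) = ev X \<cdot> (v \<lhd> X)"
  shows "u = v"
proof -
  have "T \<in> Obj C"
    using assms(2) Dom_Obj by (auto simp: in_Hom)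
  then show ?thesis
    using Ev_bij[of X T] assms unfolding bij_betw_def inj_on_def by blast
qed

lemma dag_arr [simp]:
  assumes "X \<in> Obj C" "t \<in> Arr C" "Dom C t = T \<odot> X" "Cod C t = \<I>" "T \<in> Obj C"
  shows "dag C T X t \<in> Arr C" "Dom C (dag C T X t) = T" "Cod C (dag C T X t) = X\<^sup>\<star>"
  using dag_Hom(1)[of X T t] assms by (auto simp: in_Hom)

lemma ev_dag:
  assumes "X \<in> Obj C" "t \<in> Arr C" "Dom C t = T \<odot> X" "Cod C t = \<I>" "T \<in> Obj C"
    "f \<in> Arr C" "Cod C f = X"
  shows "ev X \<cdot> (dag C T X t \<boxtimes> f) = t \<cdot> (T \<rhd> f)"
proof -
  have "ev X \<cdot> (dag C T X t \<boxtimes> f) = (ev X \<cdot> (dag C T X t \<lhd> X)) \<cdot> (T \<rhd> f)"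
    using assms by (simp add: interchange)
  also have "ev X \<cdot> (dag C T X t \<lhd> X) = t"
    using dag_Hom(2)[of X T t] assms by (auto simp: in_Hom)
  finally show ?thesis .
qed

lemma ev_dag_comp:
  assumes "X \<in> Obj C" "t \<in> Arr C" "Dom C t = T \<odot> X" "Cod C t = \<I>" "T \<in> Obj C"
    "f \<in> Arr C" "Cod C f = X" "v \<in> Arr C" "Cod C v = T"
  shows "ev X \<cdot> ((dag C T X t \<cdot> v) \<boxtimes> f) = t \<cdot> (v \<boxtimes> f)"
proof -
  have "ev X \<cdot> ((dag C T X t \<cdot> v) \<boxtimes> f) = (ev X \<cdot> (dag C T X t \<lhd> X)) \<cdot> (v \<boxtimes> f)"
    using assms by (simp add: interchange)
  also have "ev X \<cdot> (dag C T X t \<lhd> X) = t"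
    using ev_dag[of X t T "Idt C X"] assms by simp
  finally show ?thesis .
qed

lemma dual_functor_obj [simp]: "OMap (dual_functor C) = Dual C"
  by (simp add: dual_functor_def)

lemma dual_arr [simp]:
  assumes "f \<in> Arr C"
  shows "dual_arr f \<in> Arr C" "Dom C (dual_arr f) = (Cod C f)\<^sup>\<star>" "Cod C (dual_arr f) = (Dom C f)\<^sup>\<star>"
  using assms by (simp_all add: dual_functor_def)

lemma ev_dual:
  assumes "g \<in> Arr C" "f \<in> Arr C" "Cod C f = X" "Dom C g = X"
  shows "ev X \<cdot> (dual_arr g \<boxtimes> f) = ev (Cod C g) \<cdot> ((Cod C g)\<^sup>\<star> \<rhd> (g \<cdot> f))"
proof -
  have "X \<in> Obj C"
    using assms by auto
  then show ?thesis
    using assms by (simp add: dual_functor_def ev_dag interchange)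
qed

lemma ev_dual_comp:
  assumes "g \<in> Arr C" "f \<in> Arr C" "Cod C f = X" "Dom C g = X" "v \<in> Arr C" "Cod C v = (Cod C g)\<^sup>\<star>"
  shows "ev X \<cdot> ((dual_arr g \<cdot> v) \<boxtimes> f) = ev (Cod C g) \<cdot> (v \<boxtimes> (g \<cdot> f))"
proof -
  have "X \<in> Obj C"
    using assms by auto
  then show ?thesis
    using assms by (simp add: dual_functor_def ev_dag_comp interchange)
qed

lemmas ev_simps = ev_dag ev_dag_comp ev_dual ev_dual_comp

lemma ev_eqI:
  assumes "u \<in> Arr C" "v \<in> Arr C" "Dom C u = Dom C v" "Cod C u = X\<^sup>\<star>" "Cod C v = X\<^sup>\<star>" "X \<in> Obj C"
    "ev X \<cdot> (u \<lhd> X) = ev X \<cdot> (v \<lhd> X)"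
  shows "u = v"
  by (rule ev_faithful[of X u "Dom C u" v]) (use assms in \<open>simp_all add: in_Hom\<close>)

lemma dual_comp:
  assumes "f \<in> Arr C" "g \<in> Arr C" "Dom C g = Cod C f"
  shows "dual_arr (g \<cdot> f) = dual_arr f \<cdot> dual_arr g"
  by (rule ev_eqI[where X = "Dom C f"]) (simp_all add: assms ev_simps)

lemma dual_Idt:
  assumes "X \<in> Obj C"
  shows "dual_arr (Idt C X) = Idt C (X\<^sup>\<star>)"
  by (rule ev_eqI[where X = X]) (simp_all add: assms ev_simps)

lemma category_op_moncat: "category (op_moncat C)"
  using monoidal_op_moncat by (simp add: monoidal_category_def)

lemma functor_dual: "is_functor (op_moncat C) C (dual_functor C)" "is_functor C (op_moncat C) (dual_functor C)"
  unfolding is_functor_def using category_op_moncat category_axioms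
  by (auto simp: in_Hom dual_comp dual_Idt)

abbreviation \<eta> where "\<eta> \<equiv> dual_eta C"
abbreviation \<epsilon> where "\<epsilon> \<equiv> dual_eps C"

lemma eta_eps_arr [simp]:
  assumes "X \<in> Obj C"
  shows "\<eta> X \<in> Arr C" "Dom C (\<eta> X) = X" "Cod C (\<eta> X) = X\<^sup>\<star>\<^sup>\<star>"
    "\<epsilon> X \<in> Arr C" "Dom C (\<epsilon> X) = X" "Cod C (\<epsilon> X) = X\<^sup>\<star>\<^sup>\<star>"
  using assms by (simp_all add: dual_eta_def dual_eps_def)

lemma ev_eta:
  assumes [simp]: "X \<in> Obj C" "f \<in> Arr C" "Cod C f = X\<^sup>\<star>"
  shows "ev (X\<^sup>\<star>) \<cdot> (\<eta> X \<boxtimes> f) = ev X \<cdot> ((f \<lhd> X) \<cdot> \<c> X (Dom C f))"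
  by (simp add: dual_eta_def ev_dag braid_natural)

lemma ev_eps:
  assumes [simp]: "X \<in> Obj C" "f \<in> Arr C" "Cod C f = X\<^sup>\<star>"
  shows "ev (X\<^sup>\<star>) \<cdot> (\<epsilon> X \<boxtimes> f) = ev X \<cdot> ((f \<lhd> X) \<cdot> \<c>\<^sup>- (Dom C f) X)"
  by (simp add: dual_eps_def ev_dag braid_inv_natural)

lemma ev_eta_eps_comp:
  assumes [simp]: "X \<in> Obj C" "f \<in> Arr C" "Cod C f = X\<^sup>\<star>" "g \<in> Arr C" "Cod C g = X"
  shows "ev (X\<^sup>\<star>) \<cdot> ((\<eta> X \<cdot> g) \<boxtimes> f) = ev X \<cdot> ((f \<boxtimes> g) \<cdot> \<c> (Dom C g) (Dom C f))"
    "ev (X\<^sup>\<star>) \<cdot> ((\<epsilon> X \<cdot> g) \<boxtimes> f) = ev X \<cdot> ((f \<boxtimes> g) \<cdot> \<c>\<^sup>- (Dom C f) (Dom C g))"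
  by (simp_all add: dual_eta_def dual_eps_def ev_dag_comp braid_natural braid_inv_natural)

lemma eta_eps_natural:
  assumes "f \<in> Arr C" "Dom C f = X" "Cod C f = Y"
  shows "\<eta> Y \<cdot> f = dual_arr (dual_arr f) \<cdot> \<eta> X" "\<epsilon> Y \<cdot> f = dual_arr (dual_arr f) \<cdot> \<epsilon> X"
proof -
  have [simp]: "X \<in> Obj C" "Y \<in> Obj C"
    using assms by auto
  have *: "ev X \<cdot> ((dual_arr f \<lhd> X) \<cdot> k) = ev Y \<cdot> ((Y\<^sup>\<star> \<rhd> f) \<cdot> k)" if "k \<in> Arr C" "Cod C k = Y\<^sup>\<star> \<odot> X" for k
    using assms that comp_eq_cont[OF ev_dual[of f "Idt C X" X]] by simp
  show "\<eta> Y \<cdot> f = dual_arr (dual_arr f) \<cdot> \<eta> X" "\<epsilon> Y \<cdot> f = dual_arr (dual_arr f) \<cdot> \<epsilon> X"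
    by (rule ev_eqI[where X = "Y\<^sup>\<star>"]; simp add: assms ev_simps ev_eta ev_eps ev_eta_eps_comp *)+
qed

lemma triangle_identities:
  assumes [simp]: "X \<in> Obj C"
  shows "dual_arr (\<eta> X) \<cdot> \<epsilon> (X\<^sup>\<star>) = Idt C (X\<^sup>\<star>)" "dual_arr (\<epsilon> X) \<cdot> \<eta> (X\<^sup>\<star>) = Idt C (X\<^sup>\<star>)"
proof -
  have *: "ev (X\<^sup>\<star>) \<cdot> ((\<eta> X \<lhd> X\<^sup>\<star>) \<cdot> k) = ev X \<cdot> (\<c> X (X\<^sup>\<star>) \<cdot> k)"
      if "k \<in> Arr C" "Cod C k = X \<odot> X\<^sup>\<star>" for k
    using that comp_eq_cont[of "ev (X\<^sup>\<star>)" "\<eta> X \<lhd> X\<^sup>\<star>" "ev X" "\<c> X (X\<^sup>\<star>)" k] by (simp add: ev_eta)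
  have **: "ev (X\<^sup>\<star>) \<cdot> ((\<epsilon> X \<lhd> X\<^sup>\<star>) \<cdot> k) = ev X \<cdot> (\<c>\<^sup>- (X\<^sup>\<star>) X \<cdot> k)"
      if "k \<in> Arr C" "Cod C k = X \<odot> X\<^sup>\<star>" for k
    using that comp_eq_cont[of "ev (X\<^sup>\<star>)" "\<epsilon> X \<lhd> X\<^sup>\<star>" "ev X" "\<c>\<^sup>- (X\<^sup>\<star>) X" k] by (simp add: ev_eps)
  show "dual_arr (\<eta> X) \<cdot> \<epsilon> (X\<^sup>\<star>) = Idt C (X\<^sup>\<star>)"
    by (rule ev_eqI[where X = X]) (simp_all add: ev_simps ev_eps *)
  show "dual_arr (\<epsilon> X) \<cdot> \<eta> (X\<^sup>\<star>) = Idt C (X\<^sup>\<star>)"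
    by (rule ev_eqI[where X = X]) (simp_all add: ev_simps ev_eta **)
qed

lemma dual_adjunction:
  "adjunction C (op_moncat C) (dual_functor C) (dual_functor C) \<eta> \<epsilon>"
  unfolding adjunction_def
  using functor_dual by (auto simp: in_Hom eta_eps_natural triangle_identities)

lemma mid_pairing_eq_mid:
  assumes [simp]: "X \<in> Obj C" "Y \<in> Obj C"
  shows "mid_pairing C X Y = mid (X\<^sup>\<star>) X (ev X) (Y\<^sup>\<star>) Y (ev Y)"
proof -
  have "mid (X\<^sup>\<star>) X (ev X) (Y\<^sup>\<star>) Y (ev Y) = (ev Y \<cdot> \<l> (Y\<^sup>\<star> \<odot> Y)) \<cdot> ((ev X \<lhd> (Y\<^sup>\<star> \<odot> Y)) \<cdot>
      (\<alpha>\<^sup>- (X\<^sup>\<star>) X (Y\<^sup>\<star> \<odot> Y) \<cdot> ((X\<^sup>\<star> \<rhd> inv_arr C (brd X (Y\<^sup>\<star>) Y)) \<cdot> \<alpha> (X\<^sup>\<star>) (Y\<^sup>\<star>) (X \<odot> Y))))"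
    by (simp add: mid_def cap_def)
  also have "ev Y \<cdot> \<l> (Y\<^sup>\<star> \<odot> Y) = \<l> \<I> \<cdot> (\<I> \<rhd> ev Y)"
    by (simp add: lunit_natural)
  also have "(\<l> \<I> \<cdot> (\<I> \<rhd> ev Y)) \<cdot> ((ev X \<lhd> (Y\<^sup>\<star> \<odot> Y)) \<cdot>
      (\<alpha>\<^sup>- (X\<^sup>\<star>) X (Y\<^sup>\<star> \<odot> Y) \<cdot> ((X\<^sup>\<star> \<rhd> inv_arr C (brd X (Y\<^sup>\<star>) Y)) \<cdot> \<alpha> (X\<^sup>\<star>) (Y\<^sup>\<star>) (X \<odot> Y)))) =
    \<l> \<I> \<cdot> ((ev X \<boxtimes> ev Y) \<cdot>
      (\<alpha>\<^sup>- (X\<^sup>\<star>) X (Y\<^sup>\<star> \<odot> Y) \<cdot> ((X\<^sup>\<star> \<rhd> inv_arr C (brd X (Y\<^sup>\<star>) Y)) \<cdot> \<alpha> (X\<^sup>\<star>) (Y\<^sup>\<star>) (X \<odot> Y))))"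
    by (simp add: interchange_cont)
  also have "\<dots> = mid_pairing C X Y"
    by (simp add: mid_pairing_def Let_def inv_brd whisker_comp)
  finally show ?thesis ..
qed

abbreviation \<phi>\<^sub>2 where "\<phi>\<^sub>2 \<equiv> dual2 C"
abbreviation \<phi>\<^sub>0 where "\<phi>\<^sub>0 \<equiv> dual0 C"
abbreviation ev_mid where "ev_mid X Y \<equiv> mid (X\<^sup>\<star>) X (ev X) (Y\<^sup>\<star>) Y (ev Y)"

lemma mid_arr [simp]:
  assumes "A \<in> Obj C" "X \<in> Obj C" "pairing A X s" "B \<in> Obj C" "Y \<in> Obj C" "pairing B Y t"
  shows "mid A X s B Y t \<in> Arr C" "Dom C (mid A X s B Y t) = (A \<odot> B) \<odot> (X \<odot> Y)" "Cod C (mid A X s B Y t) = \<I>"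
  using pairing_mid[OF assms] by (auto simp: in_Hom)

lemma dual2_eq:
  assumes "X \<in> Obj C" "Y \<in> Obj C"
  shows "\<phi>\<^sub>2 X Y = dag C (X\<^sup>\<star> \<odot> Y\<^sup>\<star>) (X \<odot> Y) (ev_mid X Y)"
  using assms by (simp add: dual2_def mid_pairing_eq_mid)

lemma dual2_arr [simp]:
  assumes "X \<in> Obj C" "Y \<in> Obj C"
  shows "\<phi>\<^sub>2 X Y \<in> Arr C" "Dom C (\<phi>\<^sub>2 X Y) = X\<^sup>\<star> \<odot> Y\<^sup>\<star>" "Cod C (\<phi>\<^sub>2 X Y) = (X \<odot> Y)\<^sup>\<star>"
  using assms by (simp_all add: dual2_eq)

lemma ev_dual2:
  assumes "X \<in> Obj C" "Y \<in> Obj C" "f \<in> Arr C" "Cod C f = X \<odot> Y"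
  shows "ev (X \<odot> Y) \<cdot> (\<phi>\<^sub>2 X Y \<boxtimes> f) = ev_mid X Y \<cdot> ((X\<^sup>\<star> \<odot> Y\<^sup>\<star>) \<rhd> f)"
    "v \<in> Arr C \<Longrightarrow> Cod C v = X\<^sup>\<star> \<odot> Y\<^sup>\<star> \<Longrightarrow> ev (X \<odot> Y) \<cdot> ((\<phi>\<^sub>2 X Y \<cdot> v) \<boxtimes> f) = ev_mid X Y \<cdot> (v \<boxtimes> f)"
  using assms by (simp_all add: dual2_eq ev_dag ev_dag_comp)

lemma dual0_arr [simp]: "\<phi>\<^sub>0 \<in> Arr C" "Dom C \<phi>\<^sub>0 = \<I>" "Cod C \<phi>\<^sub>0 = \<I>\<^sup>\<star>"
  by (simp_all add: dual0_def)

lemma ev_dual0: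
  assumes "f \<in> Arr C" "Cod C f = \<I>"
  shows "ev \<I> \<cdot> (\<phi>\<^sub>0 \<boxtimes> f) = \<l> \<I> \<cdot> (\<I> \<rhd> f)"
  using assms by (simp add: dual0_def ev_dag)

lemma dual2_natural:
  assumes "f \<in> Hom C X' X" "g \<in> Hom C Y' Y"
  shows "\<phi>\<^sub>2 X' Y' \<cdot> (dual_arr f \<boxtimes> dual_arr g) = dual_arr (f \<boxtimes> g) \<cdot> \<phi>\<^sub>2 X Y"
proof (rule ev_eqI[where X = "X' \<odot> Y'"])
  have a [simp]: "f \<in> Arr C" "Dom C f = X'" "Cod C f = X" "g \<in> Arr C" "Dom C g = Y'" "Cod C g = Y"
    using assms by (auto simp: in_Hom)
  have [simp]: "X \<in> Obj C" "X' \<in> Obj C" "Y \<in> Obj C" "Y' \<in> Obj C"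
    using Dom_Obj Cod_Obj a by metis+
  have "ev (X' \<odot> Y') \<cdot> ((\<phi>\<^sub>2 X' Y' \<cdot> (dual_arr f \<boxtimes> dual_arr g)) \<lhd> (X' \<odot> Y')) =
      ev_mid X' Y' \<cdot> ((dual_arr f \<boxtimes> dual_arr g) \<boxtimes> (Idt C X' \<boxtimes> Idt C Y'))"
    by (simp add: ev_dual2)
  also have "\<dots> = mid (X\<^sup>\<star>) X' (ev X' \<cdot> (dual_arr f \<lhd> X')) (Y\<^sup>\<star>) Y' (ev Y' \<cdot> (dual_arr g \<lhd> Y'))"
    by (rule mid_whisker) (simp_all add: in_Hom)
  also have "\<dots> = mid (X\<^sup>\<star>) X' (ev X \<cdot> (X\<^sup>\<star> \<rhd> f)) (Y\<^sup>\<star>) Y' (ev Y \<cdot> (Y\<^sup>\<star> \<rhd> g))"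
    by (simp add: ev_dual)
  also have "\<dots> = ev_mid X Y \<cdot> ((Idt C (X\<^sup>\<star>) \<boxtimes> Idt C (Y\<^sup>\<star>)) \<boxtimes> (f \<boxtimes> g))"
    by (rule mid_whisker[symmetric]) (simp_all add: in_Hom)
  also have "\<dots> = ev (X' \<odot> Y') \<cdot> ((dual_arr (f \<boxtimes> g) \<cdot> \<phi>\<^sub>2 X Y) \<lhd> (X' \<odot> Y'))"
    by (simp add: ev_dual_comp ev_dual2)
  finally show "ev (X' \<odot> Y') \<cdot> ((\<phi>\<^sub>2 X' Y' \<cdot> (dual_arr f \<boxtimes> dual_arr g)) \<lhd> (X' \<odot> Y')) =
      ev (X' \<odot> Y') \<cdot> ((dual_arr (f \<boxtimes> g) \<cdot> \<phi>\<^sub>2 X Y) \<lhd> (X' \<odot> Y'))" .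
qed (use assms Dom_Obj Cod_Obj in \<open>auto simp: in_Hom\<close>)

lemma ev_mid_dual2_left:
  assumes [simp]: "X \<in> Obj C" "Y \<in> Obj C" "Z \<in> Obj C"
  shows "ev_mid (X \<odot> Y) Z \<cdot> ((\<phi>\<^sub>2 X Y \<lhd> Z\<^sup>\<star>) \<lhd> ((X \<odot> Y) \<odot> Z)) =
    mid (X\<^sup>\<star> \<odot> Y\<^sup>\<star>) (X \<odot> Y) (ev_mid X Y) (Z\<^sup>\<star>) Z (ev Z)"
  using mid_whisker[of "ev (X \<odot> Y)" "(X \<odot> Y)\<^sup>\<star>" "X \<odot> Y" "ev Z" "Z\<^sup>\<star>" Z "\<phi>\<^sub>2 X Y" "X\<^sup>\<star> \<odot> Y\<^sup>\<star>" "Idt C (X \<odot> Y)" "X \<odot> Y" "Idt C (Z\<^sup>\<star>)" "Z\<^sup>\<star>" "Idt C Z" Z]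
  by (simp add: in_Hom ev_dual2)

lemma ev_mid_dual2_right:
  assumes [simp]: "X \<in> Obj C" "Y \<in> Obj C" "Z \<in> Obj C"
  shows "ev_mid X (Y \<odot> Z) \<cdot> ((X\<^sup>\<star> \<rhd> \<phi>\<^sub>2 Y Z) \<lhd> (X \<odot> (Y \<odot> Z))) =
    mid (X\<^sup>\<star>) X (ev X) (Y\<^sup>\<star> \<odot> Z\<^sup>\<star>) (Y \<odot> Z) (ev_mid Y Z)"
  using mid_whisker[of "ev X" "X\<^sup>\<star>" X "ev (Y \<odot> Z)" "(Y \<odot> Z)\<^sup>\<star>" "Y \<odot> Z" "Idt C (X\<^sup>\<star>)" "X\<^sup>\<star>" "Idt C X" X "\<phi>\<^sub>2 Y Z" "Y\<^sup>\<star> \<odot> Z\<^sup>\<star>" "Idt C (Y \<odot> Z)" "Y \<odot> Z"]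
  by (simp add: in_Hom ev_dual2)

lemma dual2_assoc:
  assumes [simp]: "X \<in> Obj C" "Y \<in> Obj C" "Z \<in> Obj C"
  shows "dual_arr (\<alpha>\<^sup>- X Y Z) \<cdot> (\<phi>\<^sub>2 (X \<odot> Y) Z \<cdot> (\<phi>\<^sub>2 X Y \<lhd> Z\<^sup>\<star>)) =
    \<phi>\<^sub>2 X (Y \<odot> Z) \<cdot> ((X\<^sup>\<star> \<rhd> \<phi>\<^sub>2 Y Z) \<cdot> \<alpha> (X\<^sup>\<star>) (Y\<^sup>\<star>) (Z\<^sup>\<star>))"
proof (rule ev_eqI[where X = "X \<odot> (Y \<odot> Z)"])
  let ?P = "X \<odot> (Y \<odot> Z)" and ?P' = "(X \<odot> Y) \<odot> Z"
  note pairing_mid [simp]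
  have "ev ?P \<cdot> ((dual_arr (\<alpha>\<^sup>- X Y Z) \<cdot> (\<phi>\<^sub>2 (X \<odot> Y) Z \<cdot> (\<phi>\<^sub>2 X Y \<lhd> Z\<^sup>\<star>))) \<lhd> ?P) =
      ev_mid (X \<odot> Y) Z \<cdot> ((\<phi>\<^sub>2 X Y \<lhd> Z\<^sup>\<star>) \<boxtimes> \<alpha>\<^sup>- X Y Z)"
    by (simp add: ev_dual_comp ev_dual2)
  also have "\<dots> = (ev_mid (X \<odot> Y) Z \<cdot> ((\<phi>\<^sub>2 X Y \<lhd> Z\<^sup>\<star>) \<lhd> ?P')) \<cdot> (((X\<^sup>\<star> \<odot> Y\<^sup>\<star>) \<odot> Z\<^sup>\<star>) \<rhd> \<alpha>\<^sup>- X Y Z)"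
    by (simp add: interchange)
  also have "\<dots> = mid (X\<^sup>\<star>) X (ev X) (Y\<^sup>\<star> \<odot> Z\<^sup>\<star>) (Y \<odot> Z) (ev_mid Y Z) \<cdot> (\<alpha> (X\<^sup>\<star>) (Y\<^sup>\<star>) (Z\<^sup>\<star>) \<lhd> ?P)"
    unfolding ev_mid_dual2_left[OF assms] by (simp add: mid_assoc interchange)
  also have "\<dots> = ev_mid X (Y \<odot> Z) \<cdot> (((X\<^sup>\<star> \<rhd> \<phi>\<^sub>2 Y Z) \<cdot> \<alpha> (X\<^sup>\<star>) (Y\<^sup>\<star>) (Z\<^sup>\<star>)) \<lhd> ?P)"
    unfolding ev_mid_dual2_right[OF assms, symmetric] by (simp add: interchange)
  also have "\<dots> = ev ?P \<cdot> ((\<phi>\<^sub>2 X (Y \<odot> Z) \<cdot> ((X\<^sup>\<star> \<rhd> \<phi>\<^sub>2 Y Z) \<cdot> \<alpha> (X\<^sup>\<star>) (Y\<^sup>\<star>) (Z\<^sup>\<star>))) \<lhd> ?P)"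
    by (simp add: ev_dual2)
  finally show "ev ?P \<cdot> ((dual_arr (\<alpha>\<^sup>- X Y Z) \<cdot> (\<phi>\<^sub>2 (X \<odot> Y) Z \<cdot> (\<phi>\<^sub>2 X Y \<lhd> Z\<^sup>\<star>))) \<lhd> ?P) =
      ev ?P \<cdot> ((\<phi>\<^sub>2 X (Y \<odot> Z) \<cdot> ((X\<^sup>\<star> \<rhd> \<phi>\<^sub>2 Y Z) \<cdot> \<alpha> (X\<^sup>\<star>) (Y\<^sup>\<star>) (Z\<^sup>\<star>))) \<lhd> ?P)" .
qed simp_all

lemma dual2_unit_left:
  assumes [simp]: "X \<in> Obj C"
  shows "dual_arr (inv_arr C (\<l> X)) \<cdot> (\<phi>\<^sub>2 \<I> X \<cdot> (\<phi>\<^sub>0 \<lhd> X\<^sup>\<star>)) = \<l> (X\<^sup>\<star>)"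
proof (rule ev_eqI[where X = X])
  have *: "ev_mid \<I> X \<cdot> ((\<phi>\<^sub>0 \<lhd> X\<^sup>\<star>) \<lhd> (\<I> \<odot> X)) = mid \<I> \<I> (\<l> \<I>) (X\<^sup>\<star>) X (ev X)"
    using mid_whisker[of "ev \<I>" "\<I>\<^sup>\<star>" \<I> "ev X" "X\<^sup>\<star>" X \<phi>\<^sub>0 \<I> "Idt C \<I>" \<I> "Idt C (X\<^sup>\<star>)" "X\<^sup>\<star>" "Idt C X" X]
    by (simp add: in_Hom ev_dual0)
  have "ev X \<cdot> ((dual_arr (inv_arr C (\<l> X)) \<cdot> (\<phi>\<^sub>2 \<I> X \<cdot> (\<phi>\<^sub>0 \<lhd> X\<^sup>\<star>))) \<lhd> X) =
      ev_mid \<I> X \<cdot> ((\<phi>\<^sub>0 \<lhd> X\<^sup>\<star>) \<boxtimes> inv_arr C (\<l> X))"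
    by (simp add: ev_dual_comp ev_dual2)
  also have "\<dots> = (ev_mid \<I> X \<cdot> ((\<phi>\<^sub>0 \<lhd> X\<^sup>\<star>) \<lhd> (\<I> \<odot> X))) \<cdot> ((\<I> \<odot> X\<^sup>\<star>) \<rhd> inv_arr C (\<l> X))"
    by (simp add: interchange)
  also have "\<dots> = ev X \<cdot> (\<l> (X\<^sup>\<star>) \<lhd> X)"
    unfolding * by (rule mid_unit_left) simp_all
  finally show "ev X \<cdot> ((dual_arr (inv_arr C (\<l> X)) \<cdot> (\<phi>\<^sub>2 \<I> X \<cdot> (\<phi>\<^sub>0 \<lhd> X\<^sup>\<star>))) \<lhd> X) =
      ev X \<cdot> (\<l> (X\<^sup>\<star>) \<lhd> X)" .
qed simp_all

lemma dual2_unit_right: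
  assumes [simp]: "X \<in> Obj C"
  shows "dual_arr (inv_arr C (\<r> X)) \<cdot> (\<phi>\<^sub>2 X \<I> \<cdot> (X\<^sup>\<star> \<rhd> \<phi>\<^sub>0)) = \<r> (X\<^sup>\<star>)"
proof (rule ev_eqI[where X = X])
  have *: "ev_mid X \<I> \<cdot> ((X\<^sup>\<star> \<rhd> \<phi>\<^sub>0) \<lhd> (X \<odot> \<I>)) = mid (X\<^sup>\<star>) X (ev X) \<I> \<I> (\<l> \<I>)"
    using mid_whisker[of "ev X" "X\<^sup>\<star>" X "ev \<I>" "\<I>\<^sup>\<star>" \<I> "Idt C (X\<^sup>\<star>)" "X\<^sup>\<star>" "Idt C X" X \<phi>\<^sub>0 \<I> "Idt C \<I>" \<I>]
    by (simp add: in_Hom ev_dual0)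
  have "ev X \<cdot> ((dual_arr (inv_arr C (\<r> X)) \<cdot> (\<phi>\<^sub>2 X \<I> \<cdot> (X\<^sup>\<star> \<rhd> \<phi>\<^sub>0))) \<lhd> X) =
      ev_mid X \<I> \<cdot> ((X\<^sup>\<star> \<rhd> \<phi>\<^sub>0) \<boxtimes> inv_arr C (\<r> X))"
    by (simp add: ev_dual_comp ev_dual2)
  also have "\<dots> = (ev_mid X \<I> \<cdot> ((X\<^sup>\<star> \<rhd> \<phi>\<^sub>0) \<lhd> (X \<odot> \<I>))) \<cdot> ((X\<^sup>\<star> \<odot> \<I>) \<rhd> inv_arr C (\<r> X))"
    by (simp add: interchange)
  also have "\<dots> = ev X \<cdot> (\<r> (X\<^sup>\<star>) \<lhd> X)"
    unfolding * by (rule mid_unit_right) simp_all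
  finally show "ev X \<cdot> ((dual_arr (inv_arr C (\<r> X)) \<cdot> (\<phi>\<^sub>2 X \<I> \<cdot> (X\<^sup>\<star> \<rhd> \<phi>\<^sub>0))) \<lhd> X) =
      ev X \<cdot> (\<r> (X\<^sup>\<star>) \<lhd> X)" .
qed simp_all

lemma dual_lax_monoidal: "lax_monoidal_functor (op_moncat C) C (dual_functor C) \<phi>\<^sub>2 \<phi>\<^sub>0"
  unfolding lax_monoidal_functor_def
  using monoidal_op_moncat monoidal_category_axioms functor_dual(1)
  by (auto simp: in_Hom dual2_natural dual2_assoc dual2_unit_left dual2_unit_right)

lemma colax2_dual:
  assumes [simp]: "X \<in> Obj C" "Y \<in> Obj C"
  shows "colax2 (op_moncat C) C (dual_functor C) \<eta> \<epsilon> \<phi>\<^sub>2 X Y =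
    \<phi>\<^sub>2 X Y \<cdot> (\<c> (Y\<^sup>\<star>) (X\<^sup>\<star>) \<cdot> \<c> (X\<^sup>\<star>) (Y\<^sup>\<star>))"
proof -
  let ?A = "X\<^sup>\<star> \<odot> Y\<^sup>\<star>" and ?f = "\<phi>\<^sub>2 (X\<^sup>\<star>) (Y\<^sup>\<star>) \<cdot> (\<eta> X \<boxtimes> \<eta> Y)"
  have "dual_arr (\<eta> X \<boxtimes> \<eta> Y) \<cdot> (dual_arr (\<phi>\<^sub>2 (X\<^sup>\<star>) (Y\<^sup>\<star>)) \<cdot> \<epsilon> ?A) =
      \<phi>\<^sub>2 X Y \<cdot> (\<c> (Y\<^sup>\<star>) (X\<^sup>\<star>) \<cdot> \<c> (X\<^sup>\<star>) (Y\<^sup>\<star>))"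
  proof (rule ev_eqI[where X = "X \<odot> Y"])
    have "ev (X \<odot> Y) \<cdot> ((dual_arr (\<eta> X \<boxtimes> \<eta> Y) \<cdot> (dual_arr (\<phi>\<^sub>2 (X\<^sup>\<star>) (Y\<^sup>\<star>)) \<cdot> \<epsilon> ?A)) \<lhd> (X \<odot> Y)) =
        (ev ?A \<cdot> (?f \<lhd> ?A)) \<cdot> \<c>\<^sup>- (X \<odot> Y) ?A"
      by (simp add: ev_dual_comp ev_eps)
    also have "ev ?A \<cdot> (?f \<lhd> ?A) = ev_mid (X\<^sup>\<star>) (Y\<^sup>\<star>) \<cdot> ((\<eta> X \<boxtimes> \<eta> Y) \<boxtimes> (Idt C (X\<^sup>\<star>) \<boxtimes> Idt C (Y\<^sup>\<star>)))"
      by (simp add: ev_dual2)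
    also have "\<dots> = mid X (X\<^sup>\<star>) (ev (X\<^sup>\<star>) \<cdot> (\<eta> X \<lhd> X\<^sup>\<star>)) Y (Y\<^sup>\<star>) (ev (Y\<^sup>\<star>) \<cdot> (\<eta> Y \<lhd> Y\<^sup>\<star>))"
      by (rule mid_whisker) (simp_all add: in_Hom)
    also have "\<dots> = ev_mid X Y \<cdot> (((\<c> (Y\<^sup>\<star>) (X\<^sup>\<star>) \<cdot> \<c> (X\<^sup>\<star>) (Y\<^sup>\<star>)) \<lhd> (X \<odot> Y)) \<cdot> \<c> (X \<odot> Y) ?A)"
      by (simp add: ev_eta mid_braid)
    also have "\<dots> \<cdot> \<c>\<^sup>- (X \<odot> Y) ?A = ev (X \<odot> Y) \<cdot> ((\<phi>\<^sub>2 X Y \<cdot> (\<c> (Y\<^sup>\<star>) (X\<^sup>\<star>) \<cdot> \<c> (X\<^sup>\<star>) (Y\<^sup>\<star>))) \<lhd> (X \<odot> Y))"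
      by (simp add: ev_dual2)
    finally show "ev (X \<odot> Y) \<cdot> ((dual_arr (\<eta> X \<boxtimes> \<eta> Y) \<cdot> (dual_arr (\<phi>\<^sub>2 (X\<^sup>\<star>) (Y\<^sup>\<star>)) \<cdot> \<epsilon> ?A)) \<lhd> (X \<odot> Y)) =
        ev (X \<odot> Y) \<cdot> ((\<phi>\<^sub>2 X Y \<cdot> (\<c> (Y\<^sup>\<star>) (X\<^sup>\<star>) \<cdot> \<c> (X\<^sup>\<star>) (Y\<^sup>\<star>))) \<lhd> (X \<odot> Y))" .
  qed simp_all
  then show ?thesis
    by (simp add: colax2_def)
qed

lemma colax0_dual: "colax0 (op_moncat C) (dual_functor C) \<epsilon> \<phi>\<^sub>0 = \<phi>\<^sub>0"
proof -
  have l: "\<l> \<I> \<cdot> \<c>\<^sup>- \<I> \<I> = \<l> \<I>"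
    using braid_unit_right[of \<I>] by (simp add: braid_unit_inverse lunit_unit_eq_runit_unit)
  have "dual_arr \<phi>\<^sub>0 \<cdot> \<epsilon> \<I> = \<phi>\<^sub>0"
    by (rule ev_eqI[where X = \<I>]) (simp_all add: l ev_dual_comp ev_eps ev_dual0
      comp_eq_cont[OF ev_dual0[of "Idt C \<I>"], of "\<c>\<^sup>- \<I> \<I>"])
  then show ?thesis
    by (simp add: colax0_def)
qed

end

section \<open>Adjoints from universal arrows\<close>

lemma is_functorD:
  assumes "is_functor A B F"
  shows "category A" "category B"
    "X \<in> Obj A \<Longrightarrow> OMap F X \<in> Obj B"
    "f \<in> Hom A X Y \<Longrightarrow> AMap F f \<in> Hom B (OMap F X) (OMap F Y)"
    "X \<in> Obj A \<Longrightarrow> AMap F (Idt A X) = Idt B (OMap F X)"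
    "f \<in> Hom A X Y \<Longrightarrow> g \<in> Hom A Y Z \<Longrightarrow> AMap F (g \<cdot>\<^bsub>A\<^esub> f) = AMap F g \<cdot>\<^bsub>B\<^esub> AMap F f"
  using assms unfolding is_functor_def by blast+

context category
begin

lemma eq_inv_comp_iff:
  assumes "iso_arr C k" "g \<in> Arr C" "h \<in> Arr C" "Cod C g = Dom C k" "Cod C h = Cod C k"
  shows "g = inv_arr C k \<cdot> h \<longleftrightarrow> k \<cdot> g = h"
  using assms inv_arr_cont by metis

lemma comp_inv_eq_iff:
  assumes k: "iso_arr C k" and "g \<in> Arr C" "h \<in> Arr C" "Dom C g = Dom C k" "Dom C h = Cod C k"
  shows "g \<cdot> inv_arr C k = h \<longleftrightarrow> g = h \<cdot> k"
proof
  note k_arr = iso_arr_arr[OF k]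
  show "g = h \<cdot> k" if h: "g \<cdot> inv_arr C k = h"
    using assms k_arr by (simp flip: h)
  show "g \<cdot> inv_arr C k = h" if g: "g = h \<cdot> k"
    using assms k_arr by (simp add: g)
qed

end

lemma (in category) Hom_Obj:
  assumes "f \<in> Hom C X Y"
  shows "X \<in> Obj C" "Y \<in> Obj C"
  using assms Dom_Obj Cod_Obj by (auto simp: in_Hom)

definition universal_arrow ::
  "('o, 'a, 'z) cat_scheme \<Rightarrow> ('p, 'b, 'y) cat_scheme \<Rightarrow> ('o, 'a, 'p, 'b) functor_data \<Rightarrow>
   'p \<Rightarrow> 'o \<Rightarrow> 'b \<Rightarrow> bool" where
  "universal_arrow A B F X U h \<longleftrightarrow> U \<in> Obj A \<and> h \<in> Hom B X (OMap F U) \<and>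
     (\<forall>Y\<in>Obj A. \<forall>f\<in>Hom B X (OMap F Y). \<exists>!g. g \<in> Hom A U Y \<and> AMap F g \<cdot>\<^bsub>B\<^esub> h = f)"

lemma universal_arrow_if_left_adjoint:
  assumes "has_left_adjoint A B F" "X \<in> Obj B"
  shows "\<exists>U h. universal_arrow A B F X U h"
proof -
  obtain E \<eta> \<epsilon> where adj: "adjunction B A E F \<eta> \<epsilon>"
    using assms(1) unfolding has_left_adjoint_def by blast
  then have E: "is_functor B A E" and F: "is_functor A B F"
    and \<eta>: "\<And>X. X \<in> Obj B \<Longrightarrow> \<eta> X \<in> Hom B X (OMap F (OMap E X))"
    and \<eta>_nat: "\<And>X Y f. f \<in> Hom B X Y \<Longrightarrow> \<eta> Y \<cdot>\<^bsub>B\<^esub> f = AMap F (AMap E f) \<cdot>\<^bsub>B\<^esub> \<eta> X"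
    and \<epsilon>: "\<And>X. X \<in> Obj A \<Longrightarrow> \<epsilon> X \<in> Hom A (OMap E (OMap F X)) X"
    and \<epsilon>_nat: "\<And>X Y f. f \<in> Hom A X Y \<Longrightarrow> \<epsilon> Y \<cdot>\<^bsub>A\<^esub> AMap E (AMap F f) = f \<cdot>\<^bsub>A\<^esub> \<epsilon> X"
    and tri: "\<And>X. X \<in> Obj B \<Longrightarrow> \<epsilon> (OMap E X) \<cdot>\<^bsub>A\<^esub> AMap E (\<eta> X) = Idt A (OMap E X)"
      "\<And>X. X \<in> Obj A \<Longrightarrow> AMap F (\<epsilon> X) \<cdot>\<^bsub>B\<^esub> \<eta> (OMap F X) = Idt B (OMap F X)"
    unfolding adjunction_def by blast+
  interpret A: category A by (rule is_functorD(1)[OF F])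
  interpret B: category B by (rule is_functorD(2)[OF F])
  have "universal_arrow A B F X (OMap E X) (\<eta> X)"
    unfolding universal_arrow_def
  proof (intro conjI ballI ex1I[where P = "\<lambda>g. g \<in> Hom A _ _ \<and> _ g"])
    show "OMap E X \<in> Obj A"
      using assms(2) is_functorD(3)[OF E] by blast
    show h: "\<eta> X \<in> Hom B X (OMap F (OMap E X))"
      using assms(2) by (rule \<eta>)
    fix Y f assume Y: "Y \<in> Obj A" and f: "f \<in> Hom B X (OMap F Y)"
    have Ef: "AMap E f \<in> Hom A (OMap E X) (OMap E (OMap F Y))"
      using is_functorD(4)[OF E f] .
    show "\<epsilon> Y \<cdot>\<^bsub>A\<^esub> AMap E f \<in> Hom A (OMap E X) Y"
      by (rule A.Comp_Hom[OF Ef \<epsilon>[OF Y]])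
    have "AMap F (\<epsilon> Y \<cdot>\<^bsub>A\<^esub> AMap E f) \<cdot>\<^bsub>B\<^esub> \<eta> X = AMap F (\<epsilon> Y) \<cdot>\<^bsub>B\<^esub> AMap F (AMap E f) \<cdot>\<^bsub>B\<^esub> \<eta> X"
      by (simp add: is_functorD(6)[OF F Ef \<epsilon>[OF Y]])
    also have "\<dots> = AMap F (\<epsilon> Y) \<cdot>\<^bsub>B\<^esub> (\<eta> (OMap F Y) \<cdot>\<^bsub>B\<^esub> f)"
      unfolding \<eta>_nat[OF f]
      by (rule B.Comp_assoc[OF h is_functorD(4)[OF F Ef] is_functorD(4)[OF F \<epsilon>[OF Y]]])
    also have "\<dots> = (AMap F (\<epsilon> Y) \<cdot>\<^bsub>B\<^esub> \<eta> (OMap F Y)) \<cdot>\<^bsub>B\<^esub> f"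
      by (rule B.Comp_assoc[symmetric, OF f \<eta> is_functorD(4)[OF F \<epsilon>[OF Y]]])
        (rule is_functorD(3)[OF F Y])
    also have "\<dots> = f"
      using f Y by (simp add: tri(2) B.Comp_Idt_left)
    finally show "AMap F (\<epsilon> Y \<cdot>\<^bsub>A\<^esub> AMap E f) \<cdot>\<^bsub>B\<^esub> \<eta> X = f" .
    fix g assume "g \<in> Hom A (OMap E X) Y \<and> AMap F g \<cdot>\<^bsub>B\<^esub> \<eta> X = f"
    then have g: "g \<in> Hom A (OMap E X) Y" and gf: "f = AMap F g \<cdot>\<^bsub>B\<^esub> \<eta> X"
      by blast+
    have Fg: "AMap F g \<in> Hom B (OMap F (OMap E X)) (OMap F Y)"
      by (rule is_functorD(4)[OF F g])
    have EX: "OMap E X \<in> Obj A"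
      using g A.Hom_Obj by blast
    have "\<epsilon> Y \<cdot>\<^bsub>A\<^esub> AMap E f = \<epsilon> Y \<cdot>\<^bsub>A\<^esub> (AMap E (AMap F g) \<cdot>\<^bsub>A\<^esub> AMap E (\<eta> X))"
      unfolding gf by (simp add: is_functorD(6)[OF E h Fg])
    also have "\<dots> = (\<epsilon> Y \<cdot>\<^bsub>A\<^esub> AMap E (AMap F g)) \<cdot>\<^bsub>A\<^esub> AMap E (\<eta> X)"
      by (rule A.Comp_assoc[symmetric, OF is_functorD(4)[OF E h] is_functorD(4)[OF E Fg] \<epsilon>[OF Y]])
    also have "\<dots> = g \<cdot>\<^bsub>A\<^esub> (\<epsilon> (OMap E X) \<cdot>\<^bsub>A\<^esub> AMap E (\<eta> X))"
      unfolding \<epsilon>_nat[OF g] by (rule A.Comp_assoc[OF is_functorD(4)[OF E h] \<epsilon>[OF EX] g])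
    also have "\<dots> = g"
      using g assms(2) by (simp add: tri(1) A.Comp_Idt_right)
    finally show "g = \<epsilon> Y \<cdot>\<^bsub>A\<^esub> AMap E f" ..
  qed
  then show ?thesis by blast
qed

lemma left_adjoint_if_universal_arrows:
  assumes F: "is_functor A B F"
    and "\<And>X. X \<in> Obj B \<Longrightarrow> \<exists>U h. universal_arrow A B F X U h"
  shows "has_left_adjoint A B F"
proof -
  interpret A: category A by (rule is_functorD(1)[OF F])
  interpret B: category B by (rule is_functorD(2)[OF F])
  obtain U h where u: "\<And>X. X \<in> Obj B \<Longrightarrow> universal_arrow A B F X (U X) (h X)"
    using assms(2) by metis
  have U: "U X \<in> Obj A" and h: "h X \<in> Hom B X (OMap F (U X))" if "X \<in> Obj B" for X
    using u[OF that] unfolding universal_arrow_def by blast+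
  define lift where "lift X Y f = (THE g. g \<in> Hom A (U X) Y \<and> AMap F g \<cdot>\<^bsub>B\<^esub> h X = f)" for X Y f
  have lift: "lift X Y f \<in> Hom A (U X) Y" "AMap F (lift X Y f) \<cdot>\<^bsub>B\<^esub> h X = f"
    if "Y \<in> Obj A" "f \<in> Hom B X (OMap F Y)" for X Y f
  proof -
    have "\<exists>!g. g \<in> Hom A (U X) Y \<and> AMap F g \<cdot>\<^bsub>B\<^esub> h X = f"
      using u[of X] that B.Hom_Obj unfolding universal_arrow_def by blast
    from theI'[OF this] show "lift X Y f \<in> Hom A (U X) Y" "AMap F (lift X Y f) \<cdot>\<^bsub>B\<^esub> h X = f"
      unfolding lift_def by blast+
  qed
  have unique: "g = g'"
    if "X \<in> Obj B" "g \<in> Hom A (U X) Y" "g' \<in> Hom A (U X) Y" "AMap F g \<cdot>\<^bsub>B\<^esub> h X = AMap F g' \<cdot>\<^bsub>B\<^esub> h X"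
    for X Y g g'
  proof -
    have "Y \<in> Obj A" "AMap F g \<cdot>\<^bsub>B\<^esub> h X \<in> Hom B X (OMap F Y)"
      using that A.Hom_Obj B.Comp_Hom[OF h is_functorD(4)[OF F]] by blast+
    then show ?thesis
      using u[OF that(1)] that(2-4) unfolding universal_arrow_def by metis
  qed
  define E where "E = \<lparr>OMap = U, AMap = (\<lambda>f. lift (Dom B f) (U (Cod B f)) (h (Cod B f) \<cdot>\<^bsub>B\<^esub> f))\<rparr>"
  define \<epsilon> where "\<epsilon> Y = lift (OMap F Y) Y (Idt B (OMap F Y))" for Y
  have E_Hom: "AMap E f \<in> Hom A (U X) (U Y)" and E_h: "AMap F (AMap E f) \<cdot>\<^bsub>B\<^esub> h X = h Y \<cdot>\<^bsub>B\<^esub> f"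
    if f: "f \<in> Hom B X Y" for f X Y
  proof -
    have [simp]: "Dom B f = X" "Cod B f = Y"
      using f by (auto simp: in_Hom)
    have "h Y \<cdot>\<^bsub>B\<^esub> f \<in> Hom B X (OMap F (U Y))" "U Y \<in> Obj A"
      using B.Comp_Hom[OF f h] U B.Hom_Obj[OF f] by blast+
    from lift[OF this(2,1)] show "AMap E f \<in> Hom A (U X) (U Y)" "AMap F (AMap E f) \<cdot>\<^bsub>B\<^esub> h X = h Y \<cdot>\<^bsub>B\<^esub> f"
      by (simp_all add: E_def)
  qed
  have F_comp_h: "AMap F (g' \<cdot>\<^bsub>A\<^esub> g) \<cdot>\<^bsub>B\<^esub> h X = AMap F g' \<cdot>\<^bsub>B\<^esub> (AMap F g \<cdot>\<^bsub>B\<^esub> h X)"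
    if "X \<in> Obj B" "g \<in> Hom A (U X) Y" "g' \<in> Hom A Y Z" for X Y Z g g'
    unfolding is_functorD(6)[OF F that(2,3)]
    by (rule B.Comp_assoc[OF h[OF that(1)] is_functorD(4)[OF F that(2)] is_functorD(4)[OF F that(3)]])
  have E: "is_functor B A E"
    unfolding is_functor_def
  proof (intro conjI ballI allI)
    show "category B" "category A" by unfold_locales
    show "OMap E X \<in> Obj A" if "X \<in> Obj B" for X
      using U[OF that] by (simp add: E_def)
    show "AMap E f \<in> Hom A (OMap E X) (OMap E Y)" if "f \<in> Hom B X Y" for f X Y
      using E_Hom[OF that] by (simp add: E_def)
    show "AMap E (Idt B X) = Idt A (OMap E X)" if X: "X \<in> Obj B" for X
    proof -
      have "AMap E (Idt B X) = Idt A (U X)"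
      proof (rule unique[OF X E_Hom[OF B.Idt_Hom[OF X]] A.Idt_Hom[OF U[OF X]]])
        show "AMap F (AMap E (Idt B X)) \<cdot>\<^bsub>B\<^esub> h X = AMap F (Idt A (U X)) \<cdot>\<^bsub>B\<^esub> h X"
          unfolding E_h[OF B.Idt_Hom[OF X]] is_functorD(5)[OF F U[OF X]]
          by (simp add: B.Comp_Idt_left[OF h[OF X]] B.Comp_Idt_right[OF h[OF X]])
      qed
      then show ?thesis by (simp add: E_def)
    qed
    show "AMap E (g \<cdot>\<^bsub>B\<^esub> f) = AMap E g \<cdot>\<^bsub>A\<^esub> AMap E f"
      if f: "f \<in> Hom B X Y" and g: "g \<in> Hom B Y Z" for X Y Z f g
    proof (rule unique[OF B.Hom_Obj(1)[OF f] E_Hom[OF B.Comp_Hom[OF f g]] A.Comp_Hom[OF E_Hom[OF f] E_Hom[OF g]]])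
      have XYZ: "X \<in> Obj B" "Y \<in> Obj B" "Z \<in> Obj B"
        using f g B.Hom_Obj by blast+
      have "AMap F (AMap E g \<cdot>\<^bsub>A\<^esub> AMap E f) \<cdot>\<^bsub>B\<^esub> h X = AMap F (AMap E g) \<cdot>\<^bsub>B\<^esub> (h Y \<cdot>\<^bsub>B\<^esub> f)"
        unfolding F_comp_h[OF XYZ(1) E_Hom[OF f] E_Hom[OF g]] E_h[OF f] ..
      also have "\<dots> = (AMap F (AMap E g) \<cdot>\<^bsub>B\<^esub> h Y) \<cdot>\<^bsub>B\<^esub> f"
        by (rule B.Comp_assoc[symmetric, OF f h[OF XYZ(2)] is_functorD(4)[OF F E_Hom[OF g]]])
      also have "\<dots> = h Z \<cdot>\<^bsub>B\<^esub> (g \<cdot>\<^bsub>B\<^esub> f)"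
        unfolding E_h[OF g] by (rule B.Comp_assoc[OF f g h[OF XYZ(3)]])
      finally show "AMap F (AMap E (g \<cdot>\<^bsub>B\<^esub> f)) \<cdot>\<^bsub>B\<^esub> h X = AMap F (AMap E g \<cdot>\<^bsub>A\<^esub> AMap E f) \<cdot>\<^bsub>B\<^esub> h X"
        unfolding E_h[OF B.Comp_Hom[OF f g]] by simp
    qed
  qed
  have E_obj: "OMap E X = U X" for X
    by (simp add: E_def)
  have \<epsilon>: "\<epsilon> Y \<in> Hom A (U (OMap F Y)) Y" "AMap F (\<epsilon> Y) \<cdot>\<^bsub>B\<^esub> h (OMap F Y) = Idt B (OMap F Y)"
    if "Y \<in> Obj A" for Y
    using lift[OF that B.Idt_Hom[OF is_functorD(3)[OF F that]]] by (simp_all add: \<epsilon>_def)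
  have "adjunction B A E F h \<epsilon>"
    unfolding adjunction_def E_obj
  proof (intro conjI ballI allI)
    show "is_functor B A E" "is_functor A B F" by fact+
    show "h X \<in> Hom B X (OMap F (U X))" if "X \<in> Obj B" for X
      using h[OF that] .
    show "h Y \<cdot>\<^bsub>B\<^esub> f = AMap F (AMap E f) \<cdot>\<^bsub>B\<^esub> h X" if "f \<in> Hom B X Y" for X Y f
      using E_h[OF that] by simp
    show "\<epsilon> Y \<in> Hom A (U (OMap F Y)) Y" "AMap F (\<epsilon> Y) \<cdot>\<^bsub>B\<^esub> h (OMap F Y) = Idt B (OMap F Y)"
      if "Y \<in> Obj A" for Y
      using \<epsilon>[OF that] .
    show "\<epsilon> Y \<cdot>\<^bsub>A\<^esub> AMap E (AMap F f) = f \<cdot>\<^bsub>A\<^esub> \<epsilon> X" if f: "f \<in> Hom A X Y" for X Y f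
    proof -
      have X: "X \<in> Obj A" and Y: "Y \<in> Obj A"
        using A.Hom_Obj[OF f] by blast+
      note FX = is_functorD(3)[OF F X] and FY = is_functorD(3)[OF F Y] and Ff = is_functorD(4)[OF F f]
      show ?thesis
      proof (rule unique[OF FX A.Comp_Hom[OF E_Hom[OF Ff] \<epsilon>(1)[OF Y]] A.Comp_Hom[OF \<epsilon>(1)[OF X] f]])
        have "AMap F (\<epsilon> Y \<cdot>\<^bsub>A\<^esub> AMap E (AMap F f)) \<cdot>\<^bsub>B\<^esub> h (OMap F X) = AMap F (\<epsilon> Y) \<cdot>\<^bsub>B\<^esub> (h (OMap F Y) \<cdot>\<^bsub>B\<^esub> AMap F f)"
          unfolding F_comp_h[OF FX E_Hom[OF Ff] \<epsilon>(1)[OF Y]] E_h[OF Ff] ..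
        also have "\<dots> = AMap F f"
          unfolding B.Comp_assoc[symmetric, OF Ff h[OF FY] is_functorD(4)[OF F \<epsilon>(1)[OF Y]]] \<epsilon>(2)[OF Y]
          by (rule B.Comp_Idt_left[OF Ff])
        also have "\<dots> = AMap F (f \<cdot>\<^bsub>A\<^esub> \<epsilon> X) \<cdot>\<^bsub>B\<^esub> h (OMap F X)"
          unfolding F_comp_h[OF FX \<epsilon>(1)[OF X] f] \<epsilon>(2)[OF X] by (rule B.Comp_Idt_right[OF Ff, symmetric])
        finally show "AMap F (\<epsilon> Y \<cdot>\<^bsub>A\<^esub> AMap E (AMap F f)) \<cdot>\<^bsub>B\<^esub> h (OMap F X) =
            AMap F (f \<cdot>\<^bsub>A\<^esub> \<epsilon> X) \<cdot>\<^bsub>B\<^esub> h (OMap F X)" .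
      qed
    qed
    show "\<epsilon> (U X) \<cdot>\<^bsub>A\<^esub> AMap E (h X) = Idt A (U X)" if X: "X \<in> Obj B" for X
    proof -
      note UX = U[OF X] and hX = h[OF X]
      note FUX = is_functorD(3)[OF F UX]
      show ?thesis
      proof (rule unique[OF X A.Comp_Hom[OF E_Hom[OF hX] \<epsilon>(1)[OF UX]] A.Idt_Hom[OF UX]])
        have "AMap F (\<epsilon> (U X) \<cdot>\<^bsub>A\<^esub> AMap E (h X)) \<cdot>\<^bsub>B\<^esub> h X = AMap F (\<epsilon> (U X)) \<cdot>\<^bsub>B\<^esub> (h (OMap F (U X)) \<cdot>\<^bsub>B\<^esub> h X)"
          unfolding F_comp_h[OF X E_Hom[OF hX] \<epsilon>(1)[OF UX]] E_h[OF hX] ..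
        also have "\<dots> = Idt B (OMap F (U X)) \<cdot>\<^bsub>B\<^esub> h X"
          unfolding B.Comp_assoc[symmetric, OF hX h[OF FUX] is_functorD(4)[OF F \<epsilon>(1)[OF UX]]] \<epsilon>(2)[OF UX] ..
        finally show "AMap F (\<epsilon> (U X) \<cdot>\<^bsub>A\<^esub> AMap E (h X)) \<cdot>\<^bsub>B\<^esub> h X = AMap F (Idt A (U X)) \<cdot>\<^bsub>B\<^esub> h X"
          by (simp add: is_functorD(5)[OF F UX])
      qed
    qed
  qed
  then show ?thesis
    unfolding has_left_adjoint_def by blast
qed

definition op_cat :: "('o, 'a, 'z) cat_scheme \<Rightarrow> ('o, 'a) cat" where
  "op_cat C = \<lparr>Obj = Obj C, Arr = Arr C, Dom = Cod C, Cod = Dom C, Idt = Idt C,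
     Comp = (\<lambda>g f. f \<cdot>\<^bsub>C\<^esub> g)\<rparr>"

lemma op_cat_simps [simp]:
  "Obj (op_cat C) = Obj C" "Arr (op_cat C) = Arr C" "Dom (op_cat C) = Cod C"
  "Cod (op_cat C) = Dom C" "Idt (op_cat C) = Idt C" "g \<cdot>\<^bsub>op_cat C\<^esub> f = f \<cdot>\<^bsub>C\<^esub> g"
  "Hom (op_cat C) X Y = Hom C Y X"
  by (auto simp add: op_cat_def Hom_def)

lemma (in category) category_op_cat: "category (op_cat C)"
  by unfold_locales (auto simp: in_Hom)

lemma functor_op_cat:
  assumes "is_functor A B F"
  shows "is_functor (op_cat A) (op_cat B) F"
  using assms category.category_op_cat[of A] category.category_op_cat[of B]
  unfolding is_functor_def by simp

lemma right_adjoint_if_couniversal_arrows: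
  assumes E: "is_functor B A E"
    and "\<And>Y. Y \<in> Obj A \<Longrightarrow> \<exists>U h. universal_arrow (op_cat B) (op_cat A) E Y U h"
  shows "has_right_adjoint B A E"
proof -
  interpret A: category A by (rule is_functorD(2)[OF E])
  interpret B: category B by (rule is_functorD(1)[OF E])
  have "has_left_adjoint (op_cat B) (op_cat A) E"
    using functor_op_cat[OF E] assms(2) by (intro left_adjoint_if_universal_arrows) simp_all
  then obtain F \<eta> \<epsilon> where adj: "adjunction (op_cat A) (op_cat B) F E \<eta> \<epsilon>"
    unfolding has_left_adjoint_def by blast
  then have "is_functor A B F"
    using A.category_axioms B.category_axioms unfolding adjunction_def is_functor_def by simp
  with adj E have "adjunction B A E F \<epsilon> \<eta>"
    unfolding adjunction_def by simp
  then show ?thesis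
    unfolding has_right_adjoint_def by blast
qed

section \<open>Algebras and coalgebras\<close>

lemma Alg_simps [simp]:
  "Obj (Alg C) = {S. is_algebra C S}" "Idt (Alg C) S = (S, Idt C (fst S), S)"
  "(T, g, T') \<cdot>\<^bsub>Alg C\<^esub> (S, f, S') = (S, g \<cdot>\<^bsub>C\<^esub> f, T')"
  by (simp_all add: Alg_def)

lemma Coalg_simps [simp]:
  "Obj (Coalg C) = {S. is_coalgebra C S}" "Idt (Coalg C) S = (S, Idt C (fst S), S)"
  "(T, g, T') \<cdot>\<^bsub>Coalg C\<^esub> (S, f, S') = (S, g \<cdot>\<^bsub>C\<^esub> f, T')"
  by (simp_all add: Coalg_def)

lemma Hom_Alg:
  "x \<in> Hom (Alg C) S T \<longleftrightarrow> (\<exists>f. x = (S, f, T) \<and> is_algebra C S \<and> is_algebra C T \<and> is_algebra_mor C S f T)"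
  by (auto simp: Hom_def Alg_def)

lemma Hom_Coalg:
  "x \<in> Hom (Coalg C) S T \<longleftrightarrow>
    (\<exists>f. x = (S, f, T) \<and> is_coalgebra C S \<and> is_coalgebra C T \<and> is_coalgebra_mor C S f T)"
  by (auto simp: Hom_def Coalg_def)

context monoidal_category
begin

lemma is_algebra_op: "is_algebra (op_moncat C) S \<longleftrightarrow> is_coalgebra C S"
proof -
  obtain X d e where S: "S = (X, d, e)"
    by (cases S)
  show ?thesis
  proof (cases "X \<in> Obj C \<and> d \<in> Hom C X (X \<odot> X) \<and> e \<in> Hom C X \<I>")
    case True
    then have arr [simp]: "X \<in> Obj C" "d \<in> Arr C" "Dom C d = X" "Cod C d = X \<odot> X"
        "e \<in> Arr C" "Dom C e = X" "Cod C e = \<I>"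
      by (auto simp: in_Hom)
    have "(d \<lhd> X) \<cdot> d = \<alpha>\<^sup>- X X X \<cdot> ((X \<rhd> d) \<cdot> d) \<longleftrightarrow> \<alpha> X X X \<cdot> ((d \<lhd> X) \<cdot> d) = (X \<rhd> d) \<cdot> d"
      by (rule eq_inv_comp_iff) simp_all
    moreover have "(e \<lhd> X) \<cdot> d = inv_arr C (\<l> X) \<longleftrightarrow> \<l> X \<cdot> ((e \<lhd> X) \<cdot> d) = Idt C X"
      using eq_inv_comp_iff[of "\<l> X" "(e \<lhd> X) \<cdot> d" "Idt C X"] by simp
    moreover have "(X \<rhd> e) \<cdot> d = inv_arr C (\<r> X) \<longleftrightarrow> \<r> X \<cdot> ((X \<rhd> e) \<cdot> d) = Idt C X"
      using eq_inv_comp_iff[of "\<r> X" "(X \<rhd> e) \<cdot> d" "Idt C X"] by simp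
    ultimately show ?thesis
      by (simp add: S is_algebra_def is_coalgebra_def in_Hom)
  qed (auto simp: S is_algebra_def is_coalgebra_def)
qed

lemma is_coalgebra_op: "is_coalgebra (op_moncat C) S \<longleftrightarrow> is_algebra C S"
proof -
  obtain X m u where S: "S = (X, m, u)"
    by (cases S)
  show ?thesis
  proof (cases "X \<in> Obj C \<and> m \<in> Hom C (X \<odot> X) X \<and> u \<in> Hom C \<I> X")
    case True
    then have arr [simp]: "X \<in> Obj C" "m \<in> Arr C" "Cod C m = X" "Dom C m = X \<odot> X"
        "u \<in> Arr C" "Cod C u = X" "Dom C u = \<I>"
      by (auto simp: in_Hom)
    have "m \<cdot> ((m \<lhd> X) \<cdot> \<alpha>\<^sup>- X X X) = m \<cdot> (X \<rhd> m) \<longleftrightarrow> m \<cdot> (m \<lhd> X) = m \<cdot> ((X \<rhd> m) \<cdot> \<alpha> X X X)"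
      using comp_inv_eq_iff[of "\<alpha> X X X" "m \<cdot> (m \<lhd> X)" "m \<cdot> (X \<rhd> m)"] by simp
    moreover have "m \<cdot> ((u \<lhd> X) \<cdot> inv_arr C (\<l> X)) = Idt C X \<longleftrightarrow> m \<cdot> (u \<lhd> X) = \<l> X"
      using comp_inv_eq_iff[of "\<l> X" "m \<cdot> (u \<lhd> X)" "Idt C X"] by simp
    moreover have "m \<cdot> ((X \<rhd> u) \<cdot> inv_arr C (\<r> X)) = Idt C X \<longleftrightarrow> m \<cdot> (X \<rhd> u) = \<r> X"
      using comp_inv_eq_iff[of "\<r> X" "m \<cdot> (X \<rhd> u)" "Idt C X"] by simp
    ultimately show ?thesis
      by (simp add: S is_algebra_def is_coalgebra_def in_Hom)
  qed (auto simp: S is_algebra_def is_coalgebra_def)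
qed

lemma is_algebra_mor_op: "is_algebra_mor (op_moncat C) S f T \<longleftrightarrow> is_coalgebra_mor C T f S"
  by (cases S; cases T) (auto simp: is_algebra_mor_def is_coalgebra_mor_def)

lemma is_coalgebra_mor_op: "is_coalgebra_mor (op_moncat C) S f T \<longleftrightarrow> is_algebra_mor C T f S"
  by (cases S; cases T) (auto simp: is_algebra_mor_def is_coalgebra_mor_def)

lemma algebra_mor_Idt: "is_algebra C S \<Longrightarrow> is_algebra_mor C S (Idt C (fst S)) S"
  by (cases S) (auto simp: is_algebra_mor_def is_algebra_def in_Hom)

lemma coalgebra_mor_Idt: "is_coalgebra C S \<Longrightarrow> is_coalgebra_mor C S (Idt C (fst S)) S"
  by (cases S) (auto simp: is_coalgebra_mor_def is_coalgebra_def in_Hom)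

lemma algebra_mor_comp:
  assumes "is_algebra C S" "is_algebra C T" "is_algebra C U" "is_algebra_mor C S f T" "is_algebra_mor C T g U"
  shows "is_algebra_mor C S (g \<cdot> f) U"
proof -
  obtain X m u Y m' u' Z m'' u'' where [simp]: "S = (X, m, u)" "T = (Y, m', u')" "U = (Z, m'', u'')"
    by (cases S; cases T; cases U)
  have arr [simp]: "f \<in> Arr C" "Dom C f = X" "Cod C f = Y" "g \<in> Arr C" "Dom C g = Y" "Cod C g = Z"
    "m \<in> Arr C" "Cod C m = X" "Dom C m = X \<odot> X" "u \<in> Arr C" "Cod C u = X" "Dom C u = \<I>"
    "m' \<in> Arr C" "Cod C m' = Y" "Dom C m' = Y \<odot> Y" "u' \<in> Arr C" "Cod C u' = Y" "Dom C u' = \<I>"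
    "m'' \<in> Arr C" "Cod C m'' = Z" "Dom C m'' = Z \<odot> Z" "u'' \<in> Arr C" "Cod C u'' = Z" "Dom C u'' = \<I>"
    and f: "f \<cdot> m = m' \<cdot> (f \<boxtimes> f)" "f \<cdot> u = u'" and g: "g \<cdot> m' = m'' \<cdot> (g \<boxtimes> g)" "g \<cdot> u' = u''"
    using assms by (auto simp: is_algebra_mor_def is_algebra_def in_Hom)
  have "g \<cdot> (f \<cdot> m) = (g \<cdot> m') \<cdot> (f \<boxtimes> f)"
    by (simp add: f)
  also have "\<dots> = m'' \<cdot> ((g \<cdot> f) \<boxtimes> (g \<cdot> f))"
    unfolding g by (simp add: interchange)
  finally show ?thesis
    by (simp add: is_algebra_mor_def in_Hom f g)
qed

lemma category_Alg: "category (Alg C)"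
proof
  fix S f T U g
  assume "f \<in> Hom (Alg C) S T" "g \<in> Hom (Alg C) T U"
  then show "g \<cdot>\<^bsub>Alg C\<^esub> f \<in> Hom (Alg C) S U"
    by (auto simp: Hom_Alg intro: algebra_mor_comp[of S T U])
next
  fix S assume "S \<in> Obj (Alg C)"
  then show "Idt (Alg C) S \<in> Hom (Alg C) S S"
    using algebra_mor_Idt by (auto simp: Hom_Alg)
qed (auto simp: Hom_Alg is_algebra_mor_def in_Hom Alg_def[THEN arg_cong, of Arr] Alg_def[THEN arg_cong, of Dom]
  Alg_def[THEN arg_cong, of Cod])

end

lemma (in monoidal_category) category_Coalg: "category (Coalg C)"
proof -
  interpret op: monoidal_category "op_moncat C"
    by (rule monoidal_op_moncat)
  show ?thesis
  proof
    fix S f T U g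
    assume "f \<in> Hom (Coalg C) S T" "g \<in> Hom (Coalg C) T U"
    then show "g \<cdot>\<^bsub>Coalg C\<^esub> f \<in> Hom (Coalg C) S U"
      using op.algebra_mor_comp[of U T S]
      by (auto simp: Hom_Coalg is_algebra_op is_algebra_mor_op)
  next
    fix S assume "S \<in> Obj (Coalg C)"
    then show "Idt (Coalg C) S \<in> Hom (Coalg C) S S"
      using coalgebra_mor_Idt by (auto simp: Hom_Coalg)
  qed (auto simp: Hom_Coalg is_coalgebra_mor_def in_Hom Coalg_def[THEN arg_cong, of Arr]
    Coalg_def[THEN arg_cong, of Dom] Coalg_def[THEN arg_cong, of Cod])
qed

context braided_monoidal_category
begin

lemma algebra_braid:
  assumes "is_algebra C (X, m, u)"
  shows "is_algebra C (X, m \<cdot> \<c> X X, u)"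
proof -
  have [simp]: "X \<in> Obj C" "m \<in> Arr C" "Cod C m = X" "Dom C m = X \<odot> X" "u \<in> Arr C" "Cod C u = X" "Dom C u = \<I>"
    and m: "m \<cdot> (m \<lhd> X) = m \<cdot> ((X \<rhd> m) \<cdot> \<alpha> X X X)" "m \<cdot> (u \<lhd> X) = \<l> X" "m \<cdot> (X \<rhd> u) = \<r> X"
    using assms by (auto simp: is_algebra_def in_Hom)
  have "m \<cdot> (\<c> X X \<cdot> ((m \<cdot> \<c> X X) \<lhd> X)) = m \<cdot> ((X \<rhd> m) \<cdot> ((X \<rhd> \<c> X X) \<cdot> \<c> (X \<odot> X) X))"
    by (simp add: braid_natural interchange_cont)
  also have "\<dots> = (m \<cdot> ((X \<rhd> m) \<cdot> \<alpha> X X X)) \<cdot> ((\<c> X X \<lhd> X) \<cdot> (\<c> X (X \<odot> X) \<cdot> \<alpha> X X X))"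
    by (simp add: half_twist)
  also have "\<dots> = m \<cdot> (((m \<cdot> \<c> X X) \<lhd> X) \<cdot> (\<c> X (X \<odot> X) \<cdot> \<alpha> X X X))"
    unfolding m(1)[symmetric] by (simp add: interchange_cont)
  also have "\<dots> = m \<cdot> (\<c> X X \<cdot> ((X \<rhd> (m \<cdot> \<c> X X)) \<cdot> \<alpha> X X X))"
    by (simp add: braid_natural_cont)
  finally have assoc: "m \<cdot> (\<c> X X \<cdot> ((m \<cdot> \<c> X X) \<lhd> X)) = m \<cdot> (\<c> X X \<cdot> ((X \<rhd> (m \<cdot> \<c> X X)) \<cdot> \<alpha> X X X))" .
  have "m \<cdot> (\<c> X X \<cdot> (u \<lhd> X)) = (m \<cdot> (X \<rhd> u)) \<cdot> \<c> \<I> X"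
    by (simp add: braid_natural)
  then have l: "m \<cdot> (\<c> X X \<cdot> (u \<lhd> X)) = \<l> X"
    by (simp add: m braid_unit_left)
  have "m \<cdot> (\<c> X X \<cdot> (X \<rhd> u)) = (m \<cdot> (u \<lhd> X)) \<cdot> \<c> X \<I>"
    by (simp add: braid_natural)
  then have r: "m \<cdot> (\<c> X X \<cdot> (X \<rhd> u)) = \<r> X"
    by (simp add: m braid_unit_right)
  show ?thesis
    using assoc l r by (simp add: is_algebra_def in_Hom)
qed

definition twist :: "('o, 'a) triple \<Rightarrow> ('o, 'a) triple" where
  "twist = (\<lambda>(X, m, u). (X, m \<cdot> (\<c> X X \<cdot> \<c> X X), u))"

definition untwist :: "('o, 'a) triple \<Rightarrow> ('o, 'a) triple" where
  "untwist = (\<lambda>(X, m, u). (X, m \<cdot> (\<c>\<^sup>- X X \<cdot> \<c>\<^sup>- X X), u))"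

lemma algebra_twist:
  assumes "is_algebra C S"
  shows "is_algebra C (twist S)"
proof -
  obtain X m u where [simp]: "S = (X, m, u)"
    by (cases S)
  have [simp]: "X \<in> Obj C" "m \<in> Arr C" "Cod C m = X" "Dom C m = X \<odot> X"
    using assms by (auto simp: is_algebra_def in_Hom)
  show ?thesis
    using algebra_braid[OF algebra_braid, of X m u] assms by (simp add: twist_def)
qed

lemma algebra_untwist:
  assumes "is_algebra C S"
  shows "is_algebra C (untwist S)"
proof -
  interpret R: braided_monoidal_category "reverse_braiding C"
    by (rule braided_reverse_braiding)
  have R: "is_algebra (reverse_braiding C) S \<longleftrightarrow> is_algebra C S" for S
    by (cases S) (simp add: is_algebra_def)
  obtain X m u where [simp]: "S = (X, m, u)"
    by (cases S)
  have [simp]: "X \<in> Obj C" "m \<in> Arr C" "Cod C m = X" "Dom C m = X \<odot> X"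
    using assms by (auto simp: is_algebra_def in_Hom)
  show ?thesis
    using R.algebra_twist[of S] assms by (simp add: R R.twist_def untwist_def)
qed

lemma algebra_mor_twist:
  assumes "is_algebra C S" "is_algebra C T"
  shows "is_algebra_mor C S f (twist T) \<longleftrightarrow> is_algebra_mor C (untwist S) f T" (is ?A)
    and "is_algebra_mor C S f T \<Longrightarrow> is_algebra_mor C (twist S) f (twist T)"
proof -
  obtain X m u Y m' u' where S: "S = (X, m, u)" and T: "T = (Y, m', u')"
    by (cases S; cases T)
  have [simp]: "X \<in> Obj C" "m \<in> Arr C" "Cod C m = X" "Dom C m = X \<odot> X"
    "Y \<in> Obj C" "m' \<in> Arr C" "Cod C m' = Y" "Dom C m' = Y \<odot> Y"
    using assms by (auto simp: S T is_algebra_def in_Hom)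
  have key: "m' \<cdot> ((\<c> Y Y \<cdot> \<c> Y Y) \<cdot> (f \<boxtimes> f)) = m' \<cdot> ((f \<boxtimes> f) \<cdot> (\<c> X X \<cdot> \<c> X X))"
    if "f \<in> Arr C" "Dom C f = X" "Cod C f = Y"
    using that by (simp add: braid_natural braid_natural_cont)
  show ?A
  proof (cases "f \<in> Hom C X Y")
    case True
    then have [simp]: "f \<in> Arr C" "Dom C f = X" "Cod C f = Y"
      by (auto simp: in_Hom)
    let ?k = "\<c> X X \<cdot> \<c> X X"
    have "(f \<cdot> m) \<cdot> inv_arr C ?k = m' \<cdot> (f \<boxtimes> f) \<longleftrightarrow> f \<cdot> m = (m' \<cdot> (f \<boxtimes> f)) \<cdot> ?k"
      by (rule comp_inv_eq_iff) simp_all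
    with key show ?thesis
      by (simp add: S T is_algebra_mor_def twist_def untwist_def in_Hom)
  qed (simp add: S T is_algebra_mor_def twist_def untwist_def)
  show "is_algebra_mor C (twist S) f (twist T)" if "is_algebra_mor C S f T"
  proof -
    have [simp]: "f \<in> Arr C" "Dom C f = X" "Cod C f = Y" and f: "f \<cdot> m = m' \<cdot> (f \<boxtimes> f)" "f \<cdot> u = u'"
      using that by (auto simp: S T is_algebra_mor_def in_Hom)
    have "(f \<cdot> m) \<cdot> (\<c> X X \<cdot> \<c> X X) = m' \<cdot> ((\<c> Y Y \<cdot> \<c> Y Y) \<cdot> (f \<boxtimes> f))"
      unfolding f using key by simp
    then show ?thesis
      using f(2) by (simp add: S T is_algebra_mor_def twist_def in_Hom)
  qed
qed

lemma fst_twist: "fst (twist S) = fst S"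
  by (cases S) (simp add: twist_def)

end

section \<open>Algebras dual to coalgebras\<close>

context prerigid_braided_category
begin

definition dual_alg :: "('o, 'a) triple \<Rightarrow> ('o, 'a) triple" where
  "dual_alg = (\<lambda>(X, d, e). (X\<^sup>\<star>, dual_arr d \<cdot> \<phi>\<^sub>2 X X, dual_arr e \<cdot> \<phi>\<^sub>0))"

lemma alg_functor_dual [simp]:
  "OMap (alg_functor C (dual_functor C) \<phi>\<^sub>2 \<phi>\<^sub>0) S = dual_alg S"
  "AMap (alg_functor C (dual_functor C) \<phi>\<^sub>2 \<phi>\<^sub>0) (S, f, T) = (dual_alg S, dual_arr f, dual_alg T)"
  by (simp_all add: alg_functor_def dual_alg_def Let_def)

lemma fst_dual_alg: "fst (dual_alg S) = (fst S)\<^sup>\<star>"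
  by (cases S) (simp add: dual_alg_def)

lemma algebra_dual_alg:
  assumes "is_coalgebra C S"
  shows "is_algebra C (dual_alg S)"
proof -
  obtain X d e where [simp]: "S = (X, d, e)"
    by (cases S)
  have [simp]: "X \<in> Obj C" "d \<in> Arr C" "Dom C d = X" "Cod C d = X \<odot> X"
      "e \<in> Arr C" "Dom C e = X" "Cod C e = \<I>"
    and S: "\<alpha> X X X \<cdot> ((d \<lhd> X) \<cdot> d) = (X \<rhd> d) \<cdot> d" "\<l> X \<cdot> ((e \<lhd> X) \<cdot> d) = Idt C X" "\<r> X \<cdot> ((X \<rhd> e) \<cdot> d) = Idt C X"
    using assms by (auto simp: is_coalgebra_def in_Hom)
  have S': "(d \<lhd> X) \<cdot> d = \<alpha>\<^sup>- X X X \<cdot> ((X \<rhd> d) \<cdot> d)" "(e \<lhd> X) \<cdot> d = inv_arr C (\<l> X)" "(X \<rhd> e) \<cdot> d = inv_arr C (\<r> X)"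
    using eq_inv_comp_iff[of "\<alpha> X X X" "(d \<lhd> X) \<cdot> d" "(X \<rhd> d) \<cdot> d"] S(1)
      eq_inv_comp_iff[of "\<l> X" "(e \<lhd> X) \<cdot> d" "Idt C X"] S(2)
      eq_inv_comp_iff[of "\<r> X" "(X \<rhd> e) \<cdot> d" "Idt C X"] S(3) by simp_all
  have nat: "\<phi>\<^sub>2 X X \<cdot> ((dual_arr f \<lhd> X\<^sup>\<star>) \<cdot> k) = dual_arr (f \<lhd> X) \<cdot> (\<phi>\<^sub>2 (Cod C f) X \<cdot> k)"
    if "f \<in> Arr C" "Dom C f = X" "k \<in> Arr C" "Cod C k = (Cod C f)\<^sup>\<star> \<odot> X\<^sup>\<star>" for f k
    using that comp_eq_cont[OF dual2_natural[of f X "Cod C f" "Idt C X" X X], of k]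
    by (simp_all add: in_Hom dual_Idt)
  have nat': "\<phi>\<^sub>2 X X \<cdot> ((X\<^sup>\<star> \<rhd> dual_arr f) \<cdot> k) = dual_arr (X \<rhd> f) \<cdot> (\<phi>\<^sub>2 X (Cod C f) \<cdot> k)"
    if "f \<in> Arr C" "Dom C f = X" "k \<in> Arr C" "Cod C k = X\<^sup>\<star> \<odot> (Cod C f)\<^sup>\<star>" for f k
    using that comp_eq_cont[OF dual2_natural[of "Idt C X" X X f X "Cod C f"], of k]
    by (simp_all add: in_Hom dual_Idt)
  note nat = nat nat'
  let ?m = "dual_arr d \<cdot> \<phi>\<^sub>2 X X"
  have "?m \<cdot> (?m \<lhd> X\<^sup>\<star>) = dual_arr ((d \<lhd> X) \<cdot> d) \<cdot> (\<phi>\<^sub>2 (X \<odot> X) X \<cdot> (\<phi>\<^sub>2 X X \<lhd> X\<^sup>\<star>))"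
    by (simp add: whisker_comp nat dual_comp)
  also have "\<dots> = (dual_arr d \<cdot> dual_arr (X \<rhd> d)) \<cdot> (dual_arr (\<alpha>\<^sup>- X X X) \<cdot> (\<phi>\<^sub>2 (X \<odot> X) X \<cdot> (\<phi>\<^sub>2 X X \<lhd> X\<^sup>\<star>)))"
    unfolding S' by (simp add: dual_comp)
  also have "\<dots> = ?m \<cdot> ((X\<^sup>\<star> \<rhd> ?m) \<cdot> \<alpha> (X\<^sup>\<star>) (X\<^sup>\<star>) (X\<^sup>\<star>))"
    by (simp add: whisker_comp nat dual2_assoc)
  finally have assoc: "?m \<cdot> (?m \<lhd> X\<^sup>\<star>) = ?m \<cdot> ((X\<^sup>\<star> \<rhd> ?m) \<cdot> \<alpha> (X\<^sup>\<star>) (X\<^sup>\<star>) (X\<^sup>\<star>))" .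
  let ?u = "dual_arr e \<cdot> \<phi>\<^sub>0"
  have "?m \<cdot> (?u \<lhd> X\<^sup>\<star>) = dual_arr ((e \<lhd> X) \<cdot> d) \<cdot> (\<phi>\<^sub>2 \<I> X \<cdot> (\<phi>\<^sub>0 \<lhd> X\<^sup>\<star>))"
    by (simp add: whisker_comp nat dual_comp)
  then have l: "?m \<cdot> (?u \<lhd> X\<^sup>\<star>) = \<l> (X\<^sup>\<star>)"
    unfolding S' by (simp add: dual2_unit_left)
  have "?m \<cdot> (X\<^sup>\<star> \<rhd> ?u) = dual_arr ((X \<rhd> e) \<cdot> d) \<cdot> (\<phi>\<^sub>2 X \<I> \<cdot> (X\<^sup>\<star> \<rhd> \<phi>\<^sub>0))"
    by (simp add: whisker_comp nat dual_comp)
  then have r: "?m \<cdot> (X\<^sup>\<star> \<rhd> ?u) = \<r> (X\<^sup>\<star>)"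
    unfolding S' by (simp add: dual2_unit_right)
  show ?thesis
    using assoc l r by (simp add: dual_alg_def is_algebra_def in_Hom)
qed

lemma algebra_mor_dual_alg:
  assumes "is_coalgebra C S" "is_coalgebra C T" "is_coalgebra_mor C S f T"
  shows "is_algebra_mor C (dual_alg T) (dual_arr f) (dual_alg S)"
proof -
  obtain X d e Y d' e' where [simp]: "S = (X, d, e)" "T = (Y, d', e')"
    by (cases S; cases T)
  have [simp]: "X \<in> Obj C" "d \<in> Arr C" "Dom C d = X" "Cod C d = X \<odot> X" "e \<in> Arr C" "Dom C e = X" "Cod C e = \<I>"
    "Y \<in> Obj C" "d' \<in> Arr C" "Dom C d' = Y" "Cod C d' = Y \<odot> Y" "e' \<in> Arr C" "Dom C e' = Y" "Cod C e' = \<I>"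
    "f \<in> Arr C" "Dom C f = X" "Cod C f = Y"
    and f: "d' \<cdot> f = (f \<boxtimes> f) \<cdot> d" "e' \<cdot> f = e"
    using assms by (auto simp: is_coalgebra_def is_coalgebra_mor_def in_Hom)
  have "dual_arr f \<cdot> (dual_arr d' \<cdot> \<phi>\<^sub>2 Y Y) = dual_arr (d' \<cdot> f) \<cdot> \<phi>\<^sub>2 Y Y"
    by (simp add: dual_comp)
  also have "\<dots> = dual_arr d \<cdot> (dual_arr (f \<boxtimes> f) \<cdot> \<phi>\<^sub>2 Y Y)"
    unfolding f by (simp add: dual_comp)
  also have "\<dots> = dual_arr d \<cdot> (\<phi>\<^sub>2 X X \<cdot> (dual_arr f \<boxtimes> dual_arr f))"
    using dual2_natural[of f X Y f X Y] by (simp add: in_Hom)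
  finally have m: "dual_arr f \<cdot> (dual_arr d' \<cdot> \<phi>\<^sub>2 Y Y) = dual_arr d \<cdot> (\<phi>\<^sub>2 X X \<cdot> (dual_arr f \<boxtimes> dual_arr f))" .
  have "dual_arr f \<cdot> (dual_arr e' \<cdot> \<phi>\<^sub>0) = dual_arr (e' \<cdot> f) \<cdot> \<phi>\<^sub>0"
    by (simp add: dual_comp)
  with m f(2) show ?thesis
    by (simp add: dual_alg_def is_algebra_mor_def in_Hom)
qed

lemma coalgebra_mor_arr:
  assumes "is_coalgebra_mor C S f T"
  shows "f \<in> Arr C" "Dom C f = fst S" "Cod C f = fst T"
  using assms by (cases S; cases T; simp add: is_coalgebra_mor_def in_Hom)+

lemma functor_dual_alg:
  "is_functor (Alg (op_moncat C)) (Alg C) (alg_functor C (dual_functor C) \<phi>\<^sub>2 \<phi>\<^sub>0)"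
  unfolding is_functor_def
proof (intro conjI ballI allI)
  show "category (Alg (op_moncat C))" "category (Alg C)"
    using category_Alg monoidal_category.category_Alg[OF monoidal_op_moncat] by blast+
  show "OMap (alg_functor C (dual_functor C) \<phi>\<^sub>2 \<phi>\<^sub>0) S \<in> Obj (Alg C)" if "S \<in> Obj (Alg (op_moncat C))" for S
    using that by (simp add: is_algebra_op algebra_dual_alg)
  show "AMap (alg_functor C (dual_functor C) \<phi>\<^sub>2 \<phi>\<^sub>0) f \<in>
      Hom (Alg C) (OMap (alg_functor C (dual_functor C) \<phi>\<^sub>2 \<phi>\<^sub>0) S) (OMap (alg_functor C (dual_functor C) \<phi>\<^sub>2 \<phi>\<^sub>0) T)"
    if "f \<in> Hom (Alg (op_moncat C)) S T" for f S T
    using that by (auto simp: Hom_Alg is_algebra_op is_algebra_mor_op algebra_dual_alg algebra_mor_dual_alg)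
  show "AMap (alg_functor C (dual_functor C) \<phi>\<^sub>2 \<phi>\<^sub>0) (Idt (Alg (op_moncat C)) S) =
      Idt (Alg C) (OMap (alg_functor C (dual_functor C) \<phi>\<^sub>2 \<phi>\<^sub>0) S)"
    if "S \<in> Obj (Alg (op_moncat C))" for S
    using that by (cases S) (simp add: is_algebra_def dual_Idt fst_dual_alg)
  show "AMap (alg_functor C (dual_functor C) \<phi>\<^sub>2 \<phi>\<^sub>0) (g \<cdot>\<^bsub>Alg (op_moncat C)\<^esub> f) =
      AMap (alg_functor C (dual_functor C) \<phi>\<^sub>2 \<phi>\<^sub>0) g \<cdot>\<^bsub>Alg C\<^esub> AMap (alg_functor C (dual_functor C) \<phi>\<^sub>2 \<phi>\<^sub>0) f"
    if "f \<in> Hom (Alg (op_moncat C)) S T" "g \<in> Hom (Alg (op_moncat C)) T U" for f g S T U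
    using that
    by (auto simp: Hom_Alg is_algebra_mor_op coalgebra_mor_arr dual_comp)
qed

text \<open>\<open>h : S \<rightarrow> U\<^sup>*\<close> is a universal arrow; over a field, \<open>U\<close> is the finite (Sweedler) dual of \<open>S\<close>.\<close>

definition finite_dual :: "('o, 'a) triple \<Rightarrow> ('o, 'a) triple \<Rightarrow> 'a \<Rightarrow> bool" where
  "finite_dual S U h \<longleftrightarrow> is_coalgebra C U \<and> is_algebra_mor C S h (dual_alg U) \<and>
     (\<forall>T f. is_coalgebra C T \<longrightarrow> is_algebra_mor C S f (dual_alg T) \<longrightarrow>
        (\<exists>!g. is_coalgebra_mor C T g U \<and> dual_arr g \<cdot> h = f))"

lemma Ball_Hom_Alg:
  "(\<forall>x\<in>Hom (Alg D) S T. P x) \<longleftrightarrow>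
    (is_algebra D S \<longrightarrow> is_algebra D T \<longrightarrow> (\<forall>f. is_algebra_mor D S f T \<longrightarrow> P (S, f, T)))"
  by (auto simp: Hom_Alg)

lemma Ex1_Hom_Alg:
  "(\<exists>!x. x \<in> Hom (Alg D) S T \<and> P x) \<longleftrightarrow>
    is_algebra D S \<and> is_algebra D T \<and> (\<exists>!f. is_algebra_mor D S f T \<and> P (S, f, T))"
  unfolding Hom_Alg by blast

lemma Ball_Hom_Coalg:
  "(\<forall>x\<in>Hom (Coalg D) S T. P x) \<longleftrightarrow>
    (is_coalgebra D S \<longrightarrow> is_coalgebra D T \<longrightarrow> (\<forall>f. is_coalgebra_mor D S f T \<longrightarrow> P (S, f, T)))"
  by (auto simp: Hom_Coalg)

lemma Ex1_Hom_Coalg: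
  "(\<exists>!x. x \<in> Hom (Coalg D) S T \<and> P x) \<longleftrightarrow>
    is_coalgebra D S \<and> is_coalgebra D T \<and> (\<exists>!f. is_coalgebra_mor D S f T \<and> P (S, f, T))"
  unfolding Hom_Coalg by blast

lemma universal_arrow_dual_alg:
  assumes "is_algebra C S"
  shows "universal_arrow (Alg (op_moncat C)) (Alg C) (alg_functor C (dual_functor C) \<phi>\<^sub>2 \<phi>\<^sub>0) S U x \<longleftrightarrow>
    (\<exists>h. x = (S, h, dual_alg U) \<and> finite_dual S U h)"
proof -
  let ?u = "universal_arrow (Alg (op_moncat C)) (Alg C) (alg_functor C (dual_functor C) \<phi>\<^sub>2 \<phi>\<^sub>0) S U"
  have "?u x \<Longrightarrow> \<exists>h. x = (S, h, dual_alg U)"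
    by (auto simp: universal_arrow_def Hom_Alg)
  moreover have "?u (S, h, dual_alg U) \<longleftrightarrow> finite_dual S U h" for h
    unfolding universal_arrow_def finite_dual_def Ball_Hom_Alg Ex1_Hom_Alg
    using assms
    by (simp add: Hom_Alg is_algebra_op is_algebra_mor_op algebra_dual_alg
      del: split_paired_All split_paired_Ex cong: conj_cong imp_cong)
  ultimately show ?thesis
    by blast
qed

lemma finite_dual_if_left_adjoint:
  assumes "has_left_adjoint (Alg (op_moncat C)) (Alg C) (alg_functor C (dual_functor C) \<phi>\<^sub>2 \<phi>\<^sub>0)" "is_algebra C S"
  shows "\<exists>U h. finite_dual S U h"
  using universal_arrow_if_left_adjoint[OF assms(1), of S] universal_arrow_dual_alg[OF assms(2)] assms(2)
  by auto

lemma left_adjoint_if_finite_dual: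
  assumes "\<And>S. is_algebra C S \<Longrightarrow> \<exists>U h. finite_dual S U h"
  shows "has_left_adjoint (Alg (op_moncat C)) (Alg C) (alg_functor C (dual_functor C) \<phi>\<^sub>2 \<phi>\<^sub>0)"
  using assms functor_dual_alg
  by (intro left_adjoint_if_universal_arrows) (auto simp: universal_arrow_dual_alg)

abbreviation colax where "colax \<equiv> colax2 (op_moncat C) C (dual_functor C) \<eta> \<epsilon> \<phi>\<^sub>2"
abbreviation coalg where
  "coalg \<equiv> coalg_functor (op_moncat C) (dual_functor C) colax (colax0 (op_moncat C) (dual_functor C) \<epsilon> \<phi>\<^sub>0)"

lemma coalg_functor_dual:
  assumes "is_coalgebra C S"
  shows "OMap coalg S = twist (dual_alg S)"
    and "is_coalgebra C T \<Longrightarrow> AMap coalg (S, f, T) = (twist (dual_alg S), dual_arr f, twist (dual_alg T))"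
proof -
  have *: "OMap coalg S = twist (dual_alg S)" if "is_coalgebra C S" for S
  proof -
    obtain X d e where [simp]: "S = (X, d, e)"
      by (cases S)
    have [simp]: "X \<in> Obj C" "d \<in> Arr C" "Dom C d = X" "Cod C d = X \<odot> X" "e \<in> Arr C" "Dom C e = X" "Cod C e = \<I>"
      using that by (auto simp: is_coalgebra_def in_Hom)
    show ?thesis
      by (simp add: coalg_functor_def Let_def colax2_dual colax0_dual twist_def dual_alg_def)
  qed
  show "OMap coalg S = twist (dual_alg S)"
    using assms by (rule *)
  show "AMap coalg (S, f, T) = (twist (dual_alg S), dual_arr f, twist (dual_alg T))" if "is_coalgebra C T"
    using *[OF assms] *[OF that] by (simp add: coalg_functor_def Let_def)
qed

lemma functor_coalg: "is_functor (Coalg C) (Coalg (op_moncat C)) coalg"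
  unfolding is_functor_def
proof (intro conjI ballI allI)
  show "category (Coalg C)" "category (Coalg (op_moncat C))"
    using category_Coalg monoidal_category.category_Coalg[OF monoidal_op_moncat] by blast+
  show "OMap coalg S \<in> Obj (Coalg (op_moncat C))" if "S \<in> Obj (Coalg C)" for S
    using that by (simp add: is_coalgebra_op coalg_functor_dual algebra_twist algebra_dual_alg)
  show "AMap coalg f \<in> Hom (Coalg (op_moncat C)) (OMap coalg S) (OMap coalg T)"
    if "f \<in> Hom (Coalg C) S T" for f S T
    using that
    by (auto simp: Hom_Coalg is_coalgebra_op is_coalgebra_mor_op coalg_functor_dual algebra_dual_alg algebra_twist
      intro!: algebra_mor_twist(2) algebra_mor_dual_alg)
  show "AMap coalg (Idt (Coalg C) S) = Idt (Coalg (op_moncat C)) (OMap coalg S)"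
    if "S \<in> Obj (Coalg C)" for S
    using that by (cases S) (simp add: coalg_functor_dual is_coalgebra_def dual_Idt fst_dual_alg fst_twist)
  show "AMap coalg (g \<cdot>\<^bsub>Coalg C\<^esub> f) = AMap coalg g \<cdot>\<^bsub>Coalg (op_moncat C)\<^esub> AMap coalg f"
    if "f \<in> Hom (Coalg C) S T" "g \<in> Hom (Coalg C) T U" for f g S T U
    using that
    by (auto simp: coalg_functor_dual Hom_Coalg coalgebra_mor_arr dual_comp)
qed

lemma couniversal_arrow_coalg:
  assumes S: "is_algebra C S" and U: "finite_dual (untwist S) U h"
  shows "universal_arrow (op_cat (Coalg C)) (op_cat (Coalg (op_moncat C))) coalg S U (twist (dual_alg U), h, S)"
proof -
  have coalg_U: "is_coalgebra C U" and h: "is_algebra_mor C (untwist S) h (dual_alg U)"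
    and univ: "\<And>T f. is_coalgebra C T \<Longrightarrow> is_algebra_mor C (untwist S) f (dual_alg T) \<Longrightarrow>
        (\<exists>!g. is_coalgebra_mor C T g U \<and> dual_arr g \<cdot> h = f)"
    using U unfolding finite_dual_def by blast+
  show ?thesis
    unfolding universal_arrow_def op_cat_simps Ball_Hom_Coalg Ex1_Hom_Coalg
    using S coalg_U h univ
    by (simp add: Hom_Coalg is_coalgebra_op is_coalgebra_mor_op coalg_functor_dual
      algebra_dual_alg algebra_twist algebra_mor_twist(1)
      del: split_paired_All split_paired_Ex cong: conj_cong imp_cong)
qed

theorem liftable_pair_dual:
  assumes "has_left_adjoint (Alg (op_moncat C)) (Alg C) (alg_functor C (dual_functor C) \<phi>\<^sub>2 \<phi>\<^sub>0)"
  shows "liftable_pair (op_moncat C) C (dual_functor C) (dual_functor C) \<eta> \<epsilon> \<phi>\<^sub>2 \<phi>\<^sub>0"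
proof -
  have "has_right_adjoint (Coalg C) (Coalg (op_moncat C)) coalg"
  proof (rule right_adjoint_if_couniversal_arrows[OF functor_coalg])
    fix S assume "S \<in> Obj (Coalg (op_moncat C))"
    then have S: "is_algebra C S"
      by (simp add: is_coalgebra_op)
    obtain U h where "finite_dual (untwist S) U h"
      using finite_dual_if_left_adjoint[OF assms algebra_untwist[OF S]] by blast
    from couniversal_arrow_coalg[OF S this]
    show "\<exists>U h. universal_arrow (op_cat (Coalg C)) (op_cat (Coalg (op_moncat C))) coalg S U h"
      by blast
  qed
  then show ?thesis
    unfolding liftable_pair_def using dual_adjunction dual_lax_monoidal assms by blast
qed

end

section \<open>Additive structure\<close>

lemma finprod_hom:
  assumes "comm_group G" "comm_group K" "\<phi> \<in> hom G K" "\<And>i. i \<le> n \<Longrightarrow> f i \<in> carrier G"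
  shows "\<phi> (finprod G f {..n::nat}) = finprod K (\<lambda>i. \<phi> (f i)) {..n}"
proof -
  interpret G: comm_group G by fact
  interpret K: comm_group K by fact
  have \<phi>: "\<phi> x \<in> carrier K" if "x \<in> carrier G" for x
    using assms(3) that by (auto simp: hom_def)
  show ?thesis
    using assms(4)
  proof (induction n)
    case 0
    then show ?case
      using \<phi> by simp
  next
    case (Suc n)
    then have f: "f \<in> {..Suc n} \<rightarrow> carrier G"
      by auto
    then have n: "finprod G f {..n} \<in> carrier G"
      by (intro G.finprod_closed) auto
    have "\<phi> (finprod G f {..Suc n}) = \<phi> (f (Suc n)) \<otimes>\<^bsub>K\<^esub> \<phi> (finprod G f {..n})"
      using f n assms(3) by (auto simp: hom_def)
    also have "\<dots> = finprod K (\<lambda>i. \<phi> (f i)) {..Suc n}"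
      using f \<phi> Suc by (subst K.finprod_Suc) auto
    finally show ?case .
  qed
qed

context preadditive_category
begin

abbreviation zero_arr ("\<zero>\<^sub>H") where "\<zero>\<^sub>H X Y \<equiv> \<one>\<^bsub>H X Y\<^esub>"

lemma zero_arr [simp]:
  assumes "X \<in> Obj C" "Y \<in> Obj C"
  shows "\<zero>\<^sub>H X Y \<in> Arr C" "Dom C (\<zero>\<^sub>H X Y) = X" "Cod C (\<zero>\<^sub>H X Y) = Y"
proof -
  interpret comm_group "H X Y"
    using assms by (rule Hom_group)
  show "\<zero>\<^sub>H X Y \<in> Arr C" "Dom C (\<zero>\<^sub>H X Y) = X" "Cod C (\<zero>\<^sub>H X Y) = Y"
    using one_closed Hom_carrier[OF assms] by (auto simp: in_Hom)
qed

lemma comp_hom: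
  assumes "g \<in> Hom C Y Z" "X \<in> Obj C"
  shows "(\<lambda>f. g \<cdot> f) \<in> hom (H X Y) (H X Z)"
proof -
  have "Y \<in> Obj C" "Z \<in> Obj C"
    using assms Hom_Obj by blast+
  then show ?thesis
    using assms Comp_add_right by (auto simp: hom_def Hom_carrier intro: Comp_Hom)
qed

lemma hom_comp:
  assumes "f \<in> Hom C X Y" "Z \<in> Obj C"
  shows "(\<lambda>g. g \<cdot> f) \<in> hom (H Y Z) (H X Z)"
proof -
  have "Y \<in> Obj C" "X \<in> Obj C"
    using assms Hom_Obj by blast+
  then show ?thesis
    using assms Comp_add_left by (auto simp: hom_def Hom_carrier intro: Comp_Hom)
qed

lemma comp_zero [simp]:
  assumes "g \<in> Arr C" "Dom C g = Y" "X \<in> Obj C"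
  shows "g \<cdot> \<zero>\<^sub>H X Y = \<zero>\<^sub>H X (Cod C g)"
proof -
  have "Y \<in> Obj C" "Cod C g \<in> Obj C" "g \<in> Hom C Y (Cod C g)"
    using assms by (auto simp: in_Hom)
  then show ?thesis
    using hom_one[OF comp_hom] Hom_group assms(3) by (metis comm_group.axioms(2))
qed

lemma zero_comp [simp]:
  assumes "f \<in> Arr C" "Cod C f = Y" "Z \<in> Obj C"
  shows "\<zero>\<^sub>H Y Z \<cdot> f = \<zero>\<^sub>H (Dom C f) Z"
proof -
  have "Y \<in> Obj C" "Dom C f \<in> Obj C" "f \<in> Hom C (Dom C f) Y"
    using assms by (auto simp: in_Hom)
  then show ?thesis
    using hom_one[OF hom_comp] Hom_group assms(3) by (metis comm_group.axioms(2))
qed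

lemma finprod_Hom:
  assumes "X \<in> Obj C" "Y \<in> Obj C" "\<And>i. i \<le> n \<Longrightarrow> f i \<in> Hom C X Y"
  shows "finprod (H X Y) f {..n::nat} \<in> Hom C X Y"
proof -
  interpret comm_group "H X Y"
    using assms(1,2) by (rule Hom_group)
  show ?thesis
    using finprod_closed[of f "{..n}"] assms by (auto simp: Hom_carrier)
qed

lemma comp_finprod:
  assumes "g \<in> Hom C Y Z" "X \<in> Obj C" "\<And>i. i \<le> n \<Longrightarrow> f i \<in> Hom C X Y"
  shows "g \<cdot> finprod (H X Y) f {..n::nat} = finprod (H X Z) (\<lambda>i. g \<cdot> f i) {..n}"
  using assms Hom_Obj[OF assms(1)]
  by (intro finprod_hom comp_hom) (auto simp: Hom_group Hom_carrier)

lemma finprod_comp: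
  assumes "f \<in> Hom C X Y" "Z \<in> Obj C" "\<And>i. i \<le> n \<Longrightarrow> g i \<in> Hom C Y Z"
  shows "finprod (H Y Z) g {..n::nat} \<cdot> f = finprod (H X Z) (\<lambda>i. g i \<cdot> f) {..n}"
  using assms Hom_Obj[OF assms(1)]
  by (intro finprod_hom[where \<phi> = "\<lambda>g. g \<cdot> f"] hom_comp) (auto simp: Hom_group Hom_carrier)

lemma finprod_single:
  assumes "X \<in> Obj C" "Y \<in> Obj C" "j \<le> n" "k \<in> Hom C X Y"
    "\<And>i. i \<le> n \<Longrightarrow> f i = (if i = j then k else \<zero>\<^sub>H X Y)"
  shows "finprod (H X Y) f {..n::nat} = k"
proof -
  interpret comm_group "H X Y"
    using assms(1,2) by (rule Hom_group)
  have "finprod (H X Y) f {..n} = finprod (H X Y) (\<lambda>i. if j = i then k else \<one>\<^bsub>H X Y\<^esub>) {..n}"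
    using assms by (intro finprod_cong) (auto simp: Hom_carrier in_Hom simp_implies_def)
  also have "\<dots> = k"
    using assms by (intro finprod_singleton) (auto simp: Hom_carrier)
  finally show ?thesis .
qed

lemma is_zero_obj_iff: "is_zero_obj C Z \<longleftrightarrow> Z \<in> Obj C \<and> Idt C Z = \<zero>\<^sub>H Z Z"
proof
  assume Z: "is_zero_obj C Z"
  then have "Z \<in> Obj C"
    by (simp add: is_zero_obj_def)
  with Z show "Z \<in> Obj C \<and> Idt C Z = \<zero>\<^sub>H Z Z"
    using Idt_Hom[of Z] zero_arr[of Z Z] unfolding is_zero_obj_def by (metis in_Hom)
next
  assume Z: "Z \<in> Obj C \<and> Idt C Z = \<zero>\<^sub>H Z Z"
  have "f = \<zero>\<^sub>H X Z" if "f \<in> Hom C X Z" for f X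
    using comp_Idt(1)[of f Z] Z that zero_comp[of f Z Z] by (auto simp: in_Hom)
  moreover have "f = \<zero>\<^sub>H Z X" if "f \<in> Hom C Z X" for f X
    using comp_Idt(2)[of f Z] Z that comp_zero[of f Z Z] by (auto simp: in_Hom)
  moreover have "\<zero>\<^sub>H X Z \<in> Hom C X Z" "\<zero>\<^sub>H Z X \<in> Hom C Z X" if "X \<in> Obj C" for X
    using that Z by (auto simp: in_Hom)
  ultimately show "is_zero_obj C Z"
    unfolding is_zero_obj_def using Z by blast
qed

lemma zero_obj_eq:
  assumes "is_zero_obj C Z" "f \<in> Arr C" "g \<in> Arr C" "Dom C f = Dom C g" "Cod C f = Cod C g"
    "Dom C f = Z \<or> Cod C f = Z"
  shows "f = g"
proof -
  have "f \<in> Hom C (Dom C f) (Cod C f)" "g \<in> Hom C (Dom C f) (Cod C f)"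
    using assms by (auto simp: in_Hom)
  then show ?thesis
    using assms(1,6) Hom_Obj unfolding is_zero_obj_def by metis
qed

lemma direct_sum_arr:
  assumes "is_direct_sum C H n X S \<iota> \<pi>"
  shows "S \<in> Obj C" "i \<le> n \<Longrightarrow> \<iota> i \<in> Hom C (X i) S" "i \<le> n \<Longrightarrow> \<pi> i \<in> Hom C S (X i)" "i \<le> n \<Longrightarrow> X i \<in> Obj C"
  using assms Hom_Obj unfolding is_direct_sum_def by blast+

lemma direct_sum_epi:
  assumes S: "is_direct_sum C H n X S \<iota> \<pi>" and f: "f \<in> Hom C S T" and g: "g \<in> Hom C S T"
    and eq: "\<And>i. i \<le> n \<Longrightarrow> f \<cdot> \<iota> i = g \<cdot> \<iota> i"
  shows "f = g"
proof -
  note arr = direct_sum_arr[OF S]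
  have T: "T \<in> Obj C"
    using f Hom_Obj by blast
  have *: "h = finprod (H S T) (\<lambda>i. (h \<cdot> \<iota> i) \<cdot> \<pi> i) {..n}" if h: "h \<in> Hom C S T" for h
  proof -
    interpret comm_group "H S T"
      using arr(1) T by (rule Hom_group)
    have "h = h \<cdot> finprod (H S S) (\<lambda>i. \<iota> i \<cdot> \<pi> i) {..n}"
      using S h by (simp add: is_direct_sum_def Comp_Idt_right)
    also have "\<dots> = finprod (H S T) (\<lambda>i. h \<cdot> (\<iota> i \<cdot> \<pi> i)) {..n}"
      using arr h by (intro comp_finprod) (auto intro: Comp_Hom)
    also have "\<dots> = finprod (H S T) (\<lambda>i. (h \<cdot> \<iota> i) \<cdot> \<pi> i) {..n}"
    proof (rule finprod_cong'[OF refl])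
      show "h \<cdot> (\<iota> i \<cdot> \<pi> i) = (h \<cdot> \<iota> i) \<cdot> \<pi> i" if "i \<in> {..n}" for i
        using that arr h by (intro Comp_assoc[symmetric]) auto
    qed (use arr h T in \<open>auto simp: Hom_carrier intro!: Comp_Hom\<close>)
    finally show ?thesis .
  qed
  interpret comm_group "H S T"
    using arr(1) T by (rule Hom_group)
  have "finprod (H S T) (\<lambda>i. (f \<cdot> \<iota> i) \<cdot> \<pi> i) {..n} = finprod (H S T) (\<lambda>i. (g \<cdot> \<iota> i) \<cdot> \<pi> i) {..n}"
    using eq arr f g T by (intro finprod_cong) (auto simp: Hom_carrier simp_implies_def intro!: Comp_Hom)
  then show ?thesis
    using *[OF f] *[OF g] by simp
qed

lemma direct_sum_desc:
  assumes S: "is_direct_sum C H n X S \<iota> \<pi>" and k: "\<And>i. i \<le> n \<Longrightarrow> k i \<in> Hom C (X i) T" and T: "T \<in> Obj C"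
  shows "finprod (H S T) (\<lambda>i. k i \<cdot> \<pi> i) {..n} \<in> Hom C S T"
    and "j \<le> n \<Longrightarrow> finprod (H S T) (\<lambda>i. k i \<cdot> \<pi> i) {..n} \<cdot> \<iota> j = k j"
proof -
  note arr = direct_sum_arr[OF S]
  have k\<pi>: "k i \<cdot> \<pi> i \<in> Hom C S T" if "i \<le> n" for i
    by (rule Comp_Hom[OF arr(3)[OF that] k[OF that]])
  show "finprod (H S T) (\<lambda>i. k i \<cdot> \<pi> i) {..n} \<in> Hom C S T"
    using arr k\<pi> T by (intro finprod_Hom) auto
  show "finprod (H S T) (\<lambda>i. k i \<cdot> \<pi> i) {..n} \<cdot> \<iota> j = k j" if j: "j \<le> n"
  proof -
    have "finprod (H S T) (\<lambda>i. k i \<cdot> \<pi> i) {..n} \<cdot> \<iota> j = finprod (H (X j) T) (\<lambda>i. (k i \<cdot> \<pi> i) \<cdot> \<iota> j) {..n}"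
      using arr k\<pi> T j by (intro finprod_comp) auto
    also have "\<dots> = k j"
    proof (rule finprod_single)
      fix i assume i: "i \<le> n"
      have "(k i \<cdot> \<pi> i) \<cdot> \<iota> j = k i \<cdot> (\<pi> i \<cdot> \<iota> j)"
        using i j arr k by (intro Comp_assoc) auto
      also have "\<pi> i \<cdot> \<iota> j = (if j = i then Idt C (X j) else \<zero>\<^sub>H (X j) (X i))"
        using S i j by (auto simp: is_direct_sum_def)
      finally show "(k i \<cdot> \<pi> i) \<cdot> \<iota> j = (if i = j then k j else \<zero>\<^sub>H (X j) T)"
        using k[OF i] k[OF j] arr(4)[OF i] arr(4)[OF j] by (auto simp: in_Hom)
    qed (use j k T arr in auto)
    finally show ?thesis .
  qed
qed

end

locale graded_setting = prerigid_braided_category C + abelian_category C H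
  for C :: "('o, 'a, 'z) prcat_scheme" (structure) and H +
  assumes additive: "tensor_additive C H"
begin

lemma tensor_hom:
  assumes "X \<in> Obj C" "Y \<in> Obj C" "Z \<in> Obj C"
  shows "(\<lambda>f. Z \<rhd> f) \<in> hom (H X Y) (H (Z \<odot> X) (Z \<odot> Y))"
    "(\<lambda>f. f \<lhd> Z) \<in> hom (H X Y) (H (X \<odot> Z) (Y \<odot> Z))"
  using additive assms
  by (auto simp: tensor_additive_def additive_endofunctor_def tensor_left_def tensor_right_def)

lemma tensor_zero:
  assumes "X \<in> Obj C" "Y \<in> Obj C" "Z \<in> Obj C"
  shows "Z \<rhd> \<zero>\<^sub>H X Y = \<zero>\<^sub>H (Z \<odot> X) (Z \<odot> Y)" "\<zero>\<^sub>H X Y \<lhd> Z = \<zero>\<^sub>H (X \<odot> Z) (Y \<odot> Z)"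
  using hom_one[OF tensor_hom(1)[OF assms]] hom_one[OF tensor_hom(2)[OF assms]] assms Hom_group
  by (auto simp: comm_group_def)

lemma is_zero_obj_tensor:
  assumes "is_zero_obj C Z" "X \<in> Obj C"
  shows "is_zero_obj C (Z \<odot> X)" "is_zero_obj C (X \<odot> Z)"
proof -
  have Z: "Z \<in> Obj C" "Idt C Z = \<zero>\<^sub>H Z Z"
    using assms by (auto simp: is_zero_obj_iff)
  have "Idt C Z \<lhd> X = \<zero>\<^sub>H (Z \<odot> X) (Z \<odot> X)" "X \<rhd> Idt C Z = \<zero>\<^sub>H (X \<odot> Z) (X \<odot> Z)"
    unfolding Z(2) using Z(1) assms(2) by (simp_all add: tensor_zero)
  then show "is_zero_obj C (Z \<odot> X)" "is_zero_obj C (X \<odot> Z)"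
    using Z(1) assms(2) by (simp_all add: is_zero_obj_iff)
qed

lemma direct_sum_tensor:
  assumes S: "is_direct_sum C H n X S \<iota> \<pi>" and Z [simp]: "Z \<in> Obj C"
  shows "is_direct_sum C H n (\<lambda>i. X i \<odot> Z) (S \<odot> Z) (\<lambda>i. \<iota> i \<lhd> Z) (\<lambda>i. \<pi> i \<lhd> Z)"
    "is_direct_sum C H n (\<lambda>i. Z \<odot> X i) (Z \<odot> S) (\<lambda>i. Z \<rhd> \<iota> i) (\<lambda>i. Z \<rhd> \<pi> i)"
proof -
  note arr0 = direct_sum_arr[OF S]
  have arr [simp]: "S \<in> Obj C" and arr' [simp]: "i \<le> n \<Longrightarrow> \<iota> i \<in> Arr C" "i \<le> n \<Longrightarrow> Dom C (\<iota> i) = X i"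
    "i \<le> n \<Longrightarrow> Cod C (\<iota> i) = S" "i \<le> n \<Longrightarrow> \<pi> i \<in> Arr C" "i \<le> n \<Longrightarrow> Cod C (\<pi> i) = X i"
    "i \<le> n \<Longrightarrow> Dom C (\<pi> i) = S" "i \<le> n \<Longrightarrow> X i \<in> Obj C" for i
    using arr0 by (auto simp: in_Hom)
  have \<pi>\<iota>: "\<pi> j \<cdot> \<iota> i = (if i = j then Idt C (X i) else \<zero>\<^sub>H (X i) (X j))" if "i \<le> n" "j \<le> n" for i j
    using S that by (auto simp: is_direct_sum_def)
  have sum: "finprod (H S S) (\<lambda>i. \<iota> i \<cdot> \<pi> i) {..n} = Idt C S"
    using S by (simp add: is_direct_sum_def)
  have car: "\<iota> i \<cdot> \<pi> i \<in> carrier (H S S)" if "i \<le> n" for i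
    using that by (simp add: Hom_carrier in_Hom)
  have "finprod (H (S \<odot> Z) (S \<odot> Z)) (\<lambda>i. (\<iota> i \<cdot> \<pi> i) \<lhd> Z) {..n} = Idt C (S \<odot> Z)"
    using finprod_hom[OF _ _ tensor_hom(2)[of S S Z], of n "\<lambda>i. \<iota> i \<cdot> \<pi> i"] car by (simp add: sum Hom_group)
  moreover have "finprod (H (S \<odot> Z) (S \<odot> Z)) (\<lambda>i. (\<iota> i \<cdot> \<pi> i) \<lhd> Z) {..n} =
      finprod (H (S \<odot> Z) (S \<odot> Z)) (\<lambda>i. (\<iota> i \<lhd> Z) \<cdot> (\<pi> i \<lhd> Z)) {..n}"
    by (rule comm_monoid.finprod_cong[OF comm_group.axioms(1)[OF Hom_group]])
      (auto simp: Hom_carrier in_Hom interchange)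
  ultimately show "is_direct_sum C H n (\<lambda>i. X i \<odot> Z) (S \<odot> Z) (\<lambda>i. \<iota> i \<lhd> Z) (\<lambda>i. \<pi> i \<lhd> Z)"
    unfolding is_direct_sum_def by (auto simp: in_Hom interchange \<pi>\<iota> tensor_zero)
  have "finprod (H (Z \<odot> S) (Z \<odot> S)) (\<lambda>i. Z \<rhd> (\<iota> i \<cdot> \<pi> i)) {..n} = Idt C (Z \<odot> S)"
    using finprod_hom[OF _ _ tensor_hom(1)[of S S Z], of n "\<lambda>i. \<iota> i \<cdot> \<pi> i"] car by (simp add: sum Hom_group)
  moreover have "finprod (H (Z \<odot> S) (Z \<odot> S)) (\<lambda>i. Z \<rhd> (\<iota> i \<cdot> \<pi> i)) {..n} =
      finprod (H (Z \<odot> S) (Z \<odot> S)) (\<lambda>i. (Z \<rhd> \<iota> i) \<cdot> (Z \<rhd> \<pi> i)) {..n}"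
    by (rule comm_monoid.finprod_cong[OF comm_group.axioms(1)[OF Hom_group]])
      (auto simp: Hom_carrier in_Hom interchange)
  ultimately show "is_direct_sum C H n (\<lambda>i. Z \<odot> X i) (Z \<odot> S) (\<lambda>i. Z \<rhd> \<iota> i) (\<lambda>i. Z \<rhd> \<pi> i)"
    unfolding is_direct_sum_def by (auto simp: in_Hom interchange \<pi>\<iota> tensor_zero)
qed

end

section \<open>The graded category\<close>

lemma graded_simps [simp]:
  "Obj (graded C H) = {X. \<forall>n. X n \<in> Obj C}" "Arr (graded C H) = {f. \<forall>n. f n \<in> Arr C}"
  "Dom (graded C H) f = (\<lambda>n. Dom C (f n))" "Cod (graded C H) f = (\<lambda>n. Cod C (f n))"
  "Idt (graded C H) X = (\<lambda>n. Idt C (X n))" "g \<cdot>\<^bsub>graded C H\<^esub> f = (\<lambda>n. g n \<cdot>\<^bsub>C\<^esub> f n)"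
  "TObj (graded C H) = gr_obj C H" "TArr (graded C H) = gr_arr C H"
  "TUnit (graded C H) = gr_deg0 C (TUnit C)" "Assoc (graded C H) = gr_assoc C H"
  "LUnit (graded C H) = gr_lunit C H" "RUnit (graded C H) = gr_runit C H"
  "Braid (graded C H) = gr_braid C H" "Dual (graded C H) = gr_dual C" "Ev (graded C H) = gr_ev C H"
  by (simp_all add: graded_def)

lemma Hom_graded: "f \<in> Hom (graded C H) X Y \<longleftrightarrow> (\<forall>n. f n \<in> Hom C (X n) (Y n))"
  by (auto simp: in_Hom fun_eq_iff)

lemma inverse_arrows_graded:
  "inverse_arrows (graded C H) f g \<longleftrightarrow> (\<forall>n. inverse_arrows C (f n) (g n))"
  by (auto simp: inverse_arrows_def in_Hom fun_eq_iff)

lemma iso_arr_graded: "iso_arr (graded C H) f \<longleftrightarrow> (\<forall>n. iso_arr C (f n))"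
  by (simp add: iso_arr_def inverse_arrows_graded choice_iff)

context graded_setting
begin

lemma inv_arr_graded:
  assumes "\<And>n. iso_arr C (f n)"
  shows "inv_arr (graded C H) f = (\<lambda>n. inv_arr C (f n))"
proof -
  have "inverse_arrows (graded C H) f (\<lambda>n. inv_arr C (f n))"
    using assms iso_inverse_arrows by (simp add: inverse_arrows_graded)
  moreover have "g = h" if "inverse_arrows (graded C H) f g" "inverse_arrows (graded C H) f h" for g h
    using that inverse_arrows_unique by (simp add: inverse_arrows_graded fun_eq_iff) blast
  ultimately show ?thesis
    unfolding inv_arr_def by blast
qed

abbreviation gob where "gob X \<equiv> \<forall>n. X n \<in> Obj C"
abbreviation gtensor (infixl "\<diamond>" 75) where "X \<diamond> Y \<equiv> gr_obj C H X Y"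

lemma gr_direct_sum:
  assumes "gob X" "gob Y"
  shows "is_direct_sum C H n (\<lambda>i. X i \<odot> Y (n - i)) ((X \<diamond> Y) n) (gr_in C H X Y n) (gr_pr C H X Y n)"
proof -
  have "\<exists>S \<iota> \<pi>. is_direct_sum C H n (\<lambda>i. X i \<odot> Y (n - i)) S \<iota> \<pi>"
    using assms by (intro direct_sums) simp
  then have "\<exists>s. case s of (S, \<iota>, \<pi>) \<Rightarrow> is_direct_sum C H n (\<lambda>i. X i \<odot> Y (n - i)) S \<iota> \<pi>"
    by auto
  then have "case direct_sum C H n (\<lambda>i. X i \<odot> Y (n - i)) of (S, \<iota>, \<pi>) \<Rightarrow>
      is_direct_sum C H n (\<lambda>i. X i \<odot> Y (n - i)) S \<iota> \<pi>"
    unfolding direct_sum_def by (rule someI_ex)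
  then show ?thesis
    by (simp add: gr_obj_def gr_in_def gr_pr_def gr_sum_def case_prod_beta)
qed

text \<open>Indexing the injections by the degrees \<open>i\<close> and \<open>j\<close> of the two factors avoids truncated subtraction.\<close>

definition gin :: "(nat \<Rightarrow> 'o) \<Rightarrow> (nat \<Rightarrow> 'o) \<Rightarrow> nat \<Rightarrow> nat \<Rightarrow> 'a" where
  "gin X Y i j = gr_in C H X Y (i + j) i"

lemma gob_gtensor [simp]: "gob X \<Longrightarrow> gob Y \<Longrightarrow> (X \<diamond> Y) n \<in> Obj C"
  using direct_sum_arr(1)[OF gr_direct_sum] .

lemma gin_arr [simp]:
  assumes "gob X" "gob Y"
  shows "gin X Y i j \<in> Arr C" "Dom C (gin X Y i j) = X i \<odot> Y j" "Cod C (gin X Y i j) = (X \<diamond> Y) (i + j)"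
  using direct_sum_arr(2)[OF gr_direct_sum[OF assms, of "i + j"], of i] by (auto simp: in_Hom gin_def)

lemma gr_pr_arr:
  assumes "gob X" "gob Y" "i \<le> n"
  shows "gr_pr C H X Y n i \<in> Arr C" "Dom C (gr_pr C H X Y n i) = (X \<diamond> Y) n"
    "Cod C (gr_pr C H X Y n i) = X i \<odot> Y (n - i)"
  using direct_sum_arr(3)[OF gr_direct_sum[OF assms(1,2)] assms(3)] by (auto simp: in_Hom)

lemma graded_epi:
  assumes "gob X" "gob Y" "f \<in> Arr C" "g \<in> Arr C" "Dom C f = (X \<diamond> Y) n" "Dom C g = (X \<diamond> Y) n"
    "Cod C f = Cod C g" "\<And>i j. i + j = n \<Longrightarrow> f \<cdot> gin X Y i j = g \<cdot> gin X Y i j"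
  shows "f = g"
proof (rule direct_sum_epi[OF gr_direct_sum[OF assms(1,2)]])
  show "f \<in> Hom C ((X \<diamond> Y) n) (Cod C f)" "g \<in> Hom C ((X \<diamond> Y) n) (Cod C f)"
    using assms by (auto simp: in_Hom)
  show "f \<cdot> gr_in C H X Y n i = g \<cdot> gr_in C H X Y n i" if "i \<le> n" for i
    using assms(8)[of i "n - i"] that by (simp add: gin_def)
qed

lemma graded_desc:
  assumes "gob X" "gob Y" "T \<in> Obj C" "\<And>i j. i + j = n \<Longrightarrow> k i j \<in> Hom C (X i \<odot> Y j) T"
  shows "\<exists>h\<in>Hom C ((X \<diamond> Y) n) T. \<forall>i j. i + j = n \<longrightarrow> h \<cdot> gin X Y i j = k i j"
proof -
  have k: "k i (n - i) \<in> Hom C (X i \<odot> Y (n - i)) T" if "i \<le> n" for i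
    using assms(4)[of i "n - i"] that by simp
  note desc = direct_sum_desc[OF gr_direct_sum[OF assms(1,2)], of n "\<lambda>i. k i (n - i)", OF k assms(3)]
  show ?thesis
    using desc(1) by (rule bexI[rotated]) (auto simp: desc(2) gin_def)
qed

lemma zero_object [simp]: "is_zero_obj C (zero_object C)" "zero_object C \<in> Obj C"
  using someI_ex[OF zero_obj] by (simp_all add: zero_object_def is_zero_obj_def)

lemma gob_deg0 [simp]: "X \<in> Obj C \<Longrightarrow> gr_deg0 C X n \<in> Obj C"
  by (simp add: gr_deg0_def)

lemma is_zero_obj_deg0: "n \<noteq> 0 \<Longrightarrow> is_zero_obj C (gr_deg0 C X n)"
  by (simp add: gr_deg0_def)

lemma gr_deg0_0 [simp]: "gr_deg0 C X 0 = X"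
  by (simp add: gr_deg0_def)

definition gin_left :: "(nat \<Rightarrow> 'o) \<Rightarrow> (nat \<Rightarrow> 'o) \<Rightarrow> (nat \<Rightarrow> 'o) \<Rightarrow> nat \<Rightarrow> nat \<Rightarrow> nat \<Rightarrow> 'a" where
  "gin_left X Y Z i j k = gin (X \<diamond> Y) Z (i + j) k \<cdot> (gin X Y i j \<lhd> Z k)"

definition gin_right :: "(nat \<Rightarrow> 'o) \<Rightarrow> (nat \<Rightarrow> 'o) \<Rightarrow> (nat \<Rightarrow> 'o) \<Rightarrow> nat \<Rightarrow> nat \<Rightarrow> nat \<Rightarrow> 'a" where
  "gin_right X Y Z i j k = gin X (Y \<diamond> Z) i (j + k) \<cdot> (X i \<rhd> gin Y Z j k)"

lemma gin_left_right_arr [simp]: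
  assumes "gob X" "gob Y" "gob Z"
  shows "gin_left X Y Z i j k \<in> Arr C" "Dom C (gin_left X Y Z i j k) = (X i \<odot> Y j) \<odot> Z k"
    "Cod C (gin_left X Y Z i j k) = (X \<diamond> Y \<diamond> Z) (i + j + k)"
    "gin_right X Y Z i j k \<in> Arr C" "Dom C (gin_right X Y Z i j k) = X i \<odot> (Y j \<odot> Z k)"
    "Cod C (gin_right X Y Z i j k) = (X \<diamond> (Y \<diamond> Z)) (i + (j + k))"
  using assms by (simp_all add: gin_left_def gin_right_def)

lemma whisker_epi:
  assumes "gob X" "gob Y" "Z \<in> Obj C" "f \<in> Arr C" "g \<in> Arr C" "Cod C f = Cod C g"
  shows "Dom C f = (X \<diamond> Y) n \<odot> Z \<Longrightarrow> Dom C g = (X \<diamond> Y) n \<odot> Z \<Longrightarrow>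
      (\<And>i j. i + j = n \<Longrightarrow> f \<cdot> (gin X Y i j \<lhd> Z) = g \<cdot> (gin X Y i j \<lhd> Z)) \<Longrightarrow> f = g"
    and "Dom C f = Z \<odot> (X \<diamond> Y) n \<Longrightarrow> Dom C g = Z \<odot> (X \<diamond> Y) n \<Longrightarrow>
      (\<And>i j. i + j = n \<Longrightarrow> f \<cdot> (Z \<rhd> gin X Y i j) = g \<cdot> (Z \<rhd> gin X Y i j)) \<Longrightarrow> f = g"
proof -
  note ds = direct_sum_tensor[OF gr_direct_sum[OF assms(1,2), of n] assms(3)]
  show "f = g" if "Dom C f = (X \<diamond> Y) n \<odot> Z" "Dom C g = (X \<diamond> Y) n \<odot> Z"
    "\<And>i j. i + j = n \<Longrightarrow> f \<cdot> (gin X Y i j \<lhd> Z) = g \<cdot> (gin X Y i j \<lhd> Z)"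
  proof (rule direct_sum_epi[OF ds(1)])
    show "f \<in> Hom C ((X \<diamond> Y) n \<odot> Z) (Cod C f)" "g \<in> Hom C ((X \<diamond> Y) n \<odot> Z) (Cod C f)"
      using assms that by (auto simp: in_Hom)
    show "f \<cdot> (gr_in C H X Y n i \<lhd> Z) = g \<cdot> (gr_in C H X Y n i \<lhd> Z)" if "i \<le> n" for i
      using \<open>i + (n - i) = n \<Longrightarrow> f \<cdot> (gin X Y i (n - i) \<lhd> Z) = _\<close> that by (simp add: gin_def)
  qed
  show "f = g" if "Dom C f = Z \<odot> (X \<diamond> Y) n" "Dom C g = Z \<odot> (X \<diamond> Y) n"
    "\<And>i j. i + j = n \<Longrightarrow> f \<cdot> (Z \<rhd> gin X Y i j) = g \<cdot> (Z \<rhd> gin X Y i j)"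
  proof (rule direct_sum_epi[OF ds(2)])
    show "f \<in> Hom C (Z \<odot> (X \<diamond> Y) n) (Cod C f)" "g \<in> Hom C (Z \<odot> (X \<diamond> Y) n) (Cod C f)"
      using assms that by (auto simp: in_Hom)
    show "f \<cdot> (Z \<rhd> gr_in C H X Y n i) = g \<cdot> (Z \<rhd> gr_in C H X Y n i)" if "i \<le> n" for i
      using \<open>i + (n - i) = n \<Longrightarrow> f \<cdot> (Z \<rhd> gin X Y i (n - i)) = _\<close> that by (simp add: gin_def)
  qed
qed

lemma graded_epi_left:
  assumes [simp]: "gob X" "gob Y" "gob Z" "f \<in> Arr C" "g \<in> Arr C"
      "Dom C f = (X \<diamond> Y \<diamond> Z) n" "Dom C g = (X \<diamond> Y \<diamond> Z) n"
    and cod: "Cod C f = Cod C g"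
    and eq: "\<And>i j k. i + j + k = n \<Longrightarrow> f \<cdot> gin_left X Y Z i j k = g \<cdot> gin_left X Y Z i j k"
  shows "f = g"
proof (rule graded_epi[of "X \<diamond> Y" Z])
  fix p k assume [simp]: "p + k = n"
  show "f \<cdot> gin (X \<diamond> Y) Z p k = g \<cdot> gin (X \<diamond> Y) Z p k"
  proof (rule whisker_epi(1)[of X Y "Z k" _ _ p])
    fix i j assume "i + j = p"
    then show "f \<cdot> gin (X \<diamond> Y) Z p k \<cdot> (gin X Y i j \<lhd> Z k) = g \<cdot> gin (X \<diamond> Y) Z p k \<cdot> (gin X Y i j \<lhd> Z k)"
      using eq[of i j k] by (simp add: gin_left_def)
  qed (simp_all add: cod)
qed (simp_all add: cod)

lemma graded_epi_right:
  assumes [simp]: "gob X" "gob Y" "gob Z" "f \<in> Arr C" "g \<in> Arr C"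
      "Dom C f = (X \<diamond> (Y \<diamond> Z)) n" "Dom C g = (X \<diamond> (Y \<diamond> Z)) n"
    and cod: "Cod C f = Cod C g"
    and eq: "\<And>i j k. i + j + k = n \<Longrightarrow> f \<cdot> gin_right X Y Z i j k = g \<cdot> gin_right X Y Z i j k"
  shows "f = g"
proof (rule graded_epi[of X "Y \<diamond> Z"])
  fix i p assume [simp]: "i + p = n"
  show "f \<cdot> gin X (Y \<diamond> Z) i p = g \<cdot> gin X (Y \<diamond> Z) i p"
  proof (rule whisker_epi(2)[of Y Z "X i" _ _ p])
    fix j k assume "j + k = p"
    then show "f \<cdot> gin X (Y \<diamond> Z) i p \<cdot> (X i \<rhd> gin Y Z j k) = g \<cdot> gin X (Y \<diamond> Z) i p \<cdot> (X i \<rhd> gin Y Z j k)"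
      using eq[of i j k] by (simp add: gin_right_def add.assoc)
  qed (simp_all add: cod)
qed (simp_all add: cod)

lemma graded_desc_right:
  assumes [simp]: "gob X" "gob Y" "gob Z" "T \<in> Obj C"
    and q: "\<And>i j k. i + j + k = n \<Longrightarrow> q i j k \<in> Hom C (X i \<odot> (Y j \<odot> Z k)) T"
  shows "\<exists>h\<in>Hom C ((X \<diamond> (Y \<diamond> Z)) n) T. \<forall>i j k. i + j + k = n \<longrightarrow> h \<cdot> gin_right X Y Z i j k = q i j k"
proof -
  have "\<exists>h\<in>Hom C (X i \<odot> (Y \<diamond> Z) p) T. \<forall>j k. j + k = p \<longrightarrow> h \<cdot> (X i \<rhd> gin Y Z j k) = q i j k"
    if "i + p = n" for i p
  proof -
    have k: "q i j (p - j) \<in> Hom C (X i \<odot> (Y j \<odot> Z (p - j))) T" if "j \<le> p" for j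
      using q[of i j "p - j"] that \<open>i + p = n\<close> by simp
    have ds: "is_direct_sum C H p (\<lambda>j. X i \<odot> (Y j \<odot> Z (p - j))) (X i \<odot> (Y \<diamond> Z) p)
        (\<lambda>j. X i \<rhd> gr_in C H Y Z p j) (\<lambda>j. X i \<rhd> gr_pr C H Y Z p j)"
      by (rule direct_sum_tensor(2)[OF gr_direct_sum]) simp_all
    note desc = direct_sum_desc[OF ds, of "\<lambda>j. q i j (p - j)", OF k assms(4)]
    show ?thesis
      using desc(1) by (rule bexI[rotated]) (auto simp: desc(2) gin_def)
  qed
  then obtain h where h: "\<And>i p. i + p = n \<Longrightarrow> h i p \<in> Hom C (X i \<odot> (Y \<diamond> Z) p) T"
    "\<And>i p j k. i + p = n \<Longrightarrow> j + k = p \<Longrightarrow> h i p \<cdot> (X i \<rhd> gin Y Z j k) = q i j k"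
    by metis
  obtain h' where h': "h' \<in> Hom C ((X \<diamond> (Y \<diamond> Z)) n) T" "\<And>i p. i + p = n \<Longrightarrow> h' \<cdot> gin X (Y \<diamond> Z) i p = h i p"
    using graded_desc[of X "Y \<diamond> Z" T n h] h(1) by auto
  have "h' \<cdot> gin_right X Y Z i j k = q i j k" if "i + j + k = n" for i j k
  proof -
    have "h' \<cdot> gin_right X Y Z i j k = (h' \<cdot> gin X (Y \<diamond> Z) i (j + k)) \<cdot> (X i \<rhd> gin Y Z j k)"
      using h'(1) that by (auto simp: gin_right_def in_Hom add.assoc)
    then show ?thesis
      using h'(2)[of i "j + k"] h(2)[of i "j + k" j k] that by (simp add: add.assoc)
  qed
  then show ?thesis
    using h'(1) by blast
qed

lemma gr_arr_gin_Hom: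
  assumes "\<forall>n. f n \<in> Arr C" "\<forall>n. g n \<in> Arr C"
  shows "gr_arr C H f g n \<in> Hom C (((\<lambda>i. Dom C (f i)) \<diamond> (\<lambda>i. Dom C (g i))) n)
      (((\<lambda>i. Cod C (f i)) \<diamond> (\<lambda>i. Cod C (g i))) n)" (is "_ \<in> Hom C ?S ?T")
    and "i + j = n \<Longrightarrow> gr_arr C H f g n \<cdot> gin (\<lambda>i. Dom C (f i)) (\<lambda>i. Dom C (g i)) i j =
      gin (\<lambda>i. Cod C (f i)) (\<lambda>i. Cod C (g i)) i j \<cdot> (f i \<boxtimes> g j)"
proof -
  let ?X = "\<lambda>i. Dom C (f i)" and ?Y = "\<lambda>i. Dom C (g i)" and ?X' = "\<lambda>i. Cod C (f i)" and ?Y' = "\<lambda>i. Cod C (g i)"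
  have gob: "gob ?X" "gob ?Y" "gob ?X'" "gob ?Y'"
    using assms by simp_all
  have k: "gr_in C H ?X' ?Y' n i \<cdot> (f i \<boxtimes> g (n - i)) \<in> Hom C (Dom C (f i) \<odot> Dom C (g (n - i))) ?T"
    if "i \<le> n" for i
    using direct_sum_arr(2)[OF gr_direct_sum[OF gob(3,4)] that] assms by (auto simp: in_Hom)
  have T: "?T \<in> Obj C"
    using gob by simp
  note desc = direct_sum_desc[OF gr_direct_sum[OF gob(1,2)], of n
      "\<lambda>i. gr_in C H ?X' ?Y' n i \<cdot> (f i \<boxtimes> g (n - i))", OF k T]
  show "gr_arr C H f g n \<in> Hom C ?S ?T"
    using desc(1) by (simp add: gr_arr_def Let_def)
  show "gr_arr C H f g n \<cdot> gin ?X ?Y i j = gin ?X' ?Y' i j \<cdot> (f i \<boxtimes> g j)" if "i + j = n"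
    using desc(2)[of i] that by (auto simp add: gr_arr_def Let_def gin_def)
qed

lemma gr_arr_arr [simp]:
  assumes "\<forall>n. f n \<in> Arr C" "\<forall>n. g n \<in> Arr C"
  shows "gr_arr C H f g n \<in> Arr C" "Dom C (gr_arr C H f g n) = ((\<lambda>i. Dom C (f i)) \<diamond> (\<lambda>i. Dom C (g i))) n"
    "Cod C (gr_arr C H f g n) = ((\<lambda>i. Cod C (f i)) \<diamond> (\<lambda>i. Cod C (g i))) n"
  using gr_arr_gin_Hom(1)[OF assms] by (auto simp: in_Hom)

lemma gr_arr_gin:
  assumes "\<forall>n. f n \<in> Arr C" "\<forall>n. g n \<in> Arr C" "X = (\<lambda>i. Dom C (f i))" "Y = (\<lambda>i. Dom C (g i))" "i + j = n"
  shows "gr_arr C H f g n \<cdot> gin X Y i j = gin (\<lambda>i. Cod C (f i)) (\<lambda>i. Cod C (g i)) i j \<cdot> (f i \<boxtimes> g j)"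
  using gr_arr_gin_Hom(2)[OF assms(1,2,5)] assms(3,4) by simp

lemma gr_arr_gin_cont:
  assumes "\<forall>n. f n \<in> Arr C" "\<forall>n. g n \<in> Arr C" "X = (\<lambda>i. Dom C (f i))" "Y = (\<lambda>i. Dom C (g i))" "i + j = n"
    "k \<in> Arr C" "Cod C k = X i \<odot> Y j"
  shows "gr_arr C H f g n \<cdot> (gin X Y i j \<cdot> k) = gin (\<lambda>i. Cod C (f i)) (\<lambda>i. Cod C (g i)) i j \<cdot> ((f i \<boxtimes> g j) \<cdot> k)"
  by (rule comp_eq_cont[OF gr_arr_gin[OF assms(1-5)]]) (use assms in auto)

lemma gr_braid_gin_Hom:
  assumes gob: "gob X" "gob Y"
  shows "gr_braid C H X Y n \<in> Hom C ((X \<diamond> Y) n) ((Y \<diamond> X) n)"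
    and "i + j = n \<Longrightarrow> gr_braid C H X Y n \<cdot> gin X Y i j = gin Y X j i \<cdot> \<c> (X i) (Y j)"
proof -
  have k: "gr_in C H Y X n (n - i) \<cdot> \<c> (X i) (Y (n - i)) \<in> Hom C (X i \<odot> Y (n - i)) ((Y \<diamond> X) n)"
    if "i \<le> n" for i
    using direct_sum_arr(2)[OF gr_direct_sum[OF gob(2,1)], of "n - i" n] gob that by (auto simp: in_Hom)
  have T: "(Y \<diamond> X) n \<in> Obj C"
    using gob by simp
  note desc = direct_sum_desc[OF gr_direct_sum[OF gob], of n
      "\<lambda>i. gr_in C H Y X n (n - i) \<cdot> \<c> (X i) (Y (n - i))", OF k T]
  show "gr_braid C H X Y n \<in> Hom C ((X \<diamond> Y) n) ((Y \<diamond> X) n)"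
    using desc(1) by (simp add: gr_braid_def)
  show "gr_braid C H X Y n \<cdot> gin X Y i j = gin Y X j i \<cdot> \<c> (X i) (Y j)" if "i + j = n"
    using desc(2)[of i] that by (auto simp add: gr_braid_def gin_def add.commute)
qed

lemma gr_braid_arr [simp]:
  assumes "gob X" "gob Y"
  shows "gr_braid C H X Y n \<in> Arr C" "Dom C (gr_braid C H X Y n) = (X \<diamond> Y) n"
    "Cod C (gr_braid C H X Y n) = (Y \<diamond> X) n"
  using gr_braid_gin_Hom(1)[OF assms] by (auto simp: in_Hom)

lemma gr_braid_gin_cont:
  assumes "gob X" "gob Y" "i + j = n" "k \<in> Arr C" "Cod C k = X i \<odot> Y j"
  shows "gr_braid C H X Y n \<cdot> (gin X Y i j \<cdot> k) = gin Y X j i \<cdot> (\<c> (X i) (Y j) \<cdot> k)"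
  by (rule comp_eq_cont[OF gr_braid_gin_Hom(2)[OF assms(1-3)]]) (use assms in \<open>auto simp: add.commute\<close>)

lemma gr_assoc_gin_Hom:
  assumes gob [simp]: "gob X" "gob Y" "gob Z"
  shows "gr_assoc C H X Y Z n \<in> Hom C ((X \<diamond> Y \<diamond> Z) n) ((X \<diamond> (Y \<diamond> Z)) n)"
    and "i + j + k = n \<Longrightarrow> gr_assoc C H X Y Z n \<cdot> gin_left X Y Z i j k = gin_right X Y Z i j k \<cdot> \<alpha> (X i) (Y j) (Z k)"
proof -
  let ?S = "(X \<diamond> Y \<diamond> Z) n" and ?T = "(X \<diamond> (Y \<diamond> Z)) n"
  define K where "K p i = gr_in C H X (Y \<diamond> Z) n i \<cdot> (X i \<rhd> gr_in C H Y Z (n - i) (p - i)) \<cdot>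
      \<alpha> (X i) (Y (p - i)) (Z (n - p))" for p i
  define L where "L p = finprod (H ((X \<diamond> Y) p \<odot> Z (n - p)) ?T)
      (\<lambda>i. K p i \<cdot> (gr_pr C H X Y p i \<lhd> Z (n - p))) {..p}" for p
  have T: "?T \<in> Obj C" "?S \<in> Obj C"
    by simp_all
  have K: "K p i = gin_right X Y Z i (p - i) (n - p) \<cdot> \<alpha> (X i) (Y (p - i)) (Z (n - p))" if "i \<le> p" "p \<le> n" for p i
    using that by (simp add: K_def gin_right_def gin_def)
  have K_Hom: "K p i \<in> Hom C ((X i \<odot> Y (p - i)) \<odot> Z (n - p)) ?T" if "i \<le> p" "p \<le> n" for p i
    using that by (simp add: K in_Hom)
  note ds = direct_sum_tensor(1)[OF gr_direct_sum[OF gob(1,2)], of "Z _"]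
  have L: "L p \<in> Hom C ((X \<diamond> Y) p \<odot> Z (n - p)) ?T"
    "i \<le> p \<Longrightarrow> L p \<cdot> (gr_in C H X Y p i \<lhd> Z (n - p)) = K p i" if "p \<le> n" for p i
    unfolding L_def
    by (rule direct_sum_desc[OF ds, where k = "K p"]; use that K_Hom T in simp)+
  have Kpr: "K p i \<cdot> (gr_pr C H X Y p i \<lhd> Z (n - p)) \<in> Hom C ((X \<diamond> Y) p \<odot> Z (n - p)) ?T" if "i \<le> p" "p \<le> n" for p i
    using K_Hom[OF that] that by (auto simp: in_Hom gr_pr_arr)
  have inner: "finprod (H ?S ?T) (\<lambda>i. K p i \<cdot> (gr_pr C H X Y p i \<lhd> Z (n - p)) \<cdot> gr_pr C H (X \<diamond> Y) Z n p) {..p} =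
      L p \<cdot> gr_pr C H (X \<diamond> Y) Z n p" if "p \<le> n" for p
    unfolding L_def
    by (rule finprod_comp[symmetric]) (use that Kpr T in \<open>auto simp: in_Hom gr_pr_arr\<close>)
  interpret ST: comm_group "H ?S ?T"
    by (rule Hom_group) (use T in simp_all)
  have "gr_assoc C H X Y Z n = finprod (H ?S ?T) (\<lambda>p. finprod (H ?S ?T)
      (\<lambda>i. K p i \<cdot> (gr_pr C H X Y p i \<lhd> Z (n - p)) \<cdot> gr_pr C H (X \<diamond> Y) Z n p) {..p}) {..n}"
    by (simp only: gr_assoc_def Let_def K_def)
  also have "\<dots> = finprod (H ?S ?T) (\<lambda>p. L p \<cdot> gr_pr C H (X \<diamond> Y) Z n p) {..n}"
  proof (rule ST.finprod_cong'[OF refl])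
    show "(\<lambda>p. L p \<cdot> gr_pr C H (X \<diamond> Y) Z n p) \<in> {..n} \<rightarrow> carrier (H ?S ?T)"
      using L(1) by (auto simp: Hom_carrier in_Hom gr_pr_arr)
  qed (use inner in simp)
  finally have eq: "gr_assoc C H X Y Z n = finprod (H ?S ?T) (\<lambda>p. L p \<cdot> gr_pr C H (X \<diamond> Y) Z n p) {..n}" .
  have "gob (X \<diamond> Y)"
    by simp
  note desc = direct_sum_desc[OF gr_direct_sum[OF this gob(3)], of n L, OF L(1) T(1)]
  show Hom: "gr_assoc C H X Y Z n \<in> Hom C ?S ?T"
    unfolding eq by (rule desc(1))
  show "gr_assoc C H X Y Z n \<cdot> gin_left X Y Z i j k = gin_right X Y Z i j k \<cdot> \<alpha> (X i) (Y j) (Z k)"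
    if n: "i + j + k = n"
  proof -
    have 1: "gr_assoc C H X Y Z n \<cdot> gin (X \<diamond> Y) Z (i + j) k = L (i + j)"
      using desc(2)[of "i + j"] n by (auto simp: eq gin_def)
    have "L (i + j) \<cdot> (gin X Y i j \<lhd> Z k) = K (i + j) i"
      using L(2)[of "i + j" i] n by (auto simp: gin_def)
    also have "\<dots> = gin_right X Y Z i j k \<cdot> \<alpha> (X i) (Y j) (Z k)"
      using K[of i "i + j"] n by auto
    finally show ?thesis
      using Hom n by (simp add: gin_left_def in_Hom flip: 1)
  qed
qed

lemma gr_assoc_arr [simp]:
  assumes "gob X" "gob Y" "gob Z"
  shows "gr_assoc C H X Y Z n \<in> Arr C" "Dom C (gr_assoc C H X Y Z n) = (X \<diamond> Y \<diamond> Z) n"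
    "Cod C (gr_assoc C H X Y Z n) = (X \<diamond> (Y \<diamond> Z)) n"
  using gr_assoc_gin_Hom(1)[OF assms] by (auto simp: in_Hom)

lemma gr_assoc_gin_cont:
  assumes "gob X" "gob Y" "gob Z" "i + j + k = n" "f \<in> Arr C" "Cod C f = (X i \<odot> Y j) \<odot> Z k"
  shows "gr_assoc C H X Y Z n \<cdot> (gin_left X Y Z i j k \<cdot> f) = gin_right X Y Z i j k \<cdot> (\<alpha> (X i) (Y j) (Z k) \<cdot> f)"
  by (rule comp_eq_cont[OF gr_assoc_gin_Hom(2)[OF assms(1-4)]]) (use assms in \<open>auto simp: add.assoc\<close>)

lemma gr_unit_arr [simp]:
  assumes "gob X"
  shows "gr_lunit C H X n \<in> Arr C" "Dom C (gr_lunit C H X n) = (gr_deg0 C \<I> \<diamond> X) n" "Cod C (gr_lunit C H X n) = X n"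
    "gr_runit C H X n \<in> Arr C" "Dom C (gr_runit C H X n) = (X \<diamond> gr_deg0 C \<I>) n" "Cod C (gr_runit C H X n) = X n"
  using assms by (simp_all add: gr_lunit_def gr_runit_def gr_pr_arr)

lemma gr_unit_gin:
  assumes [simp]: "gob X"
  shows "gr_lunit C H X n \<cdot> gin (gr_deg0 C \<I>) X 0 n = \<l> (X n)"
    "gr_runit C H X n \<cdot> gin X (gr_deg0 C \<I>) n 0 = \<r> (X n)"
proof -
  have I: "gob (gr_deg0 C \<I>)"
    by simp
  have "gr_pr C H (gr_deg0 C \<I>) X n 0 \<cdot> gr_in C H (gr_deg0 C \<I>) X n 0 = Idt C (\<I> \<odot> X n)"
    using gr_direct_sum[OF I assms, of n] by (simp add: is_direct_sum_def)
  then show "gr_lunit C H X n \<cdot> gin (gr_deg0 C \<I>) X 0 n = \<l> (X n)"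
    using gr_pr_arr[OF I assms, of 0 n] gin_arr[OF I assms, of 0 n] by (simp add: gr_lunit_def gin_def)
  have "gr_pr C H X (gr_deg0 C \<I>) n n \<cdot> gr_in C H X (gr_deg0 C \<I>) n n = Idt C (X n \<odot> \<I>)"
    using gr_direct_sum[OF assms I, of n] by (simp add: is_direct_sum_def)
  then show "gr_runit C H X n \<cdot> gin X (gr_deg0 C \<I>) n 0 = \<r> (X n)"
    using gr_pr_arr[OF assms I, of n n] gin_arr[OF assms I, of n 0] by (simp add: gr_runit_def gin_def)
qed

abbreviation \<G> where "\<G> \<equiv> graded C H"

lemma gr_arr_gin_left:
  assumes "\<forall>n. f n \<in> Arr C" "\<forall>n. g n \<in> Arr C" "\<forall>n. h n \<in> Arr C" "i + j + k = n"
  shows "gr_arr C H (gr_arr C H f g) h n \<cdot> gin_left (\<lambda>i. Dom C (f i)) (\<lambda>i. Dom C (g i)) (\<lambda>i. Dom C (h i)) i j k =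
    gin_left (\<lambda>i. Cod C (f i)) (\<lambda>i. Cod C (g i)) (\<lambda>i. Cod C (h i)) i j k \<cdot> ((f i \<boxtimes> g j) \<boxtimes> h k)"
  using assms by (simp add: gin_left_def gr_arr_gin_cont gr_arr_gin interchange)

lemma gr_arr_gin_right:
  assumes "\<forall>n. f n \<in> Arr C" "\<forall>n. g n \<in> Arr C" "\<forall>n. h n \<in> Arr C" "i + j + k = n"
  shows "gr_arr C H f (gr_arr C H g h) n \<cdot> gin_right (\<lambda>i. Dom C (f i)) (\<lambda>i. Dom C (g i)) (\<lambda>i. Dom C (h i)) i j k =
    gin_right (\<lambda>i. Cod C (f i)) (\<lambda>i. Cod C (g i)) (\<lambda>i. Cod C (h i)) i j k \<cdot> (f i \<boxtimes> (g j \<boxtimes> h k))"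
  using assms by (simp add: gin_right_def gr_arr_gin_cont gr_arr_gin interchange add.assoc)

lemma gr_arr_Idt:
  assumes [simp]: "gob X" "gob Y"
  shows "gr_arr C H (\<lambda>n. Idt C (X n)) (\<lambda>n. Idt C (Y n)) n = Idt C ((X \<diamond> Y) n)"
  by (rule graded_epi[of X Y _ _ n]) (auto simp: gr_arr_gin)

lemma gr_arr_comp:
  assumes "\<forall>n. f n \<in> Arr C" "\<forall>n. g n \<in> Arr C" "\<forall>n. f' n \<in> Arr C" "\<forall>n. g' n \<in> Arr C"
    "\<forall>n. Dom C (f' n) = Cod C (f n)" "\<forall>n. Dom C (g' n) = Cod C (g n)"
  shows "gr_arr C H (\<lambda>n. f' n \<cdot> f n) (\<lambda>n. g' n \<cdot> g n) n = gr_arr C H f' g' n \<cdot> gr_arr C H f g n"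
  by (rule graded_epi[of "\<lambda>i. Dom C (f i)" "\<lambda>i. Dom C (g i)" _ _ n])
    (use assms in \<open>auto simp: gr_arr_gin gr_arr_gin_cont interchange\<close>)

lemma gr_assoc_natural:
  assumes [simp]: "\<forall>n. f n \<in> Arr C" "\<forall>n. g n \<in> Arr C" "\<forall>n. h n \<in> Arr C"
  shows "gr_assoc C H (\<lambda>i. Cod C (f i)) (\<lambda>i. Cod C (g i)) (\<lambda>i. Cod C (h i)) n \<cdot> gr_arr C H (gr_arr C H f g) h n =
    gr_arr C H f (gr_arr C H g h) n \<cdot> gr_assoc C H (\<lambda>i. Dom C (f i)) (\<lambda>i. Dom C (g i)) (\<lambda>i. Dom C (h i)) n"
    (is "?l = ?r")
proof (rule graded_epi_left)
  let ?X = "\<lambda>i. Dom C (f i)" and ?Y = "\<lambda>i. Dom C (g i)" and ?Z = "\<lambda>i. Dom C (h i)"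
  let ?X' = "\<lambda>i. Cod C (f i)" and ?Y' = "\<lambda>i. Cod C (g i)" and ?Z' = "\<lambda>i. Cod C (h i)"
  fix i j k assume [simp]: "i + j + k = n"
  have [simp]: "i + (j + k) = n"
    by (simp add: add.assoc[symmetric])
  have "?l \<cdot> gin_left ?X ?Y ?Z i j k = gin_right ?X' ?Y' ?Z' i j k \<cdot> ((f i \<boxtimes> (g j \<boxtimes> h k)) \<cdot> \<alpha> (?X i) (?Y j) (?Z k))"
    by (simp add: gr_arr_gin_left gr_assoc_gin_cont assoc_natural)
  also have "\<dots> = (gr_arr C H f (gr_arr C H g h) n \<cdot> gin_right ?X ?Y ?Z i j k) \<cdot> \<alpha> (?X i) (?Y j) (?Z k)"
    by (simp add: gr_arr_gin_right)
  also have "\<dots> = ?r \<cdot> gin_left ?X ?Y ?Z i j k"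
    by (simp add: gr_assoc_gin_Hom(2))
  finally show "?l \<cdot> gin_left ?X ?Y ?Z i j k = ?r \<cdot> gin_left ?X ?Y ?Z i j k" .
qed simp_all

lemma iso_gr_assoc [simp]:
  assumes [simp]: "gob X" "gob Y" "gob Z"
  shows "iso_arr C (gr_assoc C H X Y Z n)"
proof -
  let ?a = "gr_assoc C H X Y Z n"
  have "\<exists>h\<in>Hom C ((X \<diamond> (Y \<diamond> Z)) n) ((X \<diamond> Y \<diamond> Z) n). \<forall>i j k. i + j + k = n \<longrightarrow>
      h \<cdot> gin_right X Y Z i j k = gin_left X Y Z i j k \<cdot> \<alpha>\<^sup>- (X i) (Y j) (Z k)"
    by (rule graded_desc_right) (auto simp: in_Hom)
  then obtain h where [simp]: "h \<in> Arr C" "Dom C h = (X \<diamond> (Y \<diamond> Z)) n" "Cod C h = (X \<diamond> Y \<diamond> Z) n"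
    and h: "\<And>i j k. i + j + k = n \<Longrightarrow> h \<cdot> gin_right X Y Z i j k = gin_left X Y Z i j k \<cdot> \<alpha>\<^sup>- (X i) (Y j) (Z k)"
    by (auto simp: in_Hom)
  have "h \<cdot> ?a = Idt C ((X \<diamond> Y \<diamond> Z) n)"
  proof (rule graded_epi_left[of X Y Z])
    fix i j k assume [simp]: "i + j + k = n"
    have [simp]: "i + (j + k) = n"
      by (simp add: add.assoc[symmetric])
    have "h \<cdot> ?a \<cdot> gin_left X Y Z i j k = (h \<cdot> gin_right X Y Z i j k) \<cdot> \<alpha> (X i) (Y j) (Z k)"
      by (simp add: gr_assoc_gin_Hom(2))
    then show "h \<cdot> ?a \<cdot> gin_left X Y Z i j k = Idt C ((X \<diamond> Y \<diamond> Z) n) \<cdot> gin_left X Y Z i j k"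
      by (simp add: h)
  qed simp_all
  moreover have "?a \<cdot> h = Idt C ((X \<diamond> (Y \<diamond> Z)) n)"
  proof (rule graded_epi_right[of X Y Z])
    fix i j k assume [simp]: "i + j + k = n"
    have [simp]: "i + (j + k) = n"
      by (simp add: add.assoc[symmetric])
    show "?a \<cdot> h \<cdot> gin_right X Y Z i j k = Idt C ((X \<diamond> (Y \<diamond> Z)) n) \<cdot> gin_right X Y Z i j k"
      by (simp add: h gr_assoc_gin_cont)
  qed simp_all
  ultimately have "inverse_arrows C ?a h"
    by (simp add: inverse_arrows_def in_Hom)
  then show ?thesis
    by (auto simp: iso_arr_def)
qed

lemma inv_gr_assoc_gin:
  assumes [simp]: "gob X" "gob Y" "gob Z" and n [simp]: "i + j + k = n"
  shows "inv_arr C (gr_assoc C H X Y Z n) \<cdot> gin_right X Y Z i j k = gin_left X Y Z i j k \<cdot> \<alpha>\<^sup>- (X i) (Y j) (Z k)"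
proof -
  have [simp]: "i + (j + k) = n"
    by (simp add: add.assoc[symmetric])
  show ?thesis
    by (rule iso_cancel_left[of "gr_assoc C H X Y Z n"]) (simp_all add: gr_assoc_gin_cont)
qed

lemma gr_pentagon:
  assumes [simp]: "gob W" "gob X" "gob Y" "gob Z"
  shows "gr_arr C H (\<lambda>n. Idt C (W n)) (gr_assoc C H X Y Z) n \<cdot>
      (gr_assoc C H W (X \<diamond> Y) Z n \<cdot> gr_arr C H (gr_assoc C H W X Y) (\<lambda>n. Idt C (Z n)) n) =
    gr_assoc C H W X (Y \<diamond> Z) n \<cdot> gr_assoc C H (W \<diamond> X) Y Z n" (is "?l1 \<cdot> (?l2 \<cdot> ?l3) = ?r1 \<cdot> ?r2")
proof (rule graded_epi[of "W \<diamond> X \<diamond> Y" Z])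
  fix p l assume n: "p + l = n"
  show "?l1 \<cdot> (?l2 \<cdot> ?l3) \<cdot> gin (W \<diamond> X \<diamond> Y) Z p l = ?r1 \<cdot> ?r2 \<cdot> gin (W \<diamond> X \<diamond> Y) Z p l"
  proof -
    have *: "?l1 \<cdot> (?l2 \<cdot> ?l3) \<cdot> gin (W \<diamond> X \<diamond> Y) Z p l \<cdot> (gin_left W X Y i j k \<lhd> Z l) =
        ?r1 \<cdot> ?r2 \<cdot> gin (W \<diamond> X \<diamond> Y) Z p l \<cdot> (gin_left W X Y i j k \<lhd> Z l)" if ijk: "i + j + k = p" for i j k
    proof -
      note p = ijk[symmetric, unfolded add.assoc] and n' = n[symmetric, unfolded ijk[symmetric] add.assoc]
      note [simp] = p n' add.assoc
      let ?J = "gin (W \<diamond> X \<diamond> Y) Z (i + (j + k)) l \<cdot> (gin_left W X Y i j k \<lhd> Z l)"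
      have "?l3 \<cdot> ?J = gin (W \<diamond> (X \<diamond> Y)) Z (i + (j + k)) l \<cdot>
          ((gr_assoc C H W X Y (i + (j + k)) \<cdot> gin_left W X Y i j k) \<lhd> Z l)"
        by (simp add: gr_arr_gin_cont interchange)
      also have "\<dots> = gin_left W (X \<diamond> Y) Z i (j + k) l \<cdot> (((W i \<rhd> gin X Y j k) \<lhd> Z l) \<cdot> (\<alpha> (W i) (X j) (Y k) \<lhd> Z l))"
        by (simp add: gr_assoc_gin_Hom(2)) (simp add: gin_left_def gin_right_def interchange interchange_cont)
      finally have 3: "?l3 \<cdot> ?J = gin_left W (X \<diamond> Y) Z i (j + k) l \<cdot>
          (((W i \<rhd> gin X Y j k) \<lhd> Z l) \<cdot> (\<alpha> (W i) (X j) (Y k) \<lhd> Z l))" .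
      have "?l2 \<cdot> (?l3 \<cdot> ?J) = gin_right W (X \<diamond> Y) Z i (j + k) l \<cdot> ((W i \<rhd> (gin X Y j k \<lhd> Z l)) \<cdot>
          (\<alpha> (W i) (X j \<odot> Y k) (Z l) \<cdot> (\<alpha> (W i) (X j) (Y k) \<lhd> Z l)))"
        unfolding 3 by (simp add: gr_assoc_gin_cont assoc_natural_cont)
      also have "\<dots> = gin W (X \<diamond> Y \<diamond> Z) i (j + (k + l)) \<cdot> ((W i \<rhd> gin_left X Y Z j k l) \<cdot>
          (\<alpha> (W i) (X j \<odot> Y k) (Z l) \<cdot> (\<alpha> (W i) (X j) (Y k) \<lhd> Z l)))"
        by (simp add: gin_right_def gin_left_def interchange_cont)
      finally have 2: "?l2 \<cdot> (?l3 \<cdot> ?J) = gin W (X \<diamond> Y \<diamond> Z) i (j + (k + l)) \<cdot> ((W i \<rhd> gin_left X Y Z j k l) \<cdot>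
          (\<alpha> (W i) (X j \<odot> Y k) (Z l) \<cdot> (\<alpha> (W i) (X j) (Y k) \<lhd> Z l)))" .
      have "?l1 \<cdot> (?l2 \<cdot> (?l3 \<cdot> ?J)) = gin W (X \<diamond> (Y \<diamond> Z)) i (j + (k + l)) \<cdot>
          ((W i \<rhd> (gr_assoc C H X Y Z (j + (k + l)) \<cdot> gin_left X Y Z j k l)) \<cdot>
          (\<alpha> (W i) (X j \<odot> Y k) (Z l) \<cdot> (\<alpha> (W i) (X j) (Y k) \<lhd> Z l)))"
        unfolding 2 by (simp add: gr_arr_gin_cont interchange_cont)
      also have "\<dots> = gin W (X \<diamond> (Y \<diamond> Z)) i (j + (k + l)) \<cdot> ((W i \<rhd> gin_right X Y Z j k l) \<cdot>
          ((W i \<rhd> \<alpha> (X j) (Y k) (Z l)) \<cdot> (\<alpha> (W i) (X j \<odot> Y k) (Z l) \<cdot> (\<alpha> (W i) (X j) (Y k) \<lhd> Z l))))"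
        by (simp add: gr_assoc_gin_Hom(2) whisker_comp)
      finally have l: "?l1 \<cdot> (?l2 \<cdot> (?l3 \<cdot> ?J)) = gin W (X \<diamond> (Y \<diamond> Z)) i (j + (k + l)) \<cdot> ((W i \<rhd> gin_right X Y Z j k l) \<cdot>
          ((W i \<rhd> \<alpha> (X j) (Y k) (Z l)) \<cdot> (\<alpha> (W i) (X j \<odot> Y k) (Z l) \<cdot> (\<alpha> (W i) (X j) (Y k) \<lhd> Z l))))" .
      have "?r2 \<cdot> ?J = ?r2 \<cdot> (gin_left (W \<diamond> X) Y Z (i + j) k l \<cdot> ((gin W X i j \<lhd> Y k) \<lhd> Z l))"
        by (simp add: gin_left_def[of "W \<diamond> X"] gin_left_def[of W X] whisker_comp)
      also have "\<dots> = gin_right (W \<diamond> X) Y Z (i + j) k l \<cdot> ((gin W X i j \<lhd> (Y k \<odot> Z l)) \<cdot> \<alpha> (W i \<odot> X j) (Y k) (Z l))"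
        by (simp add: gr_assoc_gin_cont assoc_natural)
      also have "\<dots> = gin (W \<diamond> X) (Y \<diamond> Z) (i + j) (k + l) \<cdot>
          ((gin W X i j \<boxtimes> gin Y Z k l) \<cdot> \<alpha> (W i \<odot> X j) (Y k) (Z l))"
        by (simp add: gin_right_def interchange_cont)
      also have "\<dots> = gin_left W X (Y \<diamond> Z) i j (k + l) \<cdot> (((W i \<odot> X j) \<rhd> gin Y Z k l) \<cdot> \<alpha> (W i \<odot> X j) (Y k) (Z l))"
        by (simp add: gin_left_def interchange_cont)
      finally have r2: "?r2 \<cdot> ?J = gin_left W X (Y \<diamond> Z) i j (k + l) \<cdot>
          (((W i \<odot> X j) \<rhd> gin Y Z k l) \<cdot> \<alpha> (W i \<odot> X j) (Y k) (Z l))" .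
      have nat: "\<alpha> (W i) (X j) ((Y \<diamond> Z) (k + l)) \<cdot> (((W i \<odot> X j) \<rhd> gin Y Z k l) \<cdot> \<alpha> (W i \<odot> X j) (Y k) (Z l)) =
          (W i \<rhd> (X j \<rhd> gin Y Z k l)) \<cdot> (\<alpha> (W i) (X j) (Y k \<odot> Z l) \<cdot> \<alpha> (W i \<odot> X j) (Y k) (Z l))"
        using assoc_natural_cont[of "Idt C (W i)" "Idt C (X j)" "gin Y Z k l" "W i" "X j" "(Y \<diamond> Z) (k + l)"
            "\<alpha> (W i \<odot> X j) (Y k) (Z l)"] by simp
      have "?r1 \<cdot> (?r2 \<cdot> ?J) = gin_right W X (Y \<diamond> Z) i j (k + l) \<cdot>
          ((W i \<rhd> (X j \<rhd> gin Y Z k l)) \<cdot> (\<alpha> (W i) (X j) (Y k \<odot> Z l) \<cdot> \<alpha> (W i \<odot> X j) (Y k) (Z l)))"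
        unfolding r2 by (simp add: gr_assoc_gin_cont nat)
      also have "\<dots> = gin W (X \<diamond> (Y \<diamond> Z)) i (j + (k + l)) \<cdot> ((W i \<rhd> gin_right X Y Z j k l) \<cdot>
          (\<alpha> (W i) (X j) (Y k \<odot> Z l) \<cdot> \<alpha> (W i \<odot> X j) (Y k) (Z l)))"
        by (simp add: gin_right_def interchange_cont)
      finally have "?l1 \<cdot> (?l2 \<cdot> (?l3 \<cdot> ?J)) = ?r1 \<cdot> (?r2 \<cdot> ?J)"
        unfolding l by (simp add: pentagon')
      then show ?thesis
        by simp
    qed
    note [simp] = n
    have "gob (W \<diamond> X)" "gob (W \<diamond> X \<diamond> Y)"
      by simp_all
    show ?thesis
    proof (rule whisker_epi(1)[of "W \<diamond> X" Y "Z l" _ _ p])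
      fix q k assume q: "q + k = p"
      show "?l1 \<cdot> (?l2 \<cdot> ?l3) \<cdot> gin (W \<diamond> X \<diamond> Y) Z p l \<cdot> (gin (W \<diamond> X) Y q k \<lhd> Z l) =
          ?r1 \<cdot> ?r2 \<cdot> gin (W \<diamond> X \<diamond> Y) Z p l \<cdot> (gin (W \<diamond> X) Y q k \<lhd> Z l)" (is "?L = ?R")
      proof -
        note [simp] = q
        let ?a = "\<alpha>\<^sup>- ((W \<diamond> X) q) (Y k) (Z l)" and ?b = "\<alpha> ((W \<diamond> X) q) (Y k) (Z l)"
        have "?L \<cdot> ?a = ?R \<cdot> ?a"
        proof (rule whisker_epi(1)[of W X "Y k \<odot> Z l" _ _ q])
          fix i j assume ij: "i + j = q"
          note [simp] = ij
          have "?a \<cdot> (gin W X i j \<lhd> (Y k \<odot> Z l)) = ((gin W X i j \<lhd> Y k) \<lhd> Z l) \<cdot> \<alpha>\<^sup>- (W i \<odot> X j) (Y k) (Z l)"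
            using assoc_inv_natural[of "gin W X i j" "Idt C (Y k)" "Idt C (Z l)" "(W \<diamond> X) q" "Y k" "Z l"] by simp
          moreover have "(gin (W \<diamond> X) Y q k \<lhd> Z l) \<cdot> (((gin W X i j \<lhd> Y k) \<lhd> Z l) \<cdot> \<alpha>\<^sup>- (W i \<odot> X j) (Y k) (Z l)) =
              (gin_left W X Y i j k \<lhd> Z l) \<cdot> \<alpha>\<^sup>- (W i \<odot> X j) (Y k) (Z l)"
            by (simp add: gin_left_def interchange_cont)
          moreover note *[of i j k, THEN arg_cong, of "\<lambda>x. x \<cdot> \<alpha>\<^sup>- (W i \<odot> X j) (Y k) (Z l)"]
          ultimately show "?L \<cdot> ?a \<cdot> (gin W X i j \<lhd> (Y k \<odot> Z l)) = ?R \<cdot> ?a \<cdot> (gin W X i j \<lhd> (Y k \<odot> Z l))"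
            by simp
        qed simp_all
        then show ?thesis
          by (rule iso_cancel_right[rotated]) simp_all
      qed
    qed simp_all
  qed
qed simp_all

lemma deg0_epi_left:
  assumes [simp]: "B \<in> Obj C" "gob X" "f \<in> Arr C" "g \<in> Arr C" "Dom C f = (gr_deg0 C B \<diamond> X) n"
    "Dom C g = (gr_deg0 C B \<diamond> X) n" and cod: "Cod C f = Cod C g"
    and eq: "f \<cdot> gin (gr_deg0 C B) X 0 n = g \<cdot> gin (gr_deg0 C B) X 0 n"
  shows "f = g"
proof (rule graded_epi[of "gr_deg0 C B" X _ _ n])
  fix i j assume [simp]: "i + j = n"
  show "f \<cdot> gin (gr_deg0 C B) X i j = g \<cdot> gin (gr_deg0 C B) X i j"
  proof (cases "i = 0")
    case True
    then show ?thesis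
      using eq \<open>i + j = n\<close> by simp
  next
    case False
    then show ?thesis
      using cod by (intro zero_obj_eq[OF is_zero_obj_tensor(1)[OF is_zero_obj_deg0]]) auto
  qed
qed (simp_all add: cod)

lemma deg0_epi_right:
  assumes [simp]: "B \<in> Obj C" "gob X" "f \<in> Arr C" "g \<in> Arr C" "Dom C f = (X \<diamond> gr_deg0 C B) n"
    "Dom C g = (X \<diamond> gr_deg0 C B) n" and cod: "Cod C f = Cod C g"
    and eq: "f \<cdot> gin X (gr_deg0 C B) n 0 = g \<cdot> gin X (gr_deg0 C B) n 0"
  shows "f = g"
proof (rule graded_epi[of X "gr_deg0 C B" _ _ n])
  fix i j assume [simp]: "i + j = n"
  show "f \<cdot> gin X (gr_deg0 C B) i j = g \<cdot> gin X (gr_deg0 C B) i j"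
  proof (cases "j = 0")
    case True
    then show ?thesis
      using eq \<open>i + j = n\<close> by simp
  next
    case False
    then show ?thesis
      using cod by (intro zero_obj_eq[OF is_zero_obj_tensor(2)[OF is_zero_obj_deg0]]) auto
  qed
qed (simp_all add: cod)

lemma gr_unit_natural:
  assumes [simp]: "\<forall>n. f n \<in> Arr C"
  shows "gr_lunit C H (\<lambda>i. Cod C (f i)) n \<cdot> gr_arr C H (\<lambda>n. Idt C (gr_deg0 C \<I> n)) f n =
      f n \<cdot> gr_lunit C H (\<lambda>i. Dom C (f i)) n"
    and "gr_runit C H (\<lambda>i. Cod C (f i)) n \<cdot> gr_arr C H f (\<lambda>n. Idt C (gr_deg0 C \<I> n)) n =
      f n \<cdot> gr_runit C H (\<lambda>i. Dom C (f i)) n"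
proof -
  have l: "gr_lunit C H X n \<cdot> (gin (gr_deg0 C \<I>) X 0 n \<cdot> k) = \<l> (X n) \<cdot> k"
    if "gob X" "k \<in> Arr C" "Cod C k = \<I> \<odot> X n" for X k
    using that comp_assoc[of k "gin (gr_deg0 C \<I>) X 0 n" "gr_lunit C H X n"] by (simp add: gr_unit_gin del: comp_assoc)
  have r: "gr_runit C H X n \<cdot> (gin X (gr_deg0 C \<I>) n 0 \<cdot> k) = \<r> (X n) \<cdot> k"
    if "gob X" "k \<in> Arr C" "Cod C k = X n \<odot> \<I>" for X k
    using that comp_assoc[of k "gin X (gr_deg0 C \<I>) n 0" "gr_runit C H X n"] by (simp add: gr_unit_gin del: comp_assoc)
  show "gr_lunit C H (\<lambda>i. Cod C (f i)) n \<cdot> gr_arr C H (\<lambda>n. Idt C (gr_deg0 C \<I> n)) f n =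
      f n \<cdot> gr_lunit C H (\<lambda>i. Dom C (f i)) n"
    by (rule deg0_epi_left[of \<I> "\<lambda>i. Dom C (f i)" _ _ n])
      (simp_all add: gr_arr_gin l gr_unit_gin lunit_natural)
  show "gr_runit C H (\<lambda>i. Cod C (f i)) n \<cdot> gr_arr C H f (\<lambda>n. Idt C (gr_deg0 C \<I> n)) n =
      f n \<cdot> gr_runit C H (\<lambda>i. Dom C (f i)) n"
    by (rule deg0_epi_right[of \<I> "\<lambda>i. Dom C (f i)" _ _ n])
      (simp_all add: gr_arr_gin r gr_unit_gin runit_natural)
qed

lemma iso_gr_unit [simp]:
  assumes [simp]: "gob X"
  shows "iso_arr C (gr_lunit C H X n)" "iso_arr C (gr_runit C H X n)"
proof -
  let ?l = "gr_lunit C H X n" and ?r = "gr_runit C H X n"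
  let ?i = "gin (gr_deg0 C \<I>) X 0 n" and ?j = "gin X (gr_deg0 C \<I>) n 0"
  have li: "?l \<cdot> (?i \<cdot> k) = \<l> (X n) \<cdot> k" if "k \<in> Arr C" "Cod C k = \<I> \<odot> X n" for k
    using that comp_assoc[of k ?i ?l] by (simp add: gr_unit_gin del: comp_assoc)
  have rj: "?r \<cdot> (?j \<cdot> k) = \<r> (X n) \<cdot> k" if "k \<in> Arr C" "Cod C k = X n \<odot> \<I>" for k
    using that comp_assoc[of k ?j ?r] by (simp add: gr_unit_gin del: comp_assoc)
  have "(?i \<cdot> inv_arr C (\<l> (X n))) \<cdot> ?l = Idt C ((gr_deg0 C \<I> \<diamond> X) n)"
    by (rule deg0_epi_left[of \<I> X _ _ n]) (simp_all add: gr_unit_gin)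
  then have "inverse_arrows C ?l (?i \<cdot> inv_arr C (\<l> (X n)))"
    by (simp add: inverse_arrows_def in_Hom li)
  then show "iso_arr C ?l"
    by (auto simp: iso_arr_def)
  have "(?j \<cdot> inv_arr C (\<r> (X n))) \<cdot> ?r = Idt C ((X \<diamond> gr_deg0 C \<I>) n)"
    by (rule deg0_epi_right[of \<I> X _ _ n]) (simp_all add: gr_unit_gin)
  then have "inverse_arrows C ?r (?j \<cdot> inv_arr C (\<r> (X n)))"
    by (simp add: inverse_arrows_def in_Hom rj)
  then show "iso_arr C ?r"
    by (auto simp: iso_arr_def)
qed

lemma gr_triangle:
  assumes [simp]: "gob X" "gob Y"
  shows "gr_arr C H (\<lambda>n. Idt C (X n)) (gr_lunit C H Y) n \<cdot> gr_assoc C H X (gr_deg0 C \<I>) Y n =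
    gr_arr C H (gr_runit C H X) (\<lambda>n. Idt C (Y n)) n" (is "?l \<cdot> ?a = ?r")
proof (rule graded_epi_left[of X "gr_deg0 C \<I>" Y])
  fix i j k assume n: "i + j + k = n"
  show "?l \<cdot> ?a \<cdot> gin_left X (gr_deg0 C \<I>) Y i j k = ?r \<cdot> gin_left X (gr_deg0 C \<I>) Y i j k"
  proof (cases "j = 0")
    case True
    with n have [simp]: "j = 0" "i + k = n"
      by simp_all
    have "?l \<cdot> ?a \<cdot> gin_left X (gr_deg0 C \<I>) Y i j k =
        gin X Y i k \<cdot> ((X i \<rhd> (gr_lunit C H Y k \<cdot> gin (gr_deg0 C \<I>) Y 0 k)) \<cdot> \<alpha> (X i) \<I> (Y k))"
      by (simp add: gr_assoc_gin_Hom(2)) (simp add: gin_right_def gr_arr_gin_cont interchange_cont)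
    also have "\<dots> = gin X Y i k \<cdot> ((gr_runit C H X i \<cdot> gin X (gr_deg0 C \<I>) i 0) \<lhd> Y k)"
      by (simp add: gr_unit_gin triangle')
    also have "\<dots> = ?r \<cdot> gin_left X (gr_deg0 C \<I>) Y i j k"
      by (simp add: gin_left_def gr_arr_gin_cont interchange)
    finally show ?thesis .
  next
    case False
    then have "is_zero_obj C ((X i \<odot> gr_deg0 C \<I> j) \<odot> Y k)"
      by (simp add: is_zero_obj_tensor is_zero_obj_deg0)
    then show ?thesis
      using n by (intro zero_obj_eq) auto
  qed
qed simp_all

lemma gr_braid_natural:
  assumes [simp]: "\<forall>n. f n \<in> Arr C" "\<forall>n. g n \<in> Arr C"
  shows "gr_braid C H (\<lambda>i. Cod C (f i)) (\<lambda>i. Cod C (g i)) n \<cdot> gr_arr C H f g n =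
    gr_arr C H g f n \<cdot> gr_braid C H (\<lambda>i. Dom C (f i)) (\<lambda>i. Dom C (g i)) n"
  by (rule graded_epi[of "\<lambda>i. Dom C (f i)" "\<lambda>i. Dom C (g i)" _ _ n])
    (simp_all add: gr_arr_gin gr_braid_gin_cont gr_braid_gin_Hom(2) gr_arr_gin_cont braid_natural add.commute)

lemma iso_gr_braid [simp]:
  assumes [simp]: "gob X" "gob Y"
  shows "iso_arr C (gr_braid C H X Y n)"
proof -
  let ?c = "gr_braid C H X Y n"
  have "\<exists>h\<in>Hom C ((Y \<diamond> X) n) ((X \<diamond> Y) n). \<forall>j i. j + i = n \<longrightarrow> h \<cdot> gin Y X j i = gin X Y i j \<cdot> \<c>\<^sup>- (X i) (Y j)"
    by (rule graded_desc) (auto simp: in_Hom add.commute)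
  then obtain h where [simp]: "h \<in> Arr C" "Dom C h = (Y \<diamond> X) n" "Cod C h = (X \<diamond> Y) n"
    and h: "\<And>i j. i + j = n \<Longrightarrow> h \<cdot> gin Y X j i = gin X Y i j \<cdot> \<c>\<^sup>- (X i) (Y j)"
    by (auto simp: in_Hom add.commute)
  have "h \<cdot> ?c = Idt C ((X \<diamond> Y) n)"
  proof (rule graded_epi[of X Y])
    fix i j assume ij: "i + j = n"
    then have "j + i = n"
      by linarith
    note [simp] = ij this
    have "h \<cdot> ?c \<cdot> gin X Y i j = (h \<cdot> gin Y X j i) \<cdot> \<c> (X i) (Y j)"
      by (simp add: gr_braid_gin_Hom(2))
    then show "h \<cdot> ?c \<cdot> gin X Y i j = Idt C ((X \<diamond> Y) n) \<cdot> gin X Y i j"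
      by (simp add: h)
  qed simp_all
  moreover have "?c \<cdot> h = Idt C ((Y \<diamond> X) n)"
  proof (rule graded_epi[of Y X])
    fix j i assume ji: "j + i = n"
    then have "i + j = n"
      by linarith
    note [simp] = ji this
    show "?c \<cdot> h \<cdot> gin Y X j i = Idt C ((Y \<diamond> X) n) \<cdot> gin Y X j i"
      by (simp add: h gr_braid_gin_cont)
  qed simp_all
  ultimately have "inverse_arrows C ?c h"
    by (simp add: inverse_arrows_def in_Hom)
  then show ?thesis
    by (auto simp: iso_arr_def)
qed

lemma gr_hexagon1:
  assumes [simp]: "gob X" "gob Y" "gob Z"
  shows "gr_assoc C H Y Z X n \<cdot> (gr_braid C H X (Y \<diamond> Z) n \<cdot> gr_assoc C H X Y Z n) =
    gr_arr C H (\<lambda>n. Idt C (Y n)) (gr_braid C H X Z) n \<cdot>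
      (gr_assoc C H Y X Z n \<cdot> gr_arr C H (gr_braid C H X Y) (\<lambda>n. Idt C (Z n)) n)"
    (is "?a \<cdot> (?c \<cdot> ?b) = ?d \<cdot> (?e \<cdot> ?f)")
proof (rule graded_epi_left[of X Y Z])
  fix i j k assume n: "i + j + k = n"
  note n' = n[symmetric, unfolded add.assoc]
  note [simp] = n' add.assoc add.commute add.left_commute
  have "?c \<cdot> gin_right X Y Z i j k = gin (Y \<diamond> Z) X (j + k) i \<cdot> (\<c> (X i) ((Y \<diamond> Z) (j + k)) \<cdot> (X i \<rhd> gin Y Z j k))"
    by (simp add: gin_right_def gr_braid_gin_cont)
  also have "\<dots> = gin_left Y Z X j k i \<cdot> \<c> (X i) (Y j \<odot> Z k)"
    by (simp add: gin_left_def braid_natural)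
  finally have c: "?c \<cdot> gin_right X Y Z i j k = gin_left Y Z X j k i \<cdot> \<c> (X i) (Y j \<odot> Z k)" .
  have "(?a \<cdot> (?c \<cdot> ?b)) \<cdot> gin_left X Y Z i j k = ?a \<cdot> ((?c \<cdot> gin_right X Y Z i j k) \<cdot> \<alpha> (X i) (Y j) (Z k))"
    by (simp add: gr_assoc_gin_Hom(2))
  also have "\<dots> = gin_right Y Z X j k i \<cdot> (\<alpha> (Y j) (Z k) (X i) \<cdot> (\<c> (X i) (Y j \<odot> Z k) \<cdot> \<alpha> (X i) (Y j) (Z k)))"
    unfolding c by (simp add: gr_assoc_gin_cont)
  also have "\<alpha> (Y j) (Z k) (X i) \<cdot> (\<c> (X i) (Y j \<odot> Z k) \<cdot> \<alpha> (X i) (Y j) (Z k)) =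
      (Y j \<rhd> \<c> (X i) (Z k)) \<cdot> (\<alpha> (Y j) (X i) (Z k) \<cdot> (\<c> (X i) (Y j) \<lhd> Z k))"
    by (simp add: braid_tensor_right)
  finally have l: "(?a \<cdot> (?c \<cdot> ?b)) \<cdot> gin_left X Y Z i j k = gin_right Y Z X j k i \<cdot>
      ((Y j \<rhd> \<c> (X i) (Z k)) \<cdot> (\<alpha> (Y j) (X i) (Z k) \<cdot> (\<c> (X i) (Y j) \<lhd> Z k)))" .
  have f: "?f \<cdot> gin_left X Y Z i j k = gin_left Y X Z j i k \<cdot> (\<c> (X i) (Y j) \<lhd> Z k)"
    by (simp add: gin_left_def gr_arr_gin_cont interchange gr_braid_gin_Hom(2))
  have d: "?d \<cdot> (gin_right Y X Z j i k \<cdot> k') = gin_right Y Z X j k i \<cdot> ((Y j \<rhd> \<c> (X i) (Z k)) \<cdot> k')"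
    if "k' \<in> Arr C" "Cod C k' = Y j \<odot> (X i \<odot> Z k)" for k'
    using that by (simp add: gin_right_def gr_arr_gin_cont interchange_cont gr_braid_gin_Hom(2))
  have "(?d \<cdot> (?e \<cdot> ?f)) \<cdot> gin_left X Y Z i j k = ?d \<cdot> (?e \<cdot> (gin_left Y X Z j i k \<cdot> (\<c> (X i) (Y j) \<lhd> Z k)))"
    by (simp add: f[unfolded n'])
  also have "\<dots> = gin_right Y Z X j k i \<cdot>
      ((Y j \<rhd> \<c> (X i) (Z k)) \<cdot> (\<alpha> (Y j) (X i) (Z k) \<cdot> (\<c> (X i) (Y j) \<lhd> Z k)))"
    by (subst gr_assoc_gin_cont) (simp_all add: d[unfolded n'])
  finally show "(?a \<cdot> (?c \<cdot> ?b)) \<cdot> gin_left X Y Z i j k = (?d \<cdot> (?e \<cdot> ?f)) \<cdot> gin_left X Y Z i j k"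
    unfolding l by simp
qed simp_all

lemma gr_hexagon2:
  assumes [simp]: "gob X" "gob Y" "gob Z"
  shows "inv_arr C (gr_assoc C H Z X Y n) \<cdot> (gr_braid C H (X \<diamond> Y) Z n \<cdot> inv_arr C (gr_assoc C H X Y Z n)) =
    gr_arr C H (gr_braid C H X Z) (\<lambda>n. Idt C (Y n)) n \<cdot>
      (inv_arr C (gr_assoc C H X Z Y n) \<cdot> gr_arr C H (\<lambda>n. Idt C (X n)) (gr_braid C H Y Z) n)"
    (is "?a \<cdot> (?c \<cdot> ?b) = ?d \<cdot> (?e \<cdot> ?f)")
proof (rule graded_epi_right[of X Y Z])
  fix i j k assume n: "i + j + k = n"
  note n' = n[symmetric, unfolded add.assoc]
  note [simp] = n' add.assoc add.commute add.left_commute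
  have inv_cont: "inv_arr C (gr_assoc C H U V W m) \<cdot> (gin_right U V W p q r \<cdot> k') =
      gin_left U V W p q r \<cdot> (\<alpha>\<^sup>- (U p) (V q) (W r) \<cdot> k')"
    if "gob U" "gob V" "gob W" "p + q + r = m" "k' \<in> Arr C" "Cod C k' = U p \<odot> (V q \<odot> W r)" for U V W m p q r k'
    by (rule comp_eq_cont[OF inv_gr_assoc_gin[OF that(1-4)]]) (use that in auto)
  have "?c \<cdot> gin_left X Y Z i j k = gin Z (X \<diamond> Y) k (i + j) \<cdot> (\<c> ((X \<diamond> Y) (i + j)) (Z k) \<cdot> (gin X Y i j \<lhd> Z k))"
    by (simp add: gin_left_def gr_braid_gin_cont)
  also have "\<dots> = gin_right Z X Y k i j \<cdot> \<c> (X i \<odot> Y j) (Z k)"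
    by (simp add: gin_right_def braid_natural)
  finally have c: "?c \<cdot> gin_left X Y Z i j k = gin_right Z X Y k i j \<cdot> \<c> (X i \<odot> Y j) (Z k)" .
  have "(?a \<cdot> (?c \<cdot> ?b)) \<cdot> gin_right X Y Z i j k = ?a \<cdot> ((?c \<cdot> gin_left X Y Z i j k) \<cdot> \<alpha>\<^sup>- (X i) (Y j) (Z k))"
    by (simp add: inv_gr_assoc_gin)
  also have "\<dots> = gin_left Z X Y k i j \<cdot> (\<alpha>\<^sup>- (Z k) (X i) (Y j) \<cdot> (\<c> (X i \<odot> Y j) (Z k) \<cdot> \<alpha>\<^sup>- (X i) (Y j) (Z k)))"
    unfolding c by (simp add: inv_cont)
  also have "\<alpha>\<^sup>- (Z k) (X i) (Y j) \<cdot> (\<c> (X i \<odot> Y j) (Z k) \<cdot> \<alpha>\<^sup>- (X i) (Y j) (Z k)) =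
      (\<c> (X i) (Z k) \<lhd> Y j) \<cdot> (\<alpha>\<^sup>- (X i) (Z k) (Y j) \<cdot> (X i \<rhd> \<c> (Y j) (Z k)))"
    by (simp add: braid_tensor_left)
  finally have l: "(?a \<cdot> (?c \<cdot> ?b)) \<cdot> gin_right X Y Z i j k = gin_left Z X Y k i j \<cdot>
      ((\<c> (X i) (Z k) \<lhd> Y j) \<cdot> (\<alpha>\<^sup>- (X i) (Z k) (Y j) \<cdot> (X i \<rhd> \<c> (Y j) (Z k))))" .
  have f: "?f \<cdot> gin_right X Y Z i j k = gin_right X Z Y i k j \<cdot> (X i \<rhd> \<c> (Y j) (Z k))"
    by (simp add: gin_right_def gr_arr_gin_cont interchange gr_braid_gin_Hom(2))
  have d: "?d \<cdot> (gin_left X Z Y i k j \<cdot> k') = gin_left Z X Y k i j \<cdot> ((\<c> (X i) (Z k) \<lhd> Y j) \<cdot> k')"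
    if "k' \<in> Arr C" "Cod C k' = (X i \<odot> Z k) \<odot> Y j" for k'
    using that by (simp add: gin_left_def gr_arr_gin_cont interchange_cont gr_braid_gin_Hom(2))
  have "(?d \<cdot> (?e \<cdot> ?f)) \<cdot> gin_right X Y Z i j k = ?d \<cdot> (?e \<cdot> (gin_right X Z Y i k j \<cdot> (X i \<rhd> \<c> (Y j) (Z k))))"
    by (simp add: f[unfolded n'])
  also have "\<dots> = gin_left Z X Y k i j \<cdot>
      ((\<c> (X i) (Z k) \<lhd> Y j) \<cdot> (\<alpha>\<^sup>- (X i) (Z k) (Y j) \<cdot> (X i \<rhd> \<c> (Y j) (Z k))))"
    by (subst inv_cont) (simp_all add: d[unfolded n'])
  finally show "(?a \<cdot> (?c \<cdot> ?b)) \<cdot> gin_right X Y Z i j k = (?d \<cdot> (?e \<cdot> ?f)) \<cdot> gin_right X Y Z i j k"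
    unfolding l by simp
qed simp_all

lemma category_graded: "category \<G>"
  by unfold_locales (auto simp: in_Hom fun_eq_iff)

lemma monoidal_graded: "monoidal_category \<G>"
proof -
  show ?thesis
  proof (intro monoidal_category.intro[OF category_graded] monoidal_category_axioms.intro)
    show "f \<boxtimes>\<^bsub>\<G>\<^esub> g \<in> Hom \<G> (X \<odot>\<^bsub>\<G>\<^esub> Y) (X' \<odot>\<^bsub>\<G>\<^esub> Y')" if "f \<in> Hom \<G> X X'" "g \<in> Hom \<G> Y Y'" for f g X X' Y Y'
      using that by (auto simp: in_Hom)
    show "(f' \<cdot>\<^bsub>\<G>\<^esub> f) \<boxtimes>\<^bsub>\<G>\<^esub> (g' \<cdot>\<^bsub>\<G>\<^esub> g) = (f' \<boxtimes>\<^bsub>\<G>\<^esub> g') \<cdot>\<^bsub>\<G>\<^esub> (f \<boxtimes>\<^bsub>\<G>\<^esub> g)"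
      if "f \<in> Hom \<G> X X'" "f' \<in> Hom \<G> X' X''" "g \<in> Hom \<G> Y Y'" "g' \<in> Hom \<G> Y' Y''" for f f' g g' X X' X'' Y Y' Y''
      using that by (auto simp: Hom_graded in_Hom fun_eq_iff gr_arr_comp)
    show "Assoc \<G> X' Y' Z' \<cdot>\<^bsub>\<G>\<^esub> ((f \<boxtimes>\<^bsub>\<G>\<^esub> g) \<boxtimes>\<^bsub>\<G>\<^esub> h) = (f \<boxtimes>\<^bsub>\<G>\<^esub> (g \<boxtimes>\<^bsub>\<G>\<^esub> h)) \<cdot>\<^bsub>\<G>\<^esub> Assoc \<G> X Y Z"
      if "f \<in> Hom \<G> X X'" "g \<in> Hom \<G> Y Y'" "h \<in> Hom \<G> Z Z'" for f g h X X' Y Y' Z Z'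
      using that gr_assoc_natural[of f g h] by (auto simp: in_Hom fun_eq_iff)
    show "LUnit \<G> Y \<cdot>\<^bsub>\<G>\<^esub> (Idt \<G> (TUnit \<G>) \<boxtimes>\<^bsub>\<G>\<^esub> f) = f \<cdot>\<^bsub>\<G>\<^esub> LUnit \<G> X"
      "RUnit \<G> Y \<cdot>\<^bsub>\<G>\<^esub> (f \<boxtimes>\<^bsub>\<G>\<^esub> Idt \<G> (TUnit \<G>)) = f \<cdot>\<^bsub>\<G>\<^esub> RUnit \<G> X" if "f \<in> Hom \<G> X Y" for f X Y
      using that gr_unit_natural[of f] by (auto simp: in_Hom fun_eq_iff)
  qed (auto simp: in_Hom fun_eq_iff gr_arr_Idt iso_arr_graded gr_pentagon gr_triangle)
qed

lemma braided_graded: "braided_monoidal_category \<G>"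
proof (intro braided_monoidal_category.intro[OF monoidal_graded] braided_monoidal_category_axioms.intro)
  show "Braid \<G> X' Y' \<cdot>\<^bsub>\<G>\<^esub> (f \<boxtimes>\<^bsub>\<G>\<^esub> g) = (g \<boxtimes>\<^bsub>\<G>\<^esub> f) \<cdot>\<^bsub>\<G>\<^esub> Braid \<G> X Y"
    if "f \<in> Hom \<G> X X'" "g \<in> Hom \<G> Y Y'" for f g X X' Y Y'
    using that gr_braid_natural[of f g] by (auto simp: in_Hom fun_eq_iff)
qed (auto simp: in_Hom fun_eq_iff iso_arr_graded inv_arr_graded gr_hexagon1 gr_hexagon2)

lemma in_Hom_graded:
  "f \<in> Hom \<G> X Y \<longleftrightarrow> (\<forall>n. f n \<in> Arr C) \<and> (\<forall>n. Dom C (f n) = X n) \<and> (\<forall>n. Cod C (f n) = Y n)"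
  unfolding Hom_graded by (auto simp: in_Hom)

abbreviation gin0 where "gin0 X Y \<equiv> gin X Y 0 0"

lemma iso_gin0:
  assumes [simp]: "gob X" "gob Y"
  shows "iso_arr C (gin0 X Y)" "inv_arr C (gin0 X Y) = gr_pr C H X Y 0 0"
proof -
  note ds = gr_direct_sum[OF assms, of 0]
  have "(X \<diamond> Y) 0 \<in> Obj C"
    by simp
  then interpret comm_group "H ((X \<diamond> Y) 0) ((X \<diamond> Y) 0)"
    by (intro Hom_group)
  have "gr_in C H X Y 0 0 \<cdot> gr_pr C H X Y 0 0 \<in> carrier (H ((X \<diamond> Y) 0) ((X \<diamond> Y) 0))"
    using Comp_Hom[OF direct_sum_arr(3)[OF ds, of 0] direct_sum_arr(2)[OF ds, of 0]]
    by (simp add: Hom_carrier)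
  then have "inverse_arrows C (gin0 X Y) (gr_pr C H X Y 0 0)"
    using ds by (auto simp: inverse_arrows_def is_direct_sum_def gin_def in_Hom)
  then show "iso_arr C (gin0 X Y)" "inv_arr C (gin0 X Y) = gr_pr C H X Y 0 0"
    using inv_arr_eqI by (auto simp: iso_arr_def)
qed

declare iso_gin0(1) [simp]

definition concentrated :: "(nat \<Rightarrow> 'o) \<Rightarrow> bool" where
  "concentrated X \<longleftrightarrow> gob X \<and> (\<forall>n. n \<noteq> 0 \<longrightarrow> is_zero_obj C (X n))"

lemma concentrated_deg0 [simp]: "B \<in> Obj C \<Longrightarrow> concentrated (gr_deg0 C B)"
  by (simp add: concentrated_def is_zero_obj_deg0)

lemma concentrated_tensor:
  assumes "concentrated X" "concentrated Y"
  shows "concentrated (X \<diamond> Y)"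
proof -
  have [simp]: "gob X" "gob Y"
    using assms by (simp_all add: concentrated_def)
  have "is_zero_obj C ((X \<diamond> Y) n)" if "n \<noteq> 0" for n
  proof -
    have "Idt C ((X \<diamond> Y) n) = \<zero>\<^sub>H ((X \<diamond> Y) n) ((X \<diamond> Y) n)"
    proof (rule graded_epi[of X Y _ _ n])
      fix i j assume n: "i + j = n"
      with \<open>n \<noteq> 0\<close> have "i \<noteq> 0 \<or> j \<noteq> 0"
        by linarith
      then have "is_zero_obj C (X i \<odot> Y j)"
        using assms is_zero_obj_tensor by (auto simp: concentrated_def)
      then show "Idt C ((X \<diamond> Y) n) \<cdot> gin X Y i j = \<zero>\<^sub>H ((X \<diamond> Y) n) ((X \<diamond> Y) n) \<cdot> gin X Y i j"
        by (rule zero_obj_eq) (simp_all add: n)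
    qed simp_all
    then show ?thesis
      by (simp add: is_zero_obj_iff)
  qed
  then show ?thesis
    by (simp add: concentrated_def)
qed

lemma concentrated_eq:
  assumes "concentrated X \<or> concentrated Y" "f \<in> Hom \<G> X Y" "g \<in> Hom \<G> X Y" "f 0 = g 0"
  shows "f = g"
proof
  fix n show "f n = g n"
  proof (cases "n = 0")
    case False
    then have "is_zero_obj C (X n) \<or> is_zero_obj C (Y n)"
      using assms(1) by (auto simp: concentrated_def)
    then show ?thesis
      using assms(2,3) zero_obj_eq[of "X n" "f n" "g n"] zero_obj_eq[of "Y n" "f n" "g n"]
      by (auto simp: in_Hom_graded)
  qed (use assms(4) in simp)
qed

definition deg0_arr :: "(nat \<Rightarrow> 'o) \<Rightarrow> (nat \<Rightarrow> 'o) \<Rightarrow> 'a \<Rightarrow> nat \<Rightarrow> 'a" where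
  "deg0_arr X Y f n = (if n = 0 then f else \<zero>\<^sub>H (X n) (Y n))"

lemma deg0_arr_Hom:
  assumes "gob X" "gob Y" "f \<in> Hom C (X 0) (Y 0)"
  shows "deg0_arr X Y f \<in> Hom \<G> X Y" "deg0_arr X Y f 0 = f"
  using assms unfolding in_Hom_graded in_Hom by (auto simp: deg0_arr_def)

lemma gob_dual [simp]: "gob X \<Longrightarrow> gr_dual C X n \<in> Obj C"
  by (simp add: gr_dual_def)

lemma gr_dual_0 [simp]: "gr_dual C X 0 = (X 0)\<^sup>\<star>"
  by (simp add: gr_dual_def)

lemma gr_ev_arr [simp]:
  assumes "gob X"
  shows "gr_ev C H X n \<in> Arr C" "Dom C (gr_ev C H X n) = (gr_dual C X \<diamond> X) n" "Cod C (gr_ev C H X n) = gr_deg0 C \<I> n"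
  using assms gob_dual[OF assms] by (auto simp: gr_ev_def gr_pr_arr gr_deg0_def)

lemma gr_ev_gin0:
  assumes [simp]: "gob X"
  shows "gr_ev C H X 0 \<cdot> gin0 (gr_dual C X) X = ev (X 0)"
proof -
  have "gr_ev C H X 0 \<cdot> gin0 (gr_dual C X) X = (ev (X 0) \<cdot> inv_arr C (gin0 (gr_dual C X) X)) \<cdot> gin0 (gr_dual C X) X"
    by (simp only: gr_ev_def iso_gin0 assms gob_dual simp_thms if_True)
  also have "\<dots> = ev (X 0)"
    by simp
  finally show ?thesis .
qed

lemma gr_ev_whisker0:
  assumes "gob X" "\<forall>n. u n \<in> Arr C" "\<forall>n. f n \<in> Arr C"
    "\<And>n. Cod C (u n) = gr_dual C X n" "\<And>n. Cod C (f n) = X n" "\<And>n. Dom C (u n) = T n" "\<And>n. Dom C (f n) = Y n"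
  shows "gr_ev C H X 0 \<cdot> (gr_arr C H u f 0 \<cdot> gin0 T Y) = ev (X 0) \<cdot> (u 0 \<boxtimes> f 0)"
proof -
  have gob: "gob T" "gob Y"
    using assms Dom_Obj by metis+
  have "gr_ev C H X 0 \<cdot> (gr_arr C H u f 0 \<cdot> gin0 T Y) = (gr_ev C H X 0 \<cdot> gin0 (gr_dual C X) X) \<cdot> (u 0 \<boxtimes> f 0)"
    using assms gob by (simp add: gr_arr_gin)
  then show ?thesis
    using assms by (simp add: gr_ev_gin0)
qed

lemma gr_ev_bij:
  assumes X [simp]: "gob X" and T [simp]: "gob T"
  shows "bij_betw (\<lambda>u. Ev \<G> X \<cdot>\<^bsub>\<G>\<^esub> (u \<boxtimes>\<^bsub>\<G>\<^esub> Idt \<G> X)) (Hom \<G> T (Dual \<G> X)) (Hom \<G> (T \<odot>\<^bsub>\<G>\<^esub> X) (TUnit \<G>))"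
proof -
  let ?\<phi> = "\<lambda>u n. gr_ev C H X n \<cdot> gr_arr C H u (\<lambda>n. Idt C (X n)) n"
  let ?A = "Hom \<G> T (gr_dual C X)" and ?B = "Hom \<G> (T \<diamond> X) (gr_deg0 C \<I>)"
  have \<phi>: "?\<phi> u \<in> ?B" if "u \<in> ?A" for u
    using that by (simp add: in_Hom_graded)
  have \<phi>0: "?\<phi> u 0 \<cdot> gin0 T X = ev (X 0) \<cdot> (u 0 \<lhd> X 0)" if "u \<in> ?A" for u
  proof -
    have u: "u n \<in> Arr C" "Dom C (u n) = T n" "Cod C (u n) = gr_dual C X n" for n
      using that by (simp_all add: in_Hom_graded)
    show ?thesis
      using gr_ev_whisker0[of X u "\<lambda>n. Idt C (X n)" T X] u by simp
  qed
  have "bij_betw ?\<phi> ?A ?B"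
  proof (rule bij_betw_imageI)
    show "inj_on ?\<phi> ?A"
    proof (rule inj_onI)
      fix u v assume u: "u \<in> ?A" and v: "v \<in> ?A" and eq: "?\<phi> u = ?\<phi> v"
      have "u 0 \<in> Hom C (T 0) ((X 0)\<^sup>\<star>)" "v 0 \<in> Hom C (T 0) ((X 0)\<^sup>\<star>)"
        using u v by (metis Hom_graded gr_dual_0)+
      moreover have "ev (X 0) \<cdot> (u 0 \<lhd> X 0) = ev (X 0) \<cdot> (v 0 \<lhd> X 0)"
        using \<phi>0[OF u] \<phi>0[OF v] fun_cong[OF eq, of 0] by simp
      ultimately have "u 0 = v 0"
        using X by (intro ev_faithful[of "X 0" "u 0" "T 0" "v 0"]) auto
      then show "u = v"
        using u v by (intro concentrated_eq[of T "gr_dual C X"]) (simp_all add: gr_dual_def)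
    qed
    show "?\<phi> ` ?A = ?B"
    proof (intro equalityI subsetI)
      fix t assume t: "t \<in> ?B"
      then have t0 [simp]: "t 0 \<in> Arr C" "Dom C (t 0) = (T \<diamond> X) 0" "Cod C (t 0) = \<I>"
        by (simp_all add: in_Hom_graded)
      define u where "u = deg0_arr T (gr_dual C X) (dag C (T 0) (X 0) (t 0 \<cdot> gin0 T X))"
      have u: "u \<in> ?A" "u 0 = dag C (T 0) (X 0) (t 0 \<cdot> gin0 T X)"
        unfolding u_def by (rule deg0_arr_Hom; simp add: in_Hom)+
      have "?\<phi> u 0 \<cdot> gin0 T X = t 0 \<cdot> gin0 T X"
        unfolding \<phi>0[OF u(1)] u(2) by (simp add: ev_dag)
      moreover have "?\<phi> u 0 \<in> Hom C ((T \<diamond> X) 0) \<I>"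
        using \<phi>[OF u(1)] unfolding Hom_graded by (metis gr_deg0_0)
      ultimately have "?\<phi> u 0 = t 0"
        by (intro iso_cancel_right[of "gin0 T X" "?\<phi> u 0" "t 0"]) (auto simp: in_Hom)
      then have "?\<phi> u = t"
        using \<phi>[OF u(1)] t by (intro concentrated_eq[of "T \<diamond> X" "gr_deg0 C \<I>"]) simp_all
      with u(1) show "t \<in> ?\<phi> ` ?A"
        by blast
    qed (use \<phi> in blast)
  qed
  then show ?thesis
    by simp
qed

lemma prerigid_graded: "prerigid_braided_category \<G>"
proof (intro prerigid_braided_category.intro[OF braided_graded] prerigid_braided_category_axioms.intro)
  show "bij_betw (\<lambda>u. Ev \<G> X \<cdot>\<^bsub>\<G>\<^esub> (u \<boxtimes>\<^bsub>\<G>\<^esub> Idt \<G> X)) (Hom \<G> T (Dual \<G> X)) (Hom \<G> (T \<odot>\<^bsub>\<G>\<^esub> X) (TUnit \<G>))"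
    if "X \<in> Obj \<G>" "T \<in> Obj \<G>" for X T
    using that by (intro gr_ev_bij) simp_all
qed (auto simp: in_Hom_graded)

end

sublocale graded_setting \<subseteq> G: prerigid_braided_category "graded C H"
  by (rule prerigid_graded)

context graded_setting
begin

lemma dag_graded0:
  assumes [simp]: "gob T" "gob X" and t: "t \<in> Hom \<G> (T \<diamond> X) (gr_deg0 C \<I>)"
  shows "dag \<G> T X t 0 = dag C (T 0) (X 0) (t 0 \<cdot> gin0 T X)"
proof (rule ev_eqI[where X = "X 0"])
  let ?u = "dag \<G> T X t"
  have u: "?u \<in> Hom \<G> T (gr_dual C X)" and ev_u: "Ev \<G> X \<cdot>\<^bsub>\<G>\<^esub> (?u \<boxtimes>\<^bsub>\<G>\<^esub> Idt \<G> X) = t"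
    using G.dag_Hom[of X T t] t by simp_all
  have arr: "?u n \<in> Arr C" "Dom C (?u n) = T n" "Cod C (?u n) = gr_dual C X n" for n
    using u by (simp_all add: in_Hom_graded)
  have t0 [simp]: "t 0 \<in> Arr C" "Dom C (t 0) = (T \<diamond> X) 0" "Cod C (t 0) = \<I>"
    using t by (simp_all add: in_Hom_graded)
  show "?u 0 \<in> Arr C" "Dom C (?u 0) = Dom C (dag C (T 0) (X 0) (t 0 \<cdot> gin0 T X))" "Cod C (?u 0) = (X 0)\<^sup>\<star>"
    "dag C (T 0) (X 0) (t 0 \<cdot> gin0 T X) \<in> Arr C" "Cod C (dag C (T 0) (X 0) (t 0 \<cdot> gin0 T X)) = (X 0)\<^sup>\<star>"
    by (simp_all add: arr)
  have "t 0 \<cdot> gin0 T X = gr_ev C H X 0 \<cdot> (gr_arr C H ?u (\<lambda>n. Idt C (X n)) 0 \<cdot> gin0 T X)"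
    using fun_cong[OF ev_u, of 0] arr by (simp flip: comp_assoc)
  also have "\<dots> = ev (X 0) \<cdot> (?u 0 \<lhd> X 0)"
    using gr_ev_whisker0[of X ?u "\<lambda>n. Idt C (X n)" T X] arr by simp
  finally have "t 0 \<cdot> gin0 T X = ev (X 0) \<cdot> (?u 0 \<lhd> X 0)" .
  moreover have "ev (X 0) \<cdot> (dag C (T 0) (X 0) (t 0 \<cdot> gin0 T X) \<lhd> X 0) = t 0 \<cdot> gin0 T X"
    by (simp add: ev_dag)
  ultimately show "ev (X 0) \<cdot> (?u 0 \<lhd> X 0) = ev (X 0) \<cdot> (dag C (T 0) (X 0) (t 0 \<cdot> gin0 T X) \<lhd> X 0)"
    by simp
qed simp

lemma dual_arr_graded0:
  assumes f: "f \<in> Hom \<G> X Y"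
  shows "AMap (dual_functor \<G>) f 0 = dual_arr (f 0)"
proof -
  have arr [simp]: "f n \<in> Arr C" "Dom C (f n) = X n" "Cod C (f n) = Y n" for n
    using f by (simp_all add: in_Hom_graded)
  have [simp]: "gob X" "gob Y"
    using Dom_Obj Cod_Obj arr by metis+
  let ?t = "\<lambda>n. gr_ev C H Y n \<cdot> gr_arr C H (\<lambda>n. Idt C (gr_dual C Y n)) f n"
  have "AMap (dual_functor \<G>) f 0 = dag \<G> (gr_dual C Y) X ?t 0"
    by (simp add: dual_functor_def)
  also have "\<dots> = dag C ((Y 0)\<^sup>\<star>) (X 0) (?t 0 \<cdot> gin0 (gr_dual C Y) X)"
    by (subst dag_graded0) (simp_all add: in_Hom_graded)
  also have "?t 0 \<cdot> gin0 (gr_dual C Y) X = ev (Y 0) \<cdot> ((Y 0)\<^sup>\<star> \<rhd> f 0)"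
    using gr_ev_whisker0[of Y "\<lambda>n. Idt C (gr_dual C Y n)" f "gr_dual C Y" X] by simp
  finally show ?thesis
    by (simp add: dual_functor_def)
qed

lemma mid_pairing_graded0:
  assumes [simp]: "gob X" "gob Y"
  defines "X' \<equiv> gr_dual C X" and "Y' \<equiv> gr_dual C Y"
  shows "mid_pairing \<G> X Y 0 \<cdot> (gin0 (X' \<diamond> Y') (X \<diamond> Y) \<cdot> (gin0 X' Y' \<boxtimes> gin0 X Y)) = mid_pairing C (X 0) (Y 0)"
proof -
  have [simp]: "gob X'" "gob Y'" "X' 0 = (X 0)\<^sup>\<star>" "Y' 0 = (Y 0)\<^sup>\<star>"
    by (simp_all add: X'_def Y'_def)
  let ?i = "\<lambda>X n. Idt C (X n)"
  let ?ci = "\<lambda>n. inv_arr C (gr_braid C H X Y' n)"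
  let ?a = "gr_assoc C H X' Y' (X \<diamond> Y) 0"
  let ?b = "gr_arr C H (?i X') (\<lambda>n. inv_arr C (gr_assoc C H Y' X Y n)) 0"
  let ?c = "gr_arr C H (?i X') (gr_arr C H ?ci (?i Y)) 0"
  let ?d = "gr_arr C H (?i X') (gr_assoc C H X Y' Y) 0"
  let ?e = "inv_arr C (gr_assoc C H X' X (Y' \<diamond> Y) 0)"
  let ?f = "gr_arr C H (gr_ev C H X) (gr_ev C H Y) 0"
  let ?g = "gr_lunit C H (gr_deg0 C \<I>) 0"
  let ?A = "(X 0)\<^sup>\<star>" and ?B = "(Y 0)\<^sup>\<star>"
  have inv: "inv_arr \<G> (gr_assoc C H U V W) = (\<lambda>n. inv_arr C (gr_assoc C H U V W n))"
    if "gob U" "gob V" "gob W" for U V W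
    using that by (simp add: inv_arr_graded)
  have inv': "inv_arr \<G> (gr_braid C H X Y') = ?ci"
    by (simp add: inv_arr_graded)
  have mid: "mid_pairing \<G> X Y 0 = ?g \<cdot> (?f \<cdot> (?e \<cdot> (?d \<cdot> (?c \<cdot> (?b \<cdot> ?a)))))"
    by (simp add: mid_pairing_def Let_def inv inv' X'_def[symmetric] Y'_def[symmetric])
  have ci: "?ci 0 \<cdot> gin0 Y' X = gin0 X Y' \<cdot> \<c>\<^sup>- (X 0) ?B"
    by (rule iso_cancel_left[of "gr_braid C H X Y' 0"]) (simp_all add: gr_braid_gin_cont)
  have A: "?a \<cdot> (gin0 (X' \<diamond> Y') (X \<diamond> Y) \<cdot> (gin0 X' Y' \<boxtimes> gin0 X Y)) =
      gin0 X' (Y' \<diamond> (X \<diamond> Y)) \<cdot> ((?A \<rhd> gin_right Y' X Y 0 0 0) \<cdot> \<alpha> ?A ?B (X 0 \<odot> Y 0))"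
  proof -
    have "?a \<cdot> (gin0 (X' \<diamond> Y') (X \<diamond> Y) \<cdot> (gin0 X' Y' \<boxtimes> gin0 X Y)) =
        ?a \<cdot> (gin_left X' Y' (X \<diamond> Y) 0 0 0 \<cdot> ((?A \<odot> ?B) \<rhd> gin0 X Y))"
      by (simp add: gin_left_def interchange)
    also have "\<dots> = gin_right X' Y' (X \<diamond> Y) 0 0 0 \<cdot> (\<alpha> ?A ?B ((X \<diamond> Y) 0) \<cdot> ((?A \<odot> ?B) \<rhd> gin0 X Y))"
      by (simp add: gr_assoc_gin_cont)
    also have "\<alpha> ?A ?B ((X \<diamond> Y) 0) \<cdot> ((?A \<odot> ?B) \<rhd> gin0 X Y) = (?A \<rhd> (?B \<rhd> gin0 X Y)) \<cdot> \<alpha> ?A ?B (X 0 \<odot> Y 0)"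
      using assoc_natural[of "Idt C ?A" "Idt C ?B" "gin0 X Y" ?A ?B "(X \<diamond> Y) 0"] by simp
    finally show ?thesis
      by (simp add: gin_right_def interchange_cont)
  qed
  have B: "?b \<cdot> (gin0 X' (Y' \<diamond> (X \<diamond> Y)) \<cdot> ((?A \<rhd> gin_right Y' X Y 0 0 0) \<cdot> k)) =
      gin0 X' (Y' \<diamond> X \<diamond> Y) \<cdot> ((?A \<rhd> gin_left Y' X Y 0 0 0) \<cdot> ((?A \<rhd> \<alpha>\<^sup>- ?B (X 0) (Y 0)) \<cdot> k))"
    if "k \<in> Arr C" "Cod C k = ?A \<odot> (?B \<odot> (X 0 \<odot> Y 0))" for k
    using that by (simp add: gr_arr_gin_cont interchange_cont inv_gr_assoc_gin)
  have c0: "gr_arr C H ?ci (?i Y) 0 \<cdot> gin_left Y' X Y 0 0 0 = gin_left X Y' Y 0 0 0 \<cdot> (\<c>\<^sup>- (X 0) ?B \<lhd> Y 0)"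
    by (simp add: gin_left_def gr_arr_gin_cont interchange ci)
  have Cc: "?c \<cdot> (gin0 X' (Y' \<diamond> X \<diamond> Y) \<cdot> ((?A \<rhd> gin_left Y' X Y 0 0 0) \<cdot> k)) =
      gin0 X' (X \<diamond> Y' \<diamond> Y) \<cdot> ((?A \<rhd> gin_left X Y' Y 0 0 0) \<cdot> ((?A \<rhd> (\<c>\<^sup>- (X 0) ?B \<lhd> Y 0)) \<cdot> k))"
    if "k \<in> Arr C" "Cod C k = ?A \<odot> (?B \<odot> X 0 \<odot> Y 0)" for k
    using that by (simp add: gr_arr_gin_cont interchange_cont c0)
  have D: "?d \<cdot> (gin0 X' (X \<diamond> Y' \<diamond> Y) \<cdot> ((?A \<rhd> gin_left X Y' Y 0 0 0) \<cdot> k)) =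
      gin_right X' X (Y' \<diamond> Y) 0 0 0 \<cdot> ((?A \<rhd> (X 0 \<rhd> gin0 Y' Y)) \<cdot> ((?A \<rhd> \<alpha> (X 0) ?B (Y 0)) \<cdot> k))"
    if "k \<in> Arr C" "Cod C k = ?A \<odot> (X 0 \<odot> ?B \<odot> Y 0)" for k
    using that by (simp add: gr_arr_gin_cont interchange_cont gr_assoc_gin_Hom(2) gin_right_def)
  have E: "?e \<cdot> (gin_right X' X (Y' \<diamond> Y) 0 0 0 \<cdot> ((?A \<rhd> (X 0 \<rhd> gin0 Y' Y)) \<cdot> k)) =
      gin0 (X' \<diamond> X) (Y' \<diamond> Y) \<cdot> ((gin0 X' X \<boxtimes> gin0 Y' Y) \<cdot> (\<alpha>\<^sup>- ?A (X 0) (?B \<odot> Y 0) \<cdot> k))"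
    if "k \<in> Arr C" "Cod C k = ?A \<odot> (X 0 \<odot> (?B \<odot> Y 0))" for k
  proof -
    have "?e \<cdot> (gin_right X' X (Y' \<diamond> Y) 0 0 0 \<cdot> ((?A \<rhd> (X 0 \<rhd> gin0 Y' Y)) \<cdot> k)) =
        (gin_left X' X (Y' \<diamond> Y) 0 0 0 \<cdot> \<alpha>\<^sup>- ?A (X 0) ((Y' \<diamond> Y) 0)) \<cdot> ((?A \<rhd> (X 0 \<rhd> gin0 Y' Y)) \<cdot> k)"
      using that inv_gr_assoc_gin[of X' X "Y' \<diamond> Y" 0 0 0 0] by (simp flip: comp_assoc)
    also have "\<dots> = gin_left X' X (Y' \<diamond> Y) 0 0 0 \<cdot> (((?A \<odot> X 0) \<rhd> gin0 Y' Y) \<cdot> (\<alpha>\<^sup>- ?A (X 0) (?B \<odot> Y 0) \<cdot> k))"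
      using that assoc_inv_natural_cont[of "Idt C ?A" "Idt C (X 0)" "gin0 Y' Y" ?A "X 0" "(Y' \<diamond> Y) 0" k] by simp
    finally show ?thesis
      using that by (simp add: gin_left_def interchange_cont)
  qed
  have F: "?f \<cdot> (gin0 (X' \<diamond> X) (Y' \<diamond> Y) \<cdot> ((gin0 X' X \<boxtimes> gin0 Y' Y) \<cdot> k)) =
      gin0 (gr_deg0 C \<I>) (gr_deg0 C \<I>) \<cdot> ((ev (X 0) \<boxtimes> ev (Y 0)) \<cdot> k)"
    if "k \<in> Arr C" "Cod C k = (?A \<odot> X 0) \<odot> (?B \<odot> Y 0)" for k
    using that gr_ev_gin0[of X] gr_ev_gin0[of Y]
    by (simp add: gr_arr_gin_cont interchange_cont X'_def[symmetric] Y'_def[symmetric])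
  have G: "?g \<cdot> (gin0 (gr_deg0 C \<I>) (gr_deg0 C \<I>) \<cdot> k) = \<l> \<I> \<cdot> k" if "k \<in> Arr C" "Cod C k = \<I> \<odot> \<I>" for k
    using that comp_assoc[of k "gin0 (gr_deg0 C \<I>) (gr_deg0 C \<I>)" ?g] gr_unit_gin(1)[of "gr_deg0 C \<I>" 0]
    by (simp del: comp_assoc)
  have "mid_pairing \<G> X Y 0 \<cdot> (gin0 (X' \<diamond> Y') (X \<diamond> Y) \<cdot> (gin0 X' Y' \<boxtimes> gin0 X Y)) =
      ?g \<cdot> (?f \<cdot> (?e \<cdot> (?d \<cdot> (?c \<cdot> (?b \<cdot> (?a \<cdot> (gin0 (X' \<diamond> Y') (X \<diamond> Y) \<cdot> (gin0 X' Y' \<boxtimes> gin0 X Y))))))))"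
    unfolding mid by (simp add: X'_def[symmetric] Y'_def[symmetric])
  also have "\<dots> = mid_pairing C (X 0) (Y 0)"
    unfolding A by (simp add: B Cc D E F G mid_pairing_def Let_def)
  finally show ?thesis .
qed

lemma mid_pairing_graded_Hom:
  assumes "gob X" "gob Y"
  shows "mid_pairing \<G> X Y \<in> Hom \<G> ((gr_dual C X \<diamond> gr_dual C Y) \<diamond> (X \<diamond> Y)) (gr_deg0 C \<I>)"
  using G.mid_arr[of "gr_dual C X" X "Ev \<G> X" "gr_dual C Y" Y "Ev \<G> Y"] assms G.Ev_Hom[of X] G.Ev_Hom[of Y]
  by (simp add: G.mid_pairing_eq_mid in_Hom)

lemma dual2_graded0:
  assumes [simp]: "gob X" "gob Y"
  shows "dual_arr (gin0 X Y) \<cdot> (dual2 \<G> X Y 0 \<cdot> gin0 (gr_dual C X) (gr_dual C Y)) = \<phi>\<^sub>2 (X 0) (Y 0)"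
proof (rule ev_eqI[where X = "X 0 \<odot> Y 0"])
  let ?X' = "gr_dual C X" and ?Y' = "gr_dual C Y"
  let ?t = "mid_pairing \<G> X Y 0 \<cdot> gin0 (?X' \<diamond> ?Y') (X \<diamond> Y)"
  note Hom = mid_pairing_graded_Hom[OF assms]
  have [simp]: "mid_pairing \<G> X Y 0 \<in> Arr C" "Dom C (mid_pairing \<G> X Y 0) = ((?X' \<diamond> ?Y') \<diamond> (X \<diamond> Y)) 0"
      "Cod C (mid_pairing \<G> X Y 0) = \<I>"
    using Hom by (simp_all add: in_Hom_graded)
  have eq: "dual2 \<G> X Y 0 = dag C ((?X' \<diamond> ?Y') 0) ((X \<diamond> Y) 0) ?t"
    using dag_graded0[OF _ _ Hom] by (simp add: dual2_def)
  then show "ev (X 0 \<odot> Y 0) \<cdot> ((dual_arr (gin0 X Y) \<cdot> (dual2 \<G> X Y 0 \<cdot> gin0 ?X' ?Y')) \<lhd> (X 0 \<odot> Y 0)) =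
      ev (X 0 \<odot> Y 0) \<cdot> (\<phi>\<^sub>2 (X 0) (Y 0) \<lhd> (X 0 \<odot> Y 0))"
    using mid_pairing_graded0[OF assms]
    by (simp add: ev_dual_comp ev_dag_comp ev_dual2 mid_pairing_eq_mid)
  show "dual_arr (gin0 X Y) \<cdot> (dual2 \<G> X Y 0 \<cdot> gin0 ?X' ?Y') \<in> Arr C"
    "Dom C (dual_arr (gin0 X Y) \<cdot> (dual2 \<G> X Y 0 \<cdot> gin0 ?X' ?Y')) = Dom C (\<phi>\<^sub>2 (X 0) (Y 0))"
    "Cod C (dual_arr (gin0 X Y) \<cdot> (dual2 \<G> X Y 0 \<cdot> gin0 ?X' ?Y')) = (X 0 \<odot> Y 0)\<^sup>\<star>"
    by (simp_all add: eq)
qed simp_all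

lemma dual0_graded0: "dual0 \<G> 0 = \<phi>\<^sub>0"
proof -
  have "gr_lunit C H (gr_deg0 C \<I>) \<in> Hom \<G> (gr_deg0 C \<I> \<diamond> gr_deg0 C \<I>) (gr_deg0 C \<I>)"
    by (simp add: in_Hom_graded)
  then show ?thesis
    using gr_unit_gin(1)[of "gr_deg0 C \<I>" 0] by (simp add: dual0_def dag_graded0)
qed

end

section \<open>Reduction to degree \<open>0\<close>\<close>

context graded_setting
begin

definition deg0_alg :: "(nat \<Rightarrow> 'o, nat \<Rightarrow> 'a) triple \<Rightarrow> ('o, 'a) triple" where
  "deg0_alg = (\<lambda>(A, m, u). (A 0, m 0 \<cdot> gin0 A A, u 0))"

definition deg0_coalg :: "(nat \<Rightarrow> 'o, nat \<Rightarrow> 'a) triple \<Rightarrow> ('o, 'a) triple" where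
  "deg0_coalg = (\<lambda>(V, d, e). (V 0, inv_arr C (gin0 V V) \<cdot> d 0, e 0))"

lemma algebra_deg0:
  assumes "is_algebra \<G> S"
  shows "is_algebra C (deg0_alg S)"
proof -
  obtain A m u where S: "S = (A, m, u)"
    by (cases S)
  have m: "m \<in> Hom \<G> (A \<diamond> A) A" and u: "u \<in> Hom \<G> (gr_deg0 C \<I>) A" and [simp]: "gob A"
    and eqs: "m \<cdot>\<^bsub>\<G>\<^esub> (m \<boxtimes>\<^bsub>\<G>\<^esub> Idt \<G> A) = m \<cdot>\<^bsub>\<G>\<^esub> (Idt \<G> A \<boxtimes>\<^bsub>\<G>\<^esub> m) \<cdot>\<^bsub>\<G>\<^esub> Assoc \<G> A A A"
      "m \<cdot>\<^bsub>\<G>\<^esub> (u \<boxtimes>\<^bsub>\<G>\<^esub> Idt \<G> A) = LUnit \<G> A" "m \<cdot>\<^bsub>\<G>\<^esub> (Idt \<G> A \<boxtimes>\<^bsub>\<G>\<^esub> u) = RUnit \<G> A"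
    using assms by (simp_all add: S is_algebra_def)
  have [simp]: "m n \<in> Arr C" "Dom C (m n) = (A \<diamond> A) n" "Cod C (m n) = A n"
    "u n \<in> Arr C" "Dom C (u n) = gr_deg0 C \<I> n" "Cod C (u n) = A n" for n
    using m u by (simp_all add: in_Hom_graded)
  let ?i = "gin_left A A A 0 0 0" and ?m = "m 0 \<cdot> gin0 A A"
  have "?m \<cdot> (?m \<lhd> A 0) = (m 0 \<cdot> gr_arr C H m (\<lambda>n. Idt C (A n)) 0) \<cdot> ?i"
    by (simp add: gin_left_def gr_arr_gin_cont interchange)
  also have "\<dots> = (m 0 \<cdot> gr_arr C H (\<lambda>n. Idt C (A n)) m 0 \<cdot> gr_assoc C H A A A 0) \<cdot> ?i"
    using fun_cong[OF eqs(1), of 0] by simp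
  also have "\<dots> = m 0 \<cdot> (gr_arr C H (\<lambda>n. Idt C (A n)) m 0 \<cdot> (gin_right A A A 0 0 0 \<cdot> \<alpha> (A 0) (A 0) (A 0)))"
    by (simp add: gr_assoc_gin_Hom(2))
  also have "\<dots> = ?m \<cdot> ((A 0 \<rhd> ?m) \<cdot> \<alpha> (A 0) (A 0) (A 0))"
    by (simp add: gin_right_def gr_arr_gin_cont interchange_cont)
  finally have assoc: "?m \<cdot> (?m \<lhd> A 0) = ?m \<cdot> ((A 0 \<rhd> ?m) \<cdot> \<alpha> (A 0) (A 0) (A 0))" .
  have "?m \<cdot> (u 0 \<lhd> A 0) = (m 0 \<cdot> gr_arr C H u (\<lambda>n. Idt C (A n)) 0) \<cdot> gin0 (gr_deg0 C \<I>) A"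
    by (simp add: gr_arr_gin)
  then have l: "?m \<cdot> (u 0 \<lhd> A 0) = \<l> (A 0)"
    using fun_cong[OF eqs(2), of 0] by (simp add: gr_unit_gin del: comp_assoc)
  have "?m \<cdot> (A 0 \<rhd> u 0) = (m 0 \<cdot> gr_arr C H (\<lambda>n. Idt C (A n)) u 0) \<cdot> gin0 A (gr_deg0 C \<I>)"
    by (simp add: gr_arr_gin)
  then have r: "?m \<cdot> (A 0 \<rhd> u 0) = \<r> (A 0)"
    using fun_cong[OF eqs(3), of 0] by (simp add: gr_unit_gin del: comp_assoc)
  show ?thesis
    using assoc l r by (simp add: S deg0_alg_def is_algebra_def in_Hom)
qed

lemma coalgebra_equations0:
  assumes [simp]: "gob V" and d: "d \<in> Hom \<G> V (V \<diamond> V)" and e: "e \<in> Hom \<G> V (gr_deg0 C \<I>)"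
  defines "d' \<equiv> inv_arr C (gin0 V V) \<cdot> d 0"
  shows "(Assoc \<G> V V V \<cdot>\<^bsub>\<G>\<^esub> (d \<boxtimes>\<^bsub>\<G>\<^esub> Idt \<G> V) \<cdot>\<^bsub>\<G>\<^esub> d) 0 =
      gin_right V V V 0 0 0 \<cdot> (\<alpha> (V 0) (V 0) (V 0) \<cdot> ((d' \<lhd> V 0) \<cdot> d'))"
    and "((Idt \<G> V \<boxtimes>\<^bsub>\<G>\<^esub> d) \<cdot>\<^bsub>\<G>\<^esub> d) 0 = gin_right V V V 0 0 0 \<cdot> ((V 0 \<rhd> d') \<cdot> d')"
    and "(LUnit \<G> V \<cdot>\<^bsub>\<G>\<^esub> (e \<boxtimes>\<^bsub>\<G>\<^esub> Idt \<G> V) \<cdot>\<^bsub>\<G>\<^esub> d) 0 = \<l> (V 0) \<cdot> ((e 0 \<lhd> V 0) \<cdot> d')"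
    and "(RUnit \<G> V \<cdot>\<^bsub>\<G>\<^esub> (Idt \<G> V \<boxtimes>\<^bsub>\<G>\<^esub> e) \<cdot>\<^bsub>\<G>\<^esub> d) 0 = \<r> (V 0) \<cdot> ((V 0 \<rhd> e 0) \<cdot> d')"
proof -
  have [simp]: "d n \<in> Arr C" "Dom C (d n) = V n" "Cod C (d n) = (V \<diamond> V) n"
    "e n \<in> Arr C" "Dom C (e n) = V n" "Cod C (e n) = gr_deg0 C \<I> n" for n
    using d e by (simp_all add: in_Hom_graded)
  have d'_arr [simp]: "d' \<in> Arr C" "Dom C d' = V 0" "Cod C d' = V 0 \<odot> V 0"
    by (simp_all add: d'_def)
  have d0: "d 0 = gin0 V V \<cdot> d'"
    by (simp add: d'_def)
  have "gr_arr C H d (\<lambda>n. Idt C (V n)) 0 \<cdot> d 0 = gin0 (V \<diamond> V) V \<cdot> ((d 0 \<lhd> V 0) \<cdot> d')"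
    by (simp add: d0 gr_arr_gin_cont)
  also have "\<dots> = gin_left V V V 0 0 0 \<cdot> ((d' \<lhd> V 0) \<cdot> d')"
    unfolding d0 by (simp add: gin_left_def whisker_comp)
  finally show "(Assoc \<G> V V V \<cdot>\<^bsub>\<G>\<^esub> (d \<boxtimes>\<^bsub>\<G>\<^esub> Idt \<G> V) \<cdot>\<^bsub>\<G>\<^esub> d) 0 =
      gin_right V V V 0 0 0 \<cdot> (\<alpha> (V 0) (V 0) (V 0) \<cdot> ((d' \<lhd> V 0) \<cdot> d'))"
    by (simp add: gr_assoc_gin_cont)
  have "gr_arr C H (\<lambda>n. Idt C (V n)) d 0 \<cdot> d 0 = gin0 V (V \<diamond> V) \<cdot> ((V 0 \<rhd> d 0) \<cdot> d')"
    by (simp add: d0 gr_arr_gin_cont)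
  also have "\<dots> = gin_right V V V 0 0 0 \<cdot> ((V 0 \<rhd> d') \<cdot> d')"
    unfolding d0 by (simp add: gin_right_def whisker_comp)
  finally show "((Idt \<G> V \<boxtimes>\<^bsub>\<G>\<^esub> d) \<cdot>\<^bsub>\<G>\<^esub> d) 0 = gin_right V V V 0 0 0 \<cdot> ((V 0 \<rhd> d') \<cdot> d')"
    by simp
  have "gr_arr C H e (\<lambda>n. Idt C (V n)) 0 \<cdot> d 0 = gin0 (gr_deg0 C \<I>) V \<cdot> ((e 0 \<lhd> V 0) \<cdot> d')"
    by (simp add: d0 gr_arr_gin_cont)
  then have "gr_lunit C H V 0 \<cdot> (gr_arr C H e (\<lambda>n. Idt C (V n)) 0 \<cdot> d 0) =
      (gr_lunit C H V 0 \<cdot> gin0 (gr_deg0 C \<I>) V) \<cdot> ((e 0 \<lhd> V 0) \<cdot> d')"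
    by simp
  then show "(LUnit \<G> V \<cdot>\<^bsub>\<G>\<^esub> (e \<boxtimes>\<^bsub>\<G>\<^esub> Idt \<G> V) \<cdot>\<^bsub>\<G>\<^esub> d) 0 = \<l> (V 0) \<cdot> ((e 0 \<lhd> V 0) \<cdot> d')"
    by (simp add: gr_unit_gin)
  have "gr_arr C H (\<lambda>n. Idt C (V n)) e 0 \<cdot> d 0 = gin0 V (gr_deg0 C \<I>) \<cdot> ((V 0 \<rhd> e 0) \<cdot> d')"
    by (simp add: d0 gr_arr_gin_cont)
  then have "gr_runit C H V 0 \<cdot> (gr_arr C H (\<lambda>n. Idt C (V n)) e 0 \<cdot> d 0) =
      (gr_runit C H V 0 \<cdot> gin0 V (gr_deg0 C \<I>)) \<cdot> ((V 0 \<rhd> e 0) \<cdot> d')"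
    by simp
  then show "(RUnit \<G> V \<cdot>\<^bsub>\<G>\<^esub> (Idt \<G> V \<boxtimes>\<^bsub>\<G>\<^esub> e) \<cdot>\<^bsub>\<G>\<^esub> d) 0 = \<r> (V 0) \<cdot> ((V 0 \<rhd> e 0) \<cdot> d')"
    by (simp add: gr_unit_gin)
qed

lemma coalgebra_deg0:
  assumes "is_coalgebra \<G> S"
  shows "is_coalgebra C (deg0_coalg S)"
proof -
  obtain V d e where S: "S = (V, d, e)"
    by (cases S)
  have d: "d \<in> Hom \<G> V (V \<diamond> V)" and e: "e \<in> Hom \<G> V (gr_deg0 C \<I>)" and V [simp]: "gob V"
    and eqs: "Assoc \<G> V V V \<cdot>\<^bsub>\<G>\<^esub> (d \<boxtimes>\<^bsub>\<G>\<^esub> Idt \<G> V) \<cdot>\<^bsub>\<G>\<^esub> d = (Idt \<G> V \<boxtimes>\<^bsub>\<G>\<^esub> d) \<cdot>\<^bsub>\<G>\<^esub> d"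
      "LUnit \<G> V \<cdot>\<^bsub>\<G>\<^esub> (e \<boxtimes>\<^bsub>\<G>\<^esub> Idt \<G> V) \<cdot>\<^bsub>\<G>\<^esub> d = Idt \<G> V"
      "RUnit \<G> V \<cdot>\<^bsub>\<G>\<^esub> (Idt \<G> V \<boxtimes>\<^bsub>\<G>\<^esub> e) \<cdot>\<^bsub>\<G>\<^esub> d = Idt \<G> V"
    using assms unfolding S is_coalgebra_def by simp_all
  have [simp]: "d 0 \<in> Arr C" "Dom C (d 0) = V 0" "Cod C (d 0) = (V \<diamond> V) 0"
    "e 0 \<in> Arr C" "Dom C (e 0) = V 0" "Cod C (e 0) = \<I>"
    using d e by (simp_all add: in_Hom_graded)
  let ?d = "inv_arr C (gin0 V V) \<cdot> d 0"
  note eqs0 = coalgebra_equations0[OF V d e, unfolded eqs(2,3), unfolded eqs(1)]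
  have "\<alpha> (V 0) (V 0) (V 0) \<cdot> ((?d \<lhd> V 0) \<cdot> ?d) = (V 0 \<rhd> ?d) \<cdot> ?d"
  proof (rule iso_cancel_left[of "gin_right V V V 0 0 0"])
    show "gin_right V V V 0 0 0 \<cdot> (\<alpha> (V 0) (V 0) (V 0) \<cdot> ((?d \<lhd> V 0) \<cdot> ?d)) =
        gin_right V V V 0 0 0 \<cdot> ((V 0 \<rhd> ?d) \<cdot> ?d)"
      using eqs0(1,2) by (rule trans[OF sym])
  qed (simp_all add: gin_right_def)
  moreover have "\<l> (V 0) \<cdot> ((e 0 \<lhd> V 0) \<cdot> ?d) = Idt C (V 0)" "\<r> (V 0) \<cdot> ((V 0 \<rhd> e 0) \<cdot> ?d) = Idt C (V 0)"
    unfolding eqs0(3,4)[symmetric] by simp_all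
  ultimately show ?thesis
    by (simp add: S deg0_coalg_def is_coalgebra_def in_Hom)
qed

definition embed :: "('o, 'a) triple \<Rightarrow> (nat \<Rightarrow> 'o, nat \<Rightarrow> 'a) triple" where
  "embed = (\<lambda>(U, d, e). let V = gr_deg0 C U in
     (V, deg0_arr V (V \<diamond> V) (gin0 V V \<cdot> d), deg0_arr V (gr_deg0 C \<I>) e))"

lemma coalgebra_embed:
  assumes "is_coalgebra C S"
  shows "is_coalgebra \<G> (embed S)" "deg0_coalg (embed S) = S" "fst (embed S) = gr_deg0 C (fst S)" "fst S \<in> Obj C"
proof -
  obtain U d e where S: "S = (U, d, e)"
    by (cases S)
  have [simp]: "U \<in> Obj C" "d \<in> Arr C" "Dom C d = U" "Cod C d = U \<odot> U" "e \<in> Arr C" "Dom C e = U" "Cod C e = \<I>"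
    and eqs: "\<alpha> U U U \<cdot> ((d \<lhd> U) \<cdot> d) = (U \<rhd> d) \<cdot> d" "\<l> U \<cdot> ((e \<lhd> U) \<cdot> d) = Idt C U" "\<r> U \<cdot> ((U \<rhd> e) \<cdot> d) = Idt C U"
    using assms by (auto simp: S is_coalgebra_def in_Hom)
  let ?V = "gr_deg0 C U"
  define d' where "d' = deg0_arr ?V (?V \<diamond> ?V) (gin0 ?V ?V \<cdot> d)"
  define e' where "e' = deg0_arr ?V (gr_deg0 C \<I>) e"
  have S': "embed S = (?V, d', e')"
    by (simp add: S embed_def Let_def d'_def e'_def)
  have d': "d' \<in> Hom \<G> ?V (?V \<diamond> ?V)" "d' 0 = gin0 ?V ?V \<cdot> d"
    unfolding d'_def by (rule deg0_arr_Hom; simp add: in_Hom)+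
  have e': "e' \<in> Hom \<G> ?V (gr_deg0 C \<I>)" "e' 0 = e"
    unfolding e'_def by (rule deg0_arr_Hom; simp add: in_Hom)+
  have V: "gob ?V" "concentrated ?V"
    by simp_all
  have d0: "inv_arr C (gin0 ?V ?V) \<cdot> d' 0 = d"
    by (simp add: d'(2))
  note eqs0 = coalgebra_equations0[OF V(1) d'(1) e'(1), unfolded d0 e'(2) gr_deg0_0]
  have G: "?V \<in> Obj \<G>"
    by simp
  have dG: "d' \<in> Hom \<G> ?V (?V \<odot>\<^bsub>\<G>\<^esub> ?V)" and eG: "e' \<in> Hom \<G> ?V (TUnit \<G>)"
    using d'(1) e'(1) by simp_all
  have H1: "Assoc \<G> ?V ?V ?V \<cdot>\<^bsub>\<G>\<^esub> (d' \<boxtimes>\<^bsub>\<G>\<^esub> Idt \<G> ?V) \<cdot>\<^bsub>\<G>\<^esub> d' \<in> Hom \<G> ?V (?V \<odot>\<^bsub>\<G>\<^esub> (?V \<odot>\<^bsub>\<G>\<^esub> ?V))"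
    by (rule G.Comp_Hom[OF dG G.Comp_Hom[OF G.TArr_Hom[OF dG G.Idt_Hom[OF G]] G.Assoc_Hom[OF G G G]]])
  have H2: "(Idt \<G> ?V \<boxtimes>\<^bsub>\<G>\<^esub> d') \<cdot>\<^bsub>\<G>\<^esub> d' \<in> Hom \<G> ?V (?V \<odot>\<^bsub>\<G>\<^esub> (?V \<odot>\<^bsub>\<G>\<^esub> ?V))"
    by (rule G.Comp_Hom[OF dG G.TArr_Hom[OF G.Idt_Hom[OF G] dG]])
  have H3: "LUnit \<G> ?V \<cdot>\<^bsub>\<G>\<^esub> (e' \<boxtimes>\<^bsub>\<G>\<^esub> Idt \<G> ?V) \<cdot>\<^bsub>\<G>\<^esub> d' \<in> Hom \<G> ?V ?V"
    by (rule G.Comp_Hom[OF dG G.Comp_Hom[OF G.TArr_Hom[OF eG G.Idt_Hom[OF G]] G.LUnit_Hom[OF G]]])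
  have H4: "RUnit \<G> ?V \<cdot>\<^bsub>\<G>\<^esub> (Idt \<G> ?V \<boxtimes>\<^bsub>\<G>\<^esub> e') \<cdot>\<^bsub>\<G>\<^esub> d' \<in> Hom \<G> ?V ?V"
    by (rule G.Comp_Hom[OF dG G.Comp_Hom[OF G.TArr_Hom[OF G.Idt_Hom[OF G] eG] G.RUnit_Hom[OF G]]])
  have E: "Assoc \<G> ?V ?V ?V \<cdot>\<^bsub>\<G>\<^esub> (d' \<boxtimes>\<^bsub>\<G>\<^esub> Idt \<G> ?V) \<cdot>\<^bsub>\<G>\<^esub> d' = (Idt \<G> ?V \<boxtimes>\<^bsub>\<G>\<^esub> d') \<cdot>\<^bsub>\<G>\<^esub> d'"
    by (rule concentrated_eq[OF _ H1 H2]) (use V eqs0(1,2) eqs(1) in \<open>simp_all only: simp_thms\<close>)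
  have L: "LUnit \<G> ?V \<cdot>\<^bsub>\<G>\<^esub> (e' \<boxtimes>\<^bsub>\<G>\<^esub> Idt \<G> ?V) \<cdot>\<^bsub>\<G>\<^esub> d' = Idt \<G> ?V"
    by (rule concentrated_eq[OF _ H3 G.Idt_Hom[OF G]]) (use V eqs0(3) eqs(2) in \<open>simp_all only: simp_thms graded_simps gr_deg0_0\<close>)
  have R: "RUnit \<G> ?V \<cdot>\<^bsub>\<G>\<^esub> (Idt \<G> ?V \<boxtimes>\<^bsub>\<G>\<^esub> e') \<cdot>\<^bsub>\<G>\<^esub> d' = Idt \<G> ?V"
    by (rule concentrated_eq[OF _ H4 G.Idt_Hom[OF G]]) (use V eqs0(4) eqs(3) in \<open>simp_all only: simp_thms graded_simps gr_deg0_0\<close>)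
  show "is_coalgebra \<G> (embed S)"
    unfolding S' is_coalgebra_def using G dG eG E L R by blast
  show "deg0_coalg (embed S) = S"
    unfolding S' by (simp add: deg0_coalg_def S d0 e'(2) del: inv_arr_cont iso_comp)
  show "fst (embed S) = gr_deg0 C (fst S)" "fst S \<in> Obj C"
    unfolding S' by (simp_all add: S)
qed

lemma algebra_mor_deg0:
  assumes "is_algebra \<G> S" "is_algebra \<G> T" and conc: "concentrated (fst T)"
  shows "is_algebra_mor \<G> S f T \<longleftrightarrow>
    f \<in> Hom \<G> (fst S) (fst T) \<and> is_algebra_mor C (deg0_alg S) (f 0) (deg0_alg T)"
proof -
  obtain A m u B m' u' where S: "S = (A, m, u)" and T: "T = (B, m', u')"
    by (cases S; cases T)
  have m: "m \<in> Hom \<G> (A \<diamond> A) A" and u: "u \<in> Hom \<G> (gr_deg0 C \<I>) A" and [simp]: "gob A"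
    and m': "m' \<in> Hom \<G> (B \<diamond> B) B" and u': "u' \<in> Hom \<G> (gr_deg0 C \<I>) B" and [simp]: "gob B"
    using assms by (simp_all add: S T is_algebra_def)
  have [simp]: "m n \<in> Arr C" "Dom C (m n) = (A \<diamond> A) n" "Cod C (m n) = A n"
    "m' n \<in> Arr C" "Dom C (m' n) = (B \<diamond> B) n" "Cod C (m' n) = B n"
    "u n \<in> Arr C" "Dom C (u n) = gr_deg0 C \<I> n" "Cod C (u n) = A n"
    "u' n \<in> Arr C" "Dom C (u' n) = gr_deg0 C \<I> n" "Cod C (u' n) = B n" for n
    using m u m' u' by (simp_all add: in_Hom_graded)
  show ?thesis
  proof (cases "f \<in> Hom \<G> A B")
    case True
    then have [simp]: "f n \<in> Arr C" "Dom C (f n) = A n" "Cod C (f n) = B n" for n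
      by (simp_all add: in_Hom_graded)
    have 1: "(f 0 \<cdot> m 0) \<cdot> gin0 A A = f 0 \<cdot> (m 0 \<cdot> gin0 A A)"
      and 2: "(m' 0 \<cdot> gr_arr C H f f 0) \<cdot> gin0 A A = m' 0 \<cdot> gin0 B B \<cdot> (f 0 \<boxtimes> f 0)"
      by (simp_all add: gr_arr_gin)
    have m0: "f 0 \<cdot> m 0 = m' 0 \<cdot> gr_arr C H f f 0 \<longleftrightarrow> f 0 \<cdot> (m 0 \<cdot> gin0 A A) = m' 0 \<cdot> gin0 B B \<cdot> (f 0 \<boxtimes> f 0)"
      unfolding 1[symmetric] 2[symmetric]
    proof
      assume "(f 0 \<cdot> m 0) \<cdot> gin0 A A = (m' 0 \<cdot> gr_arr C H f f 0) \<cdot> gin0 A A"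
      then show "f 0 \<cdot> m 0 = m' 0 \<cdot> gr_arr C H f f 0"
        by (rule iso_cancel_right[rotated]) simp_all
    qed (simp only:)
    have "f \<cdot>\<^bsub>\<G>\<^esub> m = m' \<cdot>\<^bsub>\<G>\<^esub> (f \<boxtimes>\<^bsub>\<G>\<^esub> f) \<longleftrightarrow> f 0 \<cdot> m 0 = m' 0 \<cdot> gr_arr C H f f 0"
    proof
      show "f \<cdot>\<^bsub>\<G>\<^esub> m = m' \<cdot>\<^bsub>\<G>\<^esub> (f \<boxtimes>\<^bsub>\<G>\<^esub> f)" if "f 0 \<cdot> m 0 = m' 0 \<cdot> gr_arr C H f f 0"
        using that conc by (intro concentrated_eq[of "A \<diamond> A" B]) (simp_all add: in_Hom_graded T)
    qed (auto simp: fun_eq_iff)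
    moreover have "f \<cdot>\<^bsub>\<G>\<^esub> u = u' \<longleftrightarrow> f 0 \<cdot> u 0 = u' 0"
    proof
      show "f \<cdot>\<^bsub>\<G>\<^esub> u = u'" if "f 0 \<cdot> u 0 = u' 0"
        using that by (intro concentrated_eq[of "gr_deg0 C \<I>" B]) (simp_all add: in_Hom_graded)
    qed (auto simp: fun_eq_iff)
    ultimately show ?thesis
      using True m0 by (simp add: S T is_algebra_mor_def deg0_alg_def in_Hom[of _ C])
  qed (simp add: S T is_algebra_mor_def)
qed

lemma coalgebra_mor_deg0:
  assumes "is_coalgebra \<G> S" "is_coalgebra \<G> T" and conc: "concentrated (fst T)"
  shows "is_coalgebra_mor \<G> S f T \<longleftrightarrow>
    f \<in> Hom \<G> (fst S) (fst T) \<and> is_coalgebra_mor C (deg0_coalg S) (f 0) (deg0_coalg T)"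
proof -
  obtain A d e B d' e' where S: "S = (A, d, e)" and T: "T = (B, d', e')"
    by (cases S; cases T)
  have d: "d \<in> Hom \<G> A (A \<diamond> A)" and e: "e \<in> Hom \<G> A (gr_deg0 C \<I>)" and [simp]: "gob A"
    and d': "d' \<in> Hom \<G> B (B \<diamond> B)" and e': "e' \<in> Hom \<G> B (gr_deg0 C \<I>)" and [simp]: "gob B"
    using assms by (simp_all add: S T is_coalgebra_def)
  have [simp]: "d n \<in> Arr C" "Cod C (d n) = (A \<diamond> A) n" "Dom C (d n) = A n"
    "d' n \<in> Arr C" "Cod C (d' n) = (B \<diamond> B) n" "Dom C (d' n) = B n"
    "e n \<in> Arr C" "Cod C (e n) = gr_deg0 C \<I> n" "Dom C (e n) = A n"
    "e' n \<in> Arr C" "Cod C (e' n) = gr_deg0 C \<I> n" "Dom C (e' n) = B n" for n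
    using d e d' e' by (simp_all add: in_Hom_graded)
  show ?thesis
  proof (cases "f \<in> Hom \<G> A B")
    case True
    then have [simp]: "f n \<in> Arr C" "Dom C (f n) = A n" "Cod C (f n) = B n" for n
      by (simp_all add: in_Hom_graded)
    let ?d = "inv_arr C (gin0 A A) \<cdot> d 0" and ?d' = "inv_arr C (gin0 B B) \<cdot> d' 0"
    have "gr_arr C H f f 0 \<cdot> d 0 = gr_arr C H f f 0 \<cdot> (gin0 A A \<cdot> ?d)"
      by simp
    also have "\<dots> = gin0 B B \<cdot> ((f 0 \<boxtimes> f 0) \<cdot> ?d)"
      by (rule trans[OF gr_arr_gin_cont]) simp_all
    finally have 1: "gr_arr C H f f 0 \<cdot> d 0 = gin0 B B \<cdot> ((f 0 \<boxtimes> f 0) \<cdot> ?d)" .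
    have 2: "d' 0 \<cdot> f 0 = gin0 B B \<cdot> (?d' \<cdot> f 0)"
      by simp
    have d0: "d' 0 \<cdot> f 0 = gr_arr C H f f 0 \<cdot> d 0 \<longleftrightarrow> ?d' \<cdot> f 0 = (f 0 \<boxtimes> f 0) \<cdot> ?d"
      unfolding 1 2
    proof
      assume "gin0 B B \<cdot> (?d' \<cdot> f 0) = gin0 B B \<cdot> ((f 0 \<boxtimes> f 0) \<cdot> ?d)"
      then show "?d' \<cdot> f 0 = (f 0 \<boxtimes> f 0) \<cdot> ?d"
        by (rule iso_cancel_left[rotated]) simp_all
    qed (simp only:)
    have "d' \<cdot>\<^bsub>\<G>\<^esub> f = (f \<boxtimes>\<^bsub>\<G>\<^esub> f) \<cdot>\<^bsub>\<G>\<^esub> d \<longleftrightarrow> d' 0 \<cdot> f 0 = gr_arr C H f f 0 \<cdot> d 0"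
    proof
      show "d' \<cdot>\<^bsub>\<G>\<^esub> f = (f \<boxtimes>\<^bsub>\<G>\<^esub> f) \<cdot>\<^bsub>\<G>\<^esub> d" if "d' 0 \<cdot> f 0 = gr_arr C H f f 0 \<cdot> d 0"
        using that conc concentrated_tensor[of B B]
        by (intro concentrated_eq[of A "B \<diamond> B"]) (simp_all add: in_Hom_graded T)
    qed (auto simp: fun_eq_iff)
    moreover have "e' \<cdot>\<^bsub>\<G>\<^esub> f = e \<longleftrightarrow> e' 0 \<cdot> f 0 = e 0"
    proof
      show "e' \<cdot>\<^bsub>\<G>\<^esub> f = e" if "e' 0 \<cdot> f 0 = e 0"
        using that by (intro concentrated_eq[of A "gr_deg0 C \<I>"]) (simp_all add: in_Hom_graded)
    qed (auto simp: fun_eq_iff)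
    ultimately show ?thesis
      using True d0 by (simp add: S T is_coalgebra_mor_def deg0_coalg_def in_Hom[of _ C])
  qed (simp add: S T is_coalgebra_mor_def)
qed

lemma dual_alg_deg0:
  assumes "is_coalgebra \<G> S"
  shows "deg0_alg (G.dual_alg S) = dual_alg (deg0_coalg S)" "concentrated (fst (G.dual_alg S))"
proof -
  obtain V d e where S: "S = (V, d, e)"
    by (cases S)
  have d: "d \<in> Hom \<G> V (V \<diamond> V)" and e: "e \<in> Hom \<G> V (gr_deg0 C \<I>)" and V [simp]: "gob V"
    using assms unfolding S is_coalgebra_def by simp_all
  have [simp]: "d 0 \<in> Arr C" "Dom C (d 0) = V 0" "Cod C (d 0) = (V \<diamond> V) 0"
    "e 0 \<in> Arr C" "Dom C (e 0) = V 0" "Cod C (e 0) = \<I>"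
    using d e by (simp_all add: in_Hom_graded)
  let ?V' = "gr_dual C V"
  have "dual2 \<G> V V \<in> Hom \<G> (?V' \<diamond> ?V') (gr_dual C (V \<diamond> V))"
    using G.dual2_arr[of V V] by (simp add: in_Hom)
  then have [simp]: "dual2 \<G> V V n \<in> Arr C" "Dom C (dual2 \<G> V V n) = (?V' \<diamond> ?V') n"
    "Cod C (dual2 \<G> V V n) = gr_dual C (V \<diamond> V) n" for n
    by (simp_all add: in_Hom_graded)
  have "dual_arr (inv_arr C (gin0 V V) \<cdot> d 0) \<cdot> \<phi>\<^sub>2 (V 0) (V 0) =
      dual_arr (d 0) \<cdot> ((dual_arr (inv_arr C (gin0 V V)) \<cdot> dual_arr (gin0 V V)) \<cdot> (dual2 \<G> V V 0 \<cdot> gin0 ?V' ?V'))"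
    by (simp add: dual_comp flip: dual2_graded0)
  also have "dual_arr (inv_arr C (gin0 V V)) \<cdot> dual_arr (gin0 V V) = dual_arr (gin0 V V \<cdot> inv_arr C (gin0 V V))"
    by (rule dual_comp[symmetric]) simp_all
  finally have "dual_arr (inv_arr C (gin0 V V) \<cdot> d 0) \<cdot> \<phi>\<^sub>2 (V 0) (V 0) =
      dual_arr (d 0) \<cdot> dual2 \<G> V V 0 \<cdot> gin0 ?V' ?V'"
    by (simp add: dual_Idt)
  then show "deg0_alg (G.dual_alg S) = dual_alg (deg0_coalg S)"
    by (simp add: S G.dual_alg_def dual_alg_def deg0_alg_def deg0_coalg_def dual_arr_graded0[OF d]
      dual_arr_graded0[OF e] dual0_graded0)
  show "concentrated (fst (G.dual_alg S))"
    by (simp add: S G.dual_alg_def gr_dual_def)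
qed

lemma finite_dual_graded:
  assumes S: "is_algebra \<G> S" and fd: "finite_dual (deg0_alg S) U h"
  shows "G.finite_dual S (embed U) (deg0_arr (fst S) (fst (G.dual_alg (embed U))) h)"
proof -
  let ?D = "G.dual_alg (embed U)" and ?W = "fst (embed U)"
  let ?h = "deg0_arr (fst S) (fst ?D) h"
  have U: "is_coalgebra C U" and h: "is_algebra_mor C (deg0_alg S) h (dual_alg U)"
    and univ: "\<And>T f. is_coalgebra C T \<Longrightarrow> is_algebra_mor C (deg0_alg S) f (dual_alg T) \<Longrightarrow>
      (\<exists>!g. is_coalgebra_mor C T g U \<and> dual_arr g \<cdot> h = f)"
    using fd unfolding finite_dual_def by blast+
  note emb = coalgebra_embed[OF U]
  have W: "concentrated ?W" "gob ?W"
    using emb(3,4) by simp_all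
  have D: "is_algebra \<G> ?D" "concentrated (fst ?D)" "deg0_alg ?D = dual_alg U" "fst ?D = gr_dual C ?W"
    using G.algebra_dual_alg[OF emb(1)] dual_alg_deg0[OF emb(1)] emb(2) G.fst_dual_alg[of "embed U"] by simp_all
  have A: "gob (fst S)"
    using S by (cases S) (simp add: is_algebra_def)
  have h_Hom: "h \<in> Hom C (fst S 0) (fst ?D 0)"
    using h unfolding D(4) emb(3)
    by (cases S; cases U) (simp add: is_algebra_mor_def deg0_alg_def dual_alg_def)
  have "gob (fst ?D)"
    using D(2) by (simp add: concentrated_def)
  note H = deg0_arr_Hom[OF A this h_Hom]
  have mor_h: "is_algebra_mor \<G> S ?h ?D"
    using algebra_mor_deg0[OF S D(1,2)] H h D(3) by simp
  have ex1: "\<exists>!g. is_coalgebra_mor \<G> T g (embed U) \<and> AMap (dual_functor \<G>) g \<cdot>\<^bsub>\<G>\<^esub> ?h = f"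
    if T: "is_coalgebra \<G> T" and f: "is_algebra_mor \<G> S f (G.dual_alg T)" for T f
  proof -
    note T' = G.algebra_dual_alg[OF T] dual_alg_deg0[OF T]
    have f_Hom: "f \<in> Hom \<G> (fst S) (fst (G.dual_alg T))" and f0: "is_algebra_mor C (deg0_alg S) (f 0) (dual_alg (deg0_coalg T))"
      using algebra_mor_deg0[OF S T'(1,3)] f T'(2) by simp_all
    have gobT: "gob (fst T)"
      using T by (cases T) (simp add: is_coalgebra_def)
    have uniq: "\<exists>!g. is_coalgebra_mor C (deg0_coalg T) g U \<and> dual_arr g \<cdot> h = f 0"
      by (rule univ[OF coalgebra_deg0[OF T] f0])
    have mor: "is_coalgebra_mor \<G> T g (embed U) \<longleftrightarrow> g \<in> Hom \<G> (fst T) ?W \<and> is_coalgebra_mor C (deg0_coalg T) (g 0) U" for g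
      using coalgebra_mor_deg0[OF T emb(1) W(1)] emb(2) by simp
    have comp: "AMap (dual_functor \<G>) g \<cdot>\<^bsub>\<G>\<^esub> ?h = f \<longleftrightarrow> dual_arr (g 0) \<cdot> h = f 0"
      if g: "g \<in> Hom \<G> (fst T) ?W" for g
    proof
      have "AMap (dual_functor \<G>) g \<in> Hom \<G> (fst ?D) (fst (G.dual_alg T))"
        using G.functor_dual(1) g unfolding is_functor_def by (simp add: G.fst_dual_alg)
      from G.Comp_Hom[OF H(1) this]
      have "AMap (dual_functor \<G>) g \<cdot>\<^bsub>\<G>\<^esub> ?h \<in> Hom \<G> (fst S) (fst (G.dual_alg T))" .
      then show "AMap (dual_functor \<G>) g \<cdot>\<^bsub>\<G>\<^esub> ?h = f" if "dual_arr (g 0) \<cdot> h = f 0"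
        using that f_Hom T'(3) dual_arr_graded0[OF g] H(2) by (intro concentrated_eq) auto
      show "dual_arr (g 0) \<cdot> h = f 0" if "AMap (dual_functor \<G>) g \<cdot>\<^bsub>\<G>\<^esub> ?h = f"
        using fun_cong[OF that, of 0] dual_arr_graded0[OF g] H(2) by simp
    qed
    obtain g where g: "is_coalgebra_mor C (deg0_coalg T) g U" "dual_arr g \<cdot> h = f 0"
      using uniq by blast
    have "g \<in> Hom C (fst T 0) (?W 0)"
      using g(1) unfolding emb(3) by (cases T; cases U) (simp add: is_coalgebra_mor_def deg0_coalg_def)
    note gH = deg0_arr_Hom[OF gobT W(2) this]
    show ?thesis
    proof (rule ex1I[of _ "deg0_arr (fst T) ?W g"])
      show "is_coalgebra_mor \<G> T (deg0_arr (fst T) ?W g) (embed U) \<and>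
          AMap (dual_functor \<G>) (deg0_arr (fst T) ?W g) \<cdot>\<^bsub>\<G>\<^esub> ?h = f"
        using mor comp gH g by simp
      fix g' assume g': "is_coalgebra_mor \<G> T g' (embed U) \<and> AMap (dual_functor \<G>) g' \<cdot>\<^bsub>\<G>\<^esub> ?h = f"
      then have "g' \<in> Hom \<G> (fst T) ?W" "g' 0 = g"
        using mor comp uniq g by blast+
      then show "g' = deg0_arr (fst T) ?W g"
        using gH W(1) by (intro concentrated_eq) auto
    qed
  qed
  show ?thesis
    unfolding G.finite_dual_def using emb(1) mor_h ex1 by blast
qed

end

theorem proposition4p9:
  fixes M :: "('o, 'a, 'z) prcat_scheme" and H :: "'o \<Rightarrow> 'o \<Rightarrow> 'a monoid"
  assumes "prerigid_braided_category M"
    and "abelian_category M H"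
    and "tensor_additive M H"
    and "tensor_exact M H"
    and "has_left_adjoint (Alg (op_moncat M)) (Alg M)
           (alg_functor M (dual_functor M) (dual2 M) (dual0 M))"
  shows "prerigid_braided_category (graded M H) \<and>
    liftable_pair (op_moncat (graded M H)) (graded M H)
      (dual_functor (graded M H)) (dual_functor (graded M H))
      (dual_eta (graded M H)) (dual_eps (graded M H))
      (dual2 (graded M H)) (dual0 (graded M H))"
proof -
  interpret graded_setting M H
    using assms(1-3) by (simp add: graded_setting_def graded_setting_axioms_def)
  have "\<exists>U h. G.finite_dual S U h" if S: "is_algebra (graded M H) S" for S
    using finite_dual_if_left_adjoint[OF assms(5) algebra_deg0[OF S]] finite_dual_graded[OF S] by blast
  then show ?thesis
    using prerigid_graded G.liftable_pair_dual[OF G.left_adjoint_if_finite_dual] by blast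
qed

end
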